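(* Let $r\ge 1$ be an integer. Let $f^{(r)}=\frac{\partial^r}{\partial t^r}f:[0,T]\to H$ be Lipschitz continuous and let $\mathcal K\in W^r_1(\mathbb R^+)$ with $\|\mathcal K\|_{W^r_1(\mathbb R^+)}<1$. Assume the following compatibility conditions. If $r=2k$ ($k=1,2,\dots$): $$A^ku^0\in\mathcal D(A),\qquad A^ku^1\in V,$$ $$f^{(r-2j)}(0)\in H^{2j}\cap V\quad\text{and}\quad f^{(r-2j+1)}(0)\in H^{2(j-1)}\cap V,\qquad j=1,\dots,k.$$ If $r=2k+1$ ($k=0,1,2,\dots$): $$A^ku^1\in\mathcal D(A),\qquad A^{k+1}u^0\in V,$$ $$f^{(r-2j)}(0)\in H^{2j}\cap V,\quad j=1,\dots,k\ \ (\text{if }k\ge1),\qquad f^{(r-2j+1)}(0)\in H^{2(j-1)}\cap V,\quad j=1,\dots,k+1.$$ Then there is a unique solution $u$ of $$\ddot u+Au-\int_0^t\mathcal K(t-s)Au(s)\,ds=f,\quad t\in(0,T),\qquad u(0)=u^0,\ \dot u(0)=u^1.$$ Moreover, there is a constant $C=C(\kappa,\|\mathcal K\|_{W^r_1(\mathbb R^+)},T)$ such that, for $t\in[0,T]$: if $r=2k$ ($k=1,2,\dots$), $$\|u^{(r)}(t)\|_V+\|u^{(r+1)}(t)\|\le C\Big(\|A^{k+1}u^0\|+\|A^ku^1\|+\sum_{j=1}^k\|A^jf^{(r-2j)}(0)\|+\sum_{j=1}^k\|A^{j-1}f^{(r-2j+1)}(0)\|+\int_0^t\|f^{(r)}(s)\|\,ds\Big),$$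 and if $r=2k+1$ ($k=0,1,2,\dots$), $$\|u^{(r)}(t)\|_V+\|u^{(r+1)}(t)\|\le C\Big(\|A^{k+1}u^0\|+\|A^{k+1}u^1\|+\sum_{j=1}^k\|A^jf^{(r-2j)}(0)\|+\sum_{j=1}^{k+1}\|A^{j-1}f^{(r-2j+1)}(0)\|+\int_0^t\|f^{(r)}(s)\|\,ds\Big).$$
   Context: Let $T>0$ be fixed and let $\Omega\subset\mathbb R^d$ be a bounded convex domain with smooth boundary. Write $H^s=H^s(\Omega)^d$ (Sobolev spaces), $H=H^0=L_2(\Omega)^d$ with norm $\|\cdot\|$ and inner product $(\cdot,\cdot)$, and $V=H^1_0(\Omega)^d$ (homogeneous Dirichlet boundary condition). $A$ is a fixed self-adjoint, positive definite, uniformly elliptic second order operator on $H$ (unbounded) with domain $\mathcal D(A)=H^2\cap V$; $a(u,v)=(Au,v)$ is the associated bilinear form, extended to $V\times V$, and $\|v\|_V^2=a(v,v)$. The elliptic regularity estimate $\|v\|_{H^2}\le C\|Av\|$ holds for $v\in\mathcal D(A)$. The kernel $\mathcal K$ satisfies $\mathcal K\ge0$, $\dot{\mathcal K}\le0$ and $\|\mathcal K\|_{L_1(\mathbb R^+)}=\kappa<1$. $W^r_1(\mathbb R^+)$ is the Sobolev space of functions on $(0,\infty)$ with derivatives of order up to $r$ in $L_1$. Dots denote time derivatives, and $u^{(n)}=\partial^nu/\partial t^n$, $f^{(n)}=\partial^nf/\partial t^n$. The symbols $u^0,u^1$ denote the given initial data. Sums $\sum_{j=i}^{m}$ with $i>m$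 are zero. A solution of the problem is a function satisfying the equation almost everywhere in $(0,T)$ (as an equation in $H$, the equation may be read with the sum $u-\int_0^t\mathcal K(t-s)u(s)\,ds$ in $\mathcal D(A)$) together with the initial conditions. The constant $C$ may also depend on the fixed $\Omega$ and $A$.
   Formalization: The values f^{(r-2j)}(0) and f^{(r-2j+1)}(0) are also required to lie in D(A^j) and D(A^{j-1}), so that the powers of A in the estimate exist (new only for r≥4; without it the estimate fails). A solution is taken to have an absolutely continuous first time derivative. *)

theory Defs
  imports "HOL-Analysis.Analysis"
begin

section \<open>The Hilbert space of square-integrable vector fields\<close>

definition sq_integrable :: "('a::euclidean_space \<Rightarrow> 'a) \<Rightarrow> bool" where
  "sq_integrable f \<longleftrightarrow> f \<in> borel_measurable borel \<and> integrable lborel (\<lambda>x. (norm (f x))\<^sup>2)"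

definition L2_eq :: "('a::euclidean_space \<Rightarrow> 'a) \<Rightarrow> ('a \<Rightarrow> 'a) \<Rightarrow> bool" where
  "L2_eq f g \<longleftrightarrow> sq_integrable f \<and> sq_integrable g \<and> (AE x in lborel. f x = g x)"

lemma sq_integrable_zero: "sq_integrable (\<lambda>x. 0)"
  by (simp add: sq_integrable_def)

lemma sq_integrable_measurable [measurable_dest]:
  "sq_integrable f \<Longrightarrow> f \<in> borel_measurable borel"
  by (simp add: sq_integrable_def)

lemma sq_integrable_add:
  assumes "sq_integrable f" "sq_integrable g"
  shows "sq_integrable (\<lambda>x. f x + g x)"
proof -
  have "integrable lborel (\<lambda>x. (norm (f x + g x))\<^sup>2)"
  proof (rule Bochner_Integration.integrable_bound)
    show "integrable lborel (\<lambda>x. 2 * (norm (f x))\<^sup>2 + 2 * (norm (g x))\<^sup>2)"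
      using assms by (auto simp: sq_integrable_def)
    have "(norm (f x + g x))\<^sup>2 \<le> 2 * (norm (f x))\<^sup>2 + 2 * (norm (g x))\<^sup>2" for x
      by (smt (verit) norm_triangle_ineq norm_ge_zero power_mono sum_squares_bound power2_sum)
    then show "AE x in lborel. norm ((norm (f x + g x))\<^sup>2)
        \<le> norm (2 * (norm (f x))\<^sup>2 + 2 * (norm (g x))\<^sup>2)"
      by auto
  qed (use assms in \<open>auto simp: sq_integrable_def\<close>)
  then show ?thesis using assms by (auto simp: sq_integrable_def)
qed

lemma sq_integrable_scaleR: "sq_integrable f \<Longrightarrow> sq_integrable (\<lambda>x. c *\<^sub>R f x)"
  by (auto simp: sq_integrable_def power_mult_distrib)

lemma sq_integrable_uminus: "sq_integrable f \<Longrightarrow> sq_integrable (\<lambda>x. - f x)"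
  by (auto simp: sq_integrable_def)

lemma sq_integrable_diff:
  "sq_integrable f \<Longrightarrow> sq_integrable g \<Longrightarrow> sq_integrable (\<lambda>x. f x - g x)"
  using sq_integrable_add[of f "\<lambda>x. - g x"] sq_integrable_uminus[of g] by simp

lemma integrable_inner_sq_integrable:
  assumes "sq_integrable f" "sq_integrable g"
  shows "integrable lborel (\<lambda>x. f x \<bullet> g x)"
proof (rule Bochner_Integration.integrable_bound)
  show "integrable lborel (\<lambda>x. (norm (f x))\<^sup>2 + (norm (g x))\<^sup>2)"
    using assms by (auto simp: sq_integrable_def)
  have "\<bar>f x \<bullet> g x\<bar> \<le> (norm (f x))\<^sup>2 + (norm (g x))\<^sup>2" for x
    using Cauchy_Schwarz_ineq2[of "f x" "g x"] sum_squares_bound[of "norm (f x)" "norm (g x)"]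
      mult_nonneg_nonneg[OF norm_ge_zero[of "f x"] norm_ge_zero[of "g x"]]
    by linarith
  then show "AE x in lborel. norm (f x \<bullet> g x) \<le> norm ((norm (f x))\<^sup>2 + (norm (g x))\<^sup>2)"
    by auto
qed (use assms in \<open>auto simp: sq_integrable_def\<close>)

text \<open>
  Elements are fields on the whole space, up to equality almost everywhere.  The space
  $L_2(\Omega)^d$ with $d = \dim$ is the subspace of fields vanishing a.e. outside $\Omega$,
  see \<open>L2_on\<close> below.
\<close>

quotient_type (overloaded) 'a L2 = "'a::euclidean_space \<Rightarrow> 'a" / partial: L2_eq
proof (rule part_equivpI)
  show "\<exists>f. L2_eq f f" using sq_integrable_zero by (auto simp: L2_eq_def)
  show "symp L2_eq" by (auto simp: L2_eq_def symp_def)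
  show "transp L2_eq" by (auto simp: L2_eq_def transp_def)
qed

lemma sq_integrable_rep: "sq_integrable (rep_L2 v)"
  using Quotient_rep_reflp[OF Quotient_L2] by (auto simp: L2_eq_def)

lemma rep_abs_L2: "sq_integrable f \<Longrightarrow> AE x in lborel. rep_L2 (abs_L2 f) x = f x"
  using Quotient_rep_abs[OF Quotient_L2, of f] by (auto simp: L2_eq_def)

lemma L2_eqI:
  assumes "AE x in lborel. rep_L2 v x = rep_L2 w x"
  shows "v = w"
  using Quotient_rel_rep[OF Quotient_L2, of v w] assms sq_integrable_rep
  by (auto simp: L2_eq_def)

instantiation L2 :: (euclidean_space) real_vector
begin

definition "0 = abs_L2 (\<lambda>x. 0)"
definition "v + w = abs_L2 (\<lambda>x. rep_L2 v x + rep_L2 w x)"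
definition "v - w = abs_L2 (\<lambda>x. rep_L2 v x - rep_L2 w x)"
definition "- v = abs_L2 (\<lambda>x. - rep_L2 v x)"
definition "c *\<^sub>R v = abs_L2 (\<lambda>x. c *\<^sub>R rep_L2 v x)"

lemma rep_L2_zero: "AE x in lborel. rep_L2 (0 :: 'a L2) x = 0"
  unfolding zero_L2_def by (intro rep_abs_L2 sq_integrable_zero)

lemma rep_L2_add: "AE x in lborel. rep_L2 (v + w :: 'a L2) x = rep_L2 v x + rep_L2 w x"
  unfolding plus_L2_def by (intro rep_abs_L2 sq_integrable_add sq_integrable_rep)

lemma rep_L2_diff: "AE x in lborel. rep_L2 (v - w :: 'a L2) x = rep_L2 v x - rep_L2 w x"
  unfolding minus_L2_def by (intro rep_abs_L2 sq_integrable_diff sq_integrable_rep)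

lemma rep_L2_uminus: "AE x in lborel. rep_L2 (- v :: 'a L2) x = - rep_L2 v x"
  unfolding uminus_L2_def by (intro rep_abs_L2 sq_integrable_uminus sq_integrable_rep)

lemma rep_L2_scaleR: "AE x in lborel. rep_L2 (c *\<^sub>R v :: 'a L2) x = c *\<^sub>R rep_L2 v x"
  unfolding scaleR_L2_def by (intro rep_abs_L2 sq_integrable_scaleR sq_integrable_rep)

instance
proof
  fix u v w :: "'a L2" and c d :: real
  note rep = rep_L2_zero rep_L2_add[of u v] rep_L2_add[of v w] rep_L2_add[of v u]
    rep_L2_add[of "u + v" w] rep_L2_add[of u "v + w"] rep_L2_add[of 0 u] rep_L2_add[of "- u" u]
    rep_L2_diff[of u v] rep_L2_add[of u "- v"] rep_L2_uminus[of u] rep_L2_uminus[of v]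
  show "u + v + w = u + (v + w)"
    by (rule L2_eqI) (use rep in \<open>eventually_elim, simp\<close>)
  show "u + v = v + u"
    by (rule L2_eqI) (use rep in \<open>eventually_elim, simp\<close>)
  show "0 + u = u"
    by (rule L2_eqI) (use rep in \<open>eventually_elim, simp\<close>)
  show "- u + u = 0"
    by (rule L2_eqI) (use rep in \<open>eventually_elim, simp\<close>)
  show "u - v = u + - v"
    by (rule L2_eqI) (use rep in \<open>eventually_elim, simp\<close>)
  note reps = rep_L2_add[of u v] rep_L2_scaleR[of c u] rep_L2_scaleR[of c v]
    rep_L2_scaleR[of c "u + v"] rep_L2_add[of "c *\<^sub>R u" "c *\<^sub>R v"]
    rep_L2_scaleR[of d u] rep_L2_scaleR[of "c + d" u] rep_L2_add[of "c *\<^sub>R u" "d *\<^sub>R u"]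
    rep_L2_scaleR[of c "d *\<^sub>R u"] rep_L2_scaleR[of "c * d" u] rep_L2_scaleR[of 1 u]
  show "c *\<^sub>R (u + v) = c *\<^sub>R u + c *\<^sub>R v"
    by (rule L2_eqI) (use reps in \<open>eventually_elim, simp add: scaleR_add_right\<close>)
  show "(c + d) *\<^sub>R u = c *\<^sub>R u + d *\<^sub>R u"
    by (rule L2_eqI) (use reps in \<open>eventually_elim, simp add: scaleR_add_left\<close>)
  show "c *\<^sub>R d *\<^sub>R u = (c * d) *\<^sub>R u"
    by (rule L2_eqI) (use reps in \<open>eventually_elim, simp\<close>)
  show "1 *\<^sub>R u = u"
    by (rule L2_eqI) (use reps in \<open>eventually_elim, simp\<close>)
qed

end

instantiation L2 :: (euclidean_space) real_inner
begin

definition "v \<bullet> w = (LINT x|lborel. rep_L2 v x \<bullet> rep_L2 w x)"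
definition "norm (v::'a L2) = sqrt (v \<bullet> v)"
definition "sgn (v::'a L2) = v /\<^sub>R norm v"
definition "dist (v::'a L2) w = norm (v - w)"
definition "(uniformity :: ('a L2 \<times> 'a L2) filter) = (INF e\<in>{0<..}. principal {(x, y). dist x y < e})"
definition "open (U :: 'a L2 set) \<longleftrightarrow>
  (\<forall>x\<in>U. eventually (\<lambda>(x', y). x' = x \<longrightarrow> y \<in> U) uniformity)"

instance
proof
  fix u v w :: "'a L2" and c :: real
  show "u \<bullet> v = v \<bullet> u"
    by (simp add: inner_L2_def inner_commute)
  have int: "integrable lborel (\<lambda>x. rep_L2 p x \<bullet> rep_L2 q x)" for p q :: "'a L2"
    by (intro integrable_inner_sq_integrable sq_integrable_rep)
  have meas: "(\<lambda>x. rep_L2 p x \<bullet> rep_L2 q x) \<in> borel_measurable lborel" for p q :: "'a L2"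
    using int[of p q] by (rule borel_measurable_integrable)
  have "(u + v) \<bullet> w = (LINT x|lborel. rep_L2 u x \<bullet> rep_L2 w x + rep_L2 v x \<bullet> rep_L2 w x)"
    unfolding inner_L2_def
    by (rule integral_cong_AE)
      (use rep_L2_add[of u v] meas in \<open>auto simp: inner_add_left intro!: borel_measurable_add\<close>)
  then show "(u + v) \<bullet> w = u \<bullet> w + v \<bullet> w"
    by (simp add: inner_L2_def int)
  have "(c *\<^sub>R u) \<bullet> v = (LINT x|lborel. c * (rep_L2 u x \<bullet> rep_L2 v x))"
    unfolding inner_L2_def
    by (rule integral_cong_AE)
      (use rep_L2_scaleR[of c u] meas in \<open>auto intro!: borel_measurable_times\<close>)
  then show "(c *\<^sub>R u) \<bullet> v = c * (u \<bullet> v)"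
    by (simp add: inner_L2_def)
  show "0 \<le> u \<bullet> u"
    by (simp add: inner_L2_def)
  have "u \<bullet> u = 0 \<longleftrightarrow> (AE x in lborel. rep_L2 u x \<bullet> rep_L2 u x = 0)"
    unfolding inner_L2_def by (rule integral_nonneg_eq_0_iff_AE) (use int in auto)
  also have "\<dots> \<longleftrightarrow> u = 0"
  proof
    assume "AE x in lborel. rep_L2 u x \<bullet> rep_L2 u x = 0"
    with rep_L2_zero have "AE x in lborel. rep_L2 u x = rep_L2 0 x"
      by eventually_elim simp
    then show "u = 0"
      by (rule L2_eqI)
  next
    assume "u = 0"
    then show "AE x in lborel. rep_L2 u x \<bullet> rep_L2 u x = 0"
      using rep_L2_zero by auto
  qed
  finally show "u \<bullet> u = 0 \<longleftrightarrow> u = 0" .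
qed (rule norm_L2_def sgn_L2_def dist_L2_def uniformity_L2_def open_L2_def)+

end

lemma nn_integral_rep_L2:
  "(\<integral>\<^sup>+x. ennreal ((norm (rep_L2 v x))\<^sup>2) \<partial>lborel) = ennreal ((norm v)\<^sup>2)"
proof -
  have "(\<integral>\<^sup>+x. ennreal ((norm (rep_L2 v x))\<^sup>2) \<partial>lborel)
      = ennreal (LINT x|lborel. (norm (rep_L2 v x))\<^sup>2)"
    by (rule nn_integral_eq_integral) (use sq_integrable_rep[of v] in \<open>auto simp: sq_integrable_def\<close>)
  also have "(LINT x|lborel. (norm (rep_L2 v x))\<^sup>2) = (norm v)\<^sup>2"
    by (simp only: power2_norm_eq_inner inner_L2_def)
  finally show ?thesis .
qed

lemma sq_integrableI_nn:
  assumes [measurable]: "f \<in> borel_measurable borel"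
    and "(\<integral>\<^sup>+x. ennreal ((norm (f x))\<^sup>2) \<partial>lborel) < \<infinity>"
  shows "sq_integrable f"
  unfolding sq_integrable_def using assms by (auto intro!: integrableI_nonneg)

lemma norm_abs_L2:
  assumes "sq_integrable f"
  shows "ennreal ((norm (abs_L2 f))\<^sup>2) = (\<integral>\<^sup>+x. ennreal ((norm (f x))\<^sup>2) \<partial>lborel)"
  unfolding nn_integral_rep_L2[symmetric]
  by (rule nn_integral_cong_AE) (use rep_abs_L2[OF assms] in auto)

lemma rep_L2_sum: "AE x in lborel. rep_L2 (\<Sum>i<(n::nat). Y i) x = (\<Sum>i<n. rep_L2 (Y i) x)"
proof (induction n)
  case 0
  then show ?case using rep_L2_zero by simp
next
  case (Suc n)
  with rep_L2_add[of "\<Sum>i<n. Y i" "Y n"] show ?case by eventually_elim simp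
qed

instance L2 :: (euclidean_space) banach
proof
  fix X :: "nat \<Rightarrow> 'a L2"
  assume "Cauchy X"
  then have "\<forall>n. \<exists>M. \<forall>i\<ge>M. \<forall>j\<ge>M. norm (X i - X j) < (1/2) ^ n"
    by (auto simp: Cauchy_iff)
  then obtain M where M: "\<And>n i j. i \<ge> M n \<Longrightarrow> j \<ge> M n \<Longrightarrow> norm (X i - X j) < (1/2) ^ n"
    by metis
  define r where "r n = (\<Sum>i\<le>n. M i) + n" for n
  have r: "strict_mono r"
    by (rule strict_monoI_Suc) (simp add: r_def)
  have "M n \<le> r n" for n
    using member_le_sum[of n "{..n}" M] by (simp add: r_def)
  then have rM: "M n \<le> r m" if "n \<le> m" for n m
    using that r by (meson le_trans strict_mono_leD)
  have close: "norm (X (r m) - X (r n)) < (1/2) ^ n" if "n \<le> m" for n m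
    using rM that by (intro M) auto
  define F where "F n = rep_L2 (X (r n))" for n
  have sqF: "sq_integrable (F n)" for n
    by (simp add: F_def sq_integrable_rep)
  have [measurable]: "F n \<in> borel_measurable borel" for n
    using sqF by (simp add: sq_integrable_def)
  define h where "h i x = norm (F (Suc i) x - F i x)" for i x
  have [measurable]: "h i \<in> borel_measurable borel" for i
    unfolding h_def by measurable
  obtain b :: 'a where b: "b \<in> Basis" using nonempty_Basis by blast
  define Y where "Y i = abs_L2 (\<lambda>x. h i x *\<^sub>R b)" for i
  have sqFF: "sq_integrable (\<lambda>x. F m x - F n x)" for m n
    by (intro sq_integrable_diff sqF)
  have sqY: "sq_integrable (\<lambda>x. h i x *\<^sub>R b)" for i
    using sqFF[of "Suc i" i] b by (auto simp: sq_integrable_def h_def)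
  have FF: "(\<integral>\<^sup>+x. ennreal ((norm (F m x - F n x))\<^sup>2) \<partial>lborel)
      = ennreal ((norm (X (r m) - X (r n)))\<^sup>2)" for m n
    unfolding nn_integral_rep_L2[symmetric]
    by (rule nn_integral_cong_AE) (use rep_L2_diff[of "X (r m)" "X (r n)"] in \<open>auto simp: F_def\<close>)
  have "ennreal ((norm (Y i))\<^sup>2) = ennreal ((norm (X (r (Suc i)) - X (r i)))\<^sup>2)" for i
    unfolding Y_def norm_abs_L2[OF sqY] FF[symmetric] using b by (simp add: h_def)
  then have normY: "norm (Y i) < (1/2) ^ i" for i
    using close[of i "Suc i"] by simp
  have sumY: "norm (\<Sum>i<n. Y i) \<le> 2" for n
  proof -
    have "norm (\<Sum>i<n. Y i) \<le> (\<Sum>i<n. (1/2) ^ i)"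
      by (rule order_trans[OF norm_sum]) (intro sum_mono less_imp_le normY)
    also have "\<dots> \<le> 2" by (simp add: sum_gp_strict)
    finally show ?thesis .
  qed
  have G: "(\<integral>\<^sup>+x. ennreal ((\<Sum>i<n. h i x)\<^sup>2) \<partial>lborel) \<le> 4" for n
  proof -
    have "AE x in lborel. \<forall>i. rep_L2 (Y i) x = h i x *\<^sub>R b"
      unfolding AE_all_countable Y_def using rep_abs_L2[OF sqY] by blast
    with rep_L2_sum[of Y n]
    have "AE x in lborel. rep_L2 (\<Sum>i<n. Y i) x = (\<Sum>i<n. h i x) *\<^sub>R b"
      by eventually_elim (simp add: scaleR_sum_left)
    then have "(\<integral>\<^sup>+x. ennreal ((\<Sum>i<n. h i x)\<^sup>2) \<partial>lborel)
        = (\<integral>\<^sup>+x. ennreal ((norm (rep_L2 (\<Sum>i<n. Y i) x))\<^sup>2) \<partial>lborel)"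
      using b by (intro nn_integral_cong_AE) auto
    also have "\<dots> = ennreal ((norm (\<Sum>i<n. Y i))\<^sup>2)"
      by (rule nn_integral_rep_L2)
    also have "\<dots> \<le> ennreal (2\<^sup>2)"
      using sumY[of n] by (intro ennreal_leI power_mono) auto
    finally show ?thesis by simp
  qed
  have "(\<integral>\<^sup>+x. (SUP n. ennreal ((\<Sum>i<n. h i x)\<^sup>2)) \<partial>lborel)
      = (SUP n. (\<integral>\<^sup>+x. ennreal ((\<Sum>i<n. h i x)\<^sup>2) \<partial>lborel))"
  proof (rule nn_integral_monotone_convergence_SUP)
    show "incseq (\<lambda>n x. ennreal ((\<Sum>i<n. h i x)\<^sup>2))"
      by (intro incseq_SucI le_funI ennreal_leI power_mono) (auto simp: h_def intro: sum_nonneg)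
  qed measurable
  also have "\<dots> \<le> 4" using G by (intro SUP_least)
  finally have "(\<integral>\<^sup>+x. (SUP n. ennreal ((\<Sum>i<n. h i x)\<^sup>2)) \<partial>lborel) \<noteq> \<infinity>"
    by (auto simp: top_unique)
  then have "AE x in lborel. (SUP n. ennreal ((\<Sum>i<n. h i x)\<^sup>2)) \<noteq> \<infinity>"
    by (intro nn_integral_PInf_AE) auto
  then have conv: "AE x in lborel. convergent (\<lambda>n. F n x)"
  proof eventually_elim
    case (elim x)
    then obtain c where c: "(SUP n. ennreal ((\<Sum>i<n. h i x)\<^sup>2)) = ennreal c" "c \<ge> 0"
      by (cases "SUP n. ennreal ((\<Sum>i<n. h i x)\<^sup>2)") auto
    have "(\<Sum>i<n. h i x) \<le> sqrt c" for n
    proof (rule real_le_rsqrt)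
      have "ennreal ((\<Sum>i<n. h i x)\<^sup>2) \<le> ennreal c"
        unfolding c(1)[symmetric] by (rule SUP_upper) simp
      then show "(\<Sum>i<n. h i x)\<^sup>2 \<le> c" using c(2) by simp
    qed
    then have "summable (\<lambda>i. h i x)"
      by (intro summableI_nonneg_bounded[of _ "sqrt c"]) (auto simp: h_def)
    then have "summable (\<lambda>i. F (Suc i) x - F i x)"
      unfolding h_def by (rule summable_norm_cancel)
    then have "convergent (\<lambda>n. F n x - F 0 x)"
      using sum_lessThan_telescope[of "\<lambda>n. F n x"] by (simp add: summable_iff_convergent)
    then show ?case
      using convergent_add_const_right_iff[of "\<lambda>n. F n x" "- F 0 x"] by simp
  qed
  define f where "f x = lim (\<lambda>n. F n x)" for x
  have [measurable]: "f \<in> borel_measurable borel"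
    unfolding f_def by (rule borel_measurable_lim_metric) measurable
  have fF: "(\<integral>\<^sup>+x. ennreal ((norm (f x - F n x))\<^sup>2) \<partial>lborel) \<le> ennreal (((1/2) ^ n)\<^sup>2)" for n
  proof -
    have "(\<integral>\<^sup>+x. ennreal ((norm (f x - F n x))\<^sup>2) \<partial>lborel)
        = (\<integral>\<^sup>+x. liminf (\<lambda>m. ennreal ((norm (F m x - F n x))\<^sup>2)) \<partial>lborel)"
    proof (rule nn_integral_cong_AE)
      from conv show "AE x in lborel. ennreal ((norm (f x - F n x))\<^sup>2)
          = liminf (\<lambda>m. ennreal ((norm (F m x - F n x))\<^sup>2))"
      proof eventually_elim
        case (elim x)
        then have "(\<lambda>m. F m x) \<longlonglongrightarrow> f x"
          unfolding f_def by (simp add: convergent_LIMSEQ_iff)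
        then have "(\<lambda>m. ennreal ((norm (F m x - F n x))\<^sup>2)) \<longlonglongrightarrow> ennreal ((norm (f x - F n x))\<^sup>2)"
          by (intro tendsto_ennrealI tendsto_intros)
        then show ?case by (rule lim_imp_Liminf[OF sequentially_bot, symmetric])
      qed
    qed
    also have "\<dots> \<le> liminf (\<lambda>m. (\<integral>\<^sup>+x. ennreal ((norm (F m x - F n x))\<^sup>2) \<partial>lborel))"
      by (rule nn_integral_liminf) measurable
    also have "\<dots> \<le> liminf (\<lambda>m. ennreal (((1/2) ^ n)\<^sup>2))"
    proof (rule Liminf_mono)
      show "\<forall>\<^sub>F m in sequentially. (\<integral>\<^sup>+x. ennreal ((norm (F m x - F n x))\<^sup>2) \<partial>lborel)
          \<le> ennreal (((1/2) ^ n)\<^sup>2)"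
        using eventually_ge_at_top[of n]
        by eventually_elim (unfold FF, intro ennreal_leI power_mono less_imp_le[OF close], auto)
    qed
    also have "\<dots> = ennreal (((1/2) ^ n)\<^sup>2)"
      by (simp add: Liminf_const)
    finally show ?thesis .
  qed
  have sqfF: "sq_integrable (\<lambda>x. f x - F n x)" for n
    by (rule sq_integrableI_nn) (use fF[of n] in \<open>auto simp: le_less_trans\<close>)
  have "sq_integrable f"
    using sq_integrable_add[OF sqfF[of 0] sqF[of 0]] by simp
  have lim: "norm (abs_L2 f - X (r n)) \<le> (1/2) ^ n" for n
  proof -
    have "ennreal ((norm (abs_L2 f - X (r n)))\<^sup>2)
        = (\<integral>\<^sup>+x. ennreal ((norm (f x - F n x))\<^sup>2) \<partial>lborel)"
      unfolding nn_integral_rep_L2[symmetric]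
      using rep_L2_diff[of "abs_L2 f" "X (r n)"] rep_abs_L2[OF \<open>sq_integrable f\<close>]
      by (intro nn_integral_cong_AE, eventually_elim) (simp add: F_def)
    then have "ennreal ((norm (abs_L2 f - X (r n)))\<^sup>2) \<le> ennreal (((1/2) ^ n)\<^sup>2)"
      using fF[of n] by (simp only:)
    then have "(norm (abs_L2 f - X (r n)))\<^sup>2 \<le> ((1/2) ^ n)\<^sup>2"
      by (rule ennreal_le_iff[OF zero_le_power2, THEN iffD1])
    then show ?thesis by (rule power2_le_imp_le) simp
  qed
  have "(\<lambda>n. X (r n) - abs_L2 f) \<longlonglongrightarrow> 0"
  proof (rule Lim_null_comparison)
    show "\<forall>\<^sub>F n in sequentially. norm (X (r n) - abs_L2 f) \<le> (1/2) ^ n"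
      using lim by (simp add: norm_minus_commute)
    show "(\<lambda>n. (1/2 :: real) ^ n) \<longlonglongrightarrow> 0" by (rule LIMSEQ_power_zero) simp
  qed
  then have "(X \<circ> r) \<longlonglongrightarrow> abs_L2 f"
    by (simp add: LIM_zero_iff o_def)
  then show "convergent X"
    using Cauchy_converges_subseq[OF \<open>Cauchy X\<close> r] by (auto simp: convergent_def)
qed

definition L2_on :: "'a::euclidean_space set \<Rightarrow> 'a L2 set" where
  "L2_on \<Omega> = {v. AE x in lborel. x \<notin> \<Omega> \<longrightarrow> rep_L2 v x = 0}"


section \<open>Smooth functions, test functions and smooth domains\<close>

abbreviation partial_deriv ::
    "'a::euclidean_space \<Rightarrow> ('a \<Rightarrow> 'b::real_normed_vector) \<Rightarrow> 'a \<Rightarrow> 'b" where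
  "partial_deriv b f \<equiv> \<lambda>x. frechet_derivative f (at x) b"

text \<open>Meant for open \<open>S\<close>.\<close>

primrec Ck_on :: "nat \<Rightarrow> 'a::euclidean_space set \<Rightarrow> ('a \<Rightarrow> 'b::real_normed_vector) \<Rightarrow> bool" where
  "Ck_on 0 S f \<longleftrightarrow> continuous_on S f"
| "Ck_on (Suc k) S f \<longleftrightarrow>
    (\<forall>x\<in>S. f differentiable (at x)) \<and> (\<forall>b\<in>Basis. Ck_on k S (partial_deriv b f))"

definition smooth_on :: "'a::euclidean_space set \<Rightarrow> ('a \<Rightarrow> 'b::real_normed_vector) \<Rightarrow> bool" where
  "smooth_on S f \<longleftrightarrow> (\<forall>k. Ck_on k S f)"

definition test_function ::
    "'a::euclidean_space set \<Rightarrow> ('a \<Rightarrow> 'b::real_normed_vector) \<Rightarrow> bool" where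
  "test_function \<Omega> \<phi> \<longleftrightarrow>
    smooth_on UNIV \<phi> \<and> (\<exists>S. compact S \<and> S \<subseteq> \<Omega> \<and> (\<forall>x. x \<notin> S \<longrightarrow> \<phi> x = 0))"

definition smooth_boundary :: "'a::euclidean_space set \<Rightarrow> bool" where
  "smooth_boundary \<Omega> \<longleftrightarrow>
    (\<forall>x\<in>frontier \<Omega>. \<exists>U (\<rho> :: 'a \<Rightarrow> real). open U \<and> x \<in> U \<and> smooth_on U \<rho> \<and>
      (\<forall>y\<in>U. frechet_derivative \<rho> (at y) \<noteq> (\<lambda>h. 0)) \<and> \<Omega> \<inter> U = {y \<in> U. \<rho> y < 0})"

definition smooth_convex_domain :: "'a::euclidean_space set \<Rightarrow> bool" where
  "smooth_convex_domain \<Omega> \<longleftrightarrow>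
    open \<Omega> \<and> \<Omega> \<noteq> {} \<and> bounded \<Omega> \<and> convex \<Omega> \<and> smooth_boundary \<Omega>"


section \<open>Weak derivatives and Sobolev spaces\<close>

text \<open>
  \<open>h\<close> is the weak derivative of \<open>g\<close> in direction \<open>b\<close> on the open set \<open>S\<close>.  It is only used
  for functions that are integrable or square-integrable on \<open>S\<close>.
\<close>

definition weak_deriv :: "'a::euclidean_space set \<Rightarrow> 'a
    \<Rightarrow> ('a \<Rightarrow> 'b::euclidean_space) \<Rightarrow> ('a \<Rightarrow> 'b) \<Rightarrow> bool" where
  "weak_deriv S b g h \<longleftrightarrow>
    (\<forall>\<phi> :: 'a \<Rightarrow> real. test_function S \<phi> \<longrightarrow>
      (LINT x:S|lborel. partial_deriv b \<phi> x *\<^sub>R g x) = - (LINT x:S|lborel. \<phi> x *\<^sub>R h x))"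

definition wpartial :: "'a::euclidean_space set \<Rightarrow> 'a \<Rightarrow> 'a L2 \<Rightarrow> 'a L2" where
  "wpartial \<Omega> b v = (THE w. w \<in> L2_on \<Omega> \<and> weak_deriv \<Omega> b (rep_L2 v) (rep_L2 w))"

text \<open>\<open>sobolev \<Omega> s\<close> is $H^s(\Omega)^d$.\<close>

primrec sobolev :: "'a::euclidean_space set \<Rightarrow> nat \<Rightarrow> 'a L2 set" where
  "sobolev \<Omega> 0 = L2_on \<Omega>"
| "sobolev \<Omega> (Suc s) =
    {v \<in> L2_on \<Omega>. \<forall>b\<in>Basis. \<exists>w \<in> sobolev \<Omega> s. weak_deriv \<Omega> b (rep_L2 v) (rep_L2 w)}"

primrec sobolev_norm :: "'a::euclidean_space set \<Rightarrow> nat \<Rightarrow> 'a L2 \<Rightarrow> real" where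
  "sobolev_norm \<Omega> 0 v = norm v"
| "sobolev_norm \<Omega> (Suc s) v =
    sqrt ((norm v)\<^sup>2 + (\<Sum>b\<in>Basis. (sobolev_norm \<Omega> s (wpartial \<Omega> b v))\<^sup>2))"

text \<open>$H^1_0(\Omega)^d$: the closure of the test fields in $H^1(\Omega)^d$.\<close>

definition sobolev0 :: "'a::euclidean_space set \<Rightarrow> 'a L2 set" where
  "sobolev0 \<Omega> = {v \<in> sobolev \<Omega> 1. \<forall>\<epsilon>>0. \<exists>\<phi> :: 'a \<Rightarrow> 'a.
      test_function \<Omega> \<phi> \<and> sobolev_norm \<Omega> 1 (v - abs_L2 \<phi>) < \<epsilon>}"

text \<open>
  The space $W^r_1(0,\infty)$ of real functions and its norm
  $\sum_{j \<le> r} \|K^{(j)}\|_{L_1}$.  Weak derivatives are unique a.e., so the choice made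
  by \<open>weak_deriv_pos\<close> is immaterial.
\<close>

definition weak_deriv_pos :: "(real \<Rightarrow> real) \<Rightarrow> real \<Rightarrow> real" where
  "weak_deriv_pos g =
    (SOME h. set_integrable lborel {0<..} h \<and> weak_deriv {0<..} 1 g h)"

primrec W1_pos :: "nat \<Rightarrow> (real \<Rightarrow> real) set" where
  "W1_pos 0 = {g. set_integrable lborel {0<..} g}"
| "W1_pos (Suc r) =
    {g. set_integrable lborel {0<..} g \<and> (\<exists>h \<in> W1_pos r. weak_deriv {0<..} 1 g h)}"

definition L1_norm_pos :: "(real \<Rightarrow> real) \<Rightarrow> real" where
  "L1_norm_pos g = (LINT t:{0<..}|lborel. \<bar>g t\<bar>)"

primrec W1_norm_pos :: "nat \<Rightarrow> (real \<Rightarrow> real) \<Rightarrow> real" where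
  "W1_norm_pos 0 g = L1_norm_pos g"
| "W1_norm_pos (Suc r) g = L1_norm_pos g + W1_norm_pos r (weak_deriv_pos g)"


section \<open>The elliptic operator\<close>

text \<open>
  An operator with domain \<open>D\<close> is a total function \<open>A\<close> whose values outside \<open>D\<close> are irrelevant.
\<close>

definition self_adjoint_on ::
    "'h::real_inner set \<Rightarrow> 'h set \<Rightarrow> ('h \<Rightarrow> 'h) \<Rightarrow> bool" where
  "self_adjoint_on H D A \<longleftrightarrow>
    D \<subseteq> H \<and> subspace D \<and> H \<subseteq> closure D \<and> A ` D \<subseteq> H \<and>
    (\<forall>v\<in>D. \<forall>w\<in>D. A (v + w) = A v + A w) \<and> (\<forall>c. \<forall>v\<in>D. A (c *\<^sub>R v) = c *\<^sub>R A v) \<and>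
    (\<forall>v\<in>D. \<forall>w\<in>D. A v \<bullet> w = v \<bullet> A w) \<and>
    (\<forall>w\<in>H. \<forall>z\<in>H. (\<forall>v\<in>D. A v \<bullet> w = v \<bullet> z) \<longrightarrow> w \<in> D \<and> A w = z)"

definition positive_definite_on ::
    "'h::real_inner set \<Rightarrow> ('h \<Rightarrow> 'h) \<Rightarrow> bool" where
  "positive_definite_on D A \<longleftrightarrow> (\<exists>c>0. \<forall>v\<in>D. c * (norm v)\<^sup>2 \<le> A v \<bullet> v)"

primrec op_power_dom :: "'h set \<Rightarrow> 'h set \<Rightarrow> ('h \<Rightarrow> 'h) \<Rightarrow> nat \<Rightarrow> 'h set" where
  "op_power_dom H D A 0 = H"
| "op_power_dom H D A (Suc n) = {v \<in> D. A v \<in> op_power_dom H D A n}"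

abbreviation elliptic_dom :: "'a::euclidean_space set \<Rightarrow> 'a L2 set" where
  "elliptic_dom \<Omega> \<equiv> sobolev \<Omega> 2 \<inter> sobolev0 \<Omega>"

text \<open>
  In the sense of distributions,
  $(Av)_i = -\sum_{jkl} \partial_j(p_{ijkl} \partial_l v_k) + \sum_{kl} q_{ikl} \partial_l v_k
    + \sum_k c_{ik} v_k$
  with bounded measurable coefficients and the (strong) ellipticity condition for systems.
  Indices are elements of \<open>Basis\<close>.
\<close>

definition uniformly_elliptic_second_order ::
    "'a::euclidean_space set \<Rightarrow> ('a L2 \<Rightarrow> 'a L2) \<Rightarrow> bool" where
  "uniformly_elliptic_second_order \<Omega> A \<longleftrightarrow>
    (\<exists>(p :: 'a \<Rightarrow> 'a \<Rightarrow> 'a \<Rightarrow> 'a \<Rightarrow> 'a \<Rightarrow> real) (q :: 'a \<Rightarrow> 'a \<Rightarrow> 'a \<Rightarrow> 'a \<Rightarrow> real)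
        (c :: 'a \<Rightarrow> 'a \<Rightarrow> 'a \<Rightarrow> real).
      (\<forall>i\<in>Basis. \<forall>j\<in>Basis. \<forall>k\<in>Basis. \<forall>l\<in>Basis.
        p i j k l \<in> borel_measurable borel \<and> bounded (p i j k l ` \<Omega>)) \<and>
      (\<forall>i\<in>Basis. \<forall>k\<in>Basis. \<forall>l\<in>Basis.
        q i k l \<in> borel_measurable borel \<and> bounded (q i k l ` \<Omega>)) \<and>
      (\<forall>i\<in>Basis. \<forall>k\<in>Basis. c i k \<in> borel_measurable borel \<and> bounded (c i k ` \<Omega>)) \<and>
      (\<exists>\<theta>>0. AE x in lborel. x \<in> \<Omega> \<longrightarrow> (\<forall>\<xi> \<eta>.
        \<theta> * (norm \<xi>)\<^sup>2 * (norm \<eta>)\<^sup>2 \<le>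
          (\<Sum>i\<in>Basis. \<Sum>j\<in>Basis. \<Sum>k\<in>Basis. \<Sum>l\<in>Basis.
            p i j k l x * (\<xi> \<bullet> j) * (\<xi> \<bullet> l) * (\<eta> \<bullet> i) * (\<eta> \<bullet> k)))) \<and>
      (\<forall>v \<in> elliptic_dom \<Omega>. \<forall>\<phi> :: 'a \<Rightarrow> 'a. test_function \<Omega> \<phi> \<longrightarrow>
        A v \<bullet> abs_L2 \<phi> = (LINT x:\<Omega>|lborel.
          (\<Sum>i\<in>Basis. \<Sum>j\<in>Basis. \<Sum>k\<in>Basis. \<Sum>l\<in>Basis.
            p i j k l x * (rep_L2 (wpartial \<Omega> l v) x \<bullet> k) * (partial_deriv j \<phi> x \<bullet> i)) +
          (\<Sum>i\<in>Basis. \<Sum>k\<in>Basis. \<Sum>l\<in>Basis.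
            q i k l x * (rep_L2 (wpartial \<Omega> l v) x \<bullet> k) * (\<phi> x \<bullet> i)) +
          (\<Sum>i\<in>Basis. \<Sum>k\<in>Basis. c i k x * (rep_L2 v x \<bullet> k) * (\<phi> x \<bullet> i)))))"

definition elliptic_operator :: "'a::euclidean_space set \<Rightarrow> ('a L2 \<Rightarrow> 'a L2) \<Rightarrow> bool" where
  "elliptic_operator \<Omega> A \<longleftrightarrow>
    self_adjoint_on (L2_on \<Omega>) (elliptic_dom \<Omega>) A \<and>
    positive_definite_on (elliptic_dom \<Omega>) A \<and>
    uniformly_elliptic_second_order \<Omega> A \<and>
    (\<exists>C. \<forall>v \<in> elliptic_dom \<Omega>. sobolev_norm \<Omega> 2 v \<le> C * norm (A v))"

text \<open>The form $a(v,w) = (Av,w)$, extended from the domain of \<open>A\<close> to $V$ by continuity.\<close>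

definition energy_form ::
    "'a::euclidean_space set \<Rightarrow> ('a L2 \<Rightarrow> 'a L2) \<Rightarrow> 'a L2 \<Rightarrow> 'a L2 \<Rightarrow> real" where
  "energy_form \<Omega> A v w = (THE l. \<forall>X Y.
    (\<forall>n. X n \<in> elliptic_dom \<Omega>) \<and> (\<lambda>n. sobolev_norm \<Omega> 1 (X n - v)) \<longlonglongrightarrow> 0 \<and>
    (\<forall>n. Y n \<in> elliptic_dom \<Omega>) \<and> (\<lambda>n. sobolev_norm \<Omega> 1 (Y n - w)) \<longlonglongrightarrow> 0 \<longrightarrow>
    (\<lambda>n. A (X n) \<bullet> Y n) \<longlonglongrightarrow> l)"

definition energy_norm ::
    "'a::euclidean_space set \<Rightarrow> ('a L2 \<Rightarrow> 'a L2) \<Rightarrow> 'a L2 \<Rightarrow> real" where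
  "energy_norm \<Omega> A v = sqrt (energy_form \<Omega> A v v)"


section \<open>The evolution problem\<close>

text \<open>Time derivatives on \<open>{0..T}\<close>, one-sided at the end points.\<close>

primrec time_deriv ::
    "real \<Rightarrow> nat \<Rightarrow> (real \<Rightarrow> 'h::real_normed_vector) \<Rightarrow> real \<Rightarrow> 'h" where
  "time_deriv T 0 g = g"
| "time_deriv T (Suc n) g = (\<lambda>t. vector_derivative (time_deriv T n g) (at t within {0..T}))"

definition times_differentiable ::
    "real \<Rightarrow> nat \<Rightarrow> (real \<Rightarrow> 'h::real_normed_vector) \<Rightarrow> bool" where
  "times_differentiable T n g \<longleftrightarrow>
    (\<forall>m<n. \<forall>t\<in>{0..T}. time_deriv T m g differentiable (at t within {0..T}))"

definition abs_cont :: "real \<Rightarrow> (real \<Rightarrow> 'h::real_normed_vector) \<Rightarrow> bool" where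
  "abs_cont T g \<longleftrightarrow>
    (\<forall>\<epsilon>>0. \<exists>\<delta>>0. \<forall>P. finite P \<and> (\<forall>(a, b)\<in>P. 0 \<le> a \<and> a \<le> b \<and> b \<le> T) \<and>
      disjoint_family_on (\<lambda>(a, b). {a<..<b}) P \<and> (\<Sum>(a, b)\<in>P. b - a) < \<delta> \<longrightarrow>
      (\<Sum>(a, b)\<in>P. norm (g b - g a)) < \<epsilon>)"

text \<open>
  The time derivative of a solution is required to be absolutely continuous, as otherwise the
  equation almost everywhere would not determine it.  In the equation, \<open>A\<close> is applied to
  $u - \int_0^t K(t-s) u(s)\,ds$; for the kernels considered the integrand agrees a.e. with a
  continuous function, so that the gauge integral agrees with the Bochner integral.
\<close>

definition solution :: "'a::euclidean_space set \<Rightarrow> ('a L2 \<Rightarrow> 'a L2) \<Rightarrow> (real \<Rightarrow> real) \<Rightarrow> real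
    \<Rightarrow> (real \<Rightarrow> 'a L2) \<Rightarrow> 'a L2 \<Rightarrow> 'a L2 \<Rightarrow> (real \<Rightarrow> 'a L2) \<Rightarrow> bool" where
  "solution \<Omega> A K T f u0 u1 u \<longleftrightarrow>
    (\<forall>t\<in>{0..T}. u t \<in> L2_on \<Omega>) \<and>
    times_differentiable T 1 u \<and> abs_cont T (time_deriv T 1 u) \<and>
    (AE t in lborel. t \<in> {0<..<T} \<longrightarrow>
      time_deriv T 1 u differentiable (at t) \<and>
      u t - integral {0..t} (\<lambda>s. K (t - s) *\<^sub>R u s) \<in> elliptic_dom \<Omega> \<and>
      time_deriv T 2 u t + A (u t - integral {0..t} (\<lambda>s. K (t - s) *\<^sub>R u s)) = f t) \<and>
    u 0 = u0 \<and> time_deriv T 1 u 0 = u1"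

definition admissible_kernel :: "nat \<Rightarrow> (real \<Rightarrow> real) \<Rightarrow> bool" where
  "admissible_kernel r K \<longleftrightarrow>
    K \<in> W1_pos r \<and> W1_norm_pos r K < 1 \<and> L1_norm_pos K < 1 \<and>
    (AE t in lborel. t > 0 \<longrightarrow> K t \<ge> 0) \<and> (AE t in lborel. t > 0 \<longrightarrow> weak_deriv_pos K t \<le> 0)"

text \<open>
  The compatibility conditions, where the powers of \<open>A\<close> are those of the unbounded operator.  For
  $f$, the condition that $A^j f^{(r-2j)}(0)$ exists in this sense is part of the hypotheses;
  $f^{(r-2j)}(0) \in H^{2j} \cap V$ alone does not imply it if $j \<ge> 2$.
\<close>

definition data_compatible :: "'a::euclidean_space set \<Rightarrow> ('a L2 \<Rightarrow> 'a L2) \<Rightarrow> nat \<Rightarrow> real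
    \<Rightarrow> (real \<Rightarrow> 'a L2) \<Rightarrow> 'a L2 \<Rightarrow> 'a L2 \<Rightarrow> bool" where
  "data_compatible \<Omega> A r T f u0 u1 \<longleftrightarrow>
    (let D = elliptic_dom \<Omega>; V = sobolev0 \<Omega>; D_pow = op_power_dom (L2_on \<Omega>) D A;
         f0 = (\<lambda>n. time_deriv T n f 0) in
      (\<forall>k\<ge>1. r = 2 * k \<longrightarrow>
        u0 \<in> D_pow k \<and> (A ^^ k) u0 \<in> D \<and> u1 \<in> D_pow k \<and> (A ^^ k) u1 \<in> V \<and>
        (\<forall>j\<in>{1..k}. f0 (r - 2 * j) \<in> sobolev \<Omega> (2 * j) \<inter> V \<inter> D_pow j \<and>
          f0 (r - 2 * j + 1) \<in> sobolev \<Omega> (2 * (j - 1)) \<inter> V \<inter> D_pow (j - 1))) \<and>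
      (\<forall>k. r = 2 * k + 1 \<longrightarrow>
        u1 \<in> D_pow k \<and> (A ^^ k) u1 \<in> D \<and> u0 \<in> D_pow (k + 1) \<and> (A ^^ (k + 1)) u0 \<in> V \<and>
        (\<forall>j\<in>{1..k}. f0 (r - 2 * j) \<in> sobolev \<Omega> (2 * j) \<inter> V \<inter> D_pow j) \<and>
        (\<forall>j\<in>{1..k + 1}.
          f0 (r + 1 - 2 * j) \<in> sobolev \<Omega> (2 * (j - 1)) \<inter> V \<inter> D_pow (j - 1))))"

end

theory Submission
  imports Defs
begin

text \<open>
  The $L_1$ kernel has a continuous, nonnegative, nonincreasing representative with $K(0) \<le> 1$, and
  its derivatives of order less than \<open>r\<close> are continuous and bounded by one.  With
  $S = A^{-1}$, a bounded positive operator, $v = u^{(r)}$ solves $S \ddot v + v - K * v = S g$, where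
  $g = f^{(r)} + \sum_{i<r} K^{(i)} A u^{(r-1-i)}(0)$ and the values $u^{(j)}(0)$ follow
  from the equation; each second time derivative costs one power of \<open>A\<close>, which is what the
  compatibility conditions provide.  Replacing \<open>A\<close> by the bounded operators $(S + e)^{-1}$ gives
  Volterra equations.  Testing with $\dot v$, and using $\kappa < 1$ to control \<open>v\<close> by
  $p = v - K * v$, yields
  an energy estimate uniform in \<open>e\<close>; applied to cut-off operators and to differences it makes
  $\dot v$ converge uniformly and \<open>v\<close> converge in \<open>V\<close>.  Integrating \<open>r\<close> times recovers \<open>u\<close>.
  For uniqueness, the time primitive of the difference of two solutions satisfies
  the equation without source in the $S$-inner product, so its energy vanishes.
\<close>

subsection \<open>Convolutions in time\<close>

text \<open>For the limit problem testing with v' is not legitimate, because v' lies only in H;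
  hence the estimates are made with bounded operators and carried over through \<open>S\<close>. The
  Yosida error is of size sqrt e in H, so differences of approximations are small at first only in
  the form S z . z, which is weaker than the norm. What upgrades this is that a multiplier commuting
  with \<open>S\<close> leaves the equation unchanged and acts on the data alone. For the
  high-frequency cut-off, the function e A / (1 + e A) of A, the cut-off data tend to 0; so high
  frequencies are small uniformly in the approximation, and on low frequencies the weak form
  controls the norm. The memory term is handled without differentiating K: as K decreases from K(0)
  \<le> 1, the convolution K * v has Lipschitz constant at most 2 sup |v|. The price is a supremum
  over the past, which shapes the Gronwall argument. That convergence in energy means convergence in
  V rests on coercivity of the form in H^1, which is interpolated from the H^2 regularity
  estimate.\<close>

definition conv :: "(real \<Rightarrow> real) \<Rightarrow> (real \<Rightarrow> 'h::banach) \<Rightarrow> real \<Rightarrow> 'h" where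
  "conv K x t = integral {0..t} (\<lambda>s. K (t - s) *\<^sub>R x s)"

lemma conv_zero [simp]: "conv K x 0 = 0"
  by (simp add: conv_def)

lemma continuous_on_conv_integrand:
  fixes x :: "real \<Rightarrow> 'h::banach"
  assumes "continuous_on UNIV K" "continuous_on {0..T} x" "t \<in> {0..T}"
  shows "continuous_on {0..t} (\<lambda>s. K (t - s) *\<^sub>R x s)"
  by (intro continuous_intros continuous_on_compose2[OF assms(1)] continuous_on_subset[OF assms(2)])
    (use assms(3) in auto)

lemma conv_integrable:
  fixes x :: "real \<Rightarrow> 'h::banach"
  assumes "continuous_on UNIV K" "continuous_on {0..T} x" "t \<in> {0..T}"
  shows "(\<lambda>s. K (t - s) *\<^sub>R x s) integrable_on {0..t}"
  using continuous_on_conv_integrand[OF assms] integrable_continuous_interval by blast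

lemma conv_linear:
  assumes "continuous_on UNIV K" "continuous_on {0..T} x" "t \<in> {0..T}" "bounded_linear F"
  shows "F (conv K x t) = conv K (\<lambda>s. F (x s)) t"
  unfolding conv_def
  using integral_linear[OF conv_integrable[OF assms(1-3)] assms(4)]
  by (simp add: o_def linear_simps(5)[OF assms(4)])

lemma conv_diff:
  assumes "continuous_on UNIV K" "continuous_on {0..T} x" "continuous_on {0..T} y" "t \<in> {0..T}"
  shows "conv K (\<lambda>s. x s - y s) t = conv K x t - conv K y t"
  unfolding conv_def
  by (simp add: scaleR_diff_right integral_diff[OF conv_integrable[OF assms(1,2,4)] conv_integrable[OF assms(1,3,4)]])

lemma conv_norm_le:
  assumes "continuous_on UNIV K" "continuous_on {0..T} x" "t \<in> {0..T}" "continuous_on {0..T} g"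
    and "\<And>s. s \<in> {0..t} \<Longrightarrow> 0 \<le> K s" "\<And>s. s \<in> {0..t} \<Longrightarrow> norm (x s) \<le> g s"
  shows "norm (conv K x t) \<le> conv K g t"
  unfolding conv_def
proof (rule integral_norm_bound_integral)
  show "(\<lambda>s. K (t - s) *\<^sub>R x s) integrable_on {0..t}" "(\<lambda>s. K (t - s) *\<^sub>R g s) integrable_on {0..t}"
    using assms conv_integrable by blast+
  show "norm (K (t - s) *\<^sub>R x s) \<le> K (t - s) *\<^sub>R g s" if "s \<in> {0..t}" for s
    using that assms(5)[of "t - s"] assms(6)[of s] by (auto intro: mult_left_mono)
qed

text \<open>No integrability is assumed: reflection preserves it both ways, and a non-integrable
  function has integral 0 on both sides by convention. This keeps \<open>conv_flip\<close> free of
  hypotheses.\<close>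

lemma integral_flip:
  fixes f :: "real \<Rightarrow> 'h::banach"
  shows "integral {0..t} (\<lambda>s. f (t - s)) = integral {0..t} f"
proof (cases "f integrable_on {0..t}")
  case True
  then have "((\<lambda>x. f ((-1) *\<^sub>R x + t)) has_integral (1 / \<bar>-1::real\<bar> ^ DIM(real)) *\<^sub>R integral {0..t} f)
      ((\<lambda>x. (1 / -1) *\<^sub>R x + - ((1 / -1) *\<^sub>R t)) ` cbox 0 t)"
    by (intro has_integral_affinity) (auto simp: integrable_integral)
  moreover have "(\<lambda>x. (1 / -1) *\<^sub>R x + - ((1 / -1) *\<^sub>R t)) ` cbox 0 t = {0..t::real}"
    by (auto simp: image_iff intro!: bexI[of _ "t - x" for x])
  ultimately show ?thesis by (simp add: integral_unique)
next
  case False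
  have "\<not> (\<lambda>s. f (t - s)) integrable_on {0..t}"
  proof
    assume "(\<lambda>s. f (t - s)) integrable_on {0..t}"
    then have "((\<lambda>x. f (t - ((-1) *\<^sub>R x + t))) has_integral (1 / \<bar>-1::real\<bar> ^ DIM(real)) *\<^sub>R integral {0..t} (\<lambda>s. f (t - s)))
        ((\<lambda>x. (1 / -1) *\<^sub>R x + - ((1 / -1) *\<^sub>R t)) ` cbox 0 t)"
      by (intro has_integral_affinity) (auto simp: integrable_integral)
    moreover have "(\<lambda>x. (1 / -1) *\<^sub>R x + - ((1 / -1) *\<^sub>R t)) ` cbox 0 t = {0..t::real}"
      by (auto simp: image_iff intro!: bexI[of _ "t - x" for x])
    ultimately show False using False by (auto simp: integrable_on_def)
  qed
  then show ?thesis using False by (simp add: not_integrable_integral)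
qed

lemma conv_flip: "conv K x t = integral {0..t} (\<lambda>s. K s *\<^sub>R x (t - s))"
  unfolding conv_def using integral_flip[of t "\<lambda>s. K s *\<^sub>R x (t - s)"] by simp

lemma conv_const: "conv K (\<lambda>s. c) t = integral {0..t} K *\<^sub>R c" if "continuous_on UNIV K"
proof -
  have "K integrable_on {0..t}"
    using that by (intro integrable_continuous_interval) (auto intro: continuous_on_subset)
  then show ?thesis
    unfolding conv_flip using integral_linear[OF _ bounded_linear_scaleR_left[of c], of K "{0..t}"]
    by (simp add: o_def)
qed

lemma continuous_on_clamp:
  assumes "continuous_on {0..T} y" "0 \<le> (T::real)"
  shows "continuous_on S (\<lambda>s. y (max 0 (min T s)))"
  by (rule continuous_on_compose2[OF assms(1)]) (use assms(2) in \<open>auto intro!: continuous_intros\<close>)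

text \<open>\<open>K\<close> is merely continuous, so the differentiation must fall on
  \<open>x\<close>: with the integrand \<open>K \<tau> *\<^sub>R x (t - \<tau>)\<close> the time
  occurs in the upper limit and inside \<open>x\<close> only. The two occurrences are separated into
  a function of two variables, which is then differentiated along the diagonal.\<close>

lemma conv_has_vector_derivative:
  fixes x y :: "real \<Rightarrow> 'h::banach"
  assumes K: "continuous_on UNIV K" and y: "continuous_on {0..T} y"
    and x: "\<And>s. s \<in> {0..T} \<Longrightarrow> (x has_vector_derivative y s) (at s within {0..T})"
    and t: "t \<in> {0..T}"
  shows "(conv K x has_vector_derivative K t *\<^sub>R x 0 + conv K y t) (at t within {0..T})"
proof -
  have T: "0 \<le> T" using t by auto
  define ye where "ye s = y (max 0 (min T s))" for s
  have ye: "continuous_on S ye" for S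
    unfolding ye_def by (rule continuous_on_clamp[OF y T])
  have ye_eq: "ye s = y s" if "s \<in> {0..T}" for s
    using that by (simp add: ye_def)
  \<comment> \<open>A C1 extension of \<open>x\<close> to negative times with derivative
    \<open>ye\<close>; off the diagonal the argument \<open>u - \<tau>\<close> may be
    negative.\<close>
  define xe where "xe s = x 0 + (integral {-T..s} ye - integral {-T..0} ye)" for s
  have xe: "(xe has_vector_derivative ye s) (at s within {-T..T})" if "s \<in> {-T..T}" for s
    unfolding xe_def
    by (rule derivative_eq_intros refl integral_has_vector_derivative ye that)+ simp
  have xe_cont: "continuous_on {-T..T} xe"
    using xe by (meson continuous_on_eq_continuous_within has_vector_derivative_continuous)
  have xe_eq: "xe s = x s" if s: "s \<in> {0..T}" for s
  proof -
    have "(y has_integral x s - x 0) {0..s}"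
      by (rule fundamental_theorem_of_calculus)
        (use s in \<open>auto intro!: has_vector_derivative_within_subset[OF x]\<close>)
    moreover have "(ye has_integral xe s - xe 0) {0..s}"
      by (rule fundamental_theorem_of_calculus)
        (use s in \<open>auto intro!: has_vector_derivative_within_subset[OF xe]\<close>)
    moreover have "(ye has_integral xe s - xe 0) {0..s} \<longleftrightarrow> (y has_integral xe s - xe 0) {0..s}"
      by (rule has_integral_cong) (use s in \<open>auto simp: ye_eq\<close>)
    ultimately have "x s - x 0 = xe s - xe 0" using has_integral_unique by blast
    moreover have "xe 0 = x 0" by (simp add: xe_def)
    ultimately show ?thesis by simp
  qed
  define G where "G u c = integral (cbox 0 c) (\<lambda>\<tau>. K \<tau> *\<^sub>R xe (u - \<tau>))" for u c
  have contF: "continuous_on {0..c} (\<lambda>\<tau>. K \<tau> *\<^sub>R xe (u - \<tau>))" if "u \<in> {0..T}" "c \<in> {0..T}" for u c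
    by (intro continuous_intros continuous_on_compose2[OF K] continuous_on_compose2[OF xe_cont])
      (use that in auto)
  have D1: "((\<lambda>u. G u t) has_derivative
      (\<lambda>h. h *\<^sub>R integral (cbox 0 t) (\<lambda>\<tau>. K \<tau> *\<^sub>R ye (t - \<tau>)))) (at t within {0..T})"
    unfolding G_def has_vector_derivative_def[symmetric]
  proof (rule leibniz_rule_vector_derivative[where U = "{0..T}"])
    fix u \<tau> :: real assume u: "u \<in> {0..T}" and \<tau>: "\<tau> \<in> cbox 0 t"
    have "((\<lambda>u. xe (u - \<tau>)) has_vector_derivative ye (u - \<tau>)) (at u within {0..T})"
    proof -
      have "((xe \<circ> (\<lambda>u. u - \<tau>)) has_vector_derivative 1 *\<^sub>R ye (u - \<tau>)) (at u within {0..T})"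
      proof (rule vector_diff_chain_within)
        show "((\<lambda>u. u - \<tau>) has_vector_derivative 1) (at u within {0..T})"
          by (auto intro!: derivative_eq_intros)
        show "(xe has_vector_derivative ye (u - \<tau>)) (at (u - \<tau>) within (\<lambda>u. u - \<tau>) ` {0..T})"
          by (rule has_vector_derivative_within_subset[OF xe]) (use u \<tau> t in auto)
      qed
      then show ?thesis by (simp add: o_def)
    qed
    then show "((\<lambda>u. K \<tau> *\<^sub>R xe (u - \<tau>)) has_vector_derivative K \<tau> *\<^sub>R ye (u - \<tau>)) (at u within {0..T})"
      by (auto intro!: derivative_eq_intros)
  next
    show "(\<lambda>\<tau>. K \<tau> *\<^sub>R xe (u - \<tau>)) integrable_on cbox 0 t" if "u \<in> {0..T}" for u
      using contF[OF that t] by (simp add: integrable_continuous_interval)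
    show "continuous_on ({0..T} \<times> cbox 0 t) (\<lambda>(u, \<tau>). K \<tau> *\<^sub>R ye (u - \<tau>))"
      unfolding split_def
      by (intro continuous_intros continuous_on_compose2[OF K] continuous_on_compose2[OF ye[of UNIV]]) auto
  qed (use t in auto)
  \<comment> \<open>This partial derivative is written as a bounded linear function because
    \<open>has_derivative_partialsI\<close> asks for its continuity in operator norm.\<close>
  have D2: "((\<lambda>c. G u c) has_derivative blinfun_apply (blinfun_scaleR_left (K c *\<^sub>R xe (u - c)))) (at c within {0..T})"
    if "u \<in> {0..T}" "c \<in> {0..T}" for u c
  proof -
    have "((\<lambda>c. integral {0..c} (\<lambda>\<tau>. K \<tau> *\<^sub>R xe (u - \<tau>))) has_vector_derivative K c *\<^sub>R xe (u - c)) (at c within {0..T})"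
      by (rule integral_has_vector_derivative) (use that contF[OF that(1), of T] T in auto)
    then show ?thesis
      by (simp add: G_def has_vector_derivative_def)
  qed
  have "((\<lambda>(u, c). G u c) has_derivative (\<lambda>(tx, ty). tx *\<^sub>R integral (cbox 0 t) (\<lambda>\<tau>. K \<tau> *\<^sub>R ye (t - \<tau>))
      + blinfun_apply (blinfun_scaleR_left (K t *\<^sub>R xe (t - t))) ty)) (at (t, t) within {0..T} \<times> {0..T})"
  proof (rule has_derivative_partialsI[OF D1 D2])
    have "continuous_on ({0..T} \<times> {0..T}) (\<lambda>(u, c). blinfun_scaleR_left (K c *\<^sub>R xe (u - c)))"
      unfolding split_def
      by (intro continuous_intros continuous_on_compose2[OF K] continuous_on_compose2[OF xe_cont]
          bounded_linear.continuous_on[OF bounded_linear_blinfun_scaleR_left]) auto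
    then show "continuous (at (t, t) within {0..T} \<times> {0..T}) (\<lambda>(u, c). blinfun_scaleR_left (K c *\<^sub>R xe (u - c)))"
      using t by (auto simp: continuous_on_eq_continuous_within)
  qed (use t in auto)
  then have "((\<lambda>(u, c). G u c) \<circ> (\<lambda>u. (u, u)) has_derivative (\<lambda>(tx, ty). tx *\<^sub>R integral (cbox 0 t) (\<lambda>\<tau>. K \<tau> *\<^sub>R ye (t - \<tau>))
      + blinfun_apply (blinfun_scaleR_left (K t *\<^sub>R xe (t - t))) ty) \<circ> (\<lambda>h. (h, h))) (at t within {0..T})"
    by (intro diff_chain_within has_derivative_Pair has_derivative_ident)
      (auto intro: has_derivative_subset)
  then have "((\<lambda>u. G u u) has_vector_derivative integral (cbox 0 t) (\<lambda>\<tau>. K \<tau> *\<^sub>R ye (t - \<tau>)) + K t *\<^sub>R xe 0) (at t within {0..T})"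
    by (simp add: o_def has_vector_derivative_def scaleR_add_right)
  moreover have "G u u = conv K x u" if "u \<in> {0..T}" for u
    unfolding G_def conv_flip cbox_interval by (rule integral_cong) (use that xe_eq in auto)
  moreover have "integral (cbox 0 t) (\<lambda>\<tau>. K \<tau> *\<^sub>R ye (t - \<tau>)) = conv K y t"
    unfolding conv_flip cbox_interval by (rule integral_cong) (use t ye_eq in auto)
  moreover have "xe 0 = x 0" by (simp add: xe_def)
  ultimately show ?thesis
    using has_vector_derivative_transform[OF t, of "conv K x" "\<lambda>u. G u u"] by (simp add: add.commute)
qed

text \<open>Scaling by \<open>s = t \<sigma>\<close> fixes the interval of integration, so
  continuity of parameter integrals applies; \<open>x\<close> is only continuous here.\<close>

lemma conv_continuous:
  fixes x :: "real \<Rightarrow> 'h::banach"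
  assumes K: "continuous_on UNIV K" and x: "continuous_on {0..T} x" and T: "0 \<le> T"
  shows "continuous_on {0..T} (conv K x)"
proof -
  define xe where "xe s = x (max 0 (min T s))" for s
  have xe: "continuous_on S xe" for S
    unfolding xe_def by (rule continuous_on_clamp[OF x T])
  define H where "H t = t *\<^sub>R integral (cbox 0 1) (\<lambda>\<sigma>. K (t * \<sigma>) *\<^sub>R xe (t - t * \<sigma>))" for t
  have "continuous_on {0..T} H"
    unfolding H_def
    by (intro continuous_intros integral_continuous_on_param)
      (auto simp: split_def intro!: continuous_intros continuous_on_compose2[OF K] continuous_on_compose2[OF xe[of UNIV]])
  moreover have "H t = conv K x t" if t: "t \<in> {0..T}" for t
  proof (cases "t = 0")
    case False
    then have t0: "t > 0" using t by auto
    have c: "continuous_on {0..t} (\<lambda>s. K s *\<^sub>R xe (t - s))"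
      by (intro continuous_intros continuous_on_compose2[OF K] continuous_on_compose2[OF xe[of UNIV]]) auto
    then have "((\<lambda>s. K s *\<^sub>R xe (t - s)) has_integral integral {0..t} (\<lambda>s. K s *\<^sub>R xe (t - s))) (cbox 0 t)"
      using integrable_integral[OF integrable_continuous_interval] by auto
    then have "((\<lambda>\<sigma>. K (t *\<^sub>R \<sigma> + 0) *\<^sub>R xe (t - (t *\<^sub>R \<sigma> + 0))) has_integral
        (integral {0..t} (\<lambda>s. K s *\<^sub>R xe (t - s)) /\<^sub>R t ^ DIM(real))) (cbox ((0 - 0) /\<^sub>R t) ((t - 0) /\<^sub>R t))"
      by (rule has_integral_affinity'[OF _ t0])
    then have "integral (cbox 0 1) (\<lambda>\<sigma>. K (t * \<sigma>) *\<^sub>R xe (t - t * \<sigma>)) = integral {0..t} (\<lambda>s. K s *\<^sub>R xe (t - s)) /\<^sub>R t"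
      using t0 by (simp add: integral_unique)
    then have "H t = integral {0..t} (\<lambda>s. K s *\<^sub>R xe (t - s))"
      using t0 by (simp add: H_def)
    also have "\<dots> = conv K x t"
      unfolding conv_flip by (rule integral_cong) (use t in \<open>auto simp: xe_def\<close>)
    finally show ?thesis .
  qed (simp add: H_def)
  ultimately show ?thesis by (rule continuous_on_eq)
qed

text \<open>The bound on \<open>e'\<close> involves the supremum of \<open>e\<close> over the past.
  Let \<open>m\<close> be the point where \<open>exp (- L * s) * e s\<close> is largest, with value
  \<open>N\<close>: then \<open>N * exp (L * s)\<close> bounds the whole past, and integrating up to
  \<open>m\<close> gives an inequality for \<open>N\<close> alone.\<close>

lemma gronwall_sup:
  fixes e e' h :: "real \<Rightarrow> real"
  assumes t: "0 \<le> t" and C: "C > 0" and c: "c \<ge> 0" and h: "continuous_on {0..t} h" "\<And>s. s \<in> {0..t} \<Longrightarrow> 0 \<le> h s"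
    and e: "\<And>s. s \<in> {0..t} \<Longrightarrow> (e has_real_derivative e' s) (at s within {0..t})"
      "\<And>s. s \<in> {0..t} \<Longrightarrow> 0 \<le> e s"
    and le: "\<And>s Q. s \<in> {0..t} \<Longrightarrow> (\<And>\<tau>. \<tau> \<in> {0..s} \<Longrightarrow> e \<tau> \<le> Q) \<Longrightarrow> e' s \<le> h s * sqrt (e s) + c + C * Q"
  shows "e t \<le> exp (2 * C * t) * (4 * e 0 + 4 * c * t + 4 * (integral {0..t} h)\<^sup>2)"
proof -
  \<comment> \<open>Twice \<open>C\<close>, so that the memory term integrates to less than
    \<open>N / 2 * E\<close>, half of the left-hand side.\<close>
  define L where "L = 2 * C"
  have e_cont: "continuous_on {0..t} e"
    using e(1) by (meson DERIV_continuous continuous_on_eq_continuous_within)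
  obtain m where m: "m \<in> {0..t}" and mmax: "\<And>s. s \<in> {0..t} \<Longrightarrow> exp (- L * s) * e s \<le> exp (- L * m) * e m"
  proof -
    have cc: "continuous_on {0..t} (\<lambda>s. exp (- L * s) * e s)" by (intro continuous_intros e_cont)
    then show ?thesis using continuous_attains_sup[of "{0..t}" "\<lambda>s. exp (- L * s) * e s"] t that by auto
  qed
  define N where "N = exp (- L * m) * e m"
  have N0: "N \<ge> 0" using e(2)[OF m] by (simp add: N_def)
  have eN: "e s \<le> N * exp (L * s)" if "s \<in> {0..t}" for s
  proof -
    have "exp (L * s) * (exp (- L * s) * e s) \<le> exp (L * s) * N"
      using mmax[OF that] by (intro mult_left_mono) (auto simp: N_def)
    moreover have "exp (L * s) * (exp (- L * s) * e s) = e s" by (simp add: exp_minus)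
    ultimately show ?thesis by (simp only: mult.commute)
  qed
  define E where "E = exp (L * m)"
  define R where "R = sqrt N * sqrt E"
  have E1: "E \<ge> 1" using m C by (simp add: E_def L_def)
  have emE: "e m = N * E" by (simp add: N_def E_def exp_minus)
  have bnd: "e' s \<le> h s * R + c + C * (N * exp (L * s))" if s: "s \<in> {0..m}" for s
  proof -
    have st: "s \<in> {0..t}" using s m by auto
    have "e' s \<le> h s * sqrt (e s) + c + C * (N * exp (L * s))"
    proof (rule le[OF st])
      fix \<tau> assume \<tau>: "\<tau> \<in> {0..s}"
      then have "e \<tau> \<le> N * exp (L * \<tau>)" using st by (intro eN) auto
      also have "\<dots> \<le> N * exp (L * s)" using \<tau> C N0 by (intro mult_left_mono) (auto simp: L_def)
      finally show "e \<tau> \<le> N * exp (L * s)" .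
    qed
    moreover have "sqrt (e s) \<le> R"
    proof -
      have "e s \<le> N * exp (L * s)" by (rule eN[OF st])
      also have "\<dots> \<le> N * E" using s C N0 by (intro mult_left_mono) (auto simp: L_def E_def)
      finally show ?thesis by (simp add: R_def real_sqrt_mult[symmetric])
    qed
    ultimately show ?thesis using h(2)[OF st] by (smt (verit) mult_left_mono)
  qed
  have hm: "continuous_on {0..m} h" using h(1) m by (auto intro: continuous_on_subset)
  have I1: "(e' has_integral e m - e 0) {0..m}"
    by (rule fundamental_theorem_of_calculus)
      (use m in \<open>auto intro!: has_vector_derivative_within_subset[OF e(1)[unfolded has_real_derivative_iff_has_vector_derivative]]\<close>)
  have I2: "((\<lambda>s. exp (L * s)) has_integral (exp (L * m) / L - exp (L * 0) / L)) {0..m}"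
  proof (rule fundamental_theorem_of_calculus)
    fix s :: real
    have "((\<lambda>s. exp (L * s) / L) has_real_derivative exp (L * s)) (at s within {0..m})"
      using C by (auto simp: L_def intro!: derivative_eq_intros)
    then show "((\<lambda>s. exp (L * s) / L) has_vector_derivative exp (L * s)) (at s within {0..m})"
      by (simp only: has_real_derivative_iff_has_vector_derivative)
  qed (use m in auto)
  have I3: "(h has_integral integral {0..m} h) {0..m}"
    using hm by (intro integrable_integral integrable_continuous_interval)
  have I4: "((\<lambda>s. c) has_integral c * m) {0..m}"
    using has_integral_const_real[of c 0 m] m by (simp add: mult.commute)
  have I5: "((\<lambda>s. h s * R + c + C * (N * exp (L * s))) has_integral
      integral {0..m} h * R + c * m + C * (N * (exp (L * m) / L - exp (L * 0) / L))) {0..m}"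
    by (intro has_integral_add has_integral_mult_left has_integral_mult_right I2 I3 I4)
  have "e m - e 0 \<le> integral {0..m} h * R + c * m + C * (N * (exp (L * m) / L - exp (L * 0) / L))"
    by (rule has_integral_le[OF I1 I5]) (use bnd in auto)
  also have "C * (N * (exp (L * m) / L - exp (L * 0) / L)) = N / 2 * (E - 1)"
    using C by (simp add: L_def E_def field_simps)
  finally have 1: "N * E \<le> e 0 + integral {0..m} h * R + c * m + N / 2 * (E - 1)"
    by (simp add: emE)
  define G where "G = integral {0..t} h"
  have Gm: "integral {0..m} h \<le> G"
    unfolding G_def
    by (rule integral_subset_le) (use m h hm in \<open>auto intro!: integrable_continuous_interval\<close>)
  have Gm0: "0 \<le> integral {0..m} h"
    by (rule integral_nonneg) (use m h hm in \<open>auto intro!: integrable_continuous_interval\<close>)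
  \<comment> \<open>Every term receives a factor \<open>E\<close>, which is then cancelled.\<close>
  have sqE: "sqrt E \<le> E" "sqrt E \<ge> 1"
    using E1 by (auto intro: real_le_lsqrt simp: power2_eq_square)
  have "integral {0..m} h * R \<le> G * (sqrt N * E)"
    unfolding R_def using Gm Gm0 sqE N0 by (intro mult_mono) (auto intro!: mult_left_mono)
  moreover have "c * m \<le> c * t * E"
  proof -
    have "c * m \<le> c * t" using m c by (intro mult_left_mono) auto
    also have "c * t * 1 \<le> c * t * E" using E1 c t by (intro mult_left_mono) auto
    finally show ?thesis by simp
  qed
  moreover have "e 0 * 1 \<le> e 0 * E" using E1 e(2)[of 0] t by (intro mult_left_mono) auto
  ultimately have "N * E \<le> e 0 * E + G * (sqrt N * E) + c * t * E + (N / 2 * E - N / 2)"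
    using 1 by (simp only: right_diff_distrib mult_1_right)
  also have "\<dots> \<le> e 0 * E + G * (sqrt N * E) + c * t * E + N / 2 * E" using N0 by simp
  also have "\<dots> = (e 0 + G * sqrt N + c * t + N / 2) * E" by (simp only: distrib_right mult.assoc)
  finally have 2: "N \<le> e 0 + G * sqrt N + c * t + N / 2"
    by (rule mult_right_le_imp_le) (use E1 in linarith)
  \<comment> \<open>Young's inequality absorbs another quarter of \<open>N\<close>; the quarter that
    is left explains the factors 4 in the conclusion.\<close>
  have "0 \<le> (sqrt N - 2 * G)\<^sup>2" by (rule zero_le_power2)
  also have "\<dots> = (sqrt N)\<^sup>2 + 4 * G\<^sup>2 - 4 * (G * sqrt N)" by (simp only: power2_diff power_mult_distrib) simp
  finally have "4 * (G * sqrt N) \<le> N + 4 * G\<^sup>2" using N0 by simp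
  with 2 have "N \<le> 4 * e 0 + 4 * c * t + 4 * G\<^sup>2" by simp
  moreover have "e t \<le> N * exp (L * t)" using eN[of t] t by auto
  moreover have "N * exp (L * t) \<le> (4 * e 0 + 4 * c * t + 4 * G\<^sup>2) * exp (L * t)"
    using calculation(1) by (intro mult_right_mono) auto
  ultimately show ?thesis unfolding G_def L_def by (simp only: mult.commute)
qed

lemma vector_derivative_norm_le:
  fixes f :: "real \<Rightarrow> 'h::real_normed_vector"
  assumes f: "(f has_vector_derivative f') (at t within {0..t})" and t: "t > 0"
    and le: "\<And>s. s \<in> {0..t} \<Longrightarrow> norm (f t - f s) \<le> c * (t - s)"
  shows "norm f' \<le> c"
proof -
  have "((\<lambda>s. norm ((f s - f t) - (s - t) *\<^sub>R f') / norm (s - t)) \<longlongrightarrow> 0) (at t within {0..t})"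
    using f by (simp add: has_vector_derivative_def has_derivative_iff_norm)
  then have "((\<lambda>s. c + norm ((f s - f t) - (s - t) *\<^sub>R f') / norm (s - t)) \<longlongrightarrow> c + 0) (at t within {0..t})"
    by (intro tendsto_intros)
  moreover have "\<forall>\<^sub>F s in at t within {0..t}. norm f' \<le> c + norm ((f s - f t) - (s - t) *\<^sub>R f') / norm (s - t)"
    unfolding eventually_at_filter
  proof (intro always_eventually allI impI)
    fix s assume s: "s \<noteq> t" "s \<in> {0..t}"
    have "norm ((s - t) *\<^sub>R f') \<le> norm (f s - f t) + norm ((f s - f t) - (s - t) *\<^sub>R f')"
      using norm_triangle_sub[of "(s - t) *\<^sub>R f'" "f s - f t"] by (simp add: norm_minus_commute)
    then have "(t - s) * norm f' \<le> (t - s) * c + norm ((f s - f t) - (s - t) *\<^sub>R f')"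
      using le[of s] s by (simp add: norm_minus_commute mult.commute)
    then show "norm f' \<le> c + norm ((f s - f t) - (s - t) *\<^sub>R f') / norm (s - t)"
      using s by (simp add: field_simps)
  qed
  moreover have "at t within {0..t} \<noteq> bot"
    using t by (simp add: at_within_Icc_at_left)
  ultimately show ?thesis using tendsto_lowerbound by fastforce
qed

subsection \<open>The energy estimate\<close>

text \<open>Monotonicity stands in for the sign of the derivative, because the continuous
  representative need not be differentiable everywhere when \<open>r = 1\<close>. The bound on
  \<open>K 0\<close> reflects that \<open>K 0\<close> is minus the integral of K', whose L1 norm is
  below 1.\<close>

locale memory_kernel =
  fixes K :: "real \<Rightarrow> real" and \<kappa> :: real
  assumes K_cont: "continuous_on UNIV K"
    and K_nonneg: "\<And>t. 0 \<le> t \<Longrightarrow> 0 \<le> K t"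
    and K_antimono: "\<And>s t. 0 \<le> s \<Longrightarrow> s \<le> t \<Longrightarrow> K t \<le> K s"
    and K_le_1: "K 0 \<le> 1"
    and K_int: "\<And>t. 0 \<le> t \<Longrightarrow> integral {0..t} K \<le> \<kappa>"
    and \<kappa>_less_1: "\<kappa> < 1"
begin

lemma K_integrable: "K integrable_on {a..b}"
  using K_cont by (intro integrable_continuous_interval) (auto intro: continuous_on_subset)

lemma conv_sup_le:
  fixes x :: "real \<Rightarrow> 'h::banach"
  assumes x: "continuous_on {0..t} x" "\<And>s. s \<in> {0..t} \<Longrightarrow> norm (x s) \<le> X" and t: "0 \<le> t"
  shows "norm (conv K x t) \<le> \<kappa> * X"
proof -
  have "norm (conv K x t) \<le> conv K (\<lambda>s. X) t"
    by (rule conv_norm_le[OF K_cont x(1)]) (use t x(2) K_nonneg in auto)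
  also have "\<dots> = integral {0..t} K * X"
    using K_cont by (simp add: conv_const)
  also have "\<dots> \<le> \<kappa> * X"
    using K_int[OF t] x(2)[of 0] t order_trans[OF norm_ge_zero] by (intro mult_right_mono) auto
  finally show ?thesis .
qed

text \<open>Neither \<open>K\<close> nor \<open>x\<close> is differentiated. The increment consists
  of the new mass on \<open>{s..t}\<close> and of the change of weight
  \<open>K (s - u) - K (t - u)\<close> on \<open>{0..s}\<close>, which is nonnegative by
  monotonicity. Both weights integrate exactly in terms of the primitive \<open>k\<close>, and
  \<open>k h \<le> h\<close> because \<open>K\<close> is at most 1.\<close>

lemma conv_increment_le:
  fixes x :: "real \<Rightarrow> 'h::banach"
  assumes x: "continuous_on {0..t} x" "\<And>s. s \<in> {0..t} \<Longrightarrow> norm (x s) \<le> X" and s: "s \<in> {0..t}"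
  shows "norm (conv K x t - conv K x s) \<le> 2 * X * (t - s)"
proof -
  define h where "h = t - s"
  have st: "0 \<le> s" "s \<le> t" using s by auto
  have X0: "X \<ge> 0" using x(2)[of s] s order_trans[OF norm_ge_zero] by blast
  define k where "k u = integral {0..u} K" for u
  have kint: "integral {a..b} K = k b - k a" if "0 \<le> a" "a \<le> b" for a b
    unfolding k_def using Henstock_Kurzweil_Integration.integral_combine[OF that K_integrable] by (simp add: algebra_simps)
  have i1: "(\<lambda>u. K (t - u) *\<^sub>R x u) integrable_on {0..t}"
    by (rule conv_integrable[OF K_cont x(1)]) (use st in auto)
  have i2: "(\<lambda>u. K (s - u) *\<^sub>R x u) integrable_on {0..s}"
    by (rule conv_integrable[OF K_cont x(1)]) (use st in auto)
  have i3: "(\<lambda>u. K (t - u) *\<^sub>R x u) integrable_on {0..s}" "(\<lambda>u. K (t - u) *\<^sub>R x u) integrable_on {s..t}"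
    by (rule integrable_subinterval_real[OF i1], use st in auto)+
  have j1: "(\<lambda>u. K (t - u)) integrable_on {a..b}" "(\<lambda>u. K (s - u)) integrable_on {a..b}" for a b
    by (intro integrable_continuous_interval continuous_on_compose2[OF K_cont] continuous_intros; simp)+
  have e1: "integral {0..t} (\<lambda>u. K (t - u)) = k t" "integral {0..s} (\<lambda>u. K (s - u)) = k s"
    unfolding k_def by (rule integral_flip)+
  have e2: "integral {s..t} (\<lambda>u. K (t - u)) = k h"
  proof -
    have "integral {s..t} (\<lambda>u. K (t - u)) = integral {s - s..t - s} (\<lambda>u. K (t - (u + s)))"
      using integral_shift_real_ivl[of s s t "\<lambda>u. K (t - u)"] by simp
    also have "\<dots> = integral {0..h} (\<lambda>u. K (h - u))" by (simp add: h_def algebra_simps)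
    also have "\<dots> = k h" unfolding k_def by (rule integral_flip)
    finally show ?thesis .
  qed
  have e3: "integral {0..s} (\<lambda>u. K (t - u)) = k t - k h"
    using Henstock_Kurzweil_Integration.integral_combine[OF st j1(1)[of 0 t]] e1 e2 by simp
  have D: "conv K x t - conv K x s = integral {s..t} (\<lambda>u. K (t - u) *\<^sub>R x u)
      - integral {0..s} (\<lambda>u. (K (s - u) - K (t - u)) *\<^sub>R x u)"
    unfolding conv_def scaleR_diff_left integral_diff[OF i2 i3(1)]
    using Henstock_Kurzweil_Integration.integral_combine[OF st i1] by (simp add: algebra_simps)
  have "norm (integral {s..t} (\<lambda>u. K (t - u) *\<^sub>R x u)) \<le> integral {s..t} (\<lambda>u. K (t - u) * X)"
  proof (rule integral_norm_bound_integral[OF i3(2)])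
    show "(\<lambda>u. K (t - u) * X) integrable_on {s..t}" by (intro integrable_on_mult_left j1)
    show "norm (K (t - u) *\<^sub>R x u) \<le> K (t - u) * X" if "u \<in> {s..t}" for u
      using that st x(2)[of u] K_nonneg[of "t - u"] by (simp add: mult_left_mono)
  qed
  moreover have "norm (integral {0..s} (\<lambda>u. (K (s - u) - K (t - u)) *\<^sub>R x u))
      \<le> integral {0..s} (\<lambda>u. (K (s - u) - K (t - u)) * X)"
  proof (rule integral_norm_bound_integral)
    show "(\<lambda>u. (K (s - u) - K (t - u)) *\<^sub>R x u) integrable_on {0..s}"
      unfolding scaleR_diff_left by (intro integrable_diff i2 i3)
    show "(\<lambda>u. (K (s - u) - K (t - u)) * X) integrable_on {0..s}"
      by (intro integrable_on_mult_left integrable_diff j1)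
    show "norm ((K (s - u) - K (t - u)) *\<^sub>R x u) \<le> (K (s - u) - K (t - u)) * X" if "u \<in> {0..s}" for u
      using that st x(2)[of u] K_antimono[of "s - u" "t - u"] by (simp add: mult_left_mono)
  qed
  moreover have "integral {s..t} (\<lambda>u. K (t - u) * X) = k h * X" using e2 by simp
  moreover have "integral {0..s} (\<lambda>u. (K (s - u) - K (t - u)) * X) = (k s - k t + k h) * X"
    unfolding integral_mult_left integral_diff[OF j1(2,1)] e1 e3 by simp
  ultimately have "norm (conv K x t - conv K x s) \<le> k h * X + (k s - k t + k h) * X"
    using norm_triangle_ineq4[of "integral {s..t} (\<lambda>u. K (t - u) *\<^sub>R x u)" "integral {0..s} (\<lambda>u. (K (s - u) - K (t - u)) *\<^sub>R x u)"]
    unfolding D[symmetric] by linarith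
  also have "k h * X + (k s - k t + k h) * X = (2 * k h + k s - k t) * X" by (simp only: ring_distribs mult_2)
  finally have "norm (conv K x t - conv K x s) \<le> (2 * k h + k s - k t) * X" .
  moreover have "k s \<le> k t"
  proof -
    have "0 \<le> integral {s..t} K" using st K_nonneg by (intro integral_nonneg K_integrable) auto
    then show ?thesis using kint[OF st] by simp
  qed
  moreover have "k h \<le> h"
  proof -
    have "integral {0..h} K \<le> integral {0..h} (\<lambda>u. 1)"
      using K_antimono K_le_1 by (intro integral_le K_integrable) (auto intro: order_trans)
    then show ?thesis using st by (simp add: k_def h_def)
  qed
  then have "(2 * k h + k s - k t) * X \<le> (2 * h) * X" using \<open>k s \<le> k t\<close> X0 by (intro mult_right_mono) auto
  ultimately have "norm (conv K x t - conv K x s) \<le> (2 * h) * X" by linarith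
  then show ?thesis by (simp add: h_def algebra_simps)
qed

text \<open>At \<open>t = 0\<close> the interval is a single point, where every vector counts as a
  derivative; \<open>d0\<close> prescribes the right one.\<close>

lemma conv_derivative_le:
  fixes x :: "real \<Rightarrow> 'h::banach"
  assumes d: "(conv K x has_vector_derivative d) (at t within {0..t})" and t: "0 \<le> t" "continuous_on {0..t} x"
    and d0: "t = 0 \<Longrightarrow> d = K 0 *\<^sub>R x 0"
    and X: "\<And>s. s \<in> {0..t} \<Longrightarrow> norm (x s) \<le> X"
  shows "norm d \<le> 2 * X"
proof (cases "t = 0")
  case True
  have "norm d = K 0 * norm (x 0)" using d0[OF True] K_nonneg[of 0] by simp
  also have "\<dots> \<le> 1 * norm (x 0)" using K_le_1 by (intro mult_right_mono) auto
  finally show ?thesis using X[of 0] t by (smt (verit) atLeastAtMost_iff norm_ge_zero)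
next
  case False
  then show ?thesis
    using t by (intro vector_derivative_norm_le[OF d] conv_increment_le X) auto
qed

end

lemma form_Cauchy_Schwarz:
  fixes B :: "'h::real_inner \<Rightarrow> 'h"
  assumes B: "bounded_linear B" and sym: "\<And>x y. B x \<bullet> y = x \<bullet> B y" and pos: "\<And>x. 0 \<le> B x \<bullet> x"
  shows "\<bar>B x \<bullet> y\<bar> \<le> sqrt (B x \<bullet> x) * sqrt (B y \<bullet> y)"
proof -
  interpret B: bounded_linear B by fact
  have q: "0 \<le> a\<^sup>2 * (B x \<bullet> x) + 2 * a * b * (B x \<bullet> y) + b\<^sup>2 * (B y \<bullet> y)" for a b
    using pos[of "a *\<^sub>R x + b *\<^sub>R y"] sym[of x y]
    by (simp add: B.add B.scaleR inner_add_left inner_add_right power2_eq_square inner_commute algebra_simps)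
  have "(B x \<bullet> y)\<^sup>2 \<le> (B x \<bullet> x) * (B y \<bullet> y)"
  proof (cases "B y \<bullet> y = 0")
    case True
    have "B x \<bullet> y = 0"
    proof (rule ccontr)
      assume n: "B x \<bullet> y \<noteq> 0"
      \<comment> \<open>For the multiple of \<open>y\<close> used here the quadratic form would take
        the value -1.\<close>
      show False
        using q[of 1 "- (B x \<bullet> x + 1) / (2 * (B x \<bullet> y))"] True n by (simp add: field_simps)
    qed
    then show ?thesis using True by simp
  next
    case False
    then have p: "B y \<bullet> y > 0" using pos[of y] by simp
    have "0 \<le> (B y \<bullet> y) * ((B y \<bullet> y) * (B x \<bullet> x) - (B x \<bullet> y)\<^sup>2)"
      using q[of "B y \<bullet> y" "- (B x \<bullet> y)"] by (simp add: power2_eq_square algebra_simps)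
    then show ?thesis using p by (simp add: zero_le_mult_iff mult.commute)
  qed
  then have "sqrt ((B x \<bullet> y)\<^sup>2) \<le> sqrt ((B x \<bullet> x) * (B y \<bullet> y))" by (rule real_sqrt_le_mono)
  then show ?thesis by (simp add: real_sqrt_mult)
qed

section \<open>From v - K * v back to v, and the energy inequality\<close>

context memory_kernel
begin

text \<open>At a time \<open>m\<close> where the form of \<open>v\<close> is largest, pairing
  \<open>v m = p m + conv K v m\<close> with \<open>B (v m)\<close> gives
  \<open>V\<^sup>2 \<le> P * V + \<kappa> * V\<^sup>2\<close>. This is where
  \<open>\<kappa> < 1\<close> enters.\<close>

lemma form_sup_le:
  fixes v :: "real \<Rightarrow> 'h::{real_inner,banach}"
  assumes B: "bounded_linear B" and sym: "\<And>x y. B x \<bullet> y = x \<bullet> B y" and pos: "\<And>x. 0 \<le> B x \<bullet> x"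
    and v: "continuous_on {0..t} v" and t: "0 \<le> t"
    and P: "\<And>s. s \<in> {0..t} \<Longrightarrow> sqrt (B (v s - conv K v s) \<bullet> (v s - conv K v s)) \<le> P"
    and s: "s \<in> {0..t}"
  shows "sqrt (B (v s) \<bullet> v s) \<le> P / (1 - \<kappa>)"
proof -
  interpret B: bounded_linear B by fact
  have "continuous_on {0..t} (\<lambda>s. B (v s) \<bullet> v s)"
    by (intro continuous_intros v B.continuous_on)
  then obtain m where m: "m \<in> {0..t}" and max: "\<And>s. s \<in> {0..t} \<Longrightarrow> B (v s) \<bullet> v s \<le> B (v m) \<bullet> v m"
    using continuous_attains_sup[of "{0..t}" "\<lambda>s. B (v s) \<bullet> v s"] t by auto
  define V where "V = sqrt (B (v m) \<bullet> v m)"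
  have V0: "V \<ge> 0" and V2: "V * V = B (v m) \<bullet> v m" using pos by (auto simp: V_def)
  have le: "sqrt (B (v s) \<bullet> v s) \<le> V" if "s \<in> {0..t}" for s
    using max[OF that] by (simp add: V_def)
  have vm: "continuous_on {0..m} v" using v m by (auto intro: continuous_on_subset)
  \<comment> \<open>Pairing with a fixed vector makes the convolution scalar, so the norm bound
    \<open>conv_sup_le\<close> serves for the possibly degenerate form \<open>B\<close> too.\<close>
  let ?F = "\<lambda>x. B x \<bullet> v m"
  have F: "bounded_linear ?F"
    by (intro bounded_linear_compose[OF bounded_linear_inner_left] B)
  have "\<bar>?F (v s)\<bar> \<le> V * V" if "s \<in> {0..t}" for s
  proof -
    have "\<bar>?F (v s)\<bar> \<le> sqrt (B (v s) \<bullet> v s) * V" unfolding V_def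
      by (rule form_Cauchy_Schwarz[OF B sym pos])
    also have "\<dots> \<le> V * V" using le[OF that] V0 by (rule mult_right_mono)
    finally show ?thesis .
  qed
  then have "norm (conv K (\<lambda>s. ?F (v s)) m) \<le> \<kappa> * (V * V)"
    by (intro conv_sup_le bounded_linear.continuous_on[OF F] vm) (use m in auto)
  then have 1: "?F (conv K v m) \<le> \<kappa> * (V * V)"
    using conv_linear[OF K_cont vm _ F, of m] m by auto
  have "V * V = ?F (v m - conv K v m) + ?F (conv K v m)"
    by (simp add: V2 B.diff inner_diff_left)
  also have "?F (v m - conv K v m) \<le> P * V"
  proof -
    have "?F (v m - conv K v m) \<le> sqrt (B (v m - conv K v m) \<bullet> (v m - conv K v m)) * V"
      unfolding V_def using form_Cauchy_Schwarz[OF B sym pos, of "v m - conv K v m" "v m"] by linarith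
    also have "\<dots> \<le> P * V" using P[OF m] V0 by (rule mult_right_mono)
    finally show ?thesis .
  qed
  finally have 2: "V * V \<le> P * V + \<kappa> * (V * V)" using 1 by linarith
  have P0: "P \<ge> 0" using P[OF m] pos[of "v m - conv K v m"] by (meson order_trans real_sqrt_ge_zero)
  have "V \<le> P / (1 - \<kappa>)"
  proof (cases "V = 0")
    case True then show ?thesis using P0 \<kappa>_less_1 by simp
  next
    case False
    then have "V > 0" using V0 by simp
    moreover have "((1 - \<kappa>) * V) * V \<le> P * V" using 2 by (simp add: algebra_simps)
    ultimately have "(1 - \<kappa>) * V \<le> P" by simp
    then show ?thesis using \<kappa>_less_1 by (simp add: pos_le_divide_eq mult.commute)
  qed
  then show ?thesis using le[OF s] by linarith
qed

text \<open>The kinetic part \<open>k\<close> is abstract because three choices occur: the norm of a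
  multiplier applied to v' with potential form from \<open>Y\<close>, and the \<open>S\<close>-form
  with the identity as potential form, once for differences of approximations and once for time
  primitives. Adding half the form of \<open>p = v - K * v\<close> cancels
  \<open>B p \<bullet> v'\<close> in the derivative and leaves the source and \<open>B p\<close>
  paired with the derivative of the convolution.\<close>

lemma energy_estimate:
  fixes v v' :: "real \<Rightarrow> 'h::{real_inner,banach}"
  assumes B: "bounded_linear B" and sym: "\<And>x y. B x \<bullet> y = x \<bullet> B y" and pos: "\<And>x. 0 \<le> B x \<bullet> x"
    and v: "\<And>s. s \<in> {0..T} \<Longrightarrow> (v has_vector_derivative v' s) (at s within {0..T})" "continuous_on {0..T} v'"
    and k: "\<And>s. s \<in> {0..T} \<Longrightarrow>
        (k has_real_derivative (\<rho> s - B (v s - conv K v s) \<bullet> v' s)) (at s within {0..T})"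
      "\<And>s. s \<in> {0..T} \<Longrightarrow> 0 \<le> k s"
    and \<rho>: "\<And>s. s \<in> {0..T} \<Longrightarrow> \<rho> s \<le> h s * sqrt (k s) + c" "c \<ge> 0"
    and h: "continuous_on {0..T} h" "\<And>s. s \<in> {0..T} \<Longrightarrow> 0 \<le> h s"
    and t: "t \<in> {0..T}"
  shows "k t + (B (v t - conv K v t) \<bullet> (v t - conv K v t)) / 2 \<le>
    exp (8 / (1 - \<kappa>) * t) * (4 * (k 0 + (B (v 0) \<bullet> v 0) / 2) + 4 * c * t + 4 * (integral {0..t} h)\<^sup>2)"
proof -
  interpret B: bounded_linear B by fact
  define p where "p s = v s - conv K v s" for s
  define w where "w s = K s *\<^sub>R v 0 + conv K v' s" for s
  define e where "e s = k s + (B (p s) \<bullet> p s) / 2" for s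
  define e' where "e' s = \<rho> s - B (p s) \<bullet> w s" for s
  have sub: "{0..s} \<subseteq> {0..T}" if "s \<in> {0..T}" for s using that by auto
  have v_cont: "continuous_on {0..T} v"
    using v(1) by (meson continuous_on_eq_continuous_within has_vector_derivative_continuous)
  have w: "(conv K v has_vector_derivative w s) (at s within {0..T})" if "s \<in> {0..T}" for s
    unfolding w_def by (rule conv_has_vector_derivative[OF K_cont v(2,1) that])
  have p: "(p has_vector_derivative v' s - w s) (at s within {0..T})" if "s \<in> {0..T}" for s
    unfolding p_def by (intro derivative_intros v w that)
  have e: "(e has_real_derivative e' s) (at s within {0..T})" if s: "s \<in> {0..T}" for s
  proof -
    have "((\<lambda>s. B (p s) \<bullet> p s) has_derivative (\<lambda>h. B (p s) \<bullet> (h *\<^sub>R (v' s - w s)) + B (h *\<^sub>R (v' s - w s)) \<bullet> p s))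
        (at s within {0..T})"
      by (intro has_derivative_inner B.has_derivative p[OF s, unfolded has_vector_derivative_def])
    then have "((\<lambda>s. B (p s) \<bullet> p s) has_derivative (\<lambda>h. (2 * (B (p s) \<bullet> (v' s - w s))) * h))
        (at s within {0..T})"
      by (rule has_derivative_eq_rhs)
        (auto simp: B.scaleR inner_commute fun_eq_iff sym[of "p s" "v' s - w s", symmetric])
    then have "((\<lambda>s. B (p s) \<bullet> p s) has_real_derivative 2 * (B (p s) \<bullet> (v' s - w s))) (at s within {0..T})"
      by (simp add: has_field_derivative_def mult_commute_abs)
    then have "(e has_real_derivative (\<rho> s - B (p s) \<bullet> v' s) + 2 * (B (p s) \<bullet> (v' s - w s)) / 2) (at s within {0..T})"
      unfolding e_def by (intro DERIV_add DERIV_cdivide k(1)[OF s, folded p_def])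
    then show ?thesis by (simp add: e'_def inner_diff_right diff_divide_distrib)
  qed
  have e_nonneg: "0 \<le> e s" if "s \<in> {0..T}" for s
    using k(2)[OF that] pos[of "p s"] by (simp add: e_def)
  have tT: "{0..t} \<subseteq> {0..T}" using t by auto
  have "e t \<le> exp (2 * (4 / (1 - \<kappa>)) * t) * (4 * e 0 + 4 * c * t + 4 * (integral {0..t} h)\<^sup>2)"
  proof (rule gronwall_sup)
    show "(e has_real_derivative e' s) (at s within {0..t})" if "s \<in> {0..t}" for s
      by (rule DERIV_subset[OF e tT]) (use that tT in auto)
    fix s Q assume s: "s \<in> {0..t}" and Q: "\<And>\<tau>. \<tau> \<in> {0..s} \<Longrightarrow> e \<tau> \<le> Q"
    have sT: "s \<in> {0..T}" "0 \<le> s" using s tT by auto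
    have Q0: "Q \<ge> 0" using Q[of s] e_nonneg[OF sT(1)] sT by auto
    have vs: "continuous_on {0..s} v" using v_cont sub[OF sT(1)] by (rule continuous_on_subset)
    have pQ: "sqrt (B (p \<tau>) \<bullet> p \<tau>) \<le> sqrt (2 * Q)" if "\<tau> \<in> {0..s}" for \<tau>
      using Q[OF that] k(2)[of \<tau>] sub[OF sT(1)] that by (auto simp: e_def)
    have vQ: "sqrt (B (v \<tau>) \<bullet> v \<tau>) \<le> sqrt (2 * Q) / (1 - \<kappa>)" if "\<tau> \<in> {0..s}" for \<tau>
      by (rule form_sup_le[OF B sym pos vs sT(2) _ that]) (use pQ in \<open>auto simp: p_def\<close>)
    let ?F = "\<lambda>x. x \<bullet> B (p s)"
    have F: "bounded_linear ?F" by (rule bounded_linear_inner_left)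
    \<comment> \<open>The factor 2 is the Lipschitz constant of the convolution. Each
      \<open>sqrt (2 * Q)\<close> comes from \<open>B p \<bullet> p / 2 \<le> Q\<close>, and one of
      them passes from \<open>p\<close> to \<open>v\<close> at the cost of
      \<open>1 / (1 - \<kappa>)\<close>.\<close>
    have "norm (?F (w s)) \<le> 2 * (sqrt (2 * Q) / (1 - \<kappa>) * sqrt (2 * Q))"
    proof (rule conv_derivative_le)
      have "((\<lambda>\<tau>. ?F (conv K v \<tau>)) has_vector_derivative ?F (w s)) (at s within {0..s})"
        by (intro bounded_linear.has_vector_derivative[OF F] has_vector_derivative_within_subset[OF w sub[OF sT(1)]] sT)
      then show "(conv K (\<lambda>\<tau>. ?F (v \<tau>)) has_vector_derivative ?F (w s)) (at s within {0..s})"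
      proof (rule has_vector_derivative_transform[rotated 2])
        show "conv K (\<lambda>\<tau>. ?F (v \<tau>)) \<tau> = ?F (conv K v \<tau>)" if "\<tau> \<in> {0..s}" for \<tau>
          using conv_linear[OF K_cont vs that F] by simp
      qed (use sT in auto)
      show "?F (w s) = K 0 *\<^sub>R ?F (v 0)" if "s = 0" using that by (simp add: w_def)
      show "continuous_on {0..s} (\<lambda>\<tau>. ?F (v \<tau>))" by (intro continuous_intros vs)
      fix \<tau> assume \<tau>: "\<tau> \<in> {0..s}"
      have "norm (?F (v \<tau>)) = \<bar>B (v \<tau>) \<bullet> p s\<bar>" by (simp add: sym)
      also have "\<dots> \<le> sqrt (B (v \<tau>) \<bullet> v \<tau>) * sqrt (B (p s) \<bullet> p s)"
        by (rule form_Cauchy_Schwarz[OF B sym pos])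
      also have "\<dots> \<le> sqrt (2 * Q) / (1 - \<kappa>) * sqrt (2 * Q)"
        using vQ[OF \<tau>] pQ[of s] sT \<kappa>_less_1 Q0 pos by (intro mult_mono) auto
      finally show "norm (?F (v \<tau>)) \<le> sqrt (2 * Q) / (1 - \<kappa>) * sqrt (2 * Q)" .
    qed fact
    also have "\<dots> = 4 / (1 - \<kappa>) * Q" using Q0 by (simp add: real_sqrt_mult_self)
    finally have "- (B (p s) \<bullet> w s) \<le> 4 / (1 - \<kappa>) * Q" by (simp add: inner_commute abs_le_iff)
    moreover have "\<rho> s \<le> h s * sqrt (e s) + c"
    proof -
      have "sqrt (k s) \<le> sqrt (e s)" using pos[of "p s"] by (simp add: e_def)
      then have "h s * sqrt (k s) \<le> h s * sqrt (e s)" using h(2)[OF sT(1)] by (rule mult_left_mono)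
      then show ?thesis using \<rho>(1)[OF sT(1)] by linarith
    qed
    ultimately show "e' s \<le> h s * sqrt (e s) + c + 4 / (1 - \<kappa>) * Q"
      unfolding e'_def by linarith
  qed (use t h \<rho>(2) e_nonneg \<kappa>_less_1 tT in \<open>auto intro: continuous_on_subset\<close>)
  moreover have "e 0 = k 0 + (B (v 0) \<bullet> v 0) / 2" by (simp add: e_def p_def)
  ultimately show ?thesis by (simp add: e_def p_def)
qed

end

subsection \<open>Yosida approximation\<close>

text \<open>Picard iteration. The hypothesis \<open>contr\<close> is a Volterra bound tested on
  monomials; it makes the n-th increment of order (M t)^n / n!, so the iterates converge on the
  whole interval without a smallness condition on \<open>T\<close>.\<close>

lemma volterra_fixpoint:
  fixes \<Phi> :: "(real \<Rightarrow> 'h::banach) \<Rightarrow> real \<Rightarrow> 'h"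
  assumes T: "0 \<le> T" and M: "0 \<le> M"
    and cont: "\<And>x. continuous_on {0..T} x \<Longrightarrow> continuous_on {0..T} (\<Phi> x)"
    and contr: "\<And>x y c n t. continuous_on {0..T} x \<Longrightarrow> continuous_on {0..T} y \<Longrightarrow> 0 \<le> c \<Longrightarrow>
      (\<And>s. s \<in> {0..T} \<Longrightarrow> norm (x s - y s) \<le> c * s ^ n) \<Longrightarrow> t \<in> {0..T} \<Longrightarrow>
      norm (\<Phi> x t - \<Phi> y t) \<le> M * c * (t ^ Suc n / real (Suc n))"
  shows "\<exists>x. continuous_on {0..T} x \<and> (\<forall>t\<in>{0..T}. \<Phi> x t = x t)"
proof -
  define X where "X n = (\<Phi> ^^ n) (\<lambda>_. 0)" for n
  have X_Suc: "X (Suc n) = \<Phi> (X n)" for n by (simp add: X_def)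
  have X_cont: "continuous_on {0..T} (X n)" for n
    by (induction n) (auto simp: X_def cont)
  have "compact (X 1 ` {0..T})" by (intro compact_continuous_image X_cont compact_Icc)
  then obtain c0 where c0: "\<And>t. t \<in> {0..T} \<Longrightarrow> norm (X 1 t) \<le> c0"
    using compact_imp_bounded bounded_iff by (metis image_eqI)
  have c0_nonneg: "0 \<le> c0" using c0[of 0] T order_trans[OF norm_ge_zero] by auto
  have step: "t \<in> {0..T} \<Longrightarrow> norm (X (Suc n) t - X n t) \<le> (c0 * M ^ n / fact n) * t ^ n" for n t
  proof (induction n arbitrary: t)
    case 0
    then show ?case using c0[of t] by (simp add: X_def)
  next
    case (Suc n)
    have "norm (\<Phi> (X (Suc n)) t - \<Phi> (X n) t) \<le> M * (c0 * M ^ n / fact n) * (t ^ Suc n / real (Suc n))"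
      using Suc c0_nonneg M by (intro contr X_cont) auto
    also have "\<dots> = (c0 * M ^ Suc n / fact (Suc n)) * t ^ Suc n" by (simp add: field_simps)
    finally show ?case by (simp only: X_Suc)
  qed
  have step': "norm (X (Suc n) t - X n t) \<le> c0 * (inverse (fact n) * (M * T) ^ n)" if "t \<in> {0..T}" for n t
  proof -
    have "(c0 * M ^ n / fact n) * t ^ n \<le> (c0 * M ^ n / fact n) * T ^ n"
      using that c0_nonneg M by (intro mult_left_mono power_mono) auto
    then show ?thesis using step[OF that, of n] by (simp add: power_mult_distrib field_simps)
  qed
  have "summable (\<lambda>n. c0 * (inverse (fact n) * (M * T) ^ n))"
    by (intro summable_mult summable_exp)
  then have "uniform_limit {0..T} (\<lambda>n t. \<Sum>i<n. X (Suc i) t - X i t) (\<lambda>t. \<Sum>i. X (Suc i) t - X i t) sequentially"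
    by (intro Weierstrass_m_test) (rule step')
  moreover have "(\<Sum>i<n. X (Suc i) t - X i t) = X n t" for n t
    using sum_lessThan_telescope[of "\<lambda>i. X i t" n] by (simp add: X_def)
  ultimately obtain x where x: "uniform_limit {0..T} X x sequentially" by auto
  have x_cont: "continuous_on {0..T} x"
    by (rule uniform_limit_theorem[OF _ x]) (use X_cont in auto)
  have "\<Phi> x t = x t" if t: "t \<in> {0..T}" for t
  proof -
    have "(\<lambda>n. X (Suc n) t) \<longlonglongrightarrow> x t"
      using tendsto_uniform_limitI[OF x t] by (rule LIMSEQ_Suc)
    moreover have "(\<lambda>n. X (Suc n) t) \<longlonglongrightarrow> \<Phi> x t"
    proof (rule metric_LIMSEQ_I)
      fix e :: real assume e: "e > 0"
      define d where "d = e / (M * T + 1)"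
      have d: "d > 0" using e M T by (auto simp: d_def intro!: divide_pos_pos add_nonneg_pos)
      have "\<forall>\<^sub>F n in sequentially. \<forall>s\<in>{0..T}. dist (X n s) (x s) < d"
        using x d by (simp add: uniform_limit_iff)
      then obtain N where N: "\<And>n s. n \<ge> N \<Longrightarrow> s \<in> {0..T} \<Longrightarrow> dist (X n s) (x s) < d"
        unfolding eventually_sequentially by blast
      have "dist (X (Suc n) t) (\<Phi> x t) < e" if "n \<ge> N" for n
      proof -
        have "norm (\<Phi> (X n) t - \<Phi> x t) \<le> M * d * (t ^ Suc 0 / real (Suc 0))"
          by (rule contr[OF X_cont x_cont]) (use N[OF that] d t in \<open>auto simp: dist_norm less_imp_le\<close>)
        also have "\<dots> \<le> M * d * T" using t M d by (auto intro!: mult_left_mono)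
        also have "\<dots> < (M * T + 1) * d" using d by (simp add: algebra_simps)
        also have "\<dots> = e" using M T by (simp add: d_def add_nonneg_eq_0_iff)
        finally show ?thesis by (simp add: X_Suc dist_norm)
      qed
      then show "\<exists>N. \<forall>n\<ge>N. dist (X (Suc n) t) (\<Phi> x t) < e" by blast
    qed
    ultimately show ?thesis using LIMSEQ_unique by blast
  qed
  then show ?thesis using x_cont by blast
qed

lemma (in memory_kernel) bounded_problem:
  fixes B :: "'h::banach \<Rightarrow> 'h"
  assumes T: "0 \<le> T" and B: "bounded_linear B" and g: "continuous_on {0..T} g"
  shows "\<exists>v v'. v 0 = v0 \<and> v' 0 = v1 \<and>
    (\<forall>t\<in>{0..T}. (v has_vector_derivative v' t) (at t within {0..T})) \<and>
    (\<forall>t\<in>{0..T}. (v' has_vector_derivative (g t - B (v t - conv K v t))) (at t within {0..T}))"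
proof -
  interpret B: bounded_linear B by fact
  define F where "F x s = g s - B (x s - conv K x s)" for x s
  define G where "G x s = v1 + integral {0..s} (F x)" for x s
  define \<Phi> where "\<Phi> x t = v0 + integral {0..t} (G x)" for x t
  obtain \<beta> where \<beta>: "\<beta> > 0" "\<And>x. norm (B x) \<le> norm x * \<beta>" using B.pos_bounded by blast
  have F_cont: "continuous_on {0..T} (F x)" if "continuous_on {0..T} x" for x
    unfolding F_def by (intro continuous_intros g B.continuous_on conv_continuous K_cont that T)
  have G_deriv: "(G x has_vector_derivative F x t) (at t within {0..T})"
    if "continuous_on {0..T} x" "t \<in> {0..T}" for x t
    unfolding G_def using integral_has_vector_derivative[OF F_cont[OF that(1)] that(2)]
    by (auto intro!: derivative_eq_intros)
  have G_cont: "continuous_on {0..T} (G x)" if "continuous_on {0..T} x" for x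
    using G_deriv[OF that] by (meson continuous_on_eq_continuous_within has_vector_derivative_continuous)
  have \<Phi>_deriv: "(\<Phi> x has_vector_derivative G x t) (at t within {0..T})"
    if "continuous_on {0..T} x" "t \<in> {0..T}" for x t
    unfolding \<Phi>_def using integral_has_vector_derivative[OF G_cont[OF that(1)] that(2)]
    by (auto intro!: derivative_eq_intros)
  have \<Phi>_cont: "continuous_on {0..T} (\<Phi> x)" if "continuous_on {0..T} x" for x
    using \<Phi>_deriv[OF that] by (meson continuous_on_eq_continuous_within has_vector_derivative_continuous)
  have int: "y integrable_on {0..s}" if "continuous_on {0..T} y" "s \<in> {0..T}" for y :: "real \<Rightarrow> 'h" and s
    by (rule integrable_continuous_interval, rule continuous_on_subset[OF that(1)]) (use that in auto)
  \<comment> \<open>In the Volterra constant, \<open>\<beta>\<close> bounds \<open>B\<close>, the 2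
    bounds identity minus convolution since \<open>\<kappa> < 1\<close>, and \<open>T\<close> comes
    from the inner of the two time integrations.\<close>
  have "\<exists>x. continuous_on {0..T} x \<and> (\<forall>t\<in>{0..T}. \<Phi> x t = x t)"
  proof (rule volterra_fixpoint[OF T, where M = "2 * \<beta> * T"])
    fix x y :: "real \<Rightarrow> 'h" and c n t
    assume x: "continuous_on {0..T} x" and y: "continuous_on {0..T} y" and c: "0 \<le> (c::real)"
      and xy: "\<And>s. s \<in> {0..T} \<Longrightarrow> norm (x s - y s) \<le> c * s ^ n" and t: "t \<in> {0..T}"
    have mono: "c * r ^ n \<le> c * s ^ n" if "0 \<le> r" "r \<le> s" for r s
      using that c by (intro mult_left_mono power_mono) auto
    have F_le: "norm (F x s - F y s) \<le> 2 * \<beta> * (c * s ^ n)" if s: "s \<in> {0..T}" for s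
    proof -
      have "norm (conv K (\<lambda>r. x r - y r) s) \<le> \<kappa> * (c * s ^ n)"
      proof (rule conv_sup_le)
        show "continuous_on {0..s} (\<lambda>r. x r - y r)"
          by (rule continuous_on_subset[of "{0..T}"]) (use s x y in \<open>auto intro: continuous_intros\<close>)
        show "norm (x r - y r) \<le> c * s ^ n" if "r \<in> {0..s}" for r
          using xy[of r] mono[of r s] that s by auto
      qed (use s in auto)
      also have "\<dots> \<le> 1 * (c * s ^ n)"
        using \<kappa>_less_1 c s by (intro mult_right_mono) auto
      finally have 1: "norm (conv K x s - conv K y s) \<le> c * s ^ n"
        by (simp add: conv_diff[OF K_cont x y s])
      have "F x s - F y s = B ((conv K x s - conv K y s) - (x s - y s))"
        by (simp add: F_def B.diff)
      then have "norm (F x s - F y s) \<le> norm ((conv K x s - conv K y s) - (x s - y s)) * \<beta>"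
        using \<beta>(2) by simp
      also have "\<dots> \<le> (2 * (c * s ^ n)) * \<beta>"
        using norm_triangle_ineq4[of "conv K x s - conv K y s" "x s - y s"] 1 xy[OF s] \<beta>(1)
        by (intro mult_right_mono) auto
      finally show ?thesis by (simp add: mult_ac)
    qed
    have G_le: "norm (G x s - G y s) \<le> 2 * \<beta> * T * c * s ^ n" if s: "s \<in> {0..T}" for s
    proof -
      have "norm (G x s - G y s) = norm (integral {0..s} (\<lambda>r. F x r - F y r))"
        by (simp add: G_def integral_diff[OF int[OF F_cont[OF x] s] int[OF F_cont[OF y] s]])
      also have "\<dots> \<le> integral {0..s} (\<lambda>r. 2 * \<beta> * (c * s ^ n))"
      proof (rule integral_norm_bound_integral)
        show "(\<lambda>r. F x r - F y r) integrable_on {0..s}"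
          by (intro integrable_diff int F_cont x y s)
        show "norm (F x r - F y r) \<le> 2 * \<beta> * (c * s ^ n)" if "r \<in> {0..s}" for r
          using F_le[of r] mono[of r s] that s \<beta>(1) by (auto intro!: order_trans[OF F_le] mult_left_mono)
      qed (rule integrable_const_ivl)
      also have "\<dots> = s * (2 * \<beta> * (c * s ^ n))" using s by simp
      also have "\<dots> \<le> T * (2 * \<beta> * (c * s ^ n))"
        using s c \<beta>(1) by (intro mult_right_mono) auto
      finally show ?thesis by (simp add: mult_ac)
    qed
    have "norm (\<Phi> x t - \<Phi> y t) = norm (integral {0..t} (\<lambda>r. G x r - G y r))"
      by (simp add: \<Phi>_def integral_diff[OF int[OF G_cont[OF x] t] int[OF G_cont[OF y] t]])
    also have "\<dots> \<le> integral {0..t} (\<lambda>s. 2 * \<beta> * T * c * s ^ n)"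
    proof (rule integral_norm_bound_integral)
      show "(\<lambda>r. G x r - G y r) integrable_on {0..t}"
        by (intro integrable_diff int G_cont x y t)
      show "norm (G x r - G y r) \<le> 2 * \<beta> * T * c * r ^ n" if "r \<in> {0..t}" for r
        using G_le[of r] that t by auto
    qed (auto intro!: integrable_continuous_interval continuous_intros)
    also have "\<dots> = 2 * \<beta> * T * c * (t ^ Suc n / real (Suc n))"
    proof -
      have "((\<lambda>s. s ^ n) has_integral (t ^ Suc n / real (Suc n) - 0 ^ Suc n / real (Suc n))) {0..t}"
      proof (rule fundamental_theorem_of_calculus)
        fix s :: real
        have "((\<lambda>s. s ^ Suc n / real (Suc n)) has_real_derivative (s ^ n)) (at s within {0..t})"
          using DERIV_cdivide[OF DERIV_pow[of "Suc n" s "{0..t}"], of "real (Suc n)"] by simp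
        then show "((\<lambda>s. s ^ Suc n / real (Suc n)) has_vector_derivative (s ^ n)) (at s within {0..t})"
          by (simp only: has_real_derivative_iff_has_vector_derivative)
      qed (use t in auto)
      then show ?thesis by (simp add: integral_unique)
    qed
    finally show "norm (\<Phi> x t - \<Phi> y t) \<le> 2 * \<beta> * T * c * (t ^ Suc n / real (Suc n))" .
  qed (use \<beta> T \<Phi>_cont in auto)
  then obtain v where v: "continuous_on {0..T} v" and fix_v: "\<And>t. t \<in> {0..T} \<Longrightarrow> \<Phi> v t = v t" by blast
  have "(v has_vector_derivative G v t) (at t within {0..T})" if "t \<in> {0..T}" for t
    using has_vector_derivative_transform[OF that fix_v[symmetric] \<Phi>_deriv[OF v that]] .
  moreover have "v 0 = v0" using fix_v[of 0] T by (simp add: \<Phi>_def)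
  moreover have "G v 0 = v1" by (simp add: G_def)
  ultimately show ?thesis using G_deriv[OF v] unfolding F_def by blast
qed

text \<open>For suitable \<open>\<tau>\<close> the map sending \<open>x\<close> to
  \<open>x - \<tau> *\<^sub>R (L x - y)\<close> is a contraction: the square of its factor is at
  most \<open>1 - 2 * \<tau> * l + \<tau>\<^sup>2 * m\<^sup>2\<close>, which is least at
  \<open>\<tau> = l / m\<^sup>2\<close>.\<close>

lemma lax_milgram:
  fixes L :: "'h::{real_inner,banach} \<Rightarrow> 'h"
  assumes L: "bounded_linear L" and l: "l > 0" "\<And>x. l * (norm x)\<^sup>2 \<le> L x \<bullet> x"
  shows "\<exists>!x. L x = y"
proof -
  interpret L: bounded_linear L by fact
  obtain b where b: "b > 0" "\<And>x. norm (L x) \<le> norm x * b" using L.pos_bounded by blast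
  \<comment> \<open>The maximum ensures \<open>l \<le> m\<close>, hence \<open>q \<ge> 0\<close>,
    even if the space is trivial.\<close>
  define m where "m = max b l"
  have m: "m > 0" "l \<le> m" using b l by (auto simp: m_def)
  have Lm: "norm (L x) \<le> m * norm x" for x
  proof -
    have "norm x * b \<le> m * norm x" using mult_right_mono[of b m "norm x"] by (simp add: m_def mult.commute)
    then show ?thesis using b(2)[of x] by linarith
  qed
  define \<tau> where "\<tau> = l / m\<^sup>2"
  define q where "q = 1 - \<tau> * l"
  have \<tau>: "\<tau> > 0" using l m by (simp add: \<tau>_def)
  have "l * l \<le> m\<^sup>2" using m l by (simp add: power2_eq_square mult_mono)
  then have q: "0 \<le> q" "q < 1" using l m \<tau> by (auto simp: q_def \<tau>_def)
  have contr: "norm (z - \<tau> *\<^sub>R L z) \<le> sqrt q * norm z" for z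
  proof -
    have "(norm (z - \<tau> *\<^sub>R L z))\<^sup>2 = (norm z)\<^sup>2 - 2 * \<tau> * (L z \<bullet> z) + \<tau>\<^sup>2 * (norm (L z))\<^sup>2"
      by (simp only: power2_norm_eq_inner inner_diff_left inner_diff_right inner_scaleR_left inner_scaleR_right)
        (simp add: power2_eq_square inner_commute algebra_simps)
    also have "\<dots> \<le> (norm z)\<^sup>2 - 2 * \<tau> * (l * (norm z)\<^sup>2) + \<tau>\<^sup>2 * (m * norm z)\<^sup>2"
      using l(2)[of z] Lm[of z] \<tau> by (intro add_mono diff_mono mult_left_mono power_mono) auto
    also have "\<dots> = q * (norm z)\<^sup>2"
      using m(1) by (simp add: q_def \<tau>_def power_mult_distrib field_simps power2_eq_square)
    finally have "sqrt ((norm (z - \<tau> *\<^sub>R L z))\<^sup>2) \<le> sqrt (q * (norm z)\<^sup>2)" by (rule real_sqrt_le_mono)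
    then show ?thesis by (simp add: real_sqrt_mult)
  qed
  have "\<exists>!x. x - \<tau> *\<^sub>R (L x - y) = x"
  proof (rule banach_fix_type)
    show "\<forall>x x'. dist (x - \<tau> *\<^sub>R (L x - y)) (x' - \<tau> *\<^sub>R (L x' - y)) \<le> sqrt q * dist x x'"
    proof (intro allI)
      fix x x'
      have "dist (x - \<tau> *\<^sub>R (L x - y)) (x' - \<tau> *\<^sub>R (L x' - y)) = norm ((x - x') - \<tau> *\<^sub>R L (x - x'))"
        by (simp add: dist_norm L.diff algebra_simps)
      then show "dist (x - \<tau> *\<^sub>R (L x - y)) (x' - \<tau> *\<^sub>R (L x' - y)) \<le> sqrt q * dist x x'"
        using contr[of "x - x'"] by (simp add: dist_norm)
    qed
  qed (use q in auto)
  then show ?thesis using \<tau> by simp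
qed

text \<open>Only semidefinite: in the application \<open>S\<close> inverts \<open>A\<close> on
  \<open>L2_on \<Omega>\<close> and vanishes on the orthogonal complement.\<close>

locale pos_operator =
  fixes S :: "'h::{real_inner,banach} \<Rightarrow> 'h"
  assumes S_blin: "bounded_linear S"
    and S_sym: "\<And>x y. S x \<bullet> y = x \<bullet> S y"
    and S_pos: "\<And>x. 0 \<le> S x \<bullet> x"
begin

sublocale S: bounded_linear S by (rule S_blin)

text \<open>The Yosida approximation of the inverse of \<open>S\<close>.\<close>

definition Y :: "real \<Rightarrow> 'h \<Rightarrow> 'h" where
  "Y e x = (THE y. S y + e *\<^sub>R y = x)"

context
  fixes e :: real
  assumes e: "e > 0"
begin

lemma Y_ex1: "\<exists>!y. S y + e *\<^sub>R y = x"
proof (rule lax_milgram)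
  show "bounded_linear (\<lambda>y. S y + e *\<^sub>R y)"
    by (intro bounded_linear_add S_blin bounded_linear_scaleR_right)
  show "e * (norm y)\<^sup>2 \<le> (S y + e *\<^sub>R y) \<bullet> y" for y
    using S_pos[of y] by (simp add: inner_add_left power2_norm_eq_inner)
qed (rule e)

lemma Y_eq: "S (Y e x) + e *\<^sub>R Y e x = x"
  unfolding Y_def by (rule theI'[OF Y_ex1])

lemma Y_unique: "S y + e *\<^sub>R y = x \<Longrightarrow> Y e x = y"
  using Y_ex1 Y_eq by blast

lemma S_Y: "S (Y e x) = x - e *\<^sub>R Y e x"
  using Y_eq[of x] by (simp add: eq_diff_eq)

lemma Y_S: "Y e (S x) = S (Y e x)"
  by (rule Y_unique) (metis S.add S.scaleR Y_eq)

lemma Y_add: "Y e (x + y) = Y e x + Y e y"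
  by (rule Y_unique) (simp add: S.add S_Y algebra_simps)

lemma Y_scaleR: "Y e (c *\<^sub>R x) = c *\<^sub>R Y e x"
  by (rule Y_unique) (simp add: S.scaleR S_Y algebra_simps)

text \<open>The two parts \<open>S (Y e x)\<close> and \<open>e *\<^sub>R Y e x\<close> of
  \<open>x\<close> have a nonnegative inner product, being \<open>e\<close> times a value of the
  form of \<open>S\<close>; so neither is longer than \<open>x\<close>.\<close>

lemma norm_decomp: "(norm x)\<^sup>2 = (norm (S (Y e x)))\<^sup>2 + 2 * e * (S (Y e x) \<bullet> Y e x) + (norm (e *\<^sub>R Y e x))\<^sup>2"
proof -
  have "(norm (S (Y e x) + e *\<^sub>R Y e x))\<^sup>2 = (norm (S (Y e x)))\<^sup>2 + 2 * e * (S (Y e x) \<bullet> Y e x) + (norm (e *\<^sub>R Y e x))\<^sup>2"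
    by (simp only: power2_norm_eq_inner inner_add_left inner_add_right inner_scaleR_left inner_scaleR_right)
      (simp add: inner_commute algebra_simps)
  then show ?thesis by (simp only: Y_eq)
qed

lemma norm_SY_le: "norm (S (Y e x)) \<le> norm x"
  and norm_eY_le: "norm (e *\<^sub>R Y e x) \<le> norm x"
  by (rule power2_le_imp_le; use norm_decomp[of x] S_pos[of "Y e x"] e in \<open>simp add: add_nonneg_nonneg\<close>)+

lemma Y_blin: "bounded_linear (Y e)"
proof (rule bounded_linear_intro[where K = "1 / e"])
  show "norm (Y e x) \<le> norm x * (1 / e)" for x
    using norm_eY_le[of x] e by (simp add: field_simps)
qed (rule Y_add Y_scaleR)+

lemma Y_sym: "Y e x \<bullet> y = x \<bullet> Y e y"
proof -
  have "Y e x \<bullet> (S (Y e y) + e *\<^sub>R Y e y) = (S (Y e x) + e *\<^sub>R Y e x) \<bullet> Y e y"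
    by (simp add: inner_add_left inner_add_right S_sym)
  then show ?thesis by (simp only: Y_eq)
qed

text \<open>Makes the Yosida error small: the squared norm of \<open>e *\<^sub>R Y e x\<close> is at
  most \<open>e\<close> times the potential energy \<open>Y e x \<bullet> x\<close>.\<close>

lemma eY_le: "e * (norm (Y e x))\<^sup>2 \<le> Y e x \<bullet> x"
proof -
  have "Y e x \<bullet> (S (Y e x) + e *\<^sub>R Y e x) \<ge> e * (norm (Y e x))\<^sup>2"
    using S_pos[of "Y e x"] by (simp add: inner_add_right power2_norm_eq_inner inner_commute)
  then show ?thesis by (simp only: Y_eq)
qed

lemma Y_pos: "0 \<le> Y e x \<bullet> x"
  using eY_le[of x] e by (meson less_imp_le mult_nonneg_nonneg order_trans zero_le_power2)

text \<open>Bounds the potential energy of the initial value \<open>S x\<close> independently of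
  \<open>e\<close>; spectrally, \<open>s\<^sup>2 / (s + e) \<le> s\<close>.\<close>

lemma SY_form_le: "Y e (S x) \<bullet> S x \<le> x \<bullet> S x"
proof -
  have "Y e (S x) = x - e *\<^sub>R Y e x" by (simp add: Y_S S_Y)
  moreover have "0 \<le> Y e x \<bullet> S x"
  proof -
    have "Y e x \<bullet> S (S (Y e x) + e *\<^sub>R Y e x) = S (Y e x) \<bullet> S (Y e x) + e * (S (Y e x) \<bullet> Y e x)"
      by (simp only: S.add S.scaleR inner_add_right inner_scaleR_right S_sym)
    then show ?thesis using S_pos[of "Y e x"] e by (simp add: Y_eq)
  qed
  ultimately show ?thesis using e by (simp add: inner_diff_left)
qed

end

text \<open>On the range, \<open>e *\<^sub>R Y e (S y)\<close> has norm at most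
  \<open>e * norm y\<close>. All these operators are contractions, so convergence extends to the
  closure.\<close>

lemma eY_tendsto_0:
  assumes x: "x \<in> closure (range S)" and e: "\<And>n. e n > 0" "e \<longlonglongrightarrow> 0"
  shows "(\<lambda>n. e n *\<^sub>R Y (e n) x) \<longlonglongrightarrow> 0"
proof (rule LIMSEQ_I)
  fix r :: real assume r: "r > 0"
  obtain y where y: "norm (S y - x) < r / 2"
    using x r by (metis closure_approachable dist_norm half_gt_zero rangeE)
  have "(\<lambda>n. e n * norm y) \<longlonglongrightarrow> 0 * norm y" by (intro tendsto_intros e)
  then obtain N where N: "\<And>n. n \<ge> N \<Longrightarrow> e n * norm y < r / 2"
    using order_tendstoD(2)[of _ _ _ "r / 2"] r by (force simp: eventually_sequentially)
  have "norm (e n *\<^sub>R Y (e n) x - 0) < r" if "n \<ge> N" for n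
  proof -
    interpret Yn: bounded_linear "Y (e n)" by (rule Y_blin[OF e(1)])
    have eq: "e n *\<^sub>R Y (e n) x = e n *\<^sub>R Y (e n) (S y) - e n *\<^sub>R Y (e n) (S y - x)"
      by (simp add: Yn.diff algebra_simps)
    have "norm (e n *\<^sub>R Y (e n) (S y)) \<le> e n * norm y"
      using norm_SY_le[OF e(1), of n y] e(1)[of n] by (simp add: Y_S[OF e(1)])
    then have "norm (e n *\<^sub>R Y (e n) x) \<le> e n * norm y + norm (S y - x)"
      using norm_triangle_ineq4[of "e n *\<^sub>R Y (e n) (S y)" "e n *\<^sub>R Y (e n) (S y - x)"] norm_eY_le[OF e(1), of n "S y - x"]
      unfolding eq by linarith
    then show ?thesis using N[OF that] y by simp
  qed
  then show "\<exists>N. \<forall>n\<ge>N. norm (e n *\<^sub>R Y (e n) x - 0) < r" by blast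
qed

text \<open>Contractions that converge pointwise converge uniformly along a continuous curve over a
  compact interval: a finite net of times suffices.\<close>

lemma eY_uniform:
  assumes g: "continuous_on {0..T} g" "\<And>s. s \<in> {0..T} \<Longrightarrow> g s \<in> closure (range S)"
    and e: "\<And>n. e n > 0" "e \<longlonglongrightarrow> 0" and r: "r > 0"
  shows "\<exists>N. \<forall>n\<ge>N. \<forall>s\<in>{0..T::real}. norm (e n *\<^sub>R Y (e n) (g s)) \<le> r"
proof -
  have "uniformly_continuous_on {0..T} g" using g(1) compact_uniformly_continuous by blast
  then obtain d where d: "d > 0" "\<And>s s'. s \<in> {0..T} \<Longrightarrow> s' \<in> {0..T} \<Longrightarrow> dist s' s < d \<Longrightarrow> dist (g s') (g s) < r / 2"
    using r unfolding uniformly_continuous_on_def by (metis half_gt_zero)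
  obtain k where k: "finite k" "k \<subseteq> {0..T}" "{0..T} \<subseteq> (\<Union>x\<in>k. ball x d)"
    using seq_compact_imp_totally_bounded[of "{0..T}"] d(1) compact_imp_seq_compact by (metis compact_Icc)
  have "\<exists>N. \<forall>n\<ge>N. norm (e n *\<^sub>R Y (e n) (g s)) < r / 2" if "s \<in> k" for s
    using LIMSEQ_D[OF eY_tendsto_0[OF g(2) e]] that k(2) r by (metis diff_zero half_gt_zero subsetD)
  then obtain N where N: "\<And>s n. s \<in> k \<Longrightarrow> n \<ge> N s \<Longrightarrow> norm (e n *\<^sub>R Y (e n) (g s)) < r / 2" by metis
  show ?thesis
  proof (intro exI allI impI ballI)
    fix n s assume n: "n \<ge> Max (insert 0 (N ` k))" and s: "s \<in> {0..T}"
    interpret Yn: bounded_linear "Y (e n)" by (rule Y_blin[OF e(1)])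
    obtain c where c: "c \<in> k" "dist c s < d" using k(3) s by auto
    have "n \<ge> N c" using n c k(1) by (auto intro: order_trans[OF Max_ge])
    then have "norm (e n *\<^sub>R Y (e n) (g c)) < r / 2" by (rule N[OF c(1)])
    moreover have "norm (e n *\<^sub>R Y (e n) (g s - g c)) < r / 2"
    proof -
      have "dist (g s) (g c) < r / 2" using c s k(2) by (intro d(2)) (auto simp: dist_commute)
      then show ?thesis using norm_eY_le[OF e(1), of n "g s - g c"] unfolding dist_norm by linarith
    qed
    moreover have eq: "e n *\<^sub>R Y (e n) (g s) = e n *\<^sub>R Y (e n) (g c) + e n *\<^sub>R Y (e n) (g s - g c)"
      by (simp add: Yn.diff algebra_simps)
    ultimately show "norm (e n *\<^sub>R Y (e n) (g s)) \<le> r"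
      using norm_triangle_ineq[of "e n *\<^sub>R Y (e n) (g c)" "e n *\<^sub>R Y (e n) (g s - g c)"] unfolding eq by linarith
  qed
qed

end

subsection \<open>Weak solutions\<close>

text \<open>The problem is S v'' + v - K * v = S g with \<open>v 0 = S a0\<close>, so
  \<open>a0\<close> plays the role of A v(0). The closure conditions say that \<open>v1\<close> and
  \<open>g\<close> have no component in the kernel of \<open>S\<close>; on such data the cut-offs
  tend to 0.\<close>

locale wave_problem = memory_kernel K \<kappa> + pos_operator S
  for K \<kappa> and S :: "'h::{real_inner,banach} \<Rightarrow> 'h" +
  fixes T :: real and a0 v1 :: 'h and g :: "real \<Rightarrow> 'h"
  assumes T: "0 < T" and g_cont: "continuous_on {0..T} g"
    and v1_closure: "v1 \<in> closure (range S)"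
    and g_closure: "\<And>s. s \<in> {0..T} \<Longrightarrow> g s \<in> closure (range S)"
begin

text \<open>The multipliers; functions of \<open>S\<close> are the typical case. They commute with
  every \<open>Y e\<close>, so \<open>Q v\<close> solves the approximate equation with multiplied
  data. Besides the identity, \<open>d *\<^sub>R Y d x\<close> keeps the high frequencies of A and
  \<open>S (Y d x)\<close> the low ones.\<close>

definition commuting :: "('h \<Rightarrow> 'h) \<Rightarrow> bool" where
  "commuting Q \<longleftrightarrow> bounded_linear Q \<and> (\<forall>x y. Q x \<bullet> y = x \<bullet> Q y) \<and> (\<forall>x. Q (S x) = S (Q x))"

lemma commuting_Y:
  assumes "commuting Q" "e > 0"
  shows "Q (Y e x) = Y e (Q x)"
proof (rule Y_unique[OF assms(2), symmetric])
  interpret Q: bounded_linear Q using assms by (simp add: commuting_def)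
  have "S (Q (Y e x)) + e *\<^sub>R Q (Y e x) = Q (S (Y e x) + e *\<^sub>R Y e x)"
    using assms(1) by (simp add: commuting_def Q.add Q.scaleR)
  then show "S (Q (Y e x)) + e *\<^sub>R Q (Y e x) = Q x" by (simp only: Y_eq[OF assms(2)])
qed

lemma commuting_id: "commuting (\<lambda>x. x)"
  by (simp add: commuting_def)

lemma commuting_Yosida: "d > 0 \<Longrightarrow> commuting (\<lambda>x. d *\<^sub>R Y d x)"
  unfolding commuting_def
  by (auto intro!: bounded_linear_compose[OF bounded_linear_scaleR_right Y_blin] simp: Y_sym Y_S S.scaleR)

lemma commuting_SY: "d > 0 \<Longrightarrow> commuting (\<lambda>x. S (Y d x))"
  unfolding commuting_def
  by (auto intro!: bounded_linear_compose[OF S_blin Y_blin] simp: Y_sym Y_S S_sym)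

lemma commuting_diff: "commuting P \<Longrightarrow> commuting Q \<Longrightarrow> commuting (\<lambda>x. P x - Q x)"
  unfolding commuting_def
  by (auto intro!: bounded_linear_sub simp: inner_diff_left inner_diff_right S.diff)

text \<open>The bound of \<open>energy_estimate\<close>, doubled, for kinetic energy
  \<open>(norm (Q v'))\<^sup>2 / 2\<close> and \<open>h = sqrt 2 * norm (Q g)\<close>, with the
  initial potential energy replaced by its bound \<open>Q a0 \<bullet> S (Q a0)\<close>, which is
  uniform in \<open>e\<close>.\<close>

definition energy_bound :: "('h \<Rightarrow> 'h) \<Rightarrow> real \<Rightarrow> real" where
  "energy_bound Q t = exp (8 / (1 - \<kappa>) * t) *
    (4 * (norm (Q v1))\<^sup>2 + 4 * (Q a0 \<bullet> S (Q a0)) + 16 * (integral {0..t} (\<lambda>s. norm (Q (g s))))\<^sup>2)"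

lemma norm_Qg_integrable:
  assumes "bounded_linear Q" "t \<in> {0..T}"
  shows "(\<lambda>s. norm (Q (g s))) integrable_on {0..t}"
  using assms
  by (intro integrable_continuous_interval continuous_intros bounded_linear.continuous_on[OF assms(1)]
      continuous_on_subset[OF g_cont]) auto

lemma S_pos': "0 \<le> x \<bullet> S x"
  using S_pos[of x] by (simp add: S_sym)

lemma energy_bound_mono:
  assumes Q: "bounded_linear Q" and st: "0 \<le> s" "s \<le> t" "t \<le> T"
  shows "energy_bound Q s \<le> energy_bound Q t"
  unfolding energy_bound_def
proof (intro mult_mono add_mono power_mono order_refl)
  show "exp (8 / (1 - \<kappa>) * s) \<le> exp (8 / (1 - \<kappa>) * t)"
    using st \<kappa>_less_1 by (simp add: divide_right_mono)
  show "integral {0..s} (\<lambda>s. norm (Q (g s))) \<le> integral {0..t} (\<lambda>s. norm (Q (g s)))"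
    by (rule integral_subset_le) (use st in \<open>auto intro!: norm_Qg_integrable[OF Q]\<close>)
  show "0 \<le> integral {0..s} (\<lambda>s. norm (Q (g s)))"
    by (rule integral_nonneg) (use st in \<open>auto intro!: norm_Qg_integrable[OF Q]\<close>)
qed (use S_pos'[of "Q a0"] in auto)

lemma energy_bound_nonneg: "0 \<le> energy_bound Q t"
  unfolding energy_bound_def using S_pos'[of "Q a0"] by simp

section \<open>Approximate solutions and their uniform bounds\<close>

definition approx :: "real \<Rightarrow> (real \<Rightarrow> 'h) \<Rightarrow> (real \<Rightarrow> 'h) \<Rightarrow> bool" where
  "approx e v v' \<longleftrightarrow> v 0 = S a0 \<and> v' 0 = v1 \<and>
    (\<forall>t\<in>{0..T}. (v has_vector_derivative v' t) (at t within {0..T})) \<and>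
    (\<forall>t\<in>{0..T}. (v' has_vector_derivative (g t - Y e (v t - conv K v t))) (at t within {0..T}))"

lemma approx_exists: "e > 0 \<Longrightarrow> \<exists>v v'. approx e v v'"
  unfolding approx_def by (rule bounded_problem) (use T g_cont Y_blin in auto)

lemma approx_continuous:
  assumes "approx e v v'"
  shows "continuous_on {0..T} v" "continuous_on {0..T} v'"
  using assms unfolding approx_def
  by (meson continuous_on_eq_continuous_within has_vector_derivative_continuous)+

text \<open>Amounts to testing the equation with \<open>Q (Q v')\<close>, and the bounds do not
  involve \<open>e\<close>. The third one passes from \<open>v - conv K v\<close> to
  \<open>v\<close> by \<open>form_sup_le\<close>.\<close>

lemma approx_bound:
  assumes a: "approx e v v'" and e: "e > 0" and Q: "commuting Q" and t: "t \<in> {0..T}"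
  shows "(norm (Q (v' t)))\<^sup>2 \<le> energy_bound Q t" (is ?thesis1)
    and "Y e (Q (v t - conv K v t)) \<bullet> Q (v t - conv K v t) \<le> energy_bound Q t" (is ?thesis2)
    and "Y e (Q (v t)) \<bullet> Q (v t) \<le> energy_bound Q t / (1 - \<kappa>)\<^sup>2" (is ?thesis3)
proof -
  have Qb: "bounded_linear Q" and Qsym: "\<And>x y. Q x \<bullet> y = x \<bullet> Q y" and QS: "\<And>x. Q (S x) = S (Q x)"
    using Q by (auto simp: commuting_def)
  interpret Q: bounded_linear Q by fact
  \<comment> \<open>Commutation makes this operator symmetric and nonnegative, with form
    \<open>Y e (Q x) \<bullet> Q x\<close>.\<close>
  define B where "B x = Q (Q (Y e x))" for x
  have B: "bounded_linear B"
    unfolding B_def by (intro bounded_linear_compose[OF Qb] Y_blin e)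
  have Bform: "B x \<bullet> y = Q (Y e x) \<bullet> Q y" for x y by (simp add: B_def Qsym)
  have BQ: "B x \<bullet> x = Y e (Q x) \<bullet> Q x" for x by (simp add: Bform commuting_Y[OF Q e])
  have Bsym: "B x \<bullet> y = x \<bullet> B y" for x y
    by (simp add: B_def Qsym Y_sym[OF e] commuting_Y[OF Q e])
  have Bpos: "0 \<le> B x \<bullet> x" for x by (simp add: BQ Y_pos[OF e])
  define p where "p s = v s - conv K v s" for s
  have v: "(v has_vector_derivative v' s) (at s within {0..T})" if "s \<in> {0..T}" for s
    using a that by (simp add: approx_def)
  have v': "(v' has_vector_derivative (g s - Y e (p s))) (at s within {0..T})" if "s \<in> {0..T}" for s
    using a that by (simp add: approx_def p_def)
  have main: "(norm (Q (v' t)))\<^sup>2 + B (p t) \<bullet> p t \<le> energy_bound Q t" if t: "t \<in> {0..T}" for t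
  proof -
    have "(norm (Q (v' t)))\<^sup>2 / 2 + (B (v t - conv K v t) \<bullet> (v t - conv K v t)) / 2 \<le>
      exp (8 / (1 - \<kappa>) * t) * (4 * ((norm (Q (v' 0)))\<^sup>2 / 2 + (B (v 0) \<bullet> v 0) / 2) + 4 * 0 * t
        + 4 * (integral {0..t} (\<lambda>s. sqrt 2 * norm (Q (g s))))\<^sup>2)"
    proof (rule energy_estimate[OF B Bsym Bpos v, where \<rho> = "\<lambda>s. Q (g s) \<bullet> Q (v' s)"])
      fix s assume s: "s \<in> {0..T}"
      have "((\<lambda>s. Q (v' s) \<bullet> Q (v' s)) has_derivative
          (\<lambda>h. Q (v' s) \<bullet> Q (h *\<^sub>R (g s - Y e (p s))) + Q (h *\<^sub>R (g s - Y e (p s))) \<bullet> Q (v' s))) (at s within {0..T})"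
        by (intro has_derivative_inner Q.has_derivative v'[OF s, unfolded has_vector_derivative_def])
      then have "((\<lambda>s. Q (v' s) \<bullet> Q (v' s)) has_derivative
          (\<lambda>h. (2 * (Q (g s - Y e (p s)) \<bullet> Q (v' s))) * h)) (at s within {0..T})"
        by (rule has_derivative_eq_rhs) (auto simp: Q.scaleR inner_commute fun_eq_iff)
      then have "((\<lambda>s. Q (v' s) \<bullet> Q (v' s)) has_real_derivative 2 * (Q (g s - Y e (p s)) \<bullet> Q (v' s))) (at s within {0..T})"
        by (simp add: has_field_derivative_def mult_commute_abs)
      then have "((\<lambda>s. Q (v' s) \<bullet> Q (v' s) / 2) has_real_derivative 2 * (Q (g s - Y e (p s)) \<bullet> Q (v' s)) / 2) (at s within {0..T})"
        by (rule DERIV_cdivide)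
      then show "((\<lambda>s. (norm (Q (v' s)))\<^sup>2 / 2) has_real_derivative
          Q (g s) \<bullet> Q (v' s) - B (v s - conv K v s) \<bullet> v' s) (at s within {0..T})"
        by (simp add: power2_norm_eq_inner Bform p_def Q.diff inner_diff_left diff_divide_distrib)
      have "Q (g s) \<bullet> Q (v' s) \<le> norm (Q (g s)) * norm (Q (v' s))" by (rule norm_cauchy_schwarz)
      also have "\<dots> = sqrt 2 * norm (Q (g s)) * sqrt ((norm (Q (v' s)))\<^sup>2 / 2) + 0"
        by (simp add: real_sqrt_divide)
      finally show "Q (g s) \<bullet> Q (v' s) \<le> sqrt 2 * norm (Q (g s)) * sqrt ((norm (Q (v' s)))\<^sup>2 / 2) + 0" .
    next
      show "continuous_on {0..T} (\<lambda>s. sqrt 2 * norm (Q (g s)))"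
        by (intro continuous_intros Q.continuous_on g_cont)
    qed (use t approx_continuous[OF a] in auto)
    also have "B (v 0) \<bullet> v 0 = Y e (S (Q a0)) \<bullet> S (Q a0)"
      using a by (simp add: BQ approx_def QS)
    also have "v' 0 = v1" using a by (simp add: approx_def)
    also have "integral {0..t} (\<lambda>s. sqrt 2 * norm (Q (g s))) = sqrt 2 * integral {0..t} (\<lambda>s. norm (Q (g s)))"
      by simp
    finally have "(norm (Q (v' t)))\<^sup>2 + B (p t) \<bullet> p t \<le> 2 * (exp (8 / (1 - \<kappa>) * t) *
      (4 * ((norm (Q v1))\<^sup>2 / 2 + (Y e (S (Q a0)) \<bullet> S (Q a0)) / 2) + 4 * 0 * t
        + 4 * (sqrt 2 * integral {0..t} (\<lambda>s. norm (Q (g s))))\<^sup>2))"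
      unfolding p_def by linarith
    also have "\<dots> = exp (8 / (1 - \<kappa>) * t) * (4 * (norm (Q v1))\<^sup>2 + 4 * (Y e (S (Q a0)) \<bullet> S (Q a0))
        + 16 * (integral {0..t} (\<lambda>s. norm (Q (g s))))\<^sup>2)"
      by (simp add: power_mult_distrib algebra_simps)
    also have "\<dots> \<le> energy_bound Q t"
      unfolding energy_bound_def
      using SY_form_le[OF e, of "Q a0"] by (intro mult_left_mono add_mono) auto
    finally show ?thesis .
  qed
  show ?thesis1 using main[OF t] Bpos[of "p t"] by linarith
  show ?thesis2 using main[OF t] zero_le_power2[of "norm (Q (v' t))"] unfolding BQ p_def by linarith
  have "sqrt (B (v t) \<bullet> v t) \<le> sqrt (energy_bound Q t) / (1 - \<kappa>)"
  proof (rule form_sup_le[OF B Bsym Bpos])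
    show "continuous_on {0..t} v" using approx_continuous(1)[OF a] t by (auto intro: continuous_on_subset)
    fix s assume s: "s \<in> {0..t}"
    then have "B (p s) \<bullet> p s \<le> energy_bound Q s"
      using main[of s] t by (auto intro: order_trans[rotated])
    also have "\<dots> \<le> energy_bound Q t" using energy_bound_mono[OF Qb] s t by auto
    finally show "sqrt (B (v s - conv K v s) \<bullet> (v s - conv K v s)) \<le> sqrt (energy_bound Q t)"
      by (simp add: p_def)
  qed (use t in auto)
  then have "(sqrt (B (v t) \<bullet> v t))\<^sup>2 \<le> (sqrt (energy_bound Q t) / (1 - \<kappa>))\<^sup>2"
    by (intro power_mono) (use Bpos in auto)
  then show ?thesis3 using Bpos[of "v t"] energy_bound_nonneg[of Q t] by (simp add: BQ power_divide)
qed

text \<open>The cut-off removes everything from data in the closure of the range, pointwise for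
  \<open>v1\<close> and uniformly along \<open>g\<close>. For \<open>a0\<close>, which need not lie
  there, the factor \<open>S\<close> is used: the form of the cut-off is at most
  \<open>norm a0\<close> times the cut-off of \<open>S a0\<close>.\<close>

lemma energy_bound_Yosida_tendsto_0:
  assumes e: "\<And>n. e n > 0" "e \<longlonglongrightarrow> 0"
  shows "(\<lambda>n. energy_bound (\<lambda>x. e n *\<^sub>R Y (e n) x) T) \<longlonglongrightarrow> 0"
proof -
  let ?R = "\<lambda>n x. e n *\<^sub>R Y (e n) x"
  have 1: "(\<lambda>n. (norm (?R n v1))\<^sup>2) \<longlonglongrightarrow> 0"
    using tendsto_power[OF tendsto_norm[OF eY_tendsto_0[OF v1_closure e]], of 2] by simp
  have 2: "(\<lambda>n. ?R n a0 \<bullet> S (?R n a0)) \<longlonglongrightarrow> 0"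
  proof (rule Lim_null_comparison)
    have "S a0 \<in> closure (range S)" by (rule subsetD[OF closure_subset rangeI])
    then have "(\<lambda>n. norm a0 * norm (?R n (S a0))) \<longlonglongrightarrow> norm a0 * norm (0 :: 'h)"
      by (intro tendsto_intros eY_tendsto_0 e)
    then show "(\<lambda>n. norm a0 * norm (?R n (S a0))) \<longlonglongrightarrow> 0" by (simp only: norm_zero mult_zero_right)
    have "norm (?R n a0 \<bullet> S (?R n a0)) \<le> norm a0 * norm (?R n (S a0))" for n
    proof -
      have "norm (?R n a0 \<bullet> S (?R n a0)) \<le> norm (?R n a0) * norm (S (?R n a0))"
        by (simp only: real_norm_def Cauchy_Schwarz_ineq2)
      also have "\<dots> \<le> norm a0 * norm (?R n (S a0))"
        using norm_eY_le[OF e(1)] by (intro mult_mono) (auto simp: S.scaleR Y_S[OF e(1)])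
      finally show ?thesis .
    qed
    then show "\<forall>\<^sub>F n in sequentially. norm (?R n a0 \<bullet> S (?R n a0)) \<le> norm a0 * norm (?R n (S a0))" by simp
  qed
  have 3: "(\<lambda>n. integral {0..T} (\<lambda>s. norm (?R n (g s)))) \<longlonglongrightarrow> 0"
  proof (rule LIMSEQ_I)
    fix r :: real assume r: "r > 0"
    obtain N where N: "\<And>n s. n \<ge> N \<Longrightarrow> s \<in> {0..T} \<Longrightarrow> norm (?R n (g s)) \<le> r / (2 * T)"
      using eY_uniform[OF g_cont g_closure e, of "r / (2 * T)"] r T by (meson divide_pos_pos mult_pos_pos zero_less_numeral)
    have "norm (integral {0..T} (\<lambda>s. norm (?R n (g s))) - 0) < r" if "n \<ge> N" for n
    proof -
      have "norm (integral {0..T} (\<lambda>s. norm (?R n (g s)))) \<le> integral {0..T} (\<lambda>s. r / (2 * T))"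
      proof (rule integral_norm_bound_integral)
        show "(\<lambda>s. norm (?R n (g s))) integrable_on {0..T}"
          by (rule norm_Qg_integrable) (use commuting_Yosida[OF e(1)] T in \<open>auto simp: commuting_def\<close>)
      qed (use N[OF that] in auto)
      then show ?thesis using r T by simp
    qed
    then show "\<exists>N. \<forall>n\<ge>N. norm (integral {0..T} (\<lambda>s. norm (?R n (g s))) - 0) < r" by blast
  qed
  have "(\<lambda>n. energy_bound (?R n) T) \<longlonglongrightarrow> exp (8 / (1 - \<kappa>) * T) * (4 * 0 + 4 * 0 + 16 * 0\<^sup>2)"
    unfolding energy_bound_def by (intro tendsto_intros 1 2 3)
  then show ?thesis by simp
qed

text \<open>Cauchy-Schwarz for the form of \<open>S\<close>, applied to \<open>x\<close> and
  \<open>S x\<close>. It turns the weak control of \<open>approx_difference\<close> into a bound for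
  \<open>S z\<close> in norm.\<close>

lemma norm_S_le_form: "\<exists>b>0. \<forall>x. (norm (S x))\<^sup>2 \<le> b * (S x \<bullet> x)"
proof -
  obtain b where b: "b > 0" "\<And>x. norm (S x) \<le> norm x * b" using S.pos_bounded by blast
  have "(norm (S x))\<^sup>2 \<le> b * (S x \<bullet> x)" for x
  proof -
    have "S x \<bullet> S x \<le> sqrt (S x \<bullet> x) * sqrt (S (S x) \<bullet> S x)"
      using form_Cauchy_Schwarz[OF S_blin S_sym S_pos, of x "S x"] by linarith
    also have "\<dots> \<le> sqrt (S x \<bullet> x) * sqrt (b * (norm (S x))\<^sup>2)"
    proof (intro mult_left_mono real_sqrt_le_mono)
      have "S (S x) \<bullet> S x \<le> norm (S (S x)) * norm (S x)" by (rule norm_cauchy_schwarz)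
      also have "\<dots> \<le> (norm (S x) * b) * norm (S x)" by (intro mult_right_mono b) auto
      finally show "S (S x) \<bullet> S x \<le> b * (norm (S x))\<^sup>2" by (simp add: power2_eq_square mult_ac)
    qed (use S_pos in auto)
    also have "\<dots> = sqrt (b * (S x \<bullet> x)) * norm (S x)"
      using b(1) by (simp add: real_sqrt_mult)
    finally have "norm (S x) * norm (S x) \<le> sqrt (b * (S x \<bullet> x)) * norm (S x)"
      by (simp add: power2_norm_eq_inner[symmetric] power2_eq_square)
    then have "norm (S x) \<le> sqrt (b * (S x \<bullet> x))"
      using S_pos[of x] b(1) by (cases "S x = 0") auto
    then have "(norm (S x))\<^sup>2 \<le> (sqrt (b * (S x \<bullet> x)))\<^sup>2" by (intro power_mono) auto
    then show ?thesis using S_pos[of x] b(1) by simp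
  qed
  then show ?thesis using b(1) by blast
qed

text \<open>After applying \<open>S\<close>, the difference \<open>z\<close> satisfies the equation
  with identity as potential operator and with the two Yosida errors as source, which are of order
  \<open>sqrt d\<close> and \<open>sqrt e\<close> by \<open>eY_le\<close>. Testing with
  \<open>z'\<close> controls it only in the form of \<open>S\<close>, so by itself this gives no
  convergence in norm.\<close>

lemma approx_difference:
  assumes a: "approx d v v'" "approx e w w'" and de: "d > 0" "e > 0" and t: "t \<in> {0..T}"
  shows "S (v' t - w' t) \<bullet> (v' t - w' t) \<le>
    exp (8 / (1 - \<kappa>) * T) * (16 * energy_bound (\<lambda>x. x) T * (sqrt d + sqrt e) * T)"
proof -
  define M where "M = energy_bound (\<lambda>x. x) T"
  have M0: "0 \<le> M" unfolding M_def by (rule energy_bound_nonneg)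
  have tT: "energy_bound (\<lambda>x. x) s \<le> M" if "s \<in> {0..T}" for s
    unfolding M_def by (rule energy_bound_mono) (use that in auto)
  have bnd: "norm (u' s) \<le> sqrt M" "norm (\<epsilon> *\<^sub>R Y \<epsilon> (u s - conv K u s)) \<le> sqrt \<epsilon> * sqrt M"
    if "approx \<epsilon> u u'" "\<epsilon> > 0" "s \<in> {0..T}" for u u' \<epsilon> s
  proof -
    show "norm (u' s) \<le> sqrt M"
      using approx_bound(1)[OF that(1,2) commuting_id that(3)] tT[OF that(3)] by (intro real_le_rsqrt) linarith
    have "(norm (\<epsilon> *\<^sub>R Y \<epsilon> (u s - conv K u s)))\<^sup>2 = \<epsilon> * (\<epsilon> * (norm (Y \<epsilon> (u s - conv K u s)))\<^sup>2)"
      by (simp add: power_mult_distrib power2_eq_square)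
    also have "\<dots> \<le> \<epsilon> * (Y \<epsilon> (u s - conv K u s) \<bullet> (u s - conv K u s))"
      by (intro mult_left_mono eY_le) (use that in auto)
    also have "\<dots> \<le> \<epsilon> * M"
      using approx_bound(2)[OF that(1,2) commuting_id that(3)] tT[OF that(3)] that(2)
      by (intro mult_left_mono) auto
    finally have "norm (\<epsilon> *\<^sub>R Y \<epsilon> (u s - conv K u s)) \<le> sqrt (\<epsilon> * M)" by (rule real_le_rsqrt)
    then show "norm (\<epsilon> *\<^sub>R Y \<epsilon> (u s - conv K u s)) \<le> sqrt \<epsilon> * sqrt M" by (simp add: real_sqrt_mult)
  qed
  define c where "c = 2 * M * (sqrt d + sqrt e)"
  define \<rho> where "\<rho> s = (d *\<^sub>R Y d (v s - conv K v s) - e *\<^sub>R Y e (w s - conv K w s)) \<bullet> (v' s - w' s)" for s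
  have \<rho>: "\<rho> s \<le> c" if s: "s \<in> {0..T}" for s
  proof -
    have "\<rho> s \<le> norm (d *\<^sub>R Y d (v s - conv K v s) - e *\<^sub>R Y e (w s - conv K w s)) * norm (v' s - w' s)"
      unfolding \<rho>_def by (rule norm_cauchy_schwarz)
    also have "\<dots> \<le> (sqrt d * sqrt M + sqrt e * sqrt M) * (sqrt M + sqrt M)"
    proof (rule mult_mono)
      show "norm (d *\<^sub>R Y d (v s - conv K v s) - e *\<^sub>R Y e (w s - conv K w s)) \<le> sqrt d * sqrt M + sqrt e * sqrt M"
        by (rule order_trans[OF norm_triangle_ineq4]) (intro add_mono bnd(2)[OF a(1) de(1) s] bnd(2)[OF a(2) de(2) s])
      show "norm (v' s - w' s) \<le> sqrt M + sqrt M"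
        by (rule order_trans[OF norm_triangle_ineq4]) (intro add_mono bnd(1)[OF a(1) de(1) s] bnd(1)[OF a(2) de(2) s])
    qed (use M0 de in auto)
    also have "\<dots> = 2 * (sqrt M * sqrt M) * (sqrt d + sqrt e)" by algebra
    also have "\<dots> = c" using M0 by (simp add: c_def)
    finally show ?thesis .
  qed
  define z z' where "z s = v s - w s" and "z' s = v' s - w' s" for s
  have cont: "continuous_on {0..T} v" "continuous_on {0..T} w" "continuous_on {0..T} v'" "continuous_on {0..T} w'"
    using approx_continuous[OF a(1)] approx_continuous[OF a(2)] by auto
  have "S (z' t) \<bullet> z' t / 2 + (z t - conv K z t) \<bullet> (z t - conv K z t) / 2 \<le>
     exp (8 / (1 - \<kappa>) * t) * (4 * (S (z' 0) \<bullet> z' 0 / 2 + z 0 \<bullet> z 0 / 2) + 4 * c * t + 4 * (integral {0..t} (\<lambda>_. 0))\<^sup>2)"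
  proof (rule energy_estimate[where B = "\<lambda>x. x" and \<rho> = \<rho>])
    fix s assume s: "s \<in> {0..T}"
    show "(z has_vector_derivative z' s) (at s within {0..T})"
      unfolding z_def z'_def using a s by (intro derivative_intros) (auto simp: approx_def)
    define z'' where "z'' = (g s - Y d (v s - conv K v s)) - (g s - Y e (w s - conv K w s))"
    have z'': "(z' has_vector_derivative z'') (at s within {0..T})"
      unfolding z''_def z'_def using a s by (intro derivative_intros) (auto simp: approx_def)
    have "((\<lambda>s. S (z' s) \<bullet> z' s) has_derivative
        (\<lambda>h. S (z' s) \<bullet> (h *\<^sub>R z'') + S (h *\<^sub>R z'') \<bullet> z' s)) (at s within {0..T})"
      by (intro has_derivative_inner S.has_derivative z''[unfolded has_vector_derivative_def])
    then have "((\<lambda>s. S (z' s) \<bullet> z' s) has_derivative (\<lambda>h. (2 * (S z'' \<bullet> z' s)) * h)) (at s within {0..T})"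
      by (rule has_derivative_eq_rhs) (auto simp: S.scaleR S_sym[of "z' s"] inner_commute[of "z' s"] fun_eq_iff)
    then have "((\<lambda>s. S (z' s) \<bullet> z' s) has_real_derivative 2 * (S z'' \<bullet> z' s)) (at s within {0..T})"
      by (simp add: has_field_derivative_def mult_commute_abs)
    then have der: "((\<lambda>s. S (z' s) \<bullet> z' s / 2) has_real_derivative 2 * (S z'' \<bullet> z' s) / 2) (at s within {0..T})"
      by (rule DERIV_cdivide)
    have Sz: "S z'' = (d *\<^sub>R Y d (v s - conv K v s) - e *\<^sub>R Y e (w s - conv K w s)) - (z s - conv K z s)"
      unfolding z''_def z_def conv_diff[OF K_cont cont(1,2) s]
      by (simp only: S.diff S_Y[OF de(1)] S_Y[OF de(2)]) (simp add: algebra_simps)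
    have "2 * (S z'' \<bullet> z' s) / 2 = \<rho> s - (z s - conv K z s) \<bullet> z' s"
      unfolding Sz \<rho>_def z'_def inner_diff_left by simp
    with der show "((\<lambda>s. S (z' s) \<bullet> z' s / 2) has_real_derivative \<rho> s - (z s - conv K z s) \<bullet> z' s) (at s within {0..T})"
      by (simp only:)
    show "\<rho> s \<le> 0 * sqrt (S (z' s) \<bullet> z' s / 2) + c" using \<rho>[OF s] by simp
  next
    show "continuous_on {0..T} z'" unfolding z'_def by (intro continuous_intros cont)
  qed (use M0 de t S_pos in \<open>auto simp: c_def\<close>)
  moreover have "z 0 = 0" "z' 0 = 0" using a by (auto simp: z_def z'_def approx_def)
  ultimately have "S (z' t) \<bullet> z' t / 2 + (z t - conv K z t) \<bullet> (z t - conv K z t) / 2 \<le> exp (8 / (1 - \<kappa>) * t) * (4 * c * t)"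
    by (simp add: S.zero)
  then have "S (z' t) \<bullet> z' t \<le> 2 * (exp (8 / (1 - \<kappa>) * t) * (4 * c * t))"
    using inner_ge_zero[of "z t - conv K z t"] by linarith
  also have "\<dots> \<le> 2 * (exp (8 / (1 - \<kappa>) * T) * (4 * c * T))"
    using t M0 de \<kappa>_less_1 by (intro mult_left_mono mult_mono) (auto simp: c_def divide_right_mono)
  finally show ?thesis by (simp add: c_def z'_def M_def mult_ac)
qed

end

section \<open>Bounds linear in the data, and passage to the limit\<close>

context wave_problem
begin

text \<open>Linear in the norms of the data, as the final estimate has to be, whereas
  \<open>energy_bound\<close> is quadratic: the root of a sum of squares is at most the sum, and
  taking the root halves the exponent.\<close>

definition energy_size :: "real \<Rightarrow> real" where
  "energy_size t = exp (4 / (1 - \<kappa>) * t) *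
    (2 * norm v1 + 2 * sqrt (a0 \<bullet> S a0) + 4 * integral {0..t} (\<lambda>s. norm (g s)))"

lemma energy_bound_le_size:
  assumes "t \<in> {0..T}"
  shows "energy_bound (\<lambda>x. x) t \<le> (energy_size t)\<^sup>2" and "0 \<le> energy_size t"
proof -
  define G where "G = integral {0..t} (\<lambda>s. norm (g s))"
  have G: "0 \<le> G" unfolding G_def using norm_Qg_integrable[of "\<lambda>x. x", OF _ assms] by (intro integral_nonneg) auto
  have s: "0 \<le> sqrt (a0 \<bullet> S a0)" "(sqrt (a0 \<bullet> S a0))\<^sup>2 = a0 \<bullet> S a0" using S_pos' by auto
  have "(exp (4 / (1 - \<kappa>) * t))\<^sup>2 = exp (8 / (1 - \<kappa>) * t)"
    by (simp add: power2_eq_square exp_add[symmetric] add_divide_distrib[symmetric])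
  then have "(energy_size t)\<^sup>2 = exp (8 / (1 - \<kappa>) * t) * (2 * norm v1 + 2 * sqrt (a0 \<bullet> S a0) + 4 * G)\<^sup>2"
    unfolding energy_size_def G_def by (simp only: power_mult_distrib)
  moreover have "4 * (norm v1)\<^sup>2 + 4 * (a0 \<bullet> S a0) + 16 * G\<^sup>2 \<le> (2 * norm v1 + 2 * sqrt (a0 \<bullet> S a0) + 4 * G)\<^sup>2"
  proof -
    have "(2 * norm v1 + 2 * sqrt (a0 \<bullet> S a0) + 4 * G)\<^sup>2
      = 4 * (norm v1)\<^sup>2 + 4 * (sqrt (a0 \<bullet> S a0))\<^sup>2 + 16 * G\<^sup>2
        + (8 * norm v1 * sqrt (a0 \<bullet> S a0) + 16 * norm v1 * G + 16 * sqrt (a0 \<bullet> S a0) * G)"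
      by algebra
    moreover have "0 \<le> 8 * norm v1 * sqrt (a0 \<bullet> S a0) + 16 * norm v1 * G + 16 * sqrt (a0 \<bullet> S a0) * G"
      using G s(1) by (intro add_nonneg_nonneg mult_nonneg_nonneg) auto
    ultimately show ?thesis using s(2) by linarith
  qed
  ultimately show "energy_bound (\<lambda>x. x) t \<le> (energy_size t)\<^sup>2"
    unfolding energy_bound_def G_def[symmetric] by (simp only: mult_left_mono exp_ge_zero)
  show "0 \<le> energy_size t"
    unfolding energy_size_def G_def[symmetric] using G s(1) by (intro mult_nonneg_nonneg add_nonneg_nonneg) auto
qed

text \<open>Expanding over \<open>x = S (Y d x) + d *\<^sub>R Y d x\<close>, the cross term is
  \<open>2 * d * (norm (S (Y d x)))\<^sup>2\<close>. So low-pass filtering does not increase the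
  energy of the data.\<close>

lemma SY_form_contraction:
  assumes "d > 0"
  shows "S (Y d x) \<bullet> S (S (Y d x)) \<le> x \<bullet> S x"
proof -
  let ?p = "S (Y d x)" and ?q = "d *\<^sub>R Y d x"
  have "x \<bullet> S x = (?p + ?q) \<bullet> S (?p + ?q)" by (simp only: Y_eq[OF assms])
  also have "\<dots> = ?p \<bullet> S ?p + 2 * (?q \<bullet> S ?p) + ?q \<bullet> S ?q"
    using S_sym[of ?p ?q] inner_commute[of "S ?p" ?q] by (simp only: S.add inner_add_left inner_add_right)
  finally have 1: "x \<bullet> S x = ?p \<bullet> S ?p + 2 * (?q \<bullet> S ?p) + ?q \<bullet> S ?q" .
  have "?q \<bullet> S ?p = d * (S (Y d x) \<bullet> S (Y d x))" by (simp add: S_sym)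
  then have "0 \<le> ?q \<bullet> S ?p" using assms by simp
  then show ?thesis using 1 S_pos'[of ?q] by linarith
qed

lemma energy_bound_SY_le:
  assumes "d > 0" "t \<in> {0..T}"
  shows "energy_bound (\<lambda>x. S (Y d x)) t \<le> energy_bound (\<lambda>x. x) t"
  unfolding energy_bound_def
proof (intro mult_left_mono add_mono power_mono)
  have "bounded_linear (\<lambda>x. S (Y d x))" using commuting_SY[OF assms(1)] by (simp add: commuting_def)
  note i = norm_Qg_integrable[OF this assms(2)] norm_Qg_integrable[of "\<lambda>x. x", OF _ assms(2)]
  show "integral {0..t} (\<lambda>s. norm (S (Y d (g s)))) \<le> integral {0..t} (\<lambda>s. norm (g s))"
    using i norm_SY_le[OF assms(1)] by (intro integral_le) auto
  show "0 \<le> integral {0..t} (\<lambda>s. norm (S (Y d (g s))))"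
    using i by (intro integral_nonneg) auto
qed (use norm_SY_le[OF assms(1)] SY_form_contraction[OF assms(1)] in auto)

text \<open>Serves for the difference of two cut-offs; each quadratic term obeys (a + b)^2 \<le> 2
  a^2 + 2 b^2.\<close>

lemma energy_bound_diff_le:
  assumes P: "commuting P" and Q: "commuting Q" and t: "t \<in> {0..T}"
  shows "energy_bound (\<lambda>x. P x - Q x) t \<le> 2 * energy_bound P t + 2 * energy_bound Q t"
proof -
  have Pb: "bounded_linear P" and Qb: "bounded_linear Q" using P Q by (auto simp: commuting_def)
  have lin: "4 * x + 4 * y + 16 * z \<le> 2 * (4 * x1 + 4 * y1 + 16 * z1) + 2 * (4 * x2 + 4 * y2 + 16 * z2)"
    if "x \<le> 2 * x1 + 2 * x2" "y \<le> 2 * y1 + 2 * y2" "z \<le> 2 * z1 + 2 * z2" for x y z x1 x2 y1 y2 z1 z2 :: real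
    using that by simp
  have sq: "(a + b)\<^sup>2 \<le> 2 * a\<^sup>2 + 2 * b\<^sup>2" for a b :: real
    using zero_le_power2[of "a - b"] by (simp add: power2_sum power2_diff)
  have 1: "(norm (P v1 - Q v1))\<^sup>2 \<le> 2 * (norm (P v1))\<^sup>2 + 2 * (norm (Q v1))\<^sup>2"
    by (rule order_trans[OF power_mono[OF norm_triangle_ineq4 norm_ge_zero] sq])
  have 2: "(P a0 - Q a0) \<bullet> S (P a0 - Q a0) \<le> 2 * (P a0 \<bullet> S (P a0)) + 2 * (Q a0 \<bullet> S (Q a0))"
  proof -
    have "0 \<le> (P a0 + Q a0) \<bullet> S (P a0 + Q a0)" by (rule S_pos')
    then show ?thesis by (simp add: S.add S.diff inner_add_left inner_add_right inner_diff_left inner_diff_right)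
  qed
  have "integral {0..t} (\<lambda>s. norm (P (g s) - Q (g s))) \<le> integral {0..t} (\<lambda>s. norm (P (g s)) + norm (Q (g s)))"
    using norm_Qg_integrable[OF Pb t] norm_Qg_integrable[OF Qb t] norm_Qg_integrable[OF bounded_linear_sub[OF Pb Qb] t]
    by (intro integral_le integrable_add norm_triangle_ineq4) auto
  also have "\<dots> = integral {0..t} (\<lambda>s. norm (P (g s))) + integral {0..t} (\<lambda>s. norm (Q (g s)))"
    by (rule integral_add[OF norm_Qg_integrable[OF Pb t] norm_Qg_integrable[OF Qb t]])
  finally have "(integral {0..t} (\<lambda>s. norm (P (g s) - Q (g s))))\<^sup>2
      \<le> 2 * (integral {0..t} (\<lambda>s. norm (P (g s))))\<^sup>2 + 2 * (integral {0..t} (\<lambda>s. norm (Q (g s))))\<^sup>2"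
    by (rule order_trans[OF power_mono sq])
      (rule integral_nonneg[OF norm_Qg_integrable[OF bounded_linear_sub[OF Pb Qb] t]], simp)
  with 1 2 have "4 * (norm (P v1 - Q v1))\<^sup>2 + 4 * ((P a0 - Q a0) \<bullet> S (P a0 - Q a0)) +
      16 * (integral {0..t} (\<lambda>s. norm (P (g s) - Q (g s))))\<^sup>2 \<le>
    2 * (4 * (norm (P v1))\<^sup>2 + 4 * (P a0 \<bullet> S (P a0)) + 16 * (integral {0..t} (\<lambda>s. norm (P (g s))))\<^sup>2) +
    2 * (4 * (norm (Q v1))\<^sup>2 + 4 * (Q a0 \<bullet> S (Q a0)) + 16 * (integral {0..t} (\<lambda>s. norm (Q (g s))))\<^sup>2)"
    by (rule lin)
  from mult_left_mono[OF this exp_ge_zero[of "8 / (1 - \<kappa>) * t"]]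
  show ?thesis unfolding energy_bound_def by (simp only: ring_distribs mult.left_commute)
qed

text \<open>The equation is integrated in time and multiplied by \<open>S\<close>, since v'' need
  not exist in H. The sequence \<open>y\<close> presents \<open>v t\<close> as a limit of
  \<open>S (y m)\<close>: as \<open>y \<bullet> S y\<close> is the form of A at \<open>S y\<close>,
  the last two clauses are a bound and the Cauchy property in the energy norm, which will place
  \<open>v t\<close> in V.\<close>

theorem weak_solution:
  "\<exists>v w. continuous_on {0..T} w \<and> v 0 = S a0 \<and> w 0 = v1 \<and>
    (\<forall>t\<in>{0..T}. (v has_vector_derivative w t) (at t within {0..T})) \<and>
    (\<forall>t\<in>{0..T}. S (w t) = S v1 + integral {0..t} (\<lambda>s. S (g s) - (v s - conv K v s))) \<and>
    (\<forall>t\<in>{0..T}. norm (w t) \<le> energy_size t \<and>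
      (\<exists>y. (\<lambda>m. S (y m)) \<longlonglongrightarrow> v t \<and>
        (\<forall>m. y m \<bullet> S (y m) \<le> (energy_size t / (1 - \<kappa>))\<^sup>2) \<and>
        (\<forall>r>0. \<exists>N. \<forall>m\<ge>N. \<forall>k\<ge>N. (y m - y k) \<bullet> S (y m - y k) < r)))"
proof -
  define e :: "nat \<Rightarrow> real" where "e n = inverse (real (Suc n))" for n
  have e: "e n > 0" for n by (simp add: e_def)
  have e0: "e \<longlonglongrightarrow> 0" unfolding e_def by (rule LIMSEQ_inverse_real_of_nat)
  have se0: "(\<lambda>n. sqrt (e n)) \<longlonglongrightarrow> 0" using tendsto_real_sqrt[OF e0] by simp
  define R where "R k x = e k *\<^sub>R Y (e k) x" for k x
  have R_com: "commuting (R k)" for k unfolding R_def by (rule commuting_Yosida[OF e])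
  have R_blin: "bounded_linear (R k)" for k using R_com by (simp add: commuting_def)
  define \<beta> where "\<beta> k = energy_bound (R k) T" for k
  have \<beta>: "\<beta> \<longlonglongrightarrow> 0" unfolding \<beta>_def R_def by (rule energy_bound_Yosida_tendsto_0[OF e e0])
  have \<beta>_pos: "0 \<le> \<beta> k" for k unfolding \<beta>_def by (rule energy_bound_nonneg)
  obtain V W where VW: "\<And>n. approx (e n) (V n) (W n)" using approx_exists[OF e] by metis
  have W_cont: "continuous_on {0..T} (W n)" and V_cont: "continuous_on {0..T} (V n)" for n
    using approx_continuous[OF VW] by auto
  have RW: "norm (R k (W n t)) \<le> sqrt (\<beta> k)" if "t \<in> {0..T}" for k n t
    using approx_bound(1)[OF VW[of n] e R_com[of k] that] energy_bound_mono[OF R_blin[of k], of t T] that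
    by (intro real_le_rsqrt) (auto simp: \<beta>_def)
  obtain b where b: "b > 0" "\<And>x. (norm (S x))\<^sup>2 \<le> b * (S x \<bullet> x)" using norm_S_le_form by blast
  define C0 where "C0 = b * (exp (8 / (1 - \<kappa>) * T) * (16 * energy_bound (\<lambda>x. x) T * T))"
  have SW: "(norm (S (W n t - W m t)))\<^sup>2 \<le> C0 * sqrt (e n) + C0 * sqrt (e m)" if "t \<in> {0..T}" for n m t
  proof -
    have "b * (S (W n t - W m t) \<bullet> (W n t - W m t)) \<le>
        b * (exp (8 / (1 - \<kappa>) * T) * (16 * energy_bound (\<lambda>x. x) T * (sqrt (e n) + sqrt (e m)) * T))"
      using approx_difference[OF VW[of n] VW[of m] e e that] b(1) by (intro mult_left_mono) auto
    also have "\<dots> = C0 * sqrt (e n) + C0 * sqrt (e m)" unfolding C0_def by algebra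
    finally show ?thesis using b(2) order_trans by blast
  qed
  \<comment> \<open>Split a difference \<open>z\<close> into \<open>R k z\<close> and
    \<open>S (Y (e k) z)\<close>. The first is at most \<open>2 * sqrt (\<beta> k)\<close> for all
    approximations, so \<open>k\<close> is fixed first; the second is at most
    \<open>norm (S z) / e k\<close>, which \<open>SW\<close> makes small for large indices.\<close>
  have "uniformly_Cauchy_on {0..T} W"
  proof (rule uniformly_Cauchy_onI)
    fix r :: real assume r: "r > 0"
    have "(\<lambda>k. 2 * sqrt (\<beta> k)) \<longlonglongrightarrow> 2 * sqrt 0" by (intro tendsto_intros \<beta>)
    then have "\<forall>\<^sub>F k in sequentially. 2 * sqrt (\<beta> k) < r / 2" by (rule order_tendstoD(2)) (use r in simp)
    then obtain k where k: "2 * sqrt (\<beta> k) < r / 2" by (auto simp: eventually_sequentially)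
    define q where "q = (r / 2 * e k)\<^sup>2"
    have q: "q > 0" using r e[of k] by (simp add: q_def)
    have "(\<lambda>n. C0 * sqrt (e n)) \<longlonglongrightarrow> C0 * 0" by (intro tendsto_intros se0)
    then have "\<forall>\<^sub>F n in sequentially. C0 * sqrt (e n) < q / 2" by (rule order_tendstoD(2)) (use q in simp)
    then obtain N where N: "\<And>n. n \<ge> N \<Longrightarrow> C0 * sqrt (e n) < q / 2" unfolding eventually_sequentially by blast
    have "dist (W m t) (W n t) < r" if t: "t \<in> {0..T}" and mn: "m \<ge> N" "n \<ge> N" for t m n
    proof -
      define z where "z = W m t - W n t"
      have "(norm (S z))\<^sup>2 < (r / 2 * e k)\<^sup>2" using SW[OF t, of m n] N[OF mn(1)] N[OF mn(2)] by (simp add: z_def q_def)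
      then have "norm (S z) < r / 2 * e k" by (rule power_less_imp_less_base) (use r e[of k] in simp)
      moreover have "e k * norm (Y (e k) (S z)) \<le> norm (S z)" using norm_eY_le[OF e, of k "S z"] e[of k] by simp
      ultimately have "e k * norm (Y (e k) (S z)) < e k * (r / 2)" by (simp add: mult.commute)
      then have 1: "norm (S (Y (e k) z)) < r / 2" using e[of k] by (simp add: Y_S[OF e])
      have "R k z = R k (W m t) - R k (W n t)"
        unfolding z_def by (rule linear_diff[OF bounded_linear.linear[OF R_blin]])
      then have 2: "norm (R k z) < r / 2"
        using norm_triangle_ineq4[of "R k (W m t)" "R k (W n t)"] RW[OF t, of k m] RW[OF t, of k n] k by simp
      have "z = S (Y (e k) z) + R k z" unfolding R_def by (rule Y_eq[OF e, symmetric])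
      then have "norm z \<le> norm (S (Y (e k) z)) + norm (R k z)" by (metis norm_triangle_ineq)
      then show ?thesis using 1 2 by (simp add: z_def dist_norm)
    qed
    then show "\<exists>M. \<forall>t\<in>{0..T}. \<forall>m\<ge>M. \<forall>n\<ge>M. dist (W m t) (W n t) < r" by blast
  qed
  then obtain w where w: "uniform_limit {0..T} W w sequentially"
    using Cauchy_uniformly_convergent unfolding uniformly_convergent_on_def by blast
  have w_cont: "continuous_on {0..T} w"
    by (rule uniform_limit_theorem[OF _ w]) (use W_cont in auto)
  have Wlim: "(\<lambda>n. W n t) \<longlonglongrightarrow> w t" if "t \<in> {0..T}" for t by (rule tendsto_uniform_limitI[OF w that])
  define v where "v t = S a0 + integral {0..t} w" for t
  have v: "(v has_vector_derivative w t) (at t within {0..T})" if "t \<in> {0..T}" for t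
    unfolding v_def using integral_has_vector_derivative[OF w_cont that] by (auto intro!: derivative_eq_intros)
  have v_cont: "continuous_on {0..T} v"
    using v by (meson continuous_on_eq_continuous_within has_vector_derivative_continuous)
  have int0: "y integrable_on {0..t}" if "continuous_on {0..T} y" "t \<in> {0..T}" for y :: "real \<Rightarrow> 'h" and t
    by (rule integrable_continuous_interval, rule continuous_on_subset[OF that(1)]) (use that in auto)
  have FTC: "integral {0..t} y' = y t - y 0"
    if "\<And>s. s \<in> {0..T} \<Longrightarrow> (y has_vector_derivative y' s) (at s within {0..T})" "t \<in> {0..T}" for y y' :: "real \<Rightarrow> 'h" and t
    by (rule integral_unique, rule fundamental_theorem_of_calculus)
      (use that(2) in \<open>auto intro!: has_vector_derivative_within_subset[OF that(1)]\<close>)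
  have V_int: "V n t = S a0 + integral {0..t} (W n)" if "t \<in> {0..T}" for n t
    using FTC[of "V n" "W n" t] VW[of n] that by (simp add: approx_def)
  have V_lim: "uniform_limit {0..T} V v sequentially"
  proof (rule uniform_limitI)
    fix r :: real assume r: "r > 0"
    have "\<forall>\<^sub>F n in sequentially. \<forall>t\<in>{0..T}. dist (W n t) (w t) < r / (2 * T)"
      using w r T by (intro uniform_limitD) auto
    then show "\<forall>\<^sub>F n in sequentially. \<forall>t\<in>{0..T}. dist (V n t) (v t) < r"
    proof eventually_elim
      case (elim n)
      show ?case
      proof
        fix t assume t: "t \<in> {0..T}"
        have "norm (integral {0..t} (\<lambda>s. W n s - w s)) \<le> integral {0..t} (\<lambda>s. r / (2 * T))"
        proof (rule integral_norm_bound_integral)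
          show "(\<lambda>s. W n s - w s) integrable_on {0..t}" by (intro integrable_diff int0 W_cont w_cont t)
          show "norm (W n s - w s) \<le> r / (2 * T)" if "s \<in> {0..t}" for s
            using elim that t by (auto simp: dist_norm intro!: less_imp_le)
        qed (rule integrable_const_ivl)
        also have "\<dots> = t * (r / (2 * T))" using t by simp
        also have "\<dots> \<le> T * (r / (2 * T))" using t r T by (intro mult_right_mono) auto
        also have "\<dots> < r" using r T by simp
        finally show "dist (V n t) (v t) < r"
          by (simp add: V_int[OF t] v_def dist_norm integral_diff[OF int0[OF W_cont t] int0[OF w_cont t]])
      qed
    qed
  qed
  have Vlim: "(\<lambda>n. V n t) \<longlonglongrightarrow> v t" if "t \<in> {0..T}" for t by (rule tendsto_uniform_limitI[OF V_lim that])
  have conv_lim: "uniform_limit {0..T} (\<lambda>n. conv K (V n)) (conv K v) sequentially"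
  proof (rule uniform_limitI)
    fix r :: real assume r: "r > 0"
    have "\<forall>\<^sub>F n in sequentially. \<forall>t\<in>{0..T}. dist (V n t) (v t) < r"
      using V_lim r by (rule uniform_limitD)
    then show "\<forall>\<^sub>F n in sequentially. \<forall>t\<in>{0..T}. dist (conv K (V n) t) (conv K v t) < r"
    proof eventually_elim
      case (elim n)
      show ?case
      proof
        fix t assume t: "t \<in> {0..T}"
        have "norm (conv K (\<lambda>s. V n s - v s) t) \<le> \<kappa> * r"
        proof (rule conv_sup_le)
          show "continuous_on {0..t} (\<lambda>s. V n s - v s)"
            by (rule continuous_on_subset[of "{0..T}"]) (use t in \<open>auto intro!: continuous_intros V_cont v_cont\<close>)
          show "norm (V n s - v s) \<le> r" if "s \<in> {0..t}" for s
            using elim that t by (auto simp: dist_norm intro!: less_imp_le)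
        qed (use t in auto)
        also have "\<dots> < r" using \<kappa>_less_1 r by simp
        finally show "dist (conv K (V n) t) (conv K v t) < r"
          by (simp add: dist_norm conv_diff[OF K_cont V_cont v_cont t])
      qed
    qed
  qed
  have equation: "S (w t) = S v1 + integral {0..t} (\<lambda>s. S (g s) - (v s - conv K v s))" if t: "t \<in> {0..T}" for t
  proof -
    have Sg: "continuous_on {0..T} (\<lambda>s. S (g s))" by (intro S.continuous_on g_cont)
    define P where "P n s = V n s - conv K (V n) s" for n s
    have P_cont: "continuous_on {0..T} (P n)" for n
      unfolding P_def by (intro continuous_intros V_cont conv_continuous K_cont less_imp_le[OF T])
    have p_cont: "continuous_on {0..T} (\<lambda>s. v s - conv K v s)"
      by (intro continuous_intros v_cont conv_continuous K_cont less_imp_le[OF T])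
    \<comment> \<open>Applying \<open>S\<close> plus \<open>e n\<close> times the identity undoes
      the Yosida operator, so the potential term becomes exactly \<open>P n\<close>.\<close>
    have eqn: "S (W n t) + e n *\<^sub>R W n t
      = S v1 + e n *\<^sub>R v1 + (integral {0..t} (\<lambda>s. S (g s)) + e n *\<^sub>R integral {0..t} g - integral {0..t} (P n))" for n
    proof -
      have "integral {0..t} (\<lambda>s. (S (g s) + e n *\<^sub>R g s) - P n s) = (S (W n t) + e n *\<^sub>R W n t) - (S (W n 0) + e n *\<^sub>R W n 0)"
      proof (rule FTC[OF _ t])
        fix s assume s: "s \<in> {0..T}"
        have "(W n has_vector_derivative (g s - Y (e n) (P n s))) (at s within {0..T})"
          using VW[of n] s by (simp add: approx_def P_def)
        then have "((\<lambda>s. S (W n s) + e n *\<^sub>R W n s) has_vector_derivative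
            (S (g s - Y (e n) (P n s)) + e n *\<^sub>R (g s - Y (e n) (P n s)))) (at s within {0..T})"
          by (intro has_vector_derivative_add S.has_vector_derivative
              bounded_linear.has_vector_derivative[OF bounded_linear_scaleR_right])
        then show "((\<lambda>s. S (W n s) + e n *\<^sub>R W n s) has_vector_derivative ((S (g s) + e n *\<^sub>R g s) - P n s)) (at s within {0..T})"
          by (simp add: S.diff S_Y[OF e] algebra_simps)
      qed
      moreover have "integral {0..t} (\<lambda>s. (S (g s) + e n *\<^sub>R g s) - P n s)
          = integral {0..t} (\<lambda>s. S (g s)) + e n *\<^sub>R integral {0..t} g - integral {0..t} (P n)"
        by (simp add: integral_diff integral_add int0[OF Sg t] int0[OF g_cont t] int0[OF P_cont t] integrable_add integrable_cmul)
      moreover have "W n 0 = v1" using VW[of n] by (simp add: approx_def)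
      ultimately show ?thesis by (simp add: algebra_simps)
    qed
    have "uniform_limit {0..t} P (\<lambda>s. v s - conv K v s) sequentially"
      unfolding P_def
      by (rule uniform_limit_on_subset[OF uniform_limit_minus[OF V_lim conv_lim]]) (use t in auto)
    then have Pint: "(\<lambda>n. integral {0..t} (P n)) \<longlonglongrightarrow> integral {0..t} (\<lambda>s. v s - conv K v s)"
    proof (rule uniform_limit_integral)
      show "continuous_on {0..t} (P n)" for n
        by (rule continuous_on_subset[OF P_cont]) (use t in auto)
    next
      fix I J
      assume I: "\<And>n. (P n has_integral I n) {0..t}" "((\<lambda>s. v s - conv K v s) has_integral J) {0..t}" "I \<longlonglongrightarrow> J"
      then have "integral {0..t} (P n) = I n" for n by (intro integral_unique)
      then show ?thesis using I(2,3) by (simp add: integral_unique)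
    qed simp
    have "(\<lambda>n. S (W n t) + e n *\<^sub>R W n t) \<longlonglongrightarrow> S (w t) + 0 *\<^sub>R w t"
      by (intro tendsto_intros S.tendsto Wlim t e0)
    moreover have "(\<lambda>n. S v1 + e n *\<^sub>R v1 + (integral {0..t} (\<lambda>s. S (g s)) + e n *\<^sub>R integral {0..t} g - integral {0..t} (P n)))
      \<longlonglongrightarrow> S v1 + 0 *\<^sub>R v1 + (integral {0..t} (\<lambda>s. S (g s)) + 0 *\<^sub>R integral {0..t} g - integral {0..t} (\<lambda>s. v s - conv K v s))"
      by (intro tendsto_intros Pint e0)
    ultimately have "S (w t) + 0 *\<^sub>R w t = S v1 + 0 *\<^sub>R v1 +
        (integral {0..t} (\<lambda>s. S (g s)) + 0 *\<^sub>R integral {0..t} g - integral {0..t} (\<lambda>s. v s - conv K v s))"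
      unfolding eqn by (rule LIMSEQ_unique)
    then show ?thesis
      by (simp add: integral_diff[OF int0[OF Sg t] int0[OF p_cont t]])
  qed
  have Rw: "norm (R k (w t)) \<le> sqrt (\<beta> k)" if "t \<in> {0..T}" for k t
  proof (rule LIMSEQ_le_const2)
    show "(\<lambda>n. norm (R k (W n t))) \<longlonglongrightarrow> norm (R k (w t))"
      by (intro tendsto_norm bounded_linear.tendsto[OF R_blin] Wlim that)
  qed (use RW[OF that] in auto)
  \<comment> \<open>The high frequencies of \<open>v\<close> are obtained by integrating those of
    \<open>w\<close>.\<close>
  have Rv: "norm (R k (v t)) \<le> norm (R k (S a0)) + T * sqrt (\<beta> k)" if t: "t \<in> {0..T}" for k t
  proof -
    have "R k (v t) = R k (S a0) + integral {0..t} (\<lambda>s. R k (w s))"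
      unfolding v_def using integral_linear[OF int0[OF w_cont t] R_blin, of k]
      by (simp add: o_def linear_add[OF bounded_linear.linear[OF R_blin]])
    moreover have "norm (integral {0..t} (\<lambda>s. R k (w s))) \<le> integral {0..t} (\<lambda>s. sqrt (\<beta> k))"
    proof (rule integral_norm_bound_integral)
      show "(\<lambda>s. R k (w s)) integrable_on {0..t}"
        by (intro int0 bounded_linear.continuous_on[OF R_blin] w_cont t)
    qed (use Rw t in auto)
    moreover have "integral {0..t} (\<lambda>s. sqrt (\<beta> k)) \<le> T * sqrt (\<beta> k)" using t \<beta>_pos by (simp add: mult_right_mono)
    ultimately show ?thesis using norm_triangle_ineq[of "R k (S a0)" "integral {0..t} (\<lambda>s. R k (w s))"] by simp
  qed
  \<comment> \<open>The third bound of \<open>approx_bound\<close> in the limit, with the factor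
    \<open>S\<close> of \<open>Q\<close> divided out: for \<open>z n = P (V n t)\<close> the form in
    that bound is \<open>Y (e n) (S (z n)) \<bullet> S (z n)\<close>, which falls short of
    \<open>z n \<bullet> S (z n)\<close> by at most
    \<open>e n * (norm (z n))\<^sup>2\<close>.\<close>
  have form_bound: "y \<bullet> S y \<le> energy_bound Q t / (1 - \<kappa>)\<^sup>2"
    if Q: "commuting Q" and P: "bounded_linear P" "\<And>x. Q x = S (P x)" and y: "y = P (v t)" and t: "t \<in> {0..T}" for Q P y t
  proof (rule LIMSEQ_le)
    define z where "z n = P (V n t)" for n
    have z: "z \<longlonglongrightarrow> y" unfolding z_def y by (intro bounded_linear.tendsto[OF P(1)] Vlim t)
    show "(\<lambda>n. z n \<bullet> S (z n)) \<longlonglongrightarrow> y \<bullet> S y" by (intro tendsto_intros S.tendsto z)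
    have "(\<lambda>n. energy_bound Q t / (1 - \<kappa>)\<^sup>2 + e n * (norm (z n))\<^sup>2) \<longlonglongrightarrow> energy_bound Q t / (1 - \<kappa>)\<^sup>2 + 0 * (norm y)\<^sup>2"
      by (intro tendsto_intros z e0)
    then show "(\<lambda>n. energy_bound Q t / (1 - \<kappa>)\<^sup>2 + e n * (norm (z n))\<^sup>2) \<longlonglongrightarrow> energy_bound Q t / (1 - \<kappa>)\<^sup>2" by simp
    have "z n \<bullet> S (z n) \<le> energy_bound Q t / (1 - \<kappa>)\<^sup>2 + e n * (norm (z n))\<^sup>2" for n
    proof -
      have "z n \<bullet> S (z n) = (S (Y (e n) (z n)) + e n *\<^sub>R Y (e n) (z n)) \<bullet> S (z n)" by (simp only: Y_eq[OF e])
      also have "\<dots> = Y (e n) (S (z n)) \<bullet> S (z n) + e n * (S (Y (e n) (z n)) \<bullet> z n)"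
        by (simp add: inner_add_left Y_S[OF e] S_sym)
      also have "Y (e n) (S (z n)) \<bullet> S (z n) \<le> energy_bound Q t / (1 - \<kappa>)\<^sup>2"
        using approx_bound(3)[OF VW e Q t, of n] by (simp add: z_def P(2))
      also have "e n * (S (Y (e n) (z n)) \<bullet> z n) \<le> e n * (norm (z n))\<^sup>2"
      proof (rule mult_left_mono)
        have "S (Y (e n) (z n)) \<bullet> z n \<le> norm (S (Y (e n) (z n))) * norm (z n)" by (rule norm_cauchy_schwarz)
        also have "\<dots> \<le> norm (z n) * norm (z n)" by (intro mult_right_mono norm_SY_le e) auto
        finally show "S (Y (e n) (z n)) \<bullet> z n \<le> (norm (z n))\<^sup>2" by (simp add: power2_eq_square)
      qed (use e[of n] in simp)
      finally show ?thesis by simp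
    qed
    then show "\<exists>N. \<forall>n\<ge>N. z n \<bullet> S (z n) \<le> energy_bound Q t / (1 - \<kappa>)\<^sup>2 + e n * (norm (z n))\<^sup>2" by blast
  qed
  have final: "norm (w t) \<le> energy_size t \<and>
      (\<exists>y. (\<lambda>m. S (y m)) \<longlonglongrightarrow> v t \<and>
        (\<forall>m. y m \<bullet> S (y m) \<le> (energy_size t / (1 - \<kappa>))\<^sup>2) \<and>
        (\<forall>r>0. \<exists>N. \<forall>m\<ge>N. \<forall>k\<ge>N. (y m - y k) \<bullet> S (y m - y k) < r))" if t: "t \<in> {0..T}" for t
  proof -
    \<comment> \<open>\<open>S (y m)\<close> is \<open>v t\<close> without its high frequencies;
      what is missing is \<open>R m (v t)\<close>, which vanishes by \<open>Rv\<close>.\<close>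
    define y where "y m = Y (e m) (v t)" for m
    have f1: "norm (w t) \<le> energy_size t"
    proof (rule LIMSEQ_le_const2)
      show "(\<lambda>n. norm (W n t)) \<longlonglongrightarrow> norm (w t)" by (intro tendsto_norm Wlim t)
      have "norm (W n t) \<le> energy_size t" for n
      proof (rule power2_le_imp_le)
        show "(norm (W n t))\<^sup>2 \<le> (energy_size t)\<^sup>2"
          using approx_bound(1)[OF VW e commuting_id t, of n] energy_bound_le_size(1)[OF t] by linarith
      qed (rule energy_bound_le_size[OF t])
      then show "\<exists>N. \<forall>n\<ge>N. norm (W n t) \<le> energy_size t" by blast
    qed
    have "(\<lambda>m. R m (v t)) \<longlonglongrightarrow> 0"
    proof (rule Lim_null_comparison)
      show "\<forall>\<^sub>F m in sequentially. norm (R m (v t)) \<le> norm (R m (S a0)) + T * sqrt (\<beta> m)" using Rv[OF t] by simp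
      have "(\<lambda>m. norm (R m (S a0)) + T * sqrt (\<beta> m)) \<longlonglongrightarrow> norm (0 :: 'h) + T * sqrt 0"
        unfolding R_def by (intro tendsto_intros \<beta> eY_tendsto_0 e e0 subsetD[OF closure_subset rangeI])
      then show "(\<lambda>m. norm (R m (S a0)) + T * sqrt (\<beta> m)) \<longlonglongrightarrow> 0" by simp
    qed
    then have "(\<lambda>m. v t - R m (v t)) \<longlonglongrightarrow> v t - 0" by (intro tendsto_intros)
    moreover have "S (y m) = v t - R m (v t)" for m by (simp add: y_def R_def S_Y[OF e])
    ultimately have f2: "(\<lambda>m. S (y m)) \<longlonglongrightarrow> v t" by simp
    have f3: "y m \<bullet> S (y m) \<le> (energy_size t / (1 - \<kappa>))\<^sup>2" for m
    proof -
      have "y m \<bullet> S (y m) \<le> energy_bound (\<lambda>x. S (Y (e m) x)) t / (1 - \<kappa>)\<^sup>2"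
        by (rule form_bound[OF commuting_SY[OF e] Y_blin[OF e]]) (use t in \<open>auto simp: y_def\<close>)
      also have "\<dots> \<le> (energy_size t)\<^sup>2 / (1 - \<kappa>)\<^sup>2"
        using energy_bound_SY_le[OF e[of m] t] energy_bound_le_size(1)[OF t] by (intro divide_right_mono) auto
      finally show ?thesis by (simp add: power_divide)
    qed
    have tT: "energy_bound (R k) t \<le> \<beta> k" for k unfolding \<beta>_def by (rule energy_bound_mono[OF R_blin]) (use t in auto)
    \<comment> \<open>Here \<open>S (y m - y k)\<close> is \<open>R k - R m\<close> applied to
      \<open>v t\<close>, so only high-frequency data enter.\<close>
    have le: "(y m - y k) \<bullet> S (y m - y k) \<le> (2 * \<beta> k + 2 * \<beta> m) / (1 - \<kappa>)\<^sup>2" for m k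
    proof -
      have "(y m - y k) \<bullet> S (y m - y k) \<le> energy_bound (\<lambda>x. R k x - R m x) t / (1 - \<kappa>)\<^sup>2"
      proof (rule form_bound[OF commuting_diff[OF R_com R_com], where P = "\<lambda>x. Y (e m) x - Y (e k) x"])
        show "bounded_linear (\<lambda>x. Y (e m) x - Y (e k) x)" by (intro bounded_linear_sub Y_blin e)
        show "R k x - R m x = S (Y (e m) x - Y (e k) x)" for x by (simp add: R_def S.diff S_Y[OF e])
      qed (use t in \<open>auto simp: y_def\<close>)
      also have "\<dots> \<le> (2 * \<beta> k + 2 * \<beta> m) / (1 - \<kappa>)\<^sup>2"
        using energy_bound_diff_le[OF R_com[of k] R_com[of m] t] tT[of k] tT[of m] by (intro divide_right_mono) auto
      finally show ?thesis .
    qed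
    have f4: "\<exists>N. \<forall>m\<ge>N. \<forall>k\<ge>N. (y m - y k) \<bullet> S (y m - y k) < r" if r: "r > 0" for r
    proof -
    have "(\<lambda>k. 2 * \<beta> k / (1 - \<kappa>)\<^sup>2) \<longlonglongrightarrow> 2 * 0 / (1 - \<kappa>)\<^sup>2" by (intro tendsto_intros \<beta>) (use \<kappa>_less_1 in simp)
    then have "\<forall>\<^sub>F k in sequentially. 2 * \<beta> k / (1 - \<kappa>)\<^sup>2 < r / 2" by (rule order_tendstoD(2)) (use r in simp)
    then obtain N where N: "\<And>k. k \<ge> N \<Longrightarrow> 2 * \<beta> k / (1 - \<kappa>)\<^sup>2 < r / 2" unfolding eventually_sequentially by blast
    have "(y m - y k) \<bullet> S (y m - y k) < r" if "m \<ge> N" "k \<ge> N" for m k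
      using le[of m k] N[OF that(1)] N[OF that(2)] unfolding add_divide_distrib by linarith
    then show ?thesis by blast
    qed
    show ?thesis using f1 f2 f3 f4 by blast
  qed
  have "W n 0 = v1" for n using VW[of n] by (simp add: approx_def)
  then have "w 0 = v1" using Wlim[of 0] T by (simp add: LIMSEQ_const_iff)
  moreover have "v 0 = S a0" by (simp add: v_def)
  ultimately show ?thesis using w_cont v equation final by blast
qed

end

subsection \<open>Uniqueness\<close>

text \<open>Integrating once more lowers the energy by one time derivative: the velocity of the
  primitive \<open>Z\<close> is \<open>z\<close> itself, whose derivative is available, so testing
  with \<open>z\<close> is legitimate.\<close>

lemma weak_uniqueness:
  fixes S :: "'h::{real_inner,banach} \<Rightarrow> 'h"
  assumes "memory_kernel K \<kappa>" and "pos_operator S" and T: "T > 0"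
    and z: "\<And>t. t \<in> {0..T} \<Longrightarrow> (z has_vector_derivative z' t) (at t within {0..T})" "continuous_on {0..T} z'"
    and z0: "z 0 = 0"
    and eq: "\<And>t. t \<in> {0..T} \<Longrightarrow> S (z' t) = - integral {0..t} (\<lambda>s. z s - conv K z s)"
    and t: "t \<in> {0..T}"
  shows "z t = 0"
proof -
  interpret memory_kernel K \<kappa> by fact
  interpret pos_operator S by fact
  have z_cont: "continuous_on {0..T} z"
    using z(1) by (meson continuous_on_eq_continuous_within has_vector_derivative_continuous)
  define Z where "Z t = integral {0..t} z" for t
  have Z: "(Z has_vector_derivative z t) (at t within {0..T})" if "t \<in> {0..T}" for t
    unfolding Z_def by (rule integral_has_vector_derivative[OF z_cont that])
  have Z_cont: "continuous_on {0..T} Z"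
    using Z by (meson continuous_on_eq_continuous_within has_vector_derivative_continuous)
  have Z0: "Z 0 = 0" by (simp add: Z_def)
  \<comment> \<open>Integration commutes with the memory term because \<open>Z 0 = 0\<close>: the
    derivative of \<open>conv K Z\<close> is then \<open>conv K z\<close>.\<close>
  have SZ: "S (z' s) = - (Z s - conv K Z s)" if s: "s \<in> {0..T}" for s
  proof -
    have "((\<lambda>s. z s - conv K z s) has_integral (Z s - conv K Z s) - (Z 0 - conv K Z 0)) {0..s}"
    proof (rule fundamental_theorem_of_calculus)
      fix u assume u: "u \<in> {0..s}"
      then have uT: "u \<in> {0..T}" using s by auto
      have "(conv K Z has_vector_derivative K u *\<^sub>R Z 0 + conv K z u) (at u within {0..T})"
        by (rule conv_has_vector_derivative[OF K_cont z_cont Z uT])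
      then have "((\<lambda>s. Z s - conv K Z s) has_vector_derivative z u - conv K z u) (at u within {0..T})"
        using Z[OF uT] Z0 by (intro has_vector_derivative_diff) auto
      then show "((\<lambda>s. Z s - conv K Z s) has_vector_derivative z u - conv K z u) (at u within {0..s})"
        by (rule has_vector_derivative_within_subset) (use s in auto)
    qed (use s in auto)
    then show ?thesis using eq[OF s] Z0 by (simp add: integral_unique)
  qed
  have p0: "Z s - conv K Z s = 0" if s: "s \<in> {0..T}" for s
  proof -
    have "S (z s) \<bullet> z s / 2 + (Z s - conv K Z s) \<bullet> (Z s - conv K Z s) / 2 \<le>
      exp (8 / (1 - \<kappa>) * s) * (4 * (S (z 0) \<bullet> z 0 / 2 + Z 0 \<bullet> Z 0 / 2) + 4 * 0 * s + 4 * (integral {0..s} (\<lambda>_. 0))\<^sup>2)"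
    proof (rule energy_estimate[where B = "\<lambda>x. x" and \<rho> = "\<lambda>_. 0"])
      fix u assume u: "u \<in> {0..T}"
      show "(Z has_vector_derivative z u) (at u within {0..T})" by (rule Z[OF u])
      have "((\<lambda>s. S (z s) \<bullet> z s) has_derivative
          (\<lambda>h. S (z u) \<bullet> (h *\<^sub>R z' u) + S (h *\<^sub>R z' u) \<bullet> z u)) (at u within {0..T})"
        by (intro has_derivative_inner S.has_derivative z(1)[OF u, unfolded has_vector_derivative_def])
      then have "((\<lambda>s. S (z s) \<bullet> z s) has_derivative (\<lambda>h. (2 * (S (z' u) \<bullet> z u)) * h)) (at u within {0..T})"
        by (rule has_derivative_eq_rhs) (auto simp: S.scaleR S_sym[of "z u"] inner_commute[of "z u"] fun_eq_iff)
      then have "((\<lambda>s. S (z s) \<bullet> z s) has_real_derivative 2 * (S (z' u) \<bullet> z u)) (at u within {0..T})"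
        by (simp add: has_field_derivative_def mult_commute_abs)
      then have "((\<lambda>s. S (z s) \<bullet> z s / 2) has_real_derivative 2 * (S (z' u) \<bullet> z u) / 2) (at u within {0..T})"
        by (rule DERIV_cdivide)
      then show "((\<lambda>s. S (z s) \<bullet> z s / 2) has_real_derivative 0 - (Z u - conv K Z u) \<bullet> z u) (at u within {0..T})"
        unfolding SZ[OF u] by (simp only: inner_minus_left) simp
    qed (use z_cont S_pos s in auto)
    then have "S (z s) \<bullet> z s / 2 + (Z s - conv K Z s) \<bullet> (Z s - conv K Z s) / 2 \<le> 0"
      by (simp add: z0 Z0 S.zero)
    then have "(Z s - conv K Z s) \<bullet> (Z s - conv K Z s) \<le> 0" using S_pos[of "z s"] by linarith
    then show ?thesis by (metis inner_eq_zero_iff inner_ge_zero order_antisym)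
  qed
  have Zz: "Z s = 0" if s: "s \<in> {0..T}" for s
  proof -
    have "sqrt (Z s \<bullet> Z s) \<le> 0 / (1 - \<kappa>)"
      by (rule form_sup_le[where B = "\<lambda>x. x" and t = T]) (use Z_cont T p0 s in auto)
    then show ?thesis by (simp add: norm_eq_sqrt_inner[symmetric])
  qed
  have "((\<lambda>_. 0) has_vector_derivative z t) (at t within {0..T})"
    by (rule has_vector_derivative_transform[OF t _ Z[OF t]]) (use Zz in auto)
  moreover have "((\<lambda>_. 0) has_vector_derivative 0) (at t within {0..T})" by (rule has_vector_derivative_const)
  ultimately show ?thesis
    by (rule vector_derivative_unique_within[rotated]) (use t T in \<open>auto simp: trivial_limit_within islimpt_Icc\<close>)
qed

text \<open>A gauge argument, valid in every normed space. In a fine division the intervals tagged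
  in the exceptional null set lie in an open set of measure below \<open>\<delta>\<close> and are
  treated by absolute continuity; on the others the zero derivative at the tag makes the increment
  small relative to the length.\<close>

lemma abs_cont_imp_constant:
  fixes g :: "real \<Rightarrow> 'h::real_normed_vector"
  assumes ac: "abs_cont T g"
    and d: "AE t in lborel. t \<in> {0<..<T} \<longrightarrow> (g has_vector_derivative 0) (at t)"
    and \<tau>: "\<tau> \<in> {0..T}"
  shows "g \<tau> = g 0"
proof -
  define N where "N = {t \<in> {0..T}. \<not> (g has_vector_derivative 0) (at t)}"
  have "AE t in lebesgue. t \<in> {0<..<T} \<longrightarrow> (g has_vector_derivative 0) (at t)"
    by (rule AE_completion[OF d])
  then obtain N' where N': "N' \<in> null_sets lebesgue" "{t. \<not> (t \<in> {0<..<T} \<longrightarrow> (g has_vector_derivative 0) (at t))} \<subseteq> N'"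
    by (auto simp: eventually_ae_filter)
  have "negligible N'" using N'(1) by (simp add: negligible_iff_null_sets)
  then have "negligible (N' \<union> {0, T})" by (rule negligible_Un[OF _ negligible_finite]) auto
  moreover have "N \<subseteq> N' \<union> {0, T}"
  proof
    fix t assume "t \<in> N"
    then have t: "t \<in> {0..T}" "\<not> (g has_vector_derivative 0) (at t)" by (auto simp: N_def)
    show "t \<in> N' \<union> {0, T}"
    proof (cases "t = 0 \<or> t = T")
      case False
      then have "t \<in> {0<..<T}" using t(1) by auto
      then show ?thesis using t(2) N'(2) by blast
    qed auto
  qed
  ultimately have negN: "negligible N" using negligible_subset by blast
  have small: "norm (g \<tau> - g 0) \<le> \<epsilon> + \<epsilon> * \<tau>" if \<epsilon>: "\<epsilon> > 0" for \<epsilon>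
  proof -
    have "\<exists>\<delta>>0. \<forall>P. finite P \<and> (\<forall>(a, b)\<in>P. 0 \<le> a \<and> a \<le> b \<and> b \<le> T) \<and>
      disjoint_family_on (\<lambda>(a, b). {a<..<b}) P \<and> (\<Sum>(a, b)\<in>P. b - a) < \<delta> \<longrightarrow>
      (\<Sum>(a, b)\<in>P. norm (g b - g a)) < \<epsilon>"
      by (rule ac[unfolded abs_cont_def, rule_format, OF \<epsilon>])
    then obtain \<delta> where \<delta>: "\<delta> > 0" and ac1: "\<forall>P. finite P \<and> (\<forall>(a, b)\<in>P. 0 \<le> a \<and> a \<le> b \<and> b \<le> T) \<and>
      disjoint_family_on (\<lambda>(a, b). {a<..<b}) P \<and> (\<Sum>(a, b)\<in>P. b - a) < \<delta> \<longrightarrow>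
      (\<Sum>(a, b)\<in>P. norm (g b - g a)) < \<epsilon>"
      by (elim exE conjE)
    have ac': "(\<Sum>(a, b)\<in>P. norm (g b - g a)) < \<epsilon>"
      if "finite P" "\<forall>(a, b)\<in>P. 0 \<le> a \<and> a \<le> b \<and> b \<le> T" "disjoint_family_on (\<lambda>(a, b). {a<..<b}) P"
        "(\<Sum>(a, b)\<in>P. b - a) < \<delta>" for P
      by (rule ac1[THEN spec, THEN mp]) (intro conjI that)
    obtain U where U: "open U" "N \<subseteq> U" "U - N \<in> lmeasurable" "emeasure lebesgue (U - N) < ennreal \<delta>"
      by (rule sets_lebesgue_outer_open[OF fmeasurableD[OF negligible_imp_measurable[OF negN]] \<delta>])
    have Nnull: "N \<in> null_sets lebesgue" using negN by (simp add: negligible_iff_null_sets)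
    have U_meas: "U \<in> lmeasurable"
    proof -
      have "(U - N) \<union> N \<in> lmeasurable" using U(3) negligible_imp_measurable[OF negN] by (rule fmeasurable.Un)
      then show ?thesis using U(2) by (simp add: Un_absorb2)
    qed
    have U_small: "measure lebesgue U < \<delta>"
    proof -
      have "emeasure lebesgue U = emeasure lebesgue (U - N)"
        using U_meas Nnull by (intro emeasure_Diff_null_set[symmetric]) auto
      then have "ennreal (measure lebesgue U) < ennreal \<delta>"
        using U(4) emeasure_eq_measure2[OF U_meas] by simp
      then show ?thesis by (simp add: ennreal_less_iff)
    qed
    have "\<exists>d>0. \<forall>y. \<bar>y - x\<bar> < d \<longrightarrow> norm (g y - g x) \<le> \<epsilon> * \<bar>y - x\<bar>" if "x \<in> {0..T} - N" for x
    proof -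
      have "(g has_derivative (\<lambda>h. h *\<^sub>R 0)) (at x)" using that by (auto simp: N_def has_vector_derivative_def)
      then show ?thesis using \<epsilon> unfolding has_derivative_at_alt by auto
    qed
    then obtain d where d: "\<And>x. x \<in> {0..T} - N \<Longrightarrow> d x > 0"
      "\<And>x y. x \<in> {0..T} - N \<Longrightarrow> \<bar>y - x\<bar> < d x \<Longrightarrow> norm (g y - g x) \<le> \<epsilon> * \<bar>y - x\<bar>"
      by metis
    \<comment> \<open>Fineness puts intervals tagged in \<open>N\<close> into \<open>U\<close>, and
      those tagged elsewhere in \<open>{0..T}\<close> into a ball on which the increment estimate of
      \<open>d\<close> holds.\<close>
    define \<gamma> where "\<gamma> x = (if x \<in> N then U else if x \<in> {0..T} then ball x (d x) else UNIV)" for x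
    have "gauge \<gamma>" unfolding \<gamma>_def using U d(1) by (intro gaugeI) auto
    then obtain p where p: "p tagged_division_of {0..\<tau>}" "\<gamma> fine p" by (rule fine_division_exists_real)
    have fin: "finite p" using p(1) by blast
    have pk: "x \<in> k" "k = {Inf k..Sup k}" "Inf k \<le> Sup k" "0 \<le> Inf k" "Sup k \<le> T" "k \<subseteq> \<gamma> x" if xk: "(x, k) \<in> p" for x k
    proof -
      obtain a b where k: "k = {a..b}" using tagged_division_ofD(4)[OF p(1) xk] by auto
      show "x \<in> k" using tagged_division_ofD(2)[OF p(1) xk] .
      then have "a \<le> b" using k by auto
      then show "k = {Inf k..Sup k}" "Inf k \<le> Sup k" using k by auto
      have "k \<subseteq> {0..\<tau>}" using tagged_division_ofD(3)[OF p(1) xk] .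
      then show "0 \<le> Inf k" "Sup k \<le> T" using k \<open>a \<le> b\<close> \<tau> by auto
      show "k \<subseteq> \<gamma> x" using p(2) xk by (auto simp: fine_def)
    qed
    let ?i = "\<lambda>(x :: real, k). g (Sup k) - g (Inf k)"
    \<comment> \<open>Degenerate intervals contribute nothing and are left out, since injectivity of
      \<open>?e\<close> is read off from disjoint nonempty interiors.\<close>
    define bad where "bad = {(x, k) \<in> p. x \<in> N \<and> Inf k < Sup k}"
    define good where "good = {(x, k) \<in> p. x \<notin> N}"
    have sub: "bad \<subseteq> p" "good \<subseteq> p" by (auto simp: bad_def good_def)
    have good_le: "norm (?i q) \<le> \<epsilon> * measure lborel (snd q)" if q: "q \<in> good" for q
    proof -
      obtain x k where xk: "q = (x, k)" "(x, k) \<in> p" "x \<notin> N" using q by (auto simp: good_def)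
      note P = pk[OF xk(2)]
      have x: "x \<in> {0..T} - N" using P xk(3) by (metis DiffI atLeastAtMost_iff order_trans)
      have ball: "k \<subseteq> ball x (d x)" using P(6) x xk(3) by (simp add: \<gamma>_def)
      have "Inf k \<in> k" "Sup k \<in> k" using P(2,3) by (metis atLeastAtMost_iff order_refl)+
      then have "\<bar>Sup k - x\<bar> < d x" "\<bar>Inf k - x\<bar> < d x"
        using ball by (force simp: dist_real_def)+
      then have "norm (g (Sup k) - g x) \<le> \<epsilon> * \<bar>Sup k - x\<bar>" "norm (g (Inf k) - g x) \<le> \<epsilon> * \<bar>Inf k - x\<bar>"
        by (blast intro: d(2)[OF x])+
      moreover have "Inf k \<le> x" "x \<le> Sup k" using P(1,2) by (metis atLeastAtMost_iff)+
      moreover have "norm (g (Sup k) - g (Inf k)) \<le> norm (g (Sup k) - g x) + norm (g (Inf k) - g x)"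
        using norm_triangle_ineq4[of "g (Sup k) - g x" "g (Inf k) - g x"] by simp
      ultimately have "norm (g (Sup k) - g (Inf k)) \<le> \<epsilon> * (Sup k - x) + \<epsilon> * (x - Inf k)" by simp
      also have "\<dots> = \<epsilon> * measure lborel {Inf k..Sup k}" using P(3) by (simp add: algebra_simps)
      finally show ?thesis using xk(1) P(2) by simp
    qed
    have good_sum: "(\<Sum>q\<in>good. norm (?i q)) \<le> \<epsilon> * \<tau>"
    proof -
      have "(\<Sum>q\<in>good. norm (?i q)) \<le> (\<Sum>q\<in>good. \<epsilon> * measure lborel (snd q))" by (rule sum_mono) (rule good_le)
      also have "\<dots> \<le> (\<Sum>q\<in>p. \<epsilon> * measure lborel (snd q))"
        using \<epsilon> sub fin by (intro sum_mono2) auto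
      also have "\<dots> = \<epsilon> * (\<Sum>(x, k)\<in>p. measure lborel k)" by (simp add: sum_distrib_left case_prod_unfold)
      also have "(\<Sum>(x, k)\<in>p. measure lborel k) = measure lborel {0..\<tau>}"
        using additive_content_tagged_division[of p 0 \<tau>] p(1) by simp
      finally show ?thesis using \<tau> by simp
    qed
    let ?e = "\<lambda>(x :: real, k). (Inf k, Sup k :: real)"
    have disj: "{Inf k<..<Sup k} \<inter> {Inf k'<..<Sup k'} = {}"
      if "(x, k) \<in> p" "(x', k') \<in> p" "(x, k) \<noteq> (x', k')" for x k x' k'
    proof -
      have "interior k \<inter> interior k' = {}" using tagged_division_ofD(5)[OF p(1) that] .
      moreover have "interior k = {Inf k<..<Sup k}" "interior k' = {Inf k'<..<Sup k'}"
        using pk(2)[OF that(1)] pk(2)[OF that(2)] by (metis interior_atLeastAtMost_real)+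
      ultimately show ?thesis by simp
    qed
    have inj: "inj_on ?e bad"
    proof (rule inj_onI, clarify)
      fix x k x' k' assume b: "(x, k) \<in> bad" "(x', k') \<in> bad" and eq: "Inf k = Inf k'" "Sup k = Sup k'"
      have "{Inf k<..<Sup k} \<noteq> {}" using b by (auto simp: bad_def)
      then show "x = x' \<and> k = k'" using disj[of x k x' k'] b eq by (auto simp: bad_def)
    qed
    have bad_sum: "(\<Sum>q\<in>bad. norm (?i q)) < \<epsilon>"
    proof -
      have "(\<Sum>(a, b)\<in>?e ` bad. norm (g b - g a)) < \<epsilon>"
      proof (rule ac')
        show "finite (?e ` bad)" using fin sub finite_subset by blast
        show "\<forall>(a, b)\<in>?e ` bad. 0 \<le> a \<and> a \<le> b \<and> b \<le> T" using pk(3-5) by (auto simp: bad_def)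
        show "disjoint_family_on (\<lambda>(a, b). {a<..<b}) (?e ` bad)"
          unfolding disjoint_family_on_def
        proof (intro ballI impI)
          fix m n assume mn: "m \<in> ?e ` bad" "n \<in> ?e ` bad" "m \<noteq> n"
          obtain x k where m: "(x, k) \<in> bad" "m = (Inf k, Sup k)" using mn(1) by auto
          obtain x' k' where n: "(x', k') \<in> bad" "n = (Inf k', Sup k')" using mn(2) by auto
          have "{Inf k<..<Sup k} \<inter> {Inf k'<..<Sup k'} = {}"
            using m n mn(3) by (intro disj[of x k x' k']) (auto simp: bad_def)
          then show "(case m of (a, b) \<Rightarrow> {a<..<b}) \<inter> (case n of (a, b) \<Rightarrow> {a<..<b}) = {}"
            by (simp only: m(2) n(2) prod.case)
        qed
        have "(\<Sum>(a, b)\<in>?e ` bad. b - a) = (\<Sum>q\<in>bad. Sup (snd q) - Inf (snd q))"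
          by (subst sum.reindex[OF inj]) (auto intro!: sum.cong)
        also have "\<dots> = (\<Sum>q\<in>bad. measure lebesgue {Inf (snd q)<..<Sup (snd q)})"
          by (rule sum.cong) (auto simp: bad_def)
        also have "\<dots> = measure lebesgue (\<Union>q\<in>bad. {Inf (snd q)<..<Sup (snd q)})"
        proof (rule measure_finite_Union[symmetric])
          show "finite bad" using fin sub finite_subset by blast
          show "disjoint_family_on (\<lambda>q. {Inf (snd q)<..<Sup (snd q)}) bad"
            unfolding disjoint_family_on_def
          proof (intro ballI impI)
            fix m n assume mn: "m \<in> bad" "n \<in> bad" "m \<noteq> n"
            then show "{Inf (snd m)<..<Sup (snd m)} \<inter> {Inf (snd n)<..<Sup (snd n)} = {}"
              by (intro disj[of "fst m" "snd m" "fst n" "snd n"]) (auto simp: bad_def prod_eq_iff)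
          qed
        qed (auto simp: bad_def)
        also have "\<dots> \<le> measure lebesgue U"
        proof (rule measure_mono_fmeasurable[OF _ _ U_meas])
          show "(\<Union>q\<in>bad. {Inf (snd q)<..<Sup (snd q)}) \<subseteq> U"
          proof clarsimp
            fix x k y assume q: "(x, k) \<in> bad" and y: "Inf k < y" "y < Sup k"
            then have q': "(x, k) \<in> p" "x \<in> N" by (auto simp: bad_def)
            have "y \<in> k" using pk(2)[OF q'(1)] y by (metis atLeastAtMost_iff less_imp_le)
            then show "y \<in> U" using pk(6)[OF q'(1)] q'(2) by (auto simp: \<gamma>_def)
          qed
          show "(\<Union>q\<in>bad. {Inf (snd q)<..<Sup (snd q)}) \<in> sets lebesgue"
            by (intro sets.finite_UN) (use fin sub finite_subset in auto)
        qed
        finally show "(\<Sum>(a, b)\<in>?e ` bad. b - a) < \<delta>" using U_small by linarith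
      qed
      moreover have "(\<Sum>(a, b)\<in>?e ` bad. norm (g b - g a)) = (\<Sum>q\<in>bad. norm (?i q))"
        by (subst sum.reindex[OF inj]) (auto intro!: sum.cong)
      ultimately show ?thesis by simp
    qed
    have "g \<tau> - g 0 = (\<Sum>q\<in>p. ?i q)"
      using additive_tagged_division_1[OF _ p(1), of g] \<tau> by simp
    also have "\<dots> = (\<Sum>q\<in>bad \<union> good. ?i q)"
    proof (rule sum.mono_neutral_right[OF fin])
      show "\<forall>q\<in>p - (bad \<union> good). ?i q = 0"
      proof
        fix q assume q: "q \<in> p - (bad \<union> good)"
        obtain x k where xk: "q = (x, k)" by (cases q)
        then have "Inf k = Sup k" using pk(3)[of x k] q by (auto simp: bad_def good_def)
        then show "?i q = 0" by (simp add: xk)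
      qed
    qed (use sub in auto)
    also have "\<dots> = (\<Sum>q\<in>bad. ?i q) + (\<Sum>q\<in>good. ?i q)"
      by (rule sum.union_disjoint) (use fin sub finite_subset in \<open>auto simp: bad_def good_def\<close>)
    also have "norm \<dots> \<le> (\<Sum>q\<in>bad. norm (?i q)) + (\<Sum>q\<in>good. norm (?i q))"
      by (rule norm_triangle_le) (intro add_mono norm_sum)
    finally show ?thesis using good_sum bad_sum by linarith
  qed
  have "norm (g \<tau> - g 0) \<le> 0"
  proof (rule field_le_epsilon)
    fix r :: real assume r: "r > 0"
    have t: "1 + \<tau> > 0" using \<tau> by auto
    have "r / (1 + \<tau>) + r / (1 + \<tau>) * \<tau> = r / (1 + \<tau>) * (1 + \<tau>)" by (simp only: distrib_left mult_1_right)
    also have "\<dots> = r" using t by simp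
    finally show "norm (g \<tau> - g 0) \<le> 0 + r"
      using small[of "r / (1 + \<tau>)"] r t by simp
  qed
  then show ?thesis by simp
qed

subsection \<open>Test functions\<close>

lemma poly_exp_tendsto_0: "((\<lambda>x. x ^ k * poly p x / exp x) \<longlongrightarrow> (0::real)) at_top"
proof (induction p arbitrary: k)
  case (pCons a p)
  have "((\<lambda>x. a * (x ^ k / exp x) + x ^ Suc k * poly p x / exp x) \<longlongrightarrow> a * 0 + 0) at_top"
    by (intro tendsto_intros tendsto_power_div_exp_0 pCons)
  then show ?case by (simp add: field_simps)
qed simp

text \<open>The derivatives of $t \mapsto e^{-1/t}$ have this form with varying polynomial \<open>p\<close>.\<close>

definition flat :: "real poly \<Rightarrow> real \<Rightarrow> real" where
  "flat p t = (if t \<le> 0 then 0 else poly p (inverse t) / exp (inverse t))"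

text \<open>With \<open>s = 1 / t\<close>, differentiation in \<open>t\<close> is
  \<open>- s\<^sup>2\<close> times differentiation in \<open>s\<close>; on p(s) exp (- s) it
  produces the polynomial s^2 (p - p').\<close>

definition flat_pderiv :: "real poly \<Rightarrow> real poly" where
  "flat_pderiv p = [:0, 0, 1:] * (p - pderiv p)"

lemma flat_has_derivative: "(flat p has_real_derivative flat (flat_pderiv p) t) (at t)"
proof -
  consider "t > 0" | "t < 0" | "t = 0" by linarith
  then show ?thesis
  proof cases
    case 1
    have "((\<lambda>t. poly p (inverse t) / exp (inverse t)) has_real_derivative flat (flat_pderiv p) t) (at t)"
      using 1 by (auto intro!: derivative_eq_intros simp: flat_def flat_pderiv_def field_simps power2_eq_square)
    then show ?thesis
      by (rule has_field_derivative_transform_within_open[where S = "{0<..}"]) (use 1 in \<open>auto simp: flat_def\<close>)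
  next
    case 2
    have "((\<lambda>t. 0) has_real_derivative flat (flat_pderiv p) t) (at t)"
      using 2 by (auto simp: flat_def)
    then show ?thesis
      by (rule has_field_derivative_transform_within_open[where S = "{..<0}"]) (use 2 in \<open>auto simp: flat_def\<close>)
  next
    \<comment> \<open>Only the quotient from the right is nontrivial; in terms of
      \<open>x = 1 / y\<close> it is \<open>x * poly p x / exp x\<close>.\<close>
    case 3
    have "((\<lambda>y. (flat p y - flat p 0) / (y - 0)) \<longlongrightarrow> 0) (at 0)"
    proof (rule filterlim_split_at)
      show "((\<lambda>y. (flat p y - flat p 0) / (y - 0)) \<longlongrightarrow> 0) (at_left 0)"
        by (rule tendsto_eventually) (auto simp: eventually_at_filter flat_def)
      have "((\<lambda>x. (flat p (inverse x) - flat p 0) / (inverse x - 0)) \<longlongrightarrow> 0) at_top"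
      proof (rule Lim_transform_eventually[OF poly_exp_tendsto_0[of 1 p]])
        show "\<forall>\<^sub>F x in at_top. x ^ 1 * poly p x / exp x = (flat p (inverse x) - flat p 0) / (inverse x - 0)"
          using eventually_gt_at_top[of 0] by eventually_elim (auto simp: flat_def field_simps)
      qed
      then show "((\<lambda>y. (flat p y - flat p 0) / (y - 0)) \<longlongrightarrow> 0) (at_right 0)"
        by (simp add: filterlim_at_right_to_top)
    qed
    then show ?thesis using 3 by (simp add: has_field_derivative_iff flat_def)
  qed
qed

lemma frechet_derivative_eqI: "(f has_derivative f') (at x) \<Longrightarrow> frechet_derivative f (at x) = f'"
  using frechet_derivative_at by metis

lemma Ck_on_SucI:
  assumes "\<And>x. (f has_derivative f' x) (at x)" "\<And>b. b \<in> Basis \<Longrightarrow> Ck_on k UNIV (\<lambda>x. f' x b)"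
  shows "Ck_on (Suc k) UNIV f"
proof -
  have "frechet_derivative f (at x) = f' x" for x by (rule frechet_derivative_eqI[OF assms(1)])
  then show ?thesis using assms by (auto simp: differentiable_def)
qed

lemma Ck_on_const: "Ck_on k UNIV (\<lambda>x. c)"
  by (induction k arbitrary: c) (auto simp: frechet_derivative_eqI[OF has_derivative_const])

lemma Ck_on_Suc_imp: "Ck_on (Suc k) UNIV f \<Longrightarrow> Ck_on k UNIV f"
proof (induction k arbitrary: f)
  case 0
  then show ?case by (auto simp: continuous_at_imp_continuous_on differentiable_imp_continuous_within)
next
  case (Suc k)
  show ?case unfolding Ck_on.simps(2)[of k]
    using Suc.prems Suc.IH unfolding Ck_on.simps(2)[of "Suc k"] by blast
qed

lemma Ck_on_add:
  "Ck_on k UNIV f \<Longrightarrow> Ck_on k UNIV g \<Longrightarrow> Ck_on k UNIV (\<lambda>x. f x + g x)"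
proof (induction k arbitrary: f g)
  case (Suc k)
  show ?case
    by (rule Ck_on_SucI[where f' = "\<lambda>x h. frechet_derivative f (at x) h + frechet_derivative g (at x) h"])
      (use Suc in \<open>auto intro!: has_derivative_add frechet_derivative_works[THEN iffD1]\<close>)
qed (auto intro: continuous_intros)

lemma Ck_on_mult:
  fixes f g :: "'a::euclidean_space \<Rightarrow> real"
  shows "Ck_on k UNIV f \<Longrightarrow> Ck_on k UNIV g \<Longrightarrow> Ck_on k UNIV (\<lambda>x. f x * g x)"
proof (induction k arbitrary: f g)
  case (Suc k)
  note fg = Ck_on_Suc_imp[OF Suc.prems(1)] Ck_on_Suc_imp[OF Suc.prems(2)]
  show ?case
    by (rule Ck_on_SucI[where f' = "\<lambda>x h. f x * frechet_derivative g (at x) h + frechet_derivative f (at x) h * g x"])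
      (use Suc fg in \<open>auto intro!: has_derivative_mult frechet_derivative_works[THEN iffD1] Ck_on_add\<close>)
qed (auto intro: continuous_intros)

lemma Ck_on_prod:
  fixes f :: "'i \<Rightarrow> 'a::euclidean_space \<Rightarrow> real"
  assumes "finite I" "\<And>i. i \<in> I \<Longrightarrow> Ck_on k UNIV (f i)"
  shows "Ck_on k UNIV (\<lambda>x. \<Prod>i\<in>I. f i x)"
  using assms by (induction I rule: finite_induct) (auto intro: Ck_on_const Ck_on_mult)

text \<open>The factor \<open>c\<close> and the polynomial \<open>p\<close> are arbitrary so that
  the family is closed under partial derivatives, which carries the induction on
  \<open>k\<close>.\<close>

lemma Ck_on_flat_affine:
  fixes b :: "'a::euclidean_space"
  shows "Ck_on k UNIV (\<lambda>x. c * flat p (m * (x \<bullet> b) + d))"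
proof (induction k arbitrary: c p)
  case 0
  have "continuous_on UNIV (flat p)"
    using flat_has_derivative by (meson DERIV_continuous continuous_at_imp_continuous_on)
  then have "continuous_on UNIV (\<lambda>x. flat p (m * (x \<bullet> b) + d))"
    by (rule continuous_on_compose2) (intro continuous_intros, simp)
  then show ?case by (auto intro: continuous_intros)
next
  case (Suc k)
  show ?case
  proof (rule Ck_on_SucI[where f' = "\<lambda>x h. c * ((m * (h \<bullet> b)) * flat (flat_pderiv p) (m * (x \<bullet> b) + d))"])
    fix x
    show "((\<lambda>x. c * flat p (m * (x \<bullet> b) + d)) has_derivative
        (\<lambda>h. c * ((m * (h \<bullet> b)) * flat (flat_pderiv p) (m * (x \<bullet> b) + d)))) (at x)"
      by (intro has_derivative_mult_right DERIV_compose_FDERIV[OF flat_has_derivative])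
        (auto intro!: derivative_eq_intros)
  next
    fix e :: 'a
    have "(\<lambda>x. c * ((m * (e \<bullet> b)) * flat (flat_pderiv p) (m * (x \<bullet> b) + d)))
        = (\<lambda>x. (c * m * (e \<bullet> b)) * flat (flat_pderiv p) (m * (x \<bullet> b) + d))"
      by (auto simp: mult_ac)
    then show "Ck_on k UNIV (\<lambda>x. c * ((m * (e \<bullet> b)) * flat (flat_pderiv p) (m * (x \<bullet> b) + d)))"
      using Suc by simp
  qed
qed

text \<open>Smooth, with values in [0, 1], zero outside \<open>cbox a b\<close>, and tending
  pointwise to the indicator of \<open>box a b\<close> as \<open>m\<close> grows. The arguments are
  expanded to the shape of \<open>Ck_on_flat_affine\<close>.\<close>

definition bump :: "'a::euclidean_space \<Rightarrow> 'a \<Rightarrow> real \<Rightarrow> 'a \<Rightarrow> real" where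
  "bump a b m x = (\<Prod>i\<in>Basis. flat 1 (m * (x \<bullet> i) + - m * (a \<bullet> i)) * flat 1 (- m * (x \<bullet> i) + m * (b \<bullet> i)))"

lemma flat_1_bounds: "0 \<le> flat 1 t" "flat 1 t \<le> 1"
  by (auto simp: flat_def divide_le_eq_1)

lemma bump_bounds: "0 \<le> bump a b m x" "bump a b m x \<le> 1"
  unfolding bump_def by (auto intro!: prod_nonneg prod_le_1 mult_le_one mult_nonneg_nonneg flat_1_bounds)

lemma bump_eq_0:
  assumes "m > 0" "x \<notin> cbox a b"
  shows "bump a b m x = 0"
proof -
  obtain i where i: "i \<in> Basis" "x \<bullet> i < a \<bullet> i \<or> b \<bullet> i < x \<bullet> i" using assms(2) by (auto simp: mem_box not_le)
  then have "m * (x \<bullet> i) + - m * (a \<bullet> i) \<le> 0 \<or> - m * (x \<bullet> i) + m * (b \<bullet> i) \<le> 0"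
    using assms(1) by auto
  then have "flat 1 (m * (x \<bullet> i) + - m * (a \<bullet> i)) * flat 1 (- m * (x \<bullet> i) + m * (b \<bullet> i)) = 0"
    by (auto simp: flat_def)
  then show ?thesis unfolding bump_def using i(1) by (auto intro!: prod_zero)
qed

lemma test_function_bump:
  assumes "m > 0" "cbox a b \<subseteq> \<Omega>"
  shows "test_function \<Omega> (bump a b m)"
  unfolding test_function_def smooth_on_def
proof (intro conjI allI exI[of _ "cbox a b"] impI)
  show "Ck_on k UNIV (bump a b m)" for k
    unfolding bump_def
    by (intro Ck_on_prod Ck_on_mult finite_Basis Ck_on_flat_affine[where c = 1, unfolded mult_1])
qed (use assms bump_eq_0 in auto)

lemma bump_tendsto: "(\<lambda>n. bump a b (real (Suc n)) x) \<longlonglongrightarrow> indicator (box a b) x"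
proof -
  have lim: "(\<lambda>n. flat 1 (real (Suc n) * s)) \<longlonglongrightarrow> (if s > 0 then 1 else 0)" for s
  proof (cases "s > 0")
    case True
    have "(\<lambda>n. 1 / exp (inverse (real (Suc n)) * inverse s)) \<longlonglongrightarrow> 1 / exp (0 * inverse s)"
      by (intro tendsto_intros LIMSEQ_inverse_real_of_nat) simp
    then show ?thesis using True by (simp add: flat_def mult_le_0_iff not_le)
  next
    case False
    then show ?thesis by (simp add: flat_def mult_le_0_iff not_less)
  qed
  have eq: "bump a b (real (Suc n)) x = (\<Prod>i\<in>Basis. flat 1 (real (Suc n) * (x \<bullet> i - a \<bullet> i)) * flat 1 (real (Suc n) * (b \<bullet> i - x \<bullet> i)))" for n
    unfolding bump_def by (intro prod.cong refl arg_cong2[where f = "(*)"] arg_cong[where f = "flat 1"]) (auto simp: algebra_simps)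
  have "(\<lambda>n. bump a b (real (Suc n)) x) \<longlonglongrightarrow>
      (\<Prod>i\<in>Basis. (if x \<bullet> i - a \<bullet> i > 0 then 1 else 0) * (if b \<bullet> i - x \<bullet> i > 0 then 1 else 0))"
    unfolding eq by (intro tendsto_prod tendsto_mult lim)
  moreover have "(\<Prod>i\<in>Basis. (if x \<bullet> i - a \<bullet> i > 0 then 1 else 0) * (if b \<bullet> i - x \<bullet> i > 0 then 1 else 0)) = indicat_real (box a b) x"
  proof (cases "x \<in> box a b")
    case True
    then show ?thesis by (auto simp: mem_box intro!: prod.neutral)
  next
    case False
    then obtain i where "i \<in> Basis" "x \<bullet> i \<le> a \<bullet> i \<or> b \<bullet> i \<le> x \<bullet> i" by (auto simp: mem_box not_less)
    then show ?thesis using False by (auto intro!: prod_zero bexI[of _ i])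
  qed
  ultimately show ?thesis by simp
qed

subsection \<open>The fundamental lemma of the calculus of variations\<close>

text \<open>Dominated convergence along the bumps of the box, each of which is an admissible test
  function.\<close>

lemma set_integral_box_eq_0:
  fixes w :: "'a::euclidean_space \<Rightarrow> 'b::euclidean_space"
  assumes int: "set_integrable lborel (cbox a b) w" and sub: "cbox a b \<subseteq> \<Omega>"
    and zero: "\<And>\<phi> :: 'a \<Rightarrow> real. test_function \<Omega> \<phi> \<Longrightarrow> (LINT x:\<Omega>|lborel. \<phi> x *\<^sub>R w x) = 0"
  shows "(LINT x:box a b|lborel. w x) = 0"
proof -
  define F where "F n x = bump a b (real (Suc n)) x *\<^sub>R (indicator (cbox a b) x *\<^sub>R w x)" for n x
  have m: "(\<lambda>x. indicator (cbox a b) x *\<^sub>R w x) \<in> borel_measurable lborel"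
    using int by (auto simp: set_integrable_def)
  have meas_bump: "bump a b (real (Suc n)) \<in> borel_measurable borel" for n
  proof -
    have "Ck_on 0 UNIV (bump a b (real (Suc n)))"
      using test_function_bump[of "real (Suc n)" a b UNIV] by (auto simp: test_function_def smooth_on_def)
    then show ?thesis by (auto intro: borel_measurable_continuous_onI)
  qed
  have "(\<lambda>n. LINT x|lborel. F n x) \<longlonglongrightarrow> (LINT x|lborel. indicator (box a b) x *\<^sub>R w x)"
  proof (rule integral_dominated_convergence)
    show "integrable lborel (\<lambda>x. norm (indicator (cbox a b) x *\<^sub>R w x))"
      using int unfolding set_integrable_def by (rule integrable_norm)
    show "F n \<in> borel_measurable lborel" for n
      unfolding F_def by (rule borel_measurable_scaleR[OF _ m]) (use meas_bump[of n] in simp)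
    have box: "indicat_real (box a b) x *\<^sub>R (indicat_real (cbox a b) x *\<^sub>R w x) = indicator (box a b) x *\<^sub>R w x" for x
      using box_subset_cbox[of a b] by (cases "x \<in> box a b") auto
    then show "(\<lambda>x. indicat_real (box a b) x *\<^sub>R w x) \<in> borel_measurable lborel"
      using borel_measurable_scaleR[OF _ m, of "indicat_real (box a b)"] unfolding box by simp
    have "(\<lambda>n. F n x) \<longlonglongrightarrow> indicator (box a b) x *\<^sub>R w x" for x
    proof -
      have "(\<lambda>n. F n x) \<longlonglongrightarrow> indicat_real (box a b) x *\<^sub>R (indicator (cbox a b) x *\<^sub>R w x)"
        unfolding F_def by (intro tendsto_intros bump_tendsto)
      then show ?thesis by (simp only: box)
    qed
    then show "AE x in lborel. (\<lambda>n. F n x) \<longlonglongrightarrow> indicator (box a b) x *\<^sub>R w x" by simp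
    have "norm (F n x) \<le> norm (indicator (cbox a b) x *\<^sub>R w x)" for n x
      by (simp only: F_def norm_scaleR[of "bump a b _ x"] abs_of_nonneg[OF bump_bounds(1)]
          mult_left_le_one_le[OF norm_ge_zero bump_bounds])
    then show "AE x in lborel. norm (F n x) \<le> norm (indicator (cbox a b) x *\<^sub>R w x)" for n by simp
  qed
  moreover have "(LINT x|lborel. F n x) = 0" for n
  proof -
    have "F n x = indicator \<Omega> x *\<^sub>R (bump a b (real (Suc n)) x *\<^sub>R w x)" for x
      using bump_eq_0[of "real (Suc n)" x a b] sub by (auto simp: F_def indicator_def)
    then have "(LINT x|lborel. F n x) = (LINT x:\<Omega>|lborel. bump a b (real (Suc n)) x *\<^sub>R w x)"
      by (simp add: set_lebesgue_integral_def)
    also have "\<dots> = 0" by (rule zero[OF test_function_bump[OF _ sub]]) simp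
    finally show ?thesis .
  qed
  ultimately show ?thesis by (simp add: set_lebesgue_integral_def LIMSEQ_const_iff)
qed

lemma AE_zero_if_set_integrals_zero:
  fixes u :: "'a \<Rightarrow> real"
  assumes u: "integrable M u" and zero: "\<And>A. A \<in> sets M \<Longrightarrow> (LINT x:A|M. u x) = 0"
  shows "AE x in M. u x = 0"
proof -
  have pos: "AE x in M. u x \<le> 0" if u: "integrable M u" and zero: "\<And>A. A \<in> sets M \<Longrightarrow> (LINT x:A|M. u x) = 0"
    for u :: "'a \<Rightarrow> real"
  proof -
    define A where "A = {x \<in> space M. u x > 0}"
    have A: "A \<in> sets M" unfolding A_def using u by measurable
    have "(LINT x|M. indicator A x * u x) = 0" using zero[OF A] by (simp add: set_lebesgue_integral_def)
    moreover have "integrable M (\<lambda>x. indicator A x * u x)" using integrable_mult_indicator[OF A u] by simp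
    ultimately have "AE x in M. indicator A x * u x = 0"
      using integral_nonneg_eq_0_iff_AE[of M "\<lambda>x. indicator A x * u x"] by (auto simp: A_def indicator_def)
    then show ?thesis using AE_space by eventually_elim (auto simp: A_def indicator_def split: if_splits)
  qed
  have "AE x in M. - u x \<le> 0"
    by (rule pos) (use u zero in \<open>auto simp: set_lebesgue_integral_def\<close>)
  moreover have "AE x in M. u x \<le> 0" by (rule pos[OF u zero])
  ultimately show ?thesis by eventually_elim simp
qed

text \<open>A Dynkin argument: open boxes are an intersection-stable generator of the Borel sets,
  and the total integral serves the complements.\<close>

lemma AE_zero_if_box_integrals_zero:
  fixes u :: "'a::euclidean_space \<Rightarrow> real"
  assumes u: "integrable lborel u" and box: "\<And>a b. (LINT x:box a b|lborel. u x) = 0"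
    and univ: "(LINT x|lborel. u x) = 0"
  shows "AE x in lborel. u x = 0"
proof (rule AE_zero_if_set_integrals_zero[OF u])
  fix A :: "'a set" assume "A \<in> sets lborel"
  then have A: "A \<in> sigma_sets UNIV (range (\<lambda>(a, b). box a b))"
    by (simp add: borel_eq_box[where 'a = 'a])
  have stable: "Int_stable (range (\<lambda>(a, b). box a b :: 'a set))"
    unfolding Int_stable_def by (auto simp: box_Int_box)
  have subset_Pow: "range (\<lambda>(a, b). box a b :: 'a set) \<subseteq> Pow UNIV" by simp
  from stable subset_Pow A show "(LINT x:A|lborel. u x) = 0"
  proof (induction rule: sigma_sets_induct_disjoint)
    case (compl A)
    then have A: "A \<in> sets lborel" by (simp add: borel_eq_box[where 'a = 'a])
    have "(LINT x:UNIV - A|lborel. u x) = (LINT x|lborel. u x) - (LINT x:A|lborel. u x)"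
    proof -
      have "(LINT x:UNIV - A|lborel. u x) = (LINT x|lborel. u x - indicator A x *\<^sub>R u x)"
        unfolding set_lebesgue_integral_def by (rule Bochner_Integration.integral_cong) (auto simp: indicator_def)
      also have "\<dots> = (LINT x|lborel. u x) - (LINT x:A|lborel. u x)"
        unfolding set_lebesgue_integral_def
        by (rule Bochner_Integration.integral_diff[OF u integrable_mult_indicator[OF A u]])
      finally show ?thesis .
    qed
    then show ?case using compl univ by simp
  next
    case (union A)
    then have A: "A i \<in> sets lborel" for i by (auto simp: borel_eq_box[where 'a = 'a])
    have "(LINT x:(\<Union>i. A i)|lborel. u x) = (\<Sum>i. (LINT x:A i|lborel. u x))"
    proof (rule lebesgue_integral_countable_add[OF A])
      show "A i \<inter> A j = {}" if "i \<noteq> j" for i j using union(1) that by (auto simp: disjoint_family_on_def)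
      show "set_integrable lborel (\<Union>i. A i) u"
        unfolding set_integrable_def using A by (intro integrable_mult_indicator u) auto
    qed
    then show ?case using union by simp
  next
    case (basic A)
    then show ?case by (auto simp: box)
  next
    case empty
    show ?case by (simp add: set_lebesgue_integral_def)
  qed
qed

text \<open>Each component of \<open>w\<close> is cut off to an open box whose closure lies in
  \<open>\<Omega>\<close>; its integral over any box is then one over an intersection of boxes,
  where the bumps apply. Boundaries of boxes are null, and countably many closed boxes exhaust
  \<open>\<Omega>\<close>.\<close>

lemma fundamental_lemma:
  fixes w :: "'a::euclidean_space \<Rightarrow> 'b::euclidean_space"
  assumes \<Omega>: "open \<Omega>"
    and int: "\<And>a b. cbox a b \<subseteq> \<Omega> \<Longrightarrow> set_integrable lborel (cbox a b) w"
    and zero: "\<And>\<phi> :: 'a \<Rightarrow> real. test_function \<Omega> \<phi> \<Longrightarrow> (LINT x:\<Omega>|lborel. \<phi> x *\<^sub>R w x) = 0"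
  shows "AE x in lborel. x \<in> \<Omega> \<longrightarrow> w x = 0"
proof -
  have cb: "AE x in lborel. x \<in> cbox c d \<longrightarrow> w x = 0" if sub: "cbox c d \<subseteq> \<Omega>" for c d
  proof -
    have "AE x in lborel. \<forall>i\<in>Basis. indicator (box c d) x * (w x \<bullet> i) = 0"
      unfolding AE_ball_countable[OF countable_finite[OF finite_Basis]]
    proof
      fix i :: 'b assume i: "i \<in> Basis"
      define u where "u x = indicator (box c d) x * (w x \<bullet> i)" for x
      have box_int: "set_integrable lborel (box a b) w" if "cbox a b \<subseteq> \<Omega>" for a b
        by (rule set_integrable_subset[OF int[OF that]]) (auto simp: box_subset_cbox)
      have inner: "(LINT x|lborel. indicator (box a b) x * (w x \<bullet> i)) = (LINT x:box a b|lborel. w x) \<bullet> i"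
        if "cbox a b \<subseteq> \<Omega>" for a b
        unfolding set_lebesgue_integral_def
        using integral_inner_left[OF box_int[OF that, unfolded set_integrable_def], of i] by simp
      have zero': "(LINT x|lborel. indicator (box a b) x * (w x \<bullet> i)) = 0" if "cbox a b \<subseteq> \<Omega>" for a b
        using set_integral_box_eq_0[OF int[OF that] that zero] unfolding inner[OF that] by simp
      have u: "integrable lborel u"
        using integrable_inner_left[OF box_int[OF sub, unfolded set_integrable_def], of i]
        by (simp add: u_def[abs_def])
      show "AE x in lborel. indicator (box c d) x * (w x \<bullet> i) = 0"
        unfolding u_def[symmetric]
      proof (rule AE_zero_if_box_integrals_zero[OF u])
        show "(LINT x|lborel. u x) = 0" unfolding u_def by (rule zero'[OF sub])
        fix a b :: 'a
        define a' b' where "a' = (\<Sum>i\<in>Basis. max (a\<bullet>i) (c\<bullet>i) *\<^sub>R i)" and "b' = (\<Sum>i\<in>Basis. min (b\<bullet>i) (d\<bullet>i) *\<^sub>R i)"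
        have "cbox a' b' \<subseteq> cbox c d" unfolding a'_def b'_def Int_interval[symmetric] by simp
        then have "(LINT x|lborel. indicator (box a' b') x * (w x \<bullet> i)) = 0" using sub by (intro zero') auto
        moreover have "indicator (box a b) x *\<^sub>R u x = indicator (box a' b') x * (w x \<bullet> i)" for x
          unfolding u_def a'_def b'_def box_Int_box[symmetric] by (auto simp: indicator_def)
        ultimately show "(LINT x:box a b|lborel. u x) = 0" by (simp add: set_lebesgue_integral_def)
      qed
    qed
    moreover have "AE x in lborel. x \<notin> cbox c d - box c d"
    proof -
      have "cbox c d - box c d \<in> null_sets lebesgue"
        using negligible_frontier_interval[of c d] by (simp add: negligible_iff_null_sets)
      then have "cbox c d - box c d \<in> null_sets lborel"
        by (simp add: null_sets_completion_iff)
      then show ?thesis by (rule AE_not_in)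
    qed
    ultimately show ?thesis
    proof eventually_elim
      case (elim x)
      show ?case
      proof
        assume "x \<in> cbox c d"
        then have x: "x \<in> box c d" using elim(2) by blast
        show "w x = 0"
        proof (rule euclidean_eqI)
          fix i :: 'b assume "i \<in> Basis"
          from bspec[OF elim(1) this] x show "w x \<bullet> i = 0 \<bullet> i" by simp
        qed
      qed
    qed
  qed
  obtain D where D: "countable D" "\<And>X. X \<in> D \<Longrightarrow> \<exists>a b. X = cbox a b" "D \<subseteq> Pow \<Omega>" "\<Union>D = \<Omega>"
    using open_countable_Union_open_cbox[OF \<Omega>] by metis
  have "AE x in lborel. \<forall>X\<in>D. x \<in> X \<longrightarrow> w x = 0"
    unfolding AE_ball_countable[OF D(1)]
  proof
    fix X assume X: "X \<in> D"
    then obtain a b where ab: "X = cbox a b" using D(2) by blast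
    show "AE x in lborel. x \<in> X \<longrightarrow> w x = 0" unfolding ab by (rule cb) (use X ab D(3) in blast)
  qed
  then show ?thesis
  proof eventually_elim
    case (elim x)
    show ?case using elim D(4) by blast
  qed
qed

subsection \<open>Operators on a Hilbert space\<close>

lemma orthogonal_projection:
  fixes M :: "'h::{real_inner,banach} set"
  assumes M: "subspace M" "closed M"
  shows "\<exists>m\<in>M. \<forall>x\<in>M. (y - m) \<bullet> x = 0"
proof -
  define d where "d = (INF m\<in>M. (norm (y - m))\<^sup>2)"
  have ne: "M \<noteq> {}" using subspace_0[OF M(1)] by auto
  have bdd: "bdd_below ((\<lambda>m. (norm (y - m))\<^sup>2) ` M)" by (rule bdd_belowI[of _ 0]) auto
  have d_le: "d \<le> (norm (y - m))\<^sup>2" if "m \<in> M" for m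
    unfolding d_def by (rule cINF_lower[OF bdd that])
  have "\<exists>m\<in>M. (norm (y - m))\<^sup>2 < d + inverse (real (Suc n))" for n
  proof -
    have "d < d + inverse (real (Suc n))" by simp
    then show ?thesis using cINF_less_iff[OF ne bdd] unfolding d_def by blast
  qed
  then obtain m where m: "\<And>n. m n \<in> M" "\<And>n. (norm (y - m n))\<^sup>2 < d + inverse (real (Suc n))" by metis
  have par: "(norm (a - b))\<^sup>2 + 4 * d \<le> 2 * (norm (y - a))\<^sup>2 + 2 * (norm (y - b))\<^sup>2" if "a \<in> M" "b \<in> M" for a b
  proof -
    have "(1 / 2) *\<^sub>R (a + b) \<in> M" using that M(1) by (intro subspace_scale subspace_add)
    then have "d \<le> (norm (y - (1 / 2) *\<^sub>R (a + b)))\<^sup>2" by (rule d_le)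
    moreover have "(norm (a - b))\<^sup>2 + 4 * (norm (y - (1 / 2) *\<^sub>R (a + b)))\<^sup>2 = 2 * (norm (y - a))\<^sup>2 + 2 * (norm (y - b))\<^sup>2"
      by (simp add: power2_norm_eq_inner inner_diff_left inner_diff_right inner_add_left inner_add_right inner_commute algebra_simps)
    ultimately show ?thesis by linarith
  qed
  have "Cauchy m"
  proof (rule CauchyI)
    fix e :: real assume e: "e > 0"
    then obtain N where N: "inverse (real (Suc N)) < e\<^sup>2 / 4" using reals_Archimedean[of "e\<^sup>2 / 4"] by auto
    have "norm (m i - m j) < e" if "i \<ge> N" "j \<ge> N" for i j
    proof (rule power_less_imp_less_base)
      have "inverse (real (Suc i)) \<le> inverse (real (Suc N))" "inverse (real (Suc j)) \<le> inverse (real (Suc N))"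
        using that by (auto intro!: le_imp_inverse_le)
      then show "(norm (m i - m j))\<^sup>2 < e\<^sup>2"
        using par[OF m(1) m(1), of i j] m(2)[of i] m(2)[of j] N by linarith
    qed (use e in simp)
    then show "\<exists>N. \<forall>i\<ge>N. \<forall>j\<ge>N. norm (m i - m j) < e" by blast
  qed
  then obtain l where l: "m \<longlonglongrightarrow> l" by (metis Cauchy_convergent_iff convergent_def)
  have lM: "l \<in> M" using closed_sequentially[OF M(2) m(1) l] .
  have "(\<lambda>n. (norm (y - m n))\<^sup>2) \<longlonglongrightarrow> (norm (y - l))\<^sup>2" by (intro tendsto_intros l)
  moreover have "(\<lambda>n. d + inverse (real (Suc n))) \<longlonglongrightarrow> d + 0" by (intro tendsto_intros LIMSEQ_inverse_real_of_nat)
  moreover have "\<exists>N. \<forall>n\<ge>N. (norm (y - m n))\<^sup>2 \<le> d + inverse (real (Suc n))" using m(2) less_imp_le by blast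
  ultimately have "(norm (y - l))\<^sup>2 \<le> d + 0" by (rule LIMSEQ_le)
  then have ld: "(norm (y - l))\<^sup>2 \<le> d" by simp
  have "(y - l) \<bullet> x = 0" if x: "x \<in> M" for x
  proof (cases "x = 0")
    case False
    then have xx: "x \<bullet> x > 0" by simp
    define t where "t = ((y - l) \<bullet> x) / (x \<bullet> x)"
    have "l + t *\<^sub>R x \<in> M" using lM x M(1) by (intro subspace_add subspace_scale)
    then have "(norm (y - l))\<^sup>2 \<le> (norm (y - (l + t *\<^sub>R x)))\<^sup>2" using d_le ld order_trans by blast
    also have "\<dots> = (norm ((y - l) - t *\<^sub>R x))\<^sup>2" by (simp add: algebra_simps)
    also have "\<dots> = (norm (y - l))\<^sup>2 - 2 * t * ((y - l) \<bullet> x) + t\<^sup>2 * (x \<bullet> x)"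
      by (simp only: power2_norm_eq_inner inner_diff_left[of "y - l"] inner_diff_right[of _ "y - l"] inner_scaleR_left inner_scaleR_right inner_commute[of x "y - l"])
        (simp add: power2_eq_square algebra_simps)
    also have "\<dots> = (norm (y - l))\<^sup>2 - ((y - l) \<bullet> x)\<^sup>2 / (x \<bullet> x)"
      using xx by (simp add: t_def power2_eq_square field_simps)
    finally have "((y - l) \<bullet> x)\<^sup>2 / (x \<bullet> x) \<le> 0" by simp
    then show ?thesis using xx by (simp add: divide_le_0_iff)
  qed simp
  then show ?thesis using lM by blast
qed

text \<open>\<open>S\<close> is the inverse of \<open>A\<close>, extended by zero to the orthogonal complement of \<open>H\<close>.\<close>

lemma inverse_operator:
  fixes H D :: "'h::{real_inner,banach} set" and A :: "'h \<Rightarrow> 'h"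
  assumes H: "subspace H" "closed H" and sa: "self_adjoint_on H D A" and pd: "positive_definite_on D A"
  shows "\<exists>S. pos_operator S \<and> range S = D \<and> (\<forall>v\<in>D. S (A v) = v) \<and> (\<forall>x\<in>H. A (S x) = x)"
proof -
  have DH: "D \<subseteq> H" and Dsub: "subspace D" and AD: "\<And>v. v \<in> D \<Longrightarrow> A v \<in> H"
    and A_add: "\<And>v w. v \<in> D \<Longrightarrow> w \<in> D \<Longrightarrow> A (v + w) = A v + A w"
    and A_scaleR: "\<And>c v. v \<in> D \<Longrightarrow> A (c *\<^sub>R v) = c *\<^sub>R A v"
    and A_sym: "\<And>v w. v \<in> D \<Longrightarrow> w \<in> D \<Longrightarrow> A v \<bullet> w = v \<bullet> A w"
    and A_max: "\<And>w z. w \<in> H \<Longrightarrow> z \<in> H \<Longrightarrow> (\<And>v. v \<in> D \<Longrightarrow> A v \<bullet> w = v \<bullet> z) \<Longrightarrow> w \<in> D \<and> A w = z"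
    using sa unfolding self_adjoint_on_def by blast+
  obtain c where c: "c > 0" "\<And>v. v \<in> D \<Longrightarrow> c * (norm v)\<^sup>2 \<le> A v \<bullet> v"
    using pd unfolding positive_definite_on_def by blast
  have A_diff: "A (v - w) = A v - A w" if "v \<in> D" "w \<in> D" for v w
    using A_add[OF that(1), of "(-1) *\<^sub>R w"] A_scaleR[OF that(2), of "-1"] subspace_scale[OF Dsub that(2), of "-1"] by simp
  have A_bound: "c * norm v \<le> norm (A v)" if "v \<in> D" for v
  proof -
    have "(c * norm v) * norm v \<le> norm (A v) * norm v"
      using c(2)[OF that] norm_cauchy_schwarz[of "A v" v] by (simp add: power2_eq_square)
    then show ?thesis by (cases "norm v = 0") auto
  qed
  have A_inj: "v = w" if "v \<in> D" "w \<in> D" "A v = A w" for v w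
    using A_bound[of "v - w"] A_diff[OF that(1,2)] that c(1) subspace_diff[OF Dsub that(1,2)]
    by (simp add: mult_le_0_iff)
  have R_sub: "subspace (A ` D)"
    unfolding subspace_def
  proof (intro conjI ballI allI)
    show "0 \<in> A ` D" using A_scaleR[of 0 0] subspace_0[OF Dsub] by (force simp: image_iff)
    show "x + y \<in> A ` D" if "x \<in> A ` D" "y \<in> A ` D" for x y
      using that by (auto simp: A_add[symmetric] intro!: imageI subspace_add[OF Dsub])
    show "r *\<^sub>R x \<in> A ` D" if "x \<in> A ` D" for r x
      using that by (auto simp: A_scaleR[symmetric] intro!: imageI subspace_scale[OF Dsub])
  qed
  \<comment> \<open>\<open>A\<close> is bounded below, so preimages of a convergent sequence
    converge, and maximality of a self-adjoint operator keeps the limit in the graph.\<close>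
  have R_closed: "closed (A ` D)"
    unfolding closed_sequential_limits
  proof (intro allI impI, elim conjE)
    fix X l assume X: "\<forall>n. X n \<in> A ` D" and l: "X \<longlonglongrightarrow> l"
    have "\<forall>n. \<exists>v. v \<in> D \<and> X n = A v" using X by blast
    then obtain v where v: "\<And>n. v n \<in> D" "\<And>n. X n = A (v n)" by metis
    have "Cauchy v"
    proof (rule metric_CauchyI)
      fix e :: real assume e: "e > 0"
      then have "c * e > 0" using c(1) by simp
      then obtain N where N: "\<And>i j. i \<ge> N \<Longrightarrow> j \<ge> N \<Longrightarrow> dist (X i) (X j) < c * e"
        using LIMSEQ_imp_Cauchy[OF l] unfolding Cauchy_def by blast
      have "dist (v i) (v j) < e" if "i \<ge> N" "j \<ge> N" for i j
      proof -
        have "c * norm (v i - v j) \<le> norm (X i - X j)"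
          using A_bound[OF subspace_diff[OF Dsub v(1)[of i] v(1)[of j]]] A_diff[OF v(1)[of i] v(1)[of j]] v(2) by simp
        then have "c * norm (v i - v j) < c * e" using N[OF that] by (simp add: dist_norm)
        then show ?thesis using c(1) by (simp add: dist_norm)
      qed
      then show "\<exists>N. \<forall>i\<ge>N. \<forall>j\<ge>N. dist (v i) (v j) < e" by blast
    qed
    then obtain w where w: "v \<longlonglongrightarrow> w" by (metis Cauchy_convergent_iff convergent_def)
    have "w \<in> H" by (rule closed_sequentially[OF H(2) _ w]) (use v(1) DH in auto)
    moreover have "l \<in> H" by (rule closed_sequentially[OF H(2) _ l]) (use v AD in auto)
    moreover have "A u \<bullet> w = u \<bullet> l" if u: "u \<in> D" for u
    proof (rule LIMSEQ_unique)
      show "(\<lambda>n. A u \<bullet> v n) \<longlonglongrightarrow> A u \<bullet> w" by (intro tendsto_intros w)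
      have "(\<lambda>n. u \<bullet> X n) \<longlonglongrightarrow> u \<bullet> l" by (intro tendsto_intros l)
      then show "(\<lambda>n. A u \<bullet> v n) \<longlonglongrightarrow> u \<bullet> l" using A_sym[OF u v(1)] v(2) by simp
    qed
    ultimately have "w \<in> D \<and> A w = l" by (rule A_max)
    then show "l \<in> A ` D" by blast
  qed
  \<comment> \<open>The residual of the projection onto the range is orthogonal to the range; by
    self-adjointness it lies in \<open>D\<close> and is annihilated by the injective
    \<open>A\<close>.\<close>
  have surj: "\<exists>v\<in>D. A v = x" if x: "x \<in> H" for x
  proof -
    obtain m where m: "m \<in> A ` D" "\<And>z. z \<in> A ` D \<Longrightarrow> (x - m) \<bullet> z = 0"
      using orthogonal_projection[OF R_sub R_closed] by blast
    have mH: "m \<in> H" using m(1) AD by blast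
    have "x - m \<in> D \<and> A (x - m) = 0"
    proof (rule A_max)
      show "x - m \<in> H" using subspace_diff[OF H(1) x mH] .
      show "0 \<in> H" by (rule subspace_0[OF H(1)])
      show "A v \<bullet> (x - m) = v \<bullet> 0" if "v \<in> D" for v using m(2) that by (simp add: inner_commute)
    qed
    then have "x - m = 0" using A_inj[of "x - m" 0] A_scaleR[of 0 0] subspace_0[OF Dsub] by simp
    then show ?thesis using m(1) by auto
  qed
  \<comment> \<open>\<open>P\<close> is the orthogonal projection onto \<open>H\<close>, and
    \<open>S\<close> will be the inverse of \<open>A\<close> after \<open>P\<close>, which is
    defined everywhere and still symmetric.\<close>
  have proj: "\<exists>m. m \<in> H \<and> (\<forall>x\<in>H. (y - m) \<bullet> x = 0)" for y using orthogonal_projection[OF H] by blast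
  then obtain P where P: "\<And>y. P y \<in> H" "\<And>y x. x \<in> H \<Longrightarrow> (y - P y) \<bullet> x = 0" by metis
  have P_eq: "P y = m" if "m \<in> H" "\<And>x. x \<in> H \<Longrightarrow> (y - m) \<bullet> x = 0" for y m
  proof -
    have "P y - m \<in> H" using subspace_diff[OF H(1) P(1) that(1)] .
    then have "(y - m) \<bullet> (P y - m) - (y - P y) \<bullet> (P y - m) = 0" using that(2) P(2) by simp
    then have "(P y - m) \<bullet> (P y - m) = 0" by (simp only: inner_diff_left[symmetric]) simp
    then show ?thesis by simp
  qed
  define S where "S y = (SOME v. v \<in> D \<and> A v = P y)" for y
  have S: "S y \<in> D" "A (S y) = P y" for y
  proof -
    have "\<exists>v. v \<in> D \<and> A v = P y" using surj[OF P(1)] by blast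
    from someI_ex[OF this] show "S y \<in> D" "A (S y) = P y" by (auto simp: S_def)
  qed
  have S_eq: "S y = v" if "v \<in> D" "A v = P y" for y v
    by (rule A_inj) (use S that in auto)
  have P_H: "P y = y" if "y \<in> H" for y by (rule P_eq) (use that in auto)
  have inner_P: "P y \<bullet> x = y \<bullet> x" if "x \<in> H" for x y
    using P(2)[OF that, of y] by (simp add: inner_diff_left)
  have SH: "S y \<in> H" for y using S(1) DH by blast
  have S_sym: "S x \<bullet> y = x \<bullet> S y" for x y
  proof -
    have "S x \<bullet> y = P y \<bullet> S x" using inner_P[OF SH, of y x] by (simp add: inner_commute)
    also have "\<dots> = S y \<bullet> A (S x)" using A_sym[OF S(1) S(1), of y x] S(2) by simp
    also have "\<dots> = P x \<bullet> S y" by (simp add: S(2) inner_commute)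
    also have "\<dots> = x \<bullet> S y" by (rule inner_P[OF SH])
    finally show ?thesis .
  qed
  have S_form: "S x \<bullet> x = A (S x) \<bullet> S x" for x
    using inner_P[OF SH, of x x] by (simp add: S(2) inner_commute)
  have "bounded_linear S"
  proof (rule bounded_linear_intro[where K = "1 / c"])
    show "S (x + y) = S x + S y" for x y
    proof (rule S_eq)
      have "P (x + y) = P x + P y"
      proof (rule P_eq)
        show "P x + P y \<in> H" using subspace_add[OF H(1) P(1) P(1)] .
        show "(x + y - (P x + P y)) \<bullet> z = 0" if "z \<in> H" for z
          using P(2)[OF that, of x] P(2)[OF that, of y] by (simp add: inner_diff_left inner_add_left)
      qed
      then show "A (S x + S y) = P (x + y)" using A_add[OF S(1) S(1)] S(2) by simp
    qed (use S(1) subspace_add[OF Dsub] in auto)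
    show "S (r *\<^sub>R x) = r *\<^sub>R S x" for r x
    proof (rule S_eq)
      have "P (r *\<^sub>R x) = r *\<^sub>R P x"
      proof (rule P_eq)
        show "r *\<^sub>R P x \<in> H" using subspace_scale[OF H(1) P(1)] .
        show "(r *\<^sub>R x - r *\<^sub>R P x) \<bullet> z = 0" if "z \<in> H" for z
          using P(2)[OF that, of x] by (simp add: inner_diff_left)
      qed
      then show "A (r *\<^sub>R S x) = P (r *\<^sub>R x)" using A_scaleR[OF S(1)] S(2) by simp
    qed (use S(1) subspace_scale[OF Dsub] in auto)
    show "norm (S x) \<le> norm x * (1 / c)" for x
    proof -
      have "c * (norm (S x))\<^sup>2 \<le> S x \<bullet> x" using c(2)[OF S(1)] S_form by simp
      also have "\<dots> \<le> norm (S x) * norm x" by (rule norm_cauchy_schwarz)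
      finally have "(c * norm (S x)) * norm (S x) \<le> norm x * norm (S x)" by (simp add: power2_eq_square mult_ac)
      then have "c * norm (S x) \<le> norm x" by (cases "norm (S x) = 0") auto
      then show ?thesis using c(1) by (simp add: field_simps)
    qed
  qed
  moreover have "0 \<le> S x \<bullet> x" for x
  proof -
    have "0 \<le> c * (norm (S x))\<^sup>2" using c(1) by simp
    also have "\<dots> \<le> S x \<bullet> x" using c(2)[OF S(1)] S_form by simp
    finally show ?thesis .
  qed
  ultimately have "pos_operator S" using S_sym by (simp add: pos_operator_def)
  moreover have SA: "S (A v) = v" if "v \<in> D" for v
    by (rule S_eq[OF that]) (simp add: P_H AD that)
  moreover have "range S = D" using S(1) SA by (metis image_subset_iff rangeI subsetI subset_antisym)
  moreover have "A (S x) = x" if "x \<in> H" for x using S(2) P_H[OF that] by simp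
  ultimately show ?thesis by blast
qed

text \<open>An operator that is symmetric for the weaker inner product \<open>S x \<bullet> y\<close> is bounded for it, with
  the same bound (Krein): otherwise the weak norms of its iterates would grow too fast.\<close>

lemma (in pos_operator) weakly_symmetric_bound:
  assumes TH: "\<And>x. x \<in> H \<Longrightarrow> T x \<in> H" and C: "C > 0" and bound: "\<And>x. x \<in> H \<Longrightarrow> norm (T x) \<le> C * norm x"
    and sym: "\<And>x y. x \<in> H \<Longrightarrow> y \<in> H \<Longrightarrow> S (T x) \<bullet> y = S x \<bullet> T y" and x: "x \<in> H"
  shows "S (T x) \<bullet> x \<le> C * (S x \<bullet> x)"
proof -
  define y where "y n = (T ^^ n) x" for n
  have y_Suc: "y (Suc n) = T (y n)" for n by (simp add: y_def)
  have yH: "y n \<in> H" for n by (induction n) (auto simp: y_def x TH)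
  define q where "q n = sqrt (S (y n) \<bullet> y n)" for n
  have q0: "q n \<ge> 0" for n by (simp add: q_def S_pos)
  have q2: "q n * q n = S (y n) \<bullet> y n" for n by (simp add: q_def S_pos)
  have CS: "S (y m) \<bullet> y n \<le> q m * q n" for m n
    unfolding q_def using form_Cauchy_Schwarz[OF S_blin S_sym S_pos, of "y m" "y n"] by linarith
  \<comment> \<open>Log-convexity of \<open>q\<close>: quotients of consecutive terms do not
    decrease. A first quotient \<open>r > C\<close> would force growth like \<open>r ^ n\<close>,
    while the norm bound allows only \<open>C ^ n\<close>.\<close>
  have logconv: "q (Suc n) * q (Suc n) \<le> q n * q (Suc (Suc n))" for n
  proof -
    have "q (Suc n) * q (Suc n) = S (T (y n)) \<bullet> y (Suc n)" by (simp add: q2 y_Suc)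
    also have "\<dots> = S (y n) \<bullet> y (Suc (Suc n))" by (simp add: sym yH y_Suc TH)
    also have "\<dots> \<le> q n * q (Suc (Suc n))" by (rule CS)
    finally show ?thesis .
  qed
  have main: "q 1 \<le> C * q 0"
  proof (rule ccontr)
    assume "\<not> q 1 \<le> C * q 0"
    then have less: "C * q 0 < q 1" by simp
    have q1: "q 1 > 0" using less q0[of 0] C by (meson le_less_trans mult_nonneg_nonneg less_imp_le)
    have q00: "q 0 > 0"
    proof (rule ccontr)
      assume "\<not> q 0 > 0"
      then have "q 0 = 0" using q0[of 0] by simp
      then show False using logconv[of 0] q1 by (simp add: mult_le_0_iff)
    qed
    define r where "r = q 1 / q 0"
    have r: "r > C" using less q00 by (simp add: r_def field_simps)
    have step: "q n > 0 \<and> r * q n \<le> q (Suc n)" for n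
    proof (induction n)
      case 0
      then show ?case using q00 by (simp add: r_def)
    next
      case (Suc n)
      have r0: "r > 0" using r C by simp
      have pos: "q (Suc n) > 0" using Suc r0 by (meson less_le_trans mult_pos_pos)
      have "(r * q (Suc n)) * q n \<le> q (Suc n) * q (Suc n)"
        using mult_right_mono[of "r * q n" "q (Suc n)" "q (Suc n)"] Suc pos by (simp add: mult_ac)
      also have "\<dots> \<le> q (Suc (Suc n)) * q n" using logconv[of n] by (simp add: mult.commute)
      finally show ?case using Suc pos by simp
    qed
    have lower: "r ^ n * q 0 \<le> q n" for n
    proof (induction n)
      case (Suc n)
      have "r * (r ^ n * q 0) \<le> r * q n" using Suc r C by (intro mult_left_mono) auto
      then show ?case using step[of n] by (simp add: mult_ac)
    qed simp
    have norm_y: "norm (y n) \<le> C ^ n * norm x" for n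
    proof (induction n)
      case (Suc n)
      have "norm (y (Suc n)) \<le> C * norm (y n)" unfolding y_Suc by (rule bound[OF yH])
      also have "\<dots> \<le> C * (C ^ n * norm x)" using Suc C by (intro mult_left_mono) auto
      finally show ?case by (simp add: mult_ac)
    qed (simp add: y_def)
    obtain b where b: "b > 0" "\<And>x. norm (S x) \<le> norm x * b" using S.pos_bounded by blast
    have upper: "q n \<le> sqrt b * (C ^ n * norm x)" for n
    proof -
      have "S (y n) \<bullet> y n \<le> norm (S (y n)) * norm (y n)" by (rule norm_cauchy_schwarz)
      also have "\<dots> \<le> (norm (y n) * b) * norm (y n)" by (intro mult_right_mono b) auto
      finally have "q n \<le> sqrt (b * (norm (y n))\<^sup>2)" unfolding q_def by (simp add: power2_eq_square mult_ac)
      also have "\<dots> = sqrt b * norm (y n)" by (simp add: real_sqrt_mult)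
      also have "\<dots> \<le> sqrt b * (C ^ n * norm x)" using b norm_y by (intro mult_left_mono) auto
      finally show ?thesis .
    qed
    have "(r / C) ^ n \<le> sqrt b * norm x / q 0" for n
    proof -
      have "r ^ n * q 0 \<le> (sqrt b * norm x) * C ^ n" using lower[of n] upper[of n] by (simp add: mult_ac)
      then show ?thesis using q00 C by (simp add: power_divide field_simps)
    qed
    moreover obtain n where "sqrt b * norm x / q 0 < (r / C) ^ n"
      using real_arch_pow[of "r / C" "sqrt b * norm x / q 0"] r C by auto
    ultimately show False by (meson not_less)
  qed
  have "S (T x) \<bullet> x \<le> q 1 * q 0" using CS[of 1 0] by (simp add: y_def)
  also have "\<dots> \<le> (C * q 0) * q 0" using main q0 by (intro mult_right_mono) auto
  also have "\<dots> = C * (S x \<bullet> x)" using q2[of 0] by (simp add: y_def)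
  finally show ?thesis .
qed

subsection \<open>Fields on a domain\<close>

lemma sq_integrable_compact_support:
  fixes g :: "'a::euclidean_space \<Rightarrow> 'a"
  assumes "continuous_on UNIV g" "compact S" "\<And>x. x \<notin> S \<Longrightarrow> g x = 0"
  shows "sq_integrable g"
  unfolding sq_integrable_def
proof
  show "g \<in> borel_measurable borel" using assms(1) by (rule borel_measurable_continuous_onI)
  have "continuous_on S (\<lambda>x. (norm (g x))\<^sup>2)"
    by (intro continuous_intros continuous_on_subset[OF assms(1)]) simp
  then have "integrable lborel (\<lambda>x. indicator S x *\<^sub>R (norm (g x))\<^sup>2)"
    by (rule borel_integrable_compact[OF assms(2)])
  moreover have "indicator S x *\<^sub>R (norm (g x))\<^sup>2 = (norm (g x))\<^sup>2" for x
    using assms(3)[of x] by (cases "x \<in> S") auto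
  ultimately show "integrable lborel (\<lambda>x. (norm (g x))\<^sup>2)" by (simp only:)
qed

lemma inner_abs_L2:
  assumes g: "sq_integrable g"
  shows "v \<bullet> abs_L2 g = (LINT x|lborel. rep_L2 v x \<bullet> g x)"
  unfolding inner_L2_def
proof (rule integral_cong_AE)
  show "AE x in lborel. rep_L2 v x \<bullet> rep_L2 (abs_L2 g) x = rep_L2 v x \<bullet> g x"
    using rep_abs_L2[OF g] by eventually_elim simp
qed (use sq_integrable_measurable[OF sq_integrable_rep] sq_integrable_measurable[OF g] in \<open>auto intro!: borel_measurable_inner\<close>)

lemma inner_abs_abs_L2:
  assumes "sq_integrable f" "sq_integrable g"
  shows "abs_L2 f \<bullet> abs_L2 g = (LINT x|lborel. f x \<bullet> g x)"
  unfolding inner_abs_L2[OF assms(2)]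
proof (rule integral_cong_AE)
  show "AE x in lborel. rep_L2 (abs_L2 f) x \<bullet> g x = f x \<bullet> g x"
    using rep_abs_L2[OF assms(1)] by eventually_elim simp
qed (use sq_integrable_measurable[OF sq_integrable_rep] assms[THEN sq_integrable_measurable] in \<open>auto intro!: borel_measurable_inner\<close>)

lemma test_function_continuous: "test_function \<Omega> \<phi> \<Longrightarrow> continuous_on UNIV \<phi>"
  unfolding test_function_def smooth_on_def by (metis Ck_on.simps(1))

lemma test_function_has_derivative:
  "test_function \<Omega> \<phi> \<Longrightarrow> (\<phi> has_derivative frechet_derivative \<phi> (at x)) (at x)"
  unfolding test_function_def smooth_on_def using Ck_on.simps(2)[of 0 UNIV \<phi>]
  by (metis UNIV_I frechet_derivative_works)

lemma test_function_support:
  assumes "test_function \<Omega> \<phi>"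
  shows "\<exists>S. compact S \<and> S \<subseteq> \<Omega> \<and> (\<forall>x. x \<notin> S \<longrightarrow> \<phi> x = 0)"
  using assms unfolding test_function_def by blast

lemma test_function_sq_integrable:
  fixes \<phi> :: "'a::euclidean_space \<Rightarrow> 'a"
  assumes "test_function \<Omega> \<phi>" shows "sq_integrable \<phi>"
  using test_function_support[OF assms] sq_integrable_compact_support[OF test_function_continuous[OF assms]] by metis

lemma test_function_partial:
  assumes \<phi>: "test_function \<Omega> \<phi>" and b: "b \<in> Basis"
  shows "test_function \<Omega> (partial_deriv b \<phi>)"
proof -
  obtain S where S: "compact S" "S \<subseteq> \<Omega>" "\<And>x. x \<notin> S \<Longrightarrow> \<phi> x = 0" using test_function_support[OF \<phi>] by blast
  have "partial_deriv b \<phi> x = 0" if "x \<notin> S" for x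
  proof -
    have "(\<phi> has_derivative (\<lambda>h. 0)) (at x)"
      by (rule has_derivative_transform_within_open[OF has_derivative_const[of 0], of "- S"])
        (use S that compact_imp_closed in auto)
    then show ?thesis by (simp add: frechet_derivative_eqI)
  qed
  moreover have "smooth_on UNIV (partial_deriv b \<phi>)"
    using \<phi> b Ck_on.simps(2) unfolding test_function_def smooth_on_def by blast
  ultimately show ?thesis using S unfolding test_function_def by blast
qed

lemma Ck_on_inner: "Ck_on k UNIV f \<Longrightarrow> Ck_on k UNIV (\<lambda>x. f x \<bullet> j)"
proof (induction k arbitrary: f)
  case (Suc k)
  show ?case
    by (rule Ck_on_SucI[where f' = "\<lambda>x h. frechet_derivative f (at x) h \<bullet> j"])
      (use Suc in \<open>auto intro!: has_derivative_inner_left frechet_derivative_works[THEN iffD1]\<close>)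
qed (auto intro: continuous_intros)

lemma test_function_inner:
  assumes "test_function \<Omega> \<phi>"
  shows "test_function \<Omega> (\<lambda>x. \<phi> x \<bullet> j)"
    and "partial_deriv b (\<lambda>x. \<phi> x \<bullet> j) = (\<lambda>x. partial_deriv b \<phi> x \<bullet> j)"
proof -
  show "test_function \<Omega> (\<lambda>x. \<phi> x \<bullet> j)"
    using assms unfolding test_function_def smooth_on_def by (auto intro: Ck_on_inner)
  show "partial_deriv b (\<lambda>x. \<phi> x \<bullet> j) = (\<lambda>x. partial_deriv b \<phi> x \<bullet> j)"
    using frechet_derivative_eqI[OF has_derivative_inner_left[OF test_function_has_derivative[OF assms]]] by auto
qed

lemma test_function_mult:
  fixes \<phi> \<psi> :: "'a::euclidean_space \<Rightarrow> real"
  assumes "test_function \<Omega> \<phi>" "test_function \<Omega> \<psi>"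
  shows "test_function \<Omega> (\<lambda>x. \<phi> x * \<psi> x)"
    and "partial_deriv b (\<lambda>x. \<phi> x * \<psi> x) = (\<lambda>x. \<phi> x * partial_deriv b \<psi> x + partial_deriv b \<phi> x * \<psi> x)"
proof -
  show "test_function \<Omega> (\<lambda>x. \<phi> x * \<psi> x)"
    using assms unfolding test_function_def smooth_on_def by (auto intro!: Ck_on_mult)
  show "partial_deriv b (\<lambda>x. \<phi> x * \<psi> x) = (\<lambda>x. \<phi> x * partial_deriv b \<psi> x + partial_deriv b \<phi> x * \<psi> x)"
    using frechet_derivative_eqI[OF has_derivative_mult[OF test_function_has_derivative[OF assms(1)] test_function_has_derivative[OF assms(2)]]]
    by auto
qed

text \<open>Difference quotients have integral 0 by translation invariance, and dominated
  convergence lets the step tend to 0.\<close>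

lemma integral_partial_deriv_eq_0:
  fixes f :: "'a::euclidean_space \<Rightarrow> real"
  assumes f: "test_function \<Omega> f" and b: "b \<in> Basis"
  shows "(LINT x|lborel. partial_deriv b f x) = 0"
proof -
  obtain S where "compact S" "S \<subseteq> \<Omega>" and S0: "\<And>x. x \<notin> S \<Longrightarrow> f x = 0" using test_function_support[OF f] by blast
  note S = \<open>compact S\<close> S0
  note cf = test_function_continuous[OF f]
  note cd = test_function_continuous[OF test_function_partial[OF f b]]
  define h where "h n = inverse (real (Suc n))" for n
  have h: "h n > 0" "h n \<le> 1" for n by (auto simp: h_def inverse_le_1_iff)
  have h0: "h \<longlonglongrightarrow> 0" unfolding h_def by (rule LIMSEQ_inverse_real_of_nat)
  define D where "D n x = (f (x + h n *\<^sub>R b) - f x) / h n" for n x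
  \<comment> \<open>The points from which a step of length at most 1 along \<open>b\<close> reaches
    \<open>S\<close>; outside this compact set every difference quotient vanishes.\<close>
  define S' where "S' = (\<lambda>(x, t). x - t *\<^sub>R b) ` (S \<times> {0..1})"
  have "compact S'"
    unfolding S'_def by (rule compact_continuous_image) (auto intro!: compact_Times S continuous_intros simp: split_def)
  have supp: "f (x + t *\<^sub>R b) = 0" if "x \<notin> S'" "t \<in> {0..1}" for x t
  proof (rule S(2))
    show "x + t *\<^sub>R b \<notin> S"
    proof
      assume "x + t *\<^sub>R b \<in> S"
      then have "(\<lambda>(x, t). x - t *\<^sub>R b) (x + t *\<^sub>R b, t) \<in> S'" unfolding S'_def using that by blast
      then show False using that by simp
    qed
  qed
  \<comment> \<open>Large enough to contain the intermediate points of the mean value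
    theorem.\<close>
  define S'' where "S'' = (\<lambda>(x, t). x + t *\<^sub>R b) ` (S' \<times> {0..1})"
  have "compact S''"
    unfolding S''_def by (rule compact_continuous_image) (auto intro!: compact_Times \<open>compact S'\<close> continuous_intros simp: split_def)
  then have "bounded (partial_deriv b f ` S'')"
    by (intro compact_imp_bounded compact_continuous_image continuous_on_subset[OF cd]) auto
  then obtain M where M: "\<And>x. x \<in> S'' \<Longrightarrow> \<bar>partial_deriv b f x\<bar> \<le> M" by (auto simp: bounded_iff)
  have line: "((\<lambda>t. f (x + t *\<^sub>R b)) has_real_derivative partial_deriv b f (x + t *\<^sub>R b)) (at t)" for x t
  proof -
    have "((\<lambda>t. x + t *\<^sub>R b) has_derivative (\<lambda>s. s *\<^sub>R b)) (at t)"
      by (auto intro!: derivative_eq_intros)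
    from diff_chain_at[OF this test_function_has_derivative[OF f]]
    have "((\<lambda>t. f (x + t *\<^sub>R b)) has_derivative (\<lambda>s. frechet_derivative f (at (x + t *\<^sub>R b)) (s *\<^sub>R b))) (at t)"
      by (simp add: o_def)
    then show ?thesis
      unfolding has_field_derivative_def
      by (rule has_derivative_eq_rhs)
        (simp add: fun_eq_iff linear_cmul[OF has_derivative_linear[OF test_function_has_derivative[OF f]]])
  qed
  have bound: "\<bar>D n x\<bar> \<le> M * indicator S' x" for n x
  proof (cases "x \<in> S'")
    case True
    have "\<exists>z. z > 0 \<and> z < h n \<and> f (x + h n *\<^sub>R b) - f (x + 0 *\<^sub>R b) = (h n - 0) * partial_deriv b f (x + z *\<^sub>R b)"
      by (rule MVT2[OF h(1)]) (use line in auto)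
    then obtain z where z: "z > 0" "z < h n" "f (x + h n *\<^sub>R b) - f x = h n * partial_deriv b f (x + z *\<^sub>R b)" by auto
    then have "D n x = partial_deriv b f (x + z *\<^sub>R b)" using h(1)[of n] by (simp add: D_def)
    moreover have "(\<lambda>(x, t). x + t *\<^sub>R b) (x, z) \<in> S''"
      unfolding S''_def using True z h(2)[of n] by (intro imageI) auto
    ultimately show ?thesis using M True by simp
  next
    case False
    then have "D n x = 0" using supp[OF False, of 0] supp[OF False, of "h n"] h[of n] by (simp add: D_def)
    then show ?thesis using False by simp
  qed
  have int_f: "integrable lborel f"
  proof -
    have "integrable lborel (\<lambda>x. indicator S x *\<^sub>R f x)"
      by (rule borel_integrable_compact[OF S(1)]) (rule continuous_on_subset[OF cf], simp)
    moreover have "indicator S x *\<^sub>R f x = f x" for x using S(2)[of x] by (cases "x \<in> S") auto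
    ultimately show ?thesis by (simp only:)
  qed
  have shift: "integrable lborel (\<lambda>x. f (x + c))" "(LINT x|lborel. f (x + c)) = (LINT x|lborel. f x)" for c
  proof -
    have m: "(+) c \<in> measurable lborel borel" by simp
    have fm: "f \<in> borel_measurable borel" using cf by (rule borel_measurable_continuous_onI)
    have "integrable (distr lborel borel ((+) c)) f" using int_f by (simp add: lborel_distr_plus)
    then show "integrable lborel (\<lambda>x. f (x + c))" using fm by (simp add: integrable_distr_eq add.commute)
    have "(LINT x|distr lborel borel ((+) c). f x) = (LINT x|lborel. f (c + x))"
      by (rule integral_distr) (use fm in auto)
    then show "(LINT x|lborel. f (x + c)) = (LINT x|lborel. f x)" by (simp add: lborel_distr_plus add.commute)
  qed
  have D0: "(LINT x|lborel. D n x) = 0" for n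
    unfolding D_def using shift[of "h n *\<^sub>R b"] int_f by simp
  have "(\<lambda>n. LINT x|lborel. D n x) \<longlonglongrightarrow> (LINT x|lborel. partial_deriv b f x)"
  proof (rule integral_dominated_convergence)
    show "partial_deriv b f \<in> borel_measurable lborel"
      using borel_measurable_continuous_onI[OF cd] by simp
    show "D n \<in> borel_measurable lborel" for n
      unfolding D_def using shift(1)[of "h n *\<^sub>R b"] int_f by (intro borel_measurable_divide borel_measurable_diff) auto
    have "S' \<in> sets lborel" using compact_imp_closed[OF \<open>compact S'\<close>] by simp
    moreover have "emeasure lborel S' < \<infinity>" by (rule emeasure_bounded_finite[OF compact_imp_bounded[OF \<open>compact S'\<close>]])
    ultimately show "integrable lborel (\<lambda>x. M * indicator S' x)" by (intro integrable_mult_right) auto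
    show "AE x in lborel. norm (D n x) \<le> M * indicator S' x" for n using bound by simp
    have "(\<lambda>n. D n x) \<longlonglongrightarrow> partial_deriv b f x" for x
    proof -
      have "((\<lambda>t. (f (x + t *\<^sub>R b) - f x) / t) \<longlongrightarrow> partial_deriv b f x) (at 0)"
        using line[of x 0] by (simp add: has_field_derivative_iff)
      moreover have "filterlim h (at 0) sequentially"
        unfolding filterlim_at using h0 h(1) by (auto simp: less_imp_neq[symmetric])
      ultimately show ?thesis unfolding D_def by (rule filterlim_compose)
    qed
    then show "AE x in lborel. (\<lambda>n. D n x) \<longlonglongrightarrow> partial_deriv b f x" by simp
  qed
  then show ?thesis by (simp add: D0 LIMSEQ_const_iff)
qed

lemma L2_on_zero: "0 \<in> L2_on \<Omega>"
  using rep_L2_zero by (auto simp: L2_on_def)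

lemma L2_on_add: "v \<in> L2_on \<Omega> \<Longrightarrow> w \<in> L2_on \<Omega> \<Longrightarrow> v + w \<in> L2_on \<Omega>"
  unfolding L2_on_def mem_Collect_eq
proof -
  assume "AE x in lborel. x \<notin> \<Omega> \<longrightarrow> rep_L2 v x = 0" "AE x in lborel. x \<notin> \<Omega> \<longrightarrow> rep_L2 w x = 0"
  with rep_L2_add[of v w] show "AE x in lborel. x \<notin> \<Omega> \<longrightarrow> rep_L2 (v + w) x = 0" by eventually_elim simp
qed

lemma L2_on_scaleR: "v \<in> L2_on \<Omega> \<Longrightarrow> c *\<^sub>R v \<in> L2_on \<Omega>"
  unfolding L2_on_def mem_Collect_eq
proof -
  assume "AE x in lborel. x \<notin> \<Omega> \<longrightarrow> rep_L2 v x = 0"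
  with rep_L2_scaleR[of c v] show "AE x in lborel. x \<notin> \<Omega> \<longrightarrow> rep_L2 (c *\<^sub>R v) x = 0" by eventually_elim simp
qed

lemma subspace_L2_on: "subspace (L2_on \<Omega>)"
  unfolding subspace_def using L2_on_zero L2_on_add L2_on_scaleR by blast

lemma L2_on_diff: "v \<in> L2_on \<Omega> \<Longrightarrow> w \<in> L2_on \<Omega> \<Longrightarrow> v - w \<in> L2_on \<Omega>"
  by (rule subspace_diff[OF subspace_L2_on])

lemma abs_L2_on: "sq_integrable g \<Longrightarrow> (\<And>x. x \<notin> \<Omega> \<Longrightarrow> g x = 0) \<Longrightarrow> abs_L2 g \<in> L2_on \<Omega>"
  unfolding L2_on_def mem_Collect_eq using rep_abs_L2[of g] by (auto elim!: eventually_mono)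

text \<open>Let \<open>g\<close> be the part of the limit outside \<open>\<Omega>\<close>. Every
  member of the sequence is orthogonal to \<open>g\<close>, hence so is the limit, and that inner
  product is the integral of the square of \<open>g\<close>.\<close>

lemma closed_L2_on:
  assumes "open \<Omega>" shows "closed (L2_on \<Omega>)"
  unfolding closed_sequential_limits
proof (intro allI impI, elim conjE)
  fix X v assume X: "\<forall>n. X n \<in> L2_on \<Omega>" and v: "X \<longlonglongrightarrow> v"
  define g where "g x = indicator (- \<Omega>) x *\<^sub>R rep_L2 v x" for x
  have [measurable]: "rep_L2 v \<in> borel_measurable borel" by (rule sq_integrable_measurable[OF sq_integrable_rep])
  have [measurable]: "- \<Omega> \<in> sets borel" using assms by simp
  have iv: "integrable lborel (\<lambda>x. (norm (rep_L2 v x))\<^sup>2)"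
    using sq_integrable_rep[of v] by (simp add: sq_integrable_def)
  have g: "sq_integrable g"
    unfolding sq_integrable_def
  proof
    show gm: "g \<in> borel_measurable borel" unfolding g_def by measurable
    show "integrable lborel (\<lambda>x. (norm (g x))\<^sup>2)"
    proof (rule Bochner_Integration.integrable_bound[OF iv])
      show "(\<lambda>x. (norm (g x))\<^sup>2) \<in> borel_measurable lborel" using gm by simp
    qed (auto simp: g_def indicator_def)
  qed
  have "X n \<bullet> abs_L2 g = 0" for n
  proof -
    have "AE x in lborel. rep_L2 (X n) x \<bullet> g x = 0"
      using X[rule_format, of n] unfolding L2_on_def mem_Collect_eq by eventually_elim (auto simp: g_def indicator_def)
    then show ?thesis
      unfolding inner_abs_L2[OF g] by (rule integral_eq_zero_AE)
  qed
  moreover have "(\<lambda>n. X n \<bullet> abs_L2 g) \<longlonglongrightarrow> v \<bullet> abs_L2 g" by (intro tendsto_intros v)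
  ultimately have "v \<bullet> abs_L2 g = 0" by (simp add: LIMSEQ_const_iff)
  then have "(LINT x|lborel. rep_L2 v x \<bullet> g x) = 0" by (simp add: inner_abs_L2[OF g])
  moreover have "integrable lborel (\<lambda>x. rep_L2 v x \<bullet> g x)" by (intro integrable_inner_sq_integrable sq_integrable_rep g)
  moreover have "0 \<le> rep_L2 v x \<bullet> g x" for x by (simp add: g_def)
  ultimately have "AE x in lborel. rep_L2 v x \<bullet> g x = 0" by (subst (asm) integral_nonneg_eq_0_iff_AE) auto
  then show "v \<in> L2_on \<Omega>"
    unfolding L2_on_def mem_Collect_eq by eventually_elim (auto simp: g_def indicator_def)
qed

subsection \<open>Weak derivatives in \<open>L2_on \<Omega>\<close>\<close>

definition fld :: "('a::euclidean_space \<Rightarrow> real) \<Rightarrow> 'a \<Rightarrow> 'a L2" where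
  "fld \<psi> i = abs_L2 (\<lambda>x. \<psi> x *\<^sub>R i)"

text \<open>Testing with the fields \<open>fld \<psi> i\<close> is testing the components, but stays within the Hilbert space.\<close>

definition weak_partial :: "'a::euclidean_space set \<Rightarrow> 'a \<Rightarrow> 'a L2 \<Rightarrow> 'a L2 \<Rightarrow> bool" where
  "weak_partial \<Omega> b v w \<longleftrightarrow> w \<in> L2_on \<Omega> \<and>
    (\<forall>\<psi>. test_function \<Omega> \<psi> \<longrightarrow> (\<forall>i\<in>Basis. v \<bullet> fld (partial_deriv b \<psi>) i = - (w \<bullet> fld \<psi> i)))"

lemma fld_sq_integrable:
  fixes \<psi> :: "'a::euclidean_space \<Rightarrow> real"
  assumes "test_function \<Omega> \<psi>" shows "sq_integrable (\<lambda>x. \<psi> x *\<^sub>R i)"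
proof -
  obtain S where "compact S" "S \<subseteq> \<Omega>" "\<And>x. x \<notin> S \<Longrightarrow> \<psi> x = 0" using test_function_support[OF assms] by blast
  then show ?thesis
    by (intro sq_integrable_compact_support continuous_intros test_function_continuous[OF assms]) auto
qed

lemma integrable_test_scaleR:
  fixes v :: "'a::euclidean_space L2"
  assumes "test_function \<Omega> \<psi>"
  shows "integrable lborel (\<lambda>x. \<psi> x *\<^sub>R rep_L2 v x)"
proof (rule Bochner_Integration.integrable_bound)
  obtain b :: 'a where b: "b \<in> Basis" using nonempty_Basis by blast
  have "integrable lborel (\<lambda>x. (norm (\<psi> x *\<^sub>R b))\<^sup>2)"
    using fld_sq_integrable[OF assms, of b] by (simp only: sq_integrable_def)
  then show "integrable lborel (\<lambda>x. (\<psi> x)\<^sup>2 + (norm (rep_L2 v x))\<^sup>2)"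
    using sq_integrable_rep[of v] b by (auto simp: sq_integrable_def)
  have "norm (\<psi> x *\<^sub>R rep_L2 v x) \<le> norm ((\<psi> x)\<^sup>2 + (norm (rep_L2 v x))\<^sup>2)" for x
  proof -
    have "0 \<le> \<bar>\<psi> x\<bar> * norm (rep_L2 v x)" by simp
    moreover have "2 * (\<bar>\<psi> x\<bar> * norm (rep_L2 v x)) \<le> (\<psi> x)\<^sup>2 + (norm (rep_L2 v x))\<^sup>2"
      using sum_squares_bound[of "\<bar>\<psi> x\<bar>" "norm (rep_L2 v x)"] by (simp add: mult.assoc)
    ultimately have "\<bar>\<psi> x\<bar> * norm (rep_L2 v x) \<le> (\<psi> x)\<^sup>2 + (norm (rep_L2 v x))\<^sup>2" by linarith
    then show ?thesis by simp
  qed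
  then show "AE x in lborel. norm (\<psi> x *\<^sub>R rep_L2 v x) \<le> norm ((\<psi> x)\<^sup>2 + (norm (rep_L2 v x))\<^sup>2)" by simp
  show "(\<lambda>x. \<psi> x *\<^sub>R rep_L2 v x) \<in> borel_measurable lborel"
    using borel_measurable_continuous_onI[OF test_function_continuous[OF assms]] sq_integrable_measurable[OF sq_integrable_rep[of v]]
    by (intro borel_measurable_scaleR) auto
qed

lemma integral_test_inner:
  fixes v :: "'a::euclidean_space L2"
  assumes "test_function \<Omega> \<psi>"
  shows "(LINT x:\<Omega>|lborel. \<psi> x *\<^sub>R rep_L2 v x) \<bullet> i = v \<bullet> fld \<psi> i"
proof -
  obtain S where "compact S" and S: "S \<subseteq> \<Omega>" "\<And>x. x \<notin> S \<Longrightarrow> \<psi> x = 0" using test_function_support[OF assms] by blast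
  have "indicator \<Omega> x *\<^sub>R (\<psi> x *\<^sub>R rep_L2 v x) = \<psi> x *\<^sub>R rep_L2 v x" for x
    using S by (cases "x \<in> \<Omega>") auto
  then have "(LINT x:\<Omega>|lborel. \<psi> x *\<^sub>R rep_L2 v x) = (LINT x|lborel. \<psi> x *\<^sub>R rep_L2 v x)"
    by (simp only: set_lebesgue_integral_def)
  then have "(LINT x:\<Omega>|lborel. \<psi> x *\<^sub>R rep_L2 v x) \<bullet> i = (LINT x|lborel. (\<psi> x *\<^sub>R rep_L2 v x) \<bullet> i)"
    using integral_inner_left[OF integrable_test_scaleR[OF assms, of v], of i] by simp
  also have "\<dots> = v \<bullet> fld \<psi> i"
    unfolding fld_def inner_abs_L2[OF fld_sq_integrable[OF assms]] by simp
  finally show ?thesis .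
qed

lemma weak_deriv_iff:
  assumes b: "b \<in> Basis"
  shows "weak_deriv \<Omega> b (rep_L2 v) (rep_L2 w) \<longleftrightarrow>
    (\<forall>\<psi>. test_function \<Omega> \<psi> \<longrightarrow> (\<forall>i\<in>Basis. v \<bullet> fld (partial_deriv b \<psi>) i = - (w \<bullet> fld \<psi> i)))"
proof -
  have "(LINT x:\<Omega>|lborel. partial_deriv b \<psi> x *\<^sub>R rep_L2 v x) = - (LINT x:\<Omega>|lborel. \<psi> x *\<^sub>R rep_L2 w x) \<longleftrightarrow>
      (\<forall>i\<in>Basis. v \<bullet> fld (partial_deriv b \<psi>) i = - (w \<bullet> fld \<psi> i))" if \<psi>: "test_function \<Omega> \<psi>" for \<psi>
    unfolding euclidean_eq_iff[of "LINT x:\<Omega>|lborel. partial_deriv b \<psi> x *\<^sub>R rep_L2 v x"]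
    by (simp add: integral_test_inner[OF \<psi>] integral_test_inner[OF test_function_partial[OF \<psi> b]])
  then show ?thesis unfolding weak_deriv_def by blast
qed

lemma weak_partial_iff:
  "b \<in> Basis \<Longrightarrow> weak_partial \<Omega> b v w \<longleftrightarrow> w \<in> L2_on \<Omega> \<and> weak_deriv \<Omega> b (rep_L2 v) (rep_L2 w)"
  by (simp add: weak_partial_def weak_deriv_iff)

lemma weak_partial_diff:
  "weak_partial \<Omega> b v w \<Longrightarrow> weak_partial \<Omega> b v' w' \<Longrightarrow> weak_partial \<Omega> b (v - v') (w - w')"
  by (simp add: weak_partial_def inner_diff_left L2_on_diff)

text \<open>Both sides of the defining identity are inner products with fixed fields, hence
  continuous.\<close>

lemma weak_partial_limit:
  assumes "open \<Omega>" "\<And>n. weak_partial \<Omega> b (X n) (Y n)" "X \<longlonglongrightarrow> v" "Y \<longlonglongrightarrow> w"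
  shows "weak_partial \<Omega> b v w"
  unfolding weak_partial_def
proof (intro conjI allI impI ballI)
  show "w \<in> L2_on \<Omega>"
    by (rule closed_sequentially[OF closed_L2_on[OF assms(1)] _ assms(4)]) (use assms(2) in \<open>auto simp: weak_partial_def\<close>)
  fix \<psi> :: "'a \<Rightarrow> real" and i :: 'a assume \<psi>: "test_function \<Omega> \<psi>" and i: "i \<in> Basis"
  have "(\<lambda>n. X n \<bullet> fld (partial_deriv b \<psi>) i) \<longlonglongrightarrow> v \<bullet> fld (partial_deriv b \<psi>) i"
    by (intro tendsto_intros assms(3))
  moreover have "(\<lambda>n. - (Y n \<bullet> fld \<psi> i)) \<longlonglongrightarrow> - (w \<bullet> fld \<psi> i)"
    by (intro tendsto_intros assms(4))
  moreover have "X n \<bullet> fld (partial_deriv b \<psi>) i = - (Y n \<bullet> fld \<psi> i)" for n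
    using assms(2)[of n] \<psi> i by (simp add: weak_partial_def)
  ultimately show "v \<bullet> fld (partial_deriv b \<psi>) i = - (w \<bullet> fld \<psi> i)"
    using LIMSEQ_unique by auto
qed

lemma L2_on_eq_0:
  assumes \<Omega>: "open \<Omega>" and w: "w \<in> L2_on \<Omega>"
    and zero: "\<And>\<psi> i. test_function \<Omega> \<psi> \<Longrightarrow> i \<in> Basis \<Longrightarrow> w \<bullet> fld \<psi> i = 0"
  shows "w = 0"
proof -
  have "AE x in lborel. x \<in> \<Omega> \<longrightarrow> rep_L2 w x = 0"
  proof (rule fundamental_lemma[OF \<Omega>])
    show "(LINT x:\<Omega>|lborel. \<phi> x *\<^sub>R rep_L2 w x) = 0" if "test_function \<Omega> \<phi>" for \<phi>
      by (rule euclidean_eqI) (simp add: integral_test_inner[OF that] zero[OF that])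
    fix a b :: 'a
    show "set_integrable lborel (cbox a b) (rep_L2 w)"
      unfolding set_integrable_def
    proof (rule Bochner_Integration.integrable_bound)
      show "integrable lborel (\<lambda>x. indicator (cbox a b) x + (norm (rep_L2 w x))\<^sup>2 :: real)"
        using sq_integrable_rep[of w]
        by (intro Bochner_Integration.integrable_add integrable_real_indicator emeasure_lborel_cbox_finite)
          (auto simp: sq_integrable_def)
      have "t \<le> 1 + t\<^sup>2" for t :: real using sum_squares_bound[of t 1] by (smt (verit) power2_eq_square zero_le_power2 mult_1_right power_one)
      then show "AE x in lborel. norm (indicator (cbox a b) x *\<^sub>R rep_L2 w x) \<le> norm (indicator (cbox a b) x + (norm (rep_L2 w x))\<^sup>2 :: real)"
        by (auto simp: indicator_def)
    qed (use sq_integrable_measurable[OF sq_integrable_rep[of w]] in \<open>auto intro!: borel_measurable_scaleR\<close>)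
  qed
  moreover have "AE x in lborel. x \<notin> \<Omega> \<longrightarrow> rep_L2 w x = 0" using w by (simp add: L2_on_def)
  ultimately have "AE x in lborel. rep_L2 w x = rep_L2 0 x"
    using rep_L2_zero by eventually_elim auto
  then show ?thesis by (rule L2_eqI)
qed

lemma weak_partial_unique:
  assumes "open \<Omega>" "weak_partial \<Omega> b v w" "weak_partial \<Omega> b v w'"
  shows "w = w'"
proof -
  have "w - w' = 0"
  proof (rule L2_on_eq_0[OF assms(1)])
    show "w - w' \<in> L2_on \<Omega>" using assms by (simp add: weak_partial_def L2_on_diff)
    show "(w - w') \<bullet> fld \<psi> i = 0" if "test_function \<Omega> \<psi>" "i \<in> Basis" for \<psi> i
      using assms(2,3) that unfolding weak_partial_def inner_diff_left by (metis add.inverse_inverse diff_self)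
  qed
  then show ?thesis by simp
qed

lemma wpartial_eq:
  assumes "open \<Omega>" "b \<in> Basis" "weak_partial \<Omega> b v w"
  shows "wpartial \<Omega> b v = w"
  unfolding wpartial_def weak_partial_iff[OF assms(2), symmetric]
  using assms(1,3) weak_partial_unique by blast

lemma sobolev_subset_L2_on: "sobolev \<Omega> s \<subseteq> L2_on \<Omega>"
  by (cases s) auto

text \<open>Uniqueness of weak derivatives replaces the existential witness by
  \<open>wpartial\<close>, so that derivatives can be named.\<close>

lemma sobolev_Suc_iff:
  assumes "open \<Omega>"
  shows "v \<in> sobolev \<Omega> (Suc s) \<longleftrightarrow> v \<in> L2_on \<Omega> \<and> (\<forall>b\<in>Basis. weak_partial \<Omega> b v (wpartial \<Omega> b v) \<and> wpartial \<Omega> b v \<in> sobolev \<Omega> s)"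
proof -
  have "(\<exists>w\<in>sobolev \<Omega> s. weak_deriv \<Omega> b (rep_L2 v) (rep_L2 w)) \<longleftrightarrow>
      weak_partial \<Omega> b v (wpartial \<Omega> b v) \<and> wpartial \<Omega> b v \<in> sobolev \<Omega> s" if b: "b \<in> Basis" for b
    using wpartial_eq[OF assms b] weak_partial_iff[OF b] sobolev_subset_L2_on by blast
  then show ?thesis by simp
qed

lemma sobolev_1_iff:
  assumes "open \<Omega>"
  shows "v \<in> sobolev \<Omega> 1 \<longleftrightarrow> v \<in> L2_on \<Omega> \<and> (\<forall>b\<in>Basis. weak_partial \<Omega> b v (wpartial \<Omega> b v))"
  using sobolev_Suc_iff[OF assms, of v 0] by (auto simp: weak_partial_def)

text \<open>Integration by parts: a component of \<open>\<phi>\<close> times \<open>\<psi>\<close>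
  is again a test function, so its partial derivative has integral 0.\<close>

lemma test_field_weak_partial:
  fixes \<phi> :: "'a::euclidean_space \<Rightarrow> 'a"
  assumes \<phi>: "test_function \<Omega> \<phi>" and b: "b \<in> Basis"
  shows "weak_partial \<Omega> b (abs_L2 \<phi>) (abs_L2 (partial_deriv b \<phi>))"
  unfolding weak_partial_def
proof (intro conjI allI impI ballI)
  note \<phi>' = test_function_partial[OF \<phi> b]
  obtain S where "compact S" and S: "S \<subseteq> \<Omega>" "\<And>x. x \<notin> S \<Longrightarrow> partial_deriv b \<phi> x = 0" using test_function_support[OF \<phi>'] by blast
  show "abs_L2 (partial_deriv b \<phi>) \<in> L2_on \<Omega>"
    by (rule abs_L2_on[OF test_function_sq_integrable[OF \<phi>']]) (use S in blast)
  fix \<psi> :: "'a \<Rightarrow> real" and i :: 'a assume \<psi>: "test_function \<Omega> \<psi>" and i: "i \<in> Basis"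
  note \<psi>' = test_function_partial[OF \<psi> b]
  note \<phi>i = test_function_inner[OF \<phi>, where j = i]
  have "0 = (LINT x|lborel. (\<phi> x \<bullet> i) * partial_deriv b \<psi> x + (partial_deriv b \<phi> x \<bullet> i) * \<psi> x)"
    using integral_partial_deriv_eq_0[OF test_function_mult(1)[OF \<phi>i(1) \<psi>] b]
    unfolding test_function_mult(2)[OF \<phi>i(1) \<psi>]
    by (simp add: fun_cong[OF test_function_inner(2)[OF \<phi>, where b = b and j = i]])
  also have "\<dots> = (LINT x|lborel. \<phi> x \<bullet> (partial_deriv b \<psi> x *\<^sub>R i) + partial_deriv b \<phi> x \<bullet> (\<psi> x *\<^sub>R i))"
    by (simp add: mult.commute)
  also have "\<dots> = (LINT x|lborel. \<phi> x \<bullet> (partial_deriv b \<psi> x *\<^sub>R i)) + (LINT x|lborel. partial_deriv b \<phi> x \<bullet> (\<psi> x *\<^sub>R i))"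
    by (intro Bochner_Integration.integral_add integrable_inner_sq_integrable test_function_sq_integrable[OF \<phi>] test_function_sq_integrable[OF \<phi>']
        fld_sq_integrable[OF \<psi>] fld_sq_integrable[OF \<psi>'])
  finally show "abs_L2 \<phi> \<bullet> fld (partial_deriv b \<psi>) i = - (abs_L2 (partial_deriv b \<phi>) \<bullet> fld \<psi> i)"
    unfolding fld_def
    by (simp only: inner_abs_abs_L2 test_function_sq_integrable[OF \<phi>] test_function_sq_integrable[OF \<phi>']
        fld_sq_integrable[OF \<psi>] fld_sq_integrable[OF \<psi>'])
qed

subsection \<open>The energy norm of an elliptic operator\<close>

text \<open>Equivalent to the first-order Sobolev norm, with a sum in place of the root of a sum of
  squares, so that the triangle inequality is termwise.\<close>

definition h1_size :: "'a::euclidean_space set \<Rightarrow> 'a L2 \<Rightarrow> real" where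
  "h1_size \<Omega> v = norm v + (\<Sum>b\<in>Basis. norm (wpartial \<Omega> b v))"

lemma h1_size_nonneg: "0 \<le> h1_size \<Omega> v"
  unfolding h1_size_def by (intro add_nonneg_nonneg sum_nonneg) auto

lemma norm_le_h1_size: "norm v \<le> h1_size \<Omega> v"
  unfolding h1_size_def by (simp add: sum_nonneg)

lemma sobolev_norm_1: "sobolev_norm \<Omega> 1 v = sqrt ((norm v)\<^sup>2 + (\<Sum>b\<in>Basis. (norm (wpartial \<Omega> b v))\<^sup>2))"
  by simp

lemma sobolev_norm_1_le: "sobolev_norm \<Omega> 1 v \<le> h1_size \<Omega> v"
proof -
  have "(\<Sum>b\<in>Basis. (norm (wpartial \<Omega> b v))\<^sup>2) = (L2_set (\<lambda>b. norm (wpartial \<Omega> b v)) Basis)\<^sup>2"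
    by (simp add: L2_set_def sum_nonneg)
  then have "sobolev_norm \<Omega> 1 v \<le> norm v + L2_set (\<lambda>b. norm (wpartial \<Omega> b v)) Basis"
    unfolding sobolev_norm_1 using sqrt_sum_squares_le_sum[OF norm_ge_zero L2_set_nonneg] by simp
  also have "\<dots> \<le> h1_size \<Omega> v" unfolding h1_size_def by (intro add_left_mono L2_set_le_sum) auto
  finally show ?thesis .
qed

lemma wpartial_le_sobolev_norm:
  assumes "b \<in> Basis"
  shows "sobolev_norm \<Omega> s (wpartial \<Omega> b v) \<le> sobolev_norm \<Omega> (Suc s) v"
proof -
  have "(sobolev_norm \<Omega> s (wpartial \<Omega> b v))\<^sup>2 \<le> (\<Sum>b\<in>Basis. (sobolev_norm \<Omega> s (wpartial \<Omega> b v))\<^sup>2)"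
    by (rule member_le_sum) (use assms in auto)
  then have "(sobolev_norm \<Omega> s (wpartial \<Omega> b v))\<^sup>2 \<le> (norm v)\<^sup>2 + (\<Sum>b\<in>Basis. (sobolev_norm \<Omega> s (wpartial \<Omega> b v))\<^sup>2)"
    using zero_le_power2[of "norm v"] by linarith
  then show ?thesis by (simp add: real_le_rsqrt)
qed

lemma norm_le_sobolev_norm: "norm v \<le> sobolev_norm \<Omega> s v"
  by (cases s) (auto intro!: real_le_rsqrt sum_nonneg)

lemma h1_size_le: "h1_size \<Omega> (v :: 'a::euclidean_space L2) \<le> (1 + real DIM('a)) * sobolev_norm \<Omega> 1 v"
proof -
  have "norm (wpartial \<Omega> b v) \<le> sobolev_norm \<Omega> 1 v" if "b \<in> Basis" for b
    using wpartial_le_sobolev_norm[OF that, of \<Omega> 0 v] by simp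
  then have "(\<Sum>b\<in>Basis. norm (wpartial \<Omega> b v)) \<le> (\<Sum>b\<in>(Basis :: 'a set). sobolev_norm \<Omega> 1 v)"
    by (rule sum_mono)
  then show ?thesis using norm_le_sobolev_norm[of v \<Omega> 1] unfolding h1_size_def by (simp add: distrib_right)
qed

lemma h1_tendsto_iff:
  "(\<lambda>n. sobolev_norm \<Omega> 1 (X n)) \<longlonglongrightarrow> 0 \<longleftrightarrow> (\<lambda>n. h1_size \<Omega> (X n :: 'a::euclidean_space L2)) \<longlonglongrightarrow> 0"
proof
  assume "(\<lambda>n. sobolev_norm \<Omega> 1 (X n)) \<longlonglongrightarrow> 0"
  then have "(\<lambda>n. (1 + real DIM('a)) * sobolev_norm \<Omega> 1 (X n)) \<longlonglongrightarrow> 0" by (rule tendsto_mult_right_zero)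
  then show "(\<lambda>n. h1_size \<Omega> (X n)) \<longlonglongrightarrow> 0"
    by (rule Lim_null_comparison[rotated]) (use h1_size_le[of \<Omega>] h1_size_nonneg[of \<Omega>] in \<open>auto simp del: sobolev_norm.simps One_nat_def\<close>)
next
  assume "(\<lambda>n. h1_size \<Omega> (X n)) \<longlonglongrightarrow> 0"
  then show "(\<lambda>n. sobolev_norm \<Omega> 1 (X n)) \<longlonglongrightarrow> 0"
    by (rule Lim_null_comparison[rotated])
      (simp only: real_norm_def abs_of_nonneg[OF order_trans[OF norm_ge_zero norm_le_sobolev_norm]] sobolev_norm_1_le
        eventually_True)
qed

section \<open>The spaces H^1 and V: limits and Green's formula\<close>

locale open_domain =
  fixes \<Omega> :: "'a::euclidean_space set"
  assumes \<Omega>: "open \<Omega>"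
begin

lemmas weak = sobolev_1_iff[OF \<Omega>]
lemmas weq = wpartial_eq[OF \<Omega>]

lemma weak_wpartial: "v \<in> sobolev \<Omega> 1 \<Longrightarrow> b \<in> Basis \<Longrightarrow> weak_partial \<Omega> b v (wpartial \<Omega> b v)"
  using weak by blast

lemma sobolev_1_diff:
  assumes "v \<in> sobolev \<Omega> 1" "w \<in> sobolev \<Omega> 1"
  shows "v - w \<in> sobolev \<Omega> 1" "b \<in> Basis \<Longrightarrow> wpartial \<Omega> b (v - w) = wpartial \<Omega> b v - wpartial \<Omega> b w"
proof -
  have d: "weak_partial \<Omega> b (v - w) (wpartial \<Omega> b v - wpartial \<Omega> b w)" if "b \<in> Basis" for b
    by (intro weak_partial_diff weak_wpartial assms that)
  then show "b \<in> Basis \<Longrightarrow> wpartial \<Omega> b (v - w) = wpartial \<Omega> b v - wpartial \<Omega> b w" using weq by blast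
  show "v - w \<in> sobolev \<Omega> 1" unfolding weak
    using assms weq[OF _ d] d by (auto simp: weak L2_on_diff)
qed

lemma h1_size_diff:
  assumes "v \<in> sobolev \<Omega> 1" "w \<in> sobolev \<Omega> 1"
  shows "h1_size \<Omega> (v - w) \<le> h1_size \<Omega> v + h1_size \<Omega> w"
proof -
  have "(\<Sum>b\<in>Basis. norm (wpartial \<Omega> b (v - w))) \<le> (\<Sum>b\<in>Basis. norm (wpartial \<Omega> b v) + norm (wpartial \<Omega> b w))"
    by (intro sum_mono) (simp only: sobolev_1_diff(2)[OF assms] norm_triangle_ineq4)
  then show ?thesis
    unfolding h1_size_def using norm_triangle_ineq4[of v w] by (simp add: sum.distrib)
qed

lemma h1_size_minus_commute:
  assumes "v \<in> sobolev \<Omega> 1" "w \<in> sobolev \<Omega> 1"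
  shows "h1_size \<Omega> (v - w) = h1_size \<Omega> (w - v)"
  unfolding h1_size_def
  by (intro arg_cong2[where f = "(+)"] sum.cong refl)
    (simp_all only: norm_minus_commute sobolev_1_diff(2)[OF assms] sobolev_1_diff(2)[OF assms(2,1)])

lemma h1_size_triangle:
  assumes "u \<in> sobolev \<Omega> 1" "v \<in> sobolev \<Omega> 1" "w \<in> sobolev \<Omega> 1"
  shows "h1_size \<Omega> (u - w) \<le> h1_size \<Omega> (u - v) + h1_size \<Omega> (w - v)"
  using h1_size_diff[OF sobolev_1_diff(1)[OF assms(1,2)] sobolev_1_diff(1)[OF assms(3,2)]] by simp

lemma h1_size_reverse:
  assumes "u \<in> sobolev \<Omega> 1" "v \<in> sobolev \<Omega> 1"
  shows "h1_size \<Omega> u \<le> h1_size \<Omega> v + h1_size \<Omega> (u - v)"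
proof -
  have "h1_size \<Omega> (v - (v - u)) \<le> h1_size \<Omega> v + h1_size \<Omega> (v - u)"
    by (intro h1_size_diff sobolev_1_diff assms)
  then show ?thesis using h1_size_minus_commute[OF assms] by simp
qed

lemma test_field_sobolev:
  assumes "test_function \<Omega> (\<phi> :: 'a \<Rightarrow> 'a)"
  shows "abs_L2 \<phi> \<in> sobolev \<Omega> 1" "b \<in> Basis \<Longrightarrow> wpartial \<Omega> b (abs_L2 \<phi>) = abs_L2 (partial_deriv b \<phi>)"
proof -
  note d = test_field_weak_partial[OF assms]
  then show "b \<in> Basis \<Longrightarrow> wpartial \<Omega> b (abs_L2 \<phi>) = abs_L2 (partial_deriv b \<phi>)" using weq by blast
  obtain S where "S \<subseteq> \<Omega>" "\<And>x. x \<notin> S \<Longrightarrow> \<phi> x = 0" using test_function_support[OF assms] by blast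
  then have "abs_L2 \<phi> \<in> L2_on \<Omega>" by (intro abs_L2_on test_function_sq_integrable[OF assms]) blast
  then show "abs_L2 \<phi> \<in> sobolev \<Omega> 1" unfolding weak using weq[OF _ d] d by auto
qed

lemma sobolev0_sobolev_1: "v \<in> sobolev0 \<Omega> \<Longrightarrow> v \<in> sobolev \<Omega> 1"
  unfolding sobolev0_def by simp

lemma sobolev0_approx:
  assumes "v \<in> sobolev0 \<Omega>"
  shows "\<exists>\<phi> :: nat \<Rightarrow> 'a \<Rightarrow> 'a. (\<forall>n. test_function \<Omega> (\<phi> n)) \<and> (\<lambda>n. h1_size \<Omega> (v - abs_L2 (\<phi> n))) \<longlonglongrightarrow> 0"
proof -
  have "\<exists>\<phi> :: 'a \<Rightarrow> 'a. test_function \<Omega> \<phi> \<and> sobolev_norm \<Omega> 1 (v - abs_L2 \<phi>) < inverse (real (Suc n))" for n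
    using assms unfolding sobolev0_def by (auto simp del: sobolev_norm.simps One_nat_def)
  then obtain \<phi> :: "nat \<Rightarrow> 'a \<Rightarrow> 'a" where \<phi>: "\<And>n. test_function \<Omega> (\<phi> n)"
    "\<And>n. sobolev_norm \<Omega> 1 (v - abs_L2 (\<phi> n)) < inverse (real (Suc n))" by metis
  have "(\<lambda>n. sobolev_norm \<Omega> 1 (v - abs_L2 (\<phi> n))) \<longlonglongrightarrow> 0"
  proof (rule Lim_null_comparison[OF _ LIMSEQ_inverse_real_of_nat])
    show "\<forall>\<^sub>F n in sequentially. norm (sobolev_norm \<Omega> 1 (v - abs_L2 (\<phi> n))) \<le> inverse (real (Suc n))"
      using less_imp_le[OF \<phi>(2)]
      by (intro always_eventually allI)
        (simp only: real_norm_def abs_of_nonneg[OF order_trans[OF norm_ge_zero norm_le_sobolev_norm]])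
  qed
  then have "(\<lambda>n. h1_size \<Omega> (v - abs_L2 (\<phi> n))) \<longlonglongrightarrow> 0" by (simp only: h1_tendsto_iff)
  with \<phi>(1) show ?thesis by blast
qed

lemma sobolev0I_limit:
  assumes X: "\<And>n. X n \<in> sobolev0 \<Omega>" and v: "v \<in> sobolev \<Omega> 1" and lim: "(\<lambda>n. h1_size \<Omega> (X n - v)) \<longlonglongrightarrow> 0"
  shows "v \<in> sobolev0 \<Omega>"
  unfolding sobolev0_def
proof (intro CollectI conjI allI impI)
  show "v \<in> sobolev \<Omega> 1" by fact
  fix \<epsilon> :: real assume \<epsilon>: "\<epsilon> > 0"
  obtain n where n: "h1_size \<Omega> (X n - v) < \<epsilon> / 2"
    using order_tendstoD(2)[OF lim, of "\<epsilon> / 2"] \<epsilon> by (auto simp: eventually_sequentially)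
  obtain \<phi> :: "nat \<Rightarrow> 'a \<Rightarrow> 'a" where \<phi>: "\<And>m. test_function \<Omega> (\<phi> m)" "(\<lambda>m. h1_size \<Omega> (X n - abs_L2 (\<phi> m))) \<longlonglongrightarrow> 0"
    using sobolev0_approx[OF X[of n]] by blast
  obtain m where m: "h1_size \<Omega> (X n - abs_L2 (\<phi> m)) < \<epsilon> / 2"
    using order_tendstoD(2)[OF \<phi>(2), of "\<epsilon> / 2"] \<epsilon> by (auto simp: eventually_sequentially)
  note s = sobolev0_sobolev_1[OF X[of n]] v test_field_sobolev(1)[OF \<phi>(1)[of m]]
  have "sobolev_norm \<Omega> 1 (v - abs_L2 (\<phi> m)) \<le> h1_size \<Omega> (v - abs_L2 (\<phi> m))" by (rule sobolev_norm_1_le)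
  also have "\<dots> \<le> h1_size \<Omega> (v - X n) + h1_size \<Omega> (abs_L2 (\<phi> m) - X n)"
    by (rule h1_size_triangle[OF s(2,1,3)])
  also have "\<dots> < \<epsilon>"
    using n m h1_size_minus_commute[OF s(2,1)] h1_size_minus_commute[OF s(3,1)] by linarith
  finally show "\<exists>\<phi> :: 'a \<Rightarrow> 'a. test_function \<Omega> \<phi> \<and> sobolev_norm \<Omega> 1 (v - abs_L2 \<phi>) < \<epsilon>" using \<phi>(1) by blast
qed

text \<open>Completeness of V when the limit in H is already known: the weak partial derivatives are
  Cauchy in H, and closedness of weak differentiation identifies their limits.\<close>

lemma h1_Cauchy_limit:
  assumes X: "\<And>n. X n \<in> sobolev0 \<Omega>" and lim: "X \<longlonglongrightarrow> v"
    and Cauchy: "\<And>r. r > 0 \<Longrightarrow> \<exists>N. \<forall>m\<ge>N. \<forall>n\<ge>N. h1_size \<Omega> (X m - X n) < r"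
  shows "v \<in> sobolev0 \<Omega>" "(\<lambda>n. h1_size \<Omega> (X n - v)) \<longlonglongrightarrow> 0"
proof -
  note X1 = sobolev0_sobolev_1[OF X]
  have "Cauchy (\<lambda>n. wpartial \<Omega> b (X n))" if b: "b \<in> Basis" for b
  proof (rule CauchyI)
    fix r :: real assume "r > 0"
    then obtain N where N: "\<And>m n. m \<ge> N \<Longrightarrow> n \<ge> N \<Longrightarrow> h1_size \<Omega> (X m - X n) < r" using Cauchy by blast
    have "norm (wpartial \<Omega> b (X m) - wpartial \<Omega> b (X n)) < r" if "m \<ge> N" "n \<ge> N" for m n
    proof -
      have "norm (wpartial \<Omega> b (X m - X n)) \<le> (\<Sum>b\<in>Basis. norm (wpartial \<Omega> b (X m - X n)))"
        by (rule member_le_sum) (use b in auto)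
      also have "\<dots> \<le> h1_size \<Omega> (X m - X n)" by (simp add: h1_size_def)
      finally show ?thesis using N[OF that] sobolev_1_diff(2)[OF X1 X1 b, of m n] by simp
    qed
    then show "\<exists>N. \<forall>m\<ge>N. \<forall>n\<ge>N. norm (wpartial \<Omega> b (X m) - wpartial \<Omega> b (X n)) < r" by blast
  qed
  then have "\<exists>w. (\<lambda>n. wpartial \<Omega> b (X n)) \<longlonglongrightarrow> w" if "b \<in> Basis" for b
    using that by (metis Cauchy_convergent_iff convergent_def)
  then obtain w where w: "\<And>b. b \<in> Basis \<Longrightarrow> (\<lambda>n. wpartial \<Omega> b (X n)) \<longlonglongrightarrow> w b" by metis
  have vw: "weak_partial \<Omega> b v (w b)" if b: "b \<in> Basis" for b
    by (rule weak_partial_limit[OF \<Omega> _ lim w[OF b]]) (rule weak_wpartial[OF X1 b])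
  have weq_v: "wpartial \<Omega> b v = w b" if "b \<in> Basis" for b by (rule weq[OF that vw[OF that]])
  have "v \<in> L2_on \<Omega>" by (rule closed_sequentially[OF closed_L2_on[OF \<Omega>] _ lim]) (use X1 weak in blast)
  then have v1: "v \<in> sobolev \<Omega> 1" unfolding weak using vw weq_v by simp
  have "(\<lambda>n. norm (X n - v) + (\<Sum>b\<in>Basis. norm (wpartial \<Omega> b (X n) - w b))) \<longlonglongrightarrow> norm (v - v) + (\<Sum>b\<in>Basis. norm (w b - w b))"
    by (intro tendsto_intros lim w)
  moreover have "h1_size \<Omega> (X n - v) = norm (X n - v) + (\<Sum>b\<in>Basis. norm (wpartial \<Omega> b (X n) - w b))" for n
    unfolding h1_size_def by (intro arg_cong2[where f = "(+)"] refl sum.cong) (simp add: sobolev_1_diff(2)[OF X1 v1] weq_v)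
  ultimately show "(\<lambda>n. h1_size \<Omega> (X n - v)) \<longlonglongrightarrow> 0" by simp
  then show "v \<in> sobolev0 \<Omega>" by (rule sobolev0I_limit[OF X v1])
qed

text \<open>There is no boundary term because \<open>u\<close> is an H^1 limit of test fields; for
  these the identity is the definition of a weak derivative, taken component by component.\<close>

lemma weak_Green:
  assumes w: "weak_partial \<Omega> b w w'" and b: "b \<in> Basis" and u: "u \<in> sobolev0 \<Omega>"
  shows "w \<bullet> wpartial \<Omega> b u = - (w' \<bullet> u)"
proof -
  have test: "w \<bullet> abs_L2 (partial_deriv b \<phi>) = - (w' \<bullet> abs_L2 \<phi>)" if \<phi>: "test_function \<Omega> \<phi>" for \<phi> :: "'a \<Rightarrow> 'a"
  proof -
    have decomp: "x \<bullet> abs_L2 \<psi> = (\<Sum>i\<in>Basis. x \<bullet> fld (\<lambda>y. \<psi> y \<bullet> i) i)" if \<psi>: "test_function \<Omega> \<psi>" for x and \<psi> :: "'a \<Rightarrow> 'a"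
    proof -
      note sq = fld_sq_integrable[OF test_function_inner(1)[OF \<psi>]]
      have "x \<bullet> abs_L2 \<psi> = (LINT y|lborel. (\<Sum>i\<in>Basis. rep_L2 x y \<bullet> ((\<psi> y \<bullet> i) *\<^sub>R i)))"
        unfolding inner_abs_L2[OF test_function_sq_integrable[OF \<psi>]]
        by (simp only: inner_sum_right[symmetric] euclidean_representation)
      also have "\<dots> = (\<Sum>i\<in>Basis. (LINT y|lborel. rep_L2 x y \<bullet> ((\<psi> y \<bullet> i) *\<^sub>R i)))"
        by (intro Bochner_Integration.integral_sum integrable_inner_sq_integrable sq_integrable_rep sq)
      also have "\<dots> = (\<Sum>i\<in>Basis. x \<bullet> fld (\<lambda>y. \<psi> y \<bullet> i) i)"
        unfolding fld_def by (simp only: inner_abs_L2[OF sq])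
      finally show ?thesis .
    qed
    have "w \<bullet> fld (\<lambda>y. partial_deriv b \<phi> y \<bullet> i) i = - (w' \<bullet> fld (\<lambda>y. \<phi> y \<bullet> i) i)" if "i \<in> Basis" for i
    proof -
      have "w \<bullet> fld (partial_deriv b (\<lambda>y. \<phi> y \<bullet> i)) i = - (w' \<bullet> fld (\<lambda>y. \<phi> y \<bullet> i) i)"
        using w test_function_inner(1)[OF \<phi>, of i] that unfolding weak_partial_def by blast
      then show ?thesis by (simp only: test_function_inner(2)[OF \<phi>])
    qed
    then show ?thesis
      by (simp add: decomp[OF \<phi>] decomp[OF test_function_partial[OF \<phi> b]] sum_negf)
  qed
  obtain \<phi> :: "nat \<Rightarrow> 'a \<Rightarrow> 'a" where \<phi>: "\<And>n. test_function \<Omega> (\<phi> n)" "(\<lambda>n. h1_size \<Omega> (u - abs_L2 (\<phi> n))) \<longlonglongrightarrow> 0"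
    using sobolev0_approx[OF u] by blast
  note u1 = sobolev0_sobolev_1[OF u]
  have "norm (wpartial \<Omega> b u - abs_L2 (partial_deriv b (\<phi> n))) \<le> h1_size \<Omega> (u - abs_L2 (\<phi> n))" for n
  proof -
    have "norm (wpartial \<Omega> b (u - abs_L2 (\<phi> n))) \<le> (\<Sum>b\<in>Basis. norm (wpartial \<Omega> b (u - abs_L2 (\<phi> n))))"
      by (rule member_le_sum) (use b in auto)
    also have "\<dots> \<le> h1_size \<Omega> (u - abs_L2 (\<phi> n))" by (simp add: h1_size_def)
    finally show ?thesis by (simp add: sobolev_1_diff(2)[OF u1 test_field_sobolev(1)[OF \<phi>(1)] b] test_field_sobolev(2)[OF \<phi>(1) b])
  qed
  then have "(\<lambda>n. wpartial \<Omega> b u - abs_L2 (partial_deriv b (\<phi> n))) \<longlonglongrightarrow> 0"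
    by (intro Lim_null_comparison[OF always_eventually \<phi>(2)] allI)
  then have 1: "(\<lambda>n. w \<bullet> (wpartial \<Omega> b u - abs_L2 (partial_deriv b (\<phi> n)))) \<longlonglongrightarrow> w \<bullet> 0"
    by (intro tendsto_intros)
  have "(\<lambda>n. u - abs_L2 (\<phi> n)) \<longlonglongrightarrow> 0"
    by (intro Lim_null_comparison[OF always_eventually \<phi>(2)] allI norm_le_h1_size)
  then have 2: "(\<lambda>n. - (w' \<bullet> (u - abs_L2 (\<phi> n)))) \<longlonglongrightarrow> - (w' \<bullet> 0)"
    by (intro tendsto_intros)
  have "(\<lambda>n. w \<bullet> (wpartial \<Omega> b u - abs_L2 (partial_deriv b (\<phi> n))) - (- (w' \<bullet> (u - abs_L2 (\<phi> n))))) \<longlonglongrightarrow> w \<bullet> 0 - (- (w' \<bullet> 0))"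
    by (rule tendsto_diff[OF 1 2])
  then have "w \<bullet> wpartial \<Omega> b u + w' \<bullet> u = 0"
    by (simp add: inner_diff_right test[OF \<phi>(1)] LIMSEQ_const_iff)
  then show ?thesis by simp
qed

end

text \<open>If \<open>f\<close> is not integrable, its integral is 0 by convention, and the bound
  holds because \<open>g\<close> is nonnegative almost everywhere.\<close>

lemma abs_integral_le:
  fixes f g :: "'a \<Rightarrow> real"
  assumes g: "integrable M g" and le: "AE x in M. \<bar>f x\<bar> \<le> g x"
  shows "\<bar>LINT x|M. f x\<bar> \<le> (LINT x|M. g x)"
proof (cases "integrable M f")
  case True
  have "\<bar>LINT x|M. f x\<bar> \<le> (LINT x|M. \<bar>f x\<bar>)" by (rule integral_abs_bound)
  also have "\<dots> \<le> (LINT x|M. g x)" by (rule integral_mono_AE) (use True g le in auto)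
  finally show ?thesis .
next
  case False
  have "AE x in M. 0 \<le> g x" using le by eventually_elim linarith
  then have "0 \<le> (LINT x|M. g x)" by (rule integral_nonneg_AE)
  then show ?thesis using False by (simp add: not_integrable_integral_eq)
qed

lemma norm_product_L2:
  fixes u w :: "'a::euclidean_space L2"
  shows "integrable lborel (\<lambda>x. norm (rep_L2 u x) * norm (rep_L2 w x))"
    and "(LINT x|lborel. norm (rep_L2 u x) * norm (rep_L2 w x)) \<le> norm u * norm w"
proof -
  obtain e :: 'a where e: "e \<in> Basis" using nonempty_Basis by blast
  \<comment> \<open>A scalar function is carried by a field in one coordinate direction, so that
    Cauchy-Schwarz in \<open>L2\<close> applies to products of norms.\<close>
  define N where "N u x = norm (rep_L2 u x) *\<^sub>R e" for u :: "'a L2" and x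
  have N: "sq_integrable (N u)" for u
    using sq_integrable_rep[of u] e by (auto simp: sq_integrable_def N_def[abs_def])
  have norm_N: "norm (abs_L2 (N u)) = norm u" for u
  proof -
    have "ennreal ((norm (abs_L2 (N u)))\<^sup>2) = (\<integral>\<^sup>+x. ennreal ((norm (N u x))\<^sup>2) \<partial>lborel)" by (rule norm_abs_L2[OF N])
    also have "\<dots> = ennreal ((norm u)\<^sup>2)" unfolding nn_integral_rep_L2[symmetric] using e by (simp add: N_def)
    finally show ?thesis by simp
  qed
  have eq: "N u x \<bullet> N w x = norm (rep_L2 u x) * norm (rep_L2 w x)" for x
    using e by (simp add: N_def inner_Basis)
  show "integrable lborel (\<lambda>x. norm (rep_L2 u x) * norm (rep_L2 w x))"
    using integrable_inner_sq_integrable[OF N N, of u w] by (simp only: eq)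
  have "(LINT x|lborel. norm (rep_L2 u x) * norm (rep_L2 w x)) = abs_L2 (N u) \<bullet> abs_L2 (N w)"
    by (simp only: inner_abs_abs_L2[OF N N] eq)
  also have "\<dots> \<le> norm u * norm w" using norm_cauchy_schwarz[of "abs_L2 (N u)" "abs_L2 (N w)"] by (simp only: norm_N)
  finally show "(LINT x|lborel. norm (rep_L2 u x) * norm (rep_L2 w x)) \<le> norm u * norm w" .
qed

text \<open>The field and its first derivatives as one family, \<open>None\<close> standing for the
  field itself; terms of order zero and one can then be estimated alike.\<close>

definition jet :: "'a::euclidean_space set \<Rightarrow> 'a L2 \<Rightarrow> 'a option \<Rightarrow> 'a L2" where
  "jet \<Omega> v i = (case i of None \<Rightarrow> v | Some b \<Rightarrow> wpartial \<Omega> b v)"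

abbreviation jet_index :: "'a::euclidean_space option set" where
  "jet_index \<equiv> insert None (Some ` Basis)"

lemma sum_jet: "(\<Sum>i\<in>jet_index. f (jet \<Omega> v i)) = f v + (\<Sum>b\<in>Basis. f (wpartial \<Omega> b v))"
proof -
  have "(\<Sum>i\<in>Some ` Basis. f (jet \<Omega> v i)) = (\<Sum>b\<in>Basis. f (wpartial \<Omega> b v))"
    by (subst sum.reindex) (auto simp: jet_def)
  then show ?thesis by (subst sum.insert) (auto simp: jet_def)
qed

definition jet_norm :: "'a::euclidean_space set \<Rightarrow> 'a L2 \<Rightarrow> 'a \<Rightarrow> real" where
  "jet_norm \<Omega> v x = (\<Sum>i\<in>jet_index. norm (rep_L2 (jet \<Omega> v i) x))"

lemma jet_norm_ge:
  "norm (rep_L2 v x) \<le> jet_norm \<Omega> v x" "b \<in> Basis \<Longrightarrow> norm (rep_L2 (wpartial \<Omega> b v) x) \<le> jet_norm \<Omega> v x"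
proof -
  have m: "norm (rep_L2 (jet \<Omega> v i) x) \<le> jet_norm \<Omega> v x" if "i \<in> jet_index" for i
    unfolding jet_norm_def by (rule member_le_sum) (use that in auto)
  show "norm (rep_L2 v x) \<le> jet_norm \<Omega> v x" using m[of None] by (simp add: jet_def)
  show "b \<in> Basis \<Longrightarrow> norm (rep_L2 (wpartial \<Omega> b v) x) \<le> jet_norm \<Omega> v x" using m[of "Some b"] by (simp add: jet_def)
qed

lemma jet_norm_product:
  shows "integrable lborel (\<lambda>x. jet_norm \<Omega> v x * jet_norm \<Omega> w x)"
    and "(LINT x|lborel. jet_norm \<Omega> v x * jet_norm \<Omega> w x) \<le> h1_size \<Omega> v * h1_size \<Omega> w"
proof -
  have eq: "jet_norm \<Omega> v x * jet_norm \<Omega> w x =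
      (\<Sum>i\<in>jet_index. \<Sum>j\<in>jet_index. norm (rep_L2 (jet \<Omega> v i) x) * norm (rep_L2 (jet \<Omega> w j) x))" for x
    unfolding jet_norm_def by (rule sum_product)
  show "integrable lborel (\<lambda>x. jet_norm \<Omega> v x * jet_norm \<Omega> w x)"
    unfolding eq by (intro Bochner_Integration.integrable_sum norm_product_L2)
  have "(LINT x|lborel. jet_norm \<Omega> v x * jet_norm \<Omega> w x) =
      (\<Sum>i\<in>jet_index. \<Sum>j\<in>jet_index. (LINT x|lborel. norm (rep_L2 (jet \<Omega> v i) x) * norm (rep_L2 (jet \<Omega> w j) x)))"
    unfolding eq by (simp only: Bochner_Integration.integral_sum Bochner_Integration.integrable_sum norm_product_L2)
  also have "\<dots> \<le> (\<Sum>i\<in>jet_index. \<Sum>j\<in>jet_index. norm (jet \<Omega> v i) * norm (jet \<Omega> w j))"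
    by (intro sum_mono norm_product_L2)
  also have "\<dots> = h1_size \<Omega> v * h1_size \<Omega> w"
    unfolding sum_product[symmetric] sum_jet h1_size_def ..
  finally show "(LINT x|lborel. jet_norm \<Omega> v x * jet_norm \<Omega> w x) \<le> h1_size \<Omega> v * h1_size \<Omega> w" .
qed

section \<open>Coercivity and boundedness of the form in H^1\<close>

locale elliptic_inverse = open_domain \<Omega> + pos_operator S
  for \<Omega> :: "'a::euclidean_space set" and S :: "'a L2 \<Rightarrow> 'a L2" +
  fixes A :: "'a L2 \<Rightarrow> 'a L2"
  assumes op: "elliptic_operator \<Omega> A"
    and ran: "range S = elliptic_dom \<Omega>"
    and SA: "\<And>v. v \<in> elliptic_dom \<Omega> \<Longrightarrow> S (A v) = v"
    and AS: "\<And>x. x \<in> L2_on \<Omega> \<Longrightarrow> A (S x) = x"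
begin

abbreviation D where "D \<equiv> elliptic_dom \<Omega>"

lemma self_adjoint: "self_adjoint_on (L2_on \<Omega>) D A" and pos_def: "positive_definite_on D A"
  using op by (auto simp: elliptic_operator_def)

lemma D_subspace: "subspace D" and D_L2_on: "v \<in> D \<Longrightarrow> v \<in> L2_on \<Omega>" and A_L2_on: "v \<in> D \<Longrightarrow> A v \<in> L2_on \<Omega>"
  and A_add: "v \<in> D \<Longrightarrow> w \<in> D \<Longrightarrow> A (v + w) = A v + A w"
  and A_scaleR: "v \<in> D \<Longrightarrow> A (c *\<^sub>R v) = c *\<^sub>R A v"
  and A_sym: "v \<in> D \<Longrightarrow> w \<in> D \<Longrightarrow> A v \<bullet> w = v \<bullet> A w"
  using self_adjoint unfolding self_adjoint_on_def by blast+

lemma L2_on_closure: "closure (range S) = L2_on \<Omega>"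
proof
  show "closure (range S) \<subseteq> L2_on \<Omega>"
    unfolding ran by (rule closure_minimal[OF _ closed_L2_on[OF \<Omega>]]) (use D_L2_on in blast)
  show "L2_on \<Omega> \<subseteq> closure (range S)"
    unfolding ran using self_adjoint unfolding self_adjoint_on_def by blast
qed

lemma A_diff: "v \<in> D \<Longrightarrow> w \<in> D \<Longrightarrow> A (v - w) = A v - A w"
  using A_add[of v "(-1) *\<^sub>R w"] A_scaleR[of w "-1"] subspace_scale[OF D_subspace, of w "-1"] by simp

lemma D_sobolev: "v \<in> D \<Longrightarrow> v \<in> sobolev \<Omega> 1" "v \<in> D \<Longrightarrow> v \<in> sobolev0 \<Omega>"
  using sobolev0_sobolev_1 by auto

lemma D_second:
  assumes "v \<in> D" "b \<in> Basis"
  shows "weak_partial \<Omega> b (wpartial \<Omega> b v) (wpartial \<Omega> b (wpartial \<Omega> b v))"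
proof -
  have "v \<in> sobolev \<Omega> (Suc 1)" using assms(1) by (simp add: numeral_2_eq_2)
  then have "wpartial \<Omega> b v \<in> sobolev \<Omega> 1" using sobolev_Suc_iff[OF \<Omega>, of v 1] assms(2) by blast
  then show ?thesis using weak_wpartial assms(2) by blast
qed

text \<open>A comparison operator, minus the componentwise Laplacian: on the domain of
  \<open>A\<close> its form is the squared norm of the gradient, and the H^2 estimate bounds it
  relative to \<open>A\<close>.\<close>

definition laplace :: "'a L2 \<Rightarrow> 'a L2" where
  "laplace v = - (\<Sum>b\<in>Basis. wpartial \<Omega> b (wpartial \<Omega> b v))"

lemma laplace_inner:
  assumes "v \<in> D" "u \<in> D"
  shows "laplace v \<bullet> u = (\<Sum>b\<in>Basis. wpartial \<Omega> b v \<bullet> wpartial \<Omega> b u)"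
proof -
  have "wpartial \<Omega> b v \<bullet> wpartial \<Omega> b u = - (wpartial \<Omega> b (wpartial \<Omega> b v) \<bullet> u)" if "b \<in> Basis" for b
    by (rule weak_Green[OF D_second[OF assms(1) that] that D_sobolev(2)[OF assms(2)]])
  then show ?thesis by (simp add: laplace_def inner_sum_left sum_negf)
qed

lemma laplace_bound: "\<exists>C>0. \<forall>v\<in>D. norm (laplace v) \<le> C * norm (A v)"
proof -
  obtain C where C: "\<And>v. v \<in> D \<Longrightarrow> sobolev_norm \<Omega> 2 v \<le> C * norm (A v)"
    using op unfolding elliptic_operator_def by blast
  define C' where "C' = real DIM('a) * \<bar>C\<bar> + 1"
  have "norm (laplace v) \<le> C' * norm (A v)" if v: "v \<in> D" for v
  proof -
    have "norm (wpartial \<Omega> b (wpartial \<Omega> b v)) \<le> \<bar>C\<bar> * norm (A v)" if b: "b \<in> Basis" for b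
    proof -
      have "norm (wpartial \<Omega> b (wpartial \<Omega> b v)) = sobolev_norm \<Omega> 0 (wpartial \<Omega> b (wpartial \<Omega> b v))" by simp
      also have "\<dots> \<le> sobolev_norm \<Omega> (Suc 0) (wpartial \<Omega> b v)" by (rule wpartial_le_sobolev_norm[OF b])
      also have "\<dots> \<le> sobolev_norm \<Omega> (Suc (Suc 0)) v" by (rule wpartial_le_sobolev_norm[OF b])
      also have "\<dots> \<le> C * norm (A v)" using C[OF v] by (simp only: numeral_2_eq_2)
      also have "\<dots> \<le> \<bar>C\<bar> * norm (A v)" by (intro mult_right_mono) auto
      finally show ?thesis .
    qed
    then have "(\<Sum>b\<in>Basis. norm (wpartial \<Omega> b (wpartial \<Omega> b v))) \<le> (\<Sum>b\<in>(Basis :: 'a set). \<bar>C\<bar> * norm (A v))"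
      by (rule sum_mono)
    then have "norm (laplace v) \<le> real DIM('a) * \<bar>C\<bar> * norm (A v)"
      unfolding laplace_def norm_minus_cancel using norm_sum order_trans by fastforce
    also have "\<dots> \<le> C' * norm (A v)" unfolding C'_def by (intro mult_right_mono) auto
    finally show ?thesis .
  qed
  moreover have "C' > 0" unfolding C'_def by (intro add_nonneg_pos) auto
  ultimately show ?thesis by blast
qed

lemma laplace_L2_on:
  assumes "v \<in> D" shows "laplace v \<in> L2_on \<Omega>"
proof -
  have "wpartial \<Omega> b (wpartial \<Omega> b v) \<in> L2_on \<Omega>" if "b \<in> Basis" for b
    using D_second[OF assms that] by (simp add: weak_partial_def)
  then show ?thesis unfolding laplace_def
    by (intro subspace_neg[OF subspace_L2_on] subspace_sum[OF subspace_L2_on])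
qed

text \<open>Interpolated from the H^2 estimate. The operator \<open>laplace\<close> after
  \<open>S\<close> is bounded on H by that estimate, and symmetric for the form of \<open>S\<close>
  by Green's formula. Krein's bound at the point \<open>A v\<close> then says that the squared
  gradient norm is at most \<open>C * (A v \<bullet> v)\<close>.\<close>

lemma coercive: "\<exists>C>0. \<forall>v\<in>D. h1_size \<Omega> v \<le> C * sqrt (A v \<bullet> v)"
proof -
  obtain c where c: "c > 0" "\<And>v. v \<in> D \<Longrightarrow> c * (norm v)\<^sup>2 \<le> A v \<bullet> v"
    using pos_def unfolding positive_definite_on_def by blast
  obtain C where C: "C > 0" "\<And>v. v \<in> D \<Longrightarrow> norm (laplace v) \<le> C * norm (A v)" using laplace_bound by blast
  have SD: "S x \<in> D" for x using ran by blast
  have grad: "(\<Sum>b\<in>Basis. (norm (wpartial \<Omega> b v))\<^sup>2) \<le> C * (A v \<bullet> v)" if v: "v \<in> D" for v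
  proof -
    have "S (laplace (S (A v))) \<bullet> A v \<le> C * (S (A v) \<bullet> A v)"
    proof (rule weakly_symmetric_bound[where H = "L2_on \<Omega>"])
      show "norm (laplace (S x)) \<le> C * norm x" if "x \<in> L2_on \<Omega>" for x
        using C(2)[OF SD] AS[OF that] by metis
      show "S (laplace (S x)) \<bullet> y = S x \<bullet> laplace (S y)" for x y
      proof -
        have "S (laplace (S x)) \<bullet> y = laplace (S x) \<bullet> S y" by (rule S_sym)
        also have "\<dots> = laplace (S y) \<bullet> S x" unfolding laplace_inner[OF SD SD] by (intro sum.cong refl inner_commute)
        finally show ?thesis by (simp add: inner_commute)
      qed
    qed (use C(1) A_L2_on[OF v] laplace_L2_on[OF SD] in auto)
    then have "laplace v \<bullet> v \<le> C * (A v \<bullet> v)" by (simp only: S_sym SA[OF v] inner_commute[of "A v" v])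
    then show ?thesis by (simp add: laplace_inner[OF v v] power2_norm_eq_inner)
  qed
  define C' where "C' = sqrt (1 / c) + real DIM('a) * sqrt C"
  have "h1_size \<Omega> v \<le> C' * sqrt (A v \<bullet> v)" if v: "v \<in> D" for v
  proof -
    have "(norm v)\<^sup>2 \<le> 1 / c * (A v \<bullet> v)" using c(2)[OF v] c(1) by (simp add: field_simps)
    then have 1: "norm v \<le> sqrt (1 / c) * sqrt (A v \<bullet> v)" unfolding real_sqrt_mult[symmetric] by (rule real_le_rsqrt)
    have "norm (wpartial \<Omega> b v) \<le> sqrt C * sqrt (A v \<bullet> v)" if b: "b \<in> Basis" for b
    proof -
      have "(norm (wpartial \<Omega> b v))\<^sup>2 \<le> (\<Sum>b\<in>Basis. (norm (wpartial \<Omega> b v))\<^sup>2)" by (rule member_le_sum) (use b in auto)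
      then have "(norm (wpartial \<Omega> b v))\<^sup>2 \<le> C * (A v \<bullet> v)" using grad[OF v] by linarith
      then show ?thesis unfolding real_sqrt_mult[symmetric] by (rule real_le_rsqrt)
    qed
    then have "(\<Sum>b\<in>Basis. norm (wpartial \<Omega> b v)) \<le> (\<Sum>b\<in>(Basis :: 'a set). sqrt C * sqrt (A v \<bullet> v))" by (rule sum_mono)
    then show ?thesis using 1 by (simp add: h1_size_def C'_def distrib_right mult.assoc)
  qed
  moreover have "C' > 0" unfolding C'_def using c(1) C(1) by (intro add_pos_nonneg) auto
  ultimately show ?thesis by blast
qed

text \<open>The coefficients are bounded on \<open>\<Omega>\<close>, so the integrand of the weak
  form is dominated pointwise by the product of the two first-order jets.\<close>

lemma bounded_form_test:
  "\<exists>M\<ge>0. \<forall>v\<in>D. \<forall>\<phi> :: 'a \<Rightarrow> 'a. test_function \<Omega> \<phi> \<longrightarrow> \<bar>A v \<bullet> abs_L2 \<phi>\<bar> \<le> M * (h1_size \<Omega> v * h1_size \<Omega> (abs_L2 \<phi>))"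
proof -
  have "uniformly_elliptic_second_order \<Omega> A" using op by (simp add: elliptic_operator_def)
  then obtain p :: "'a \<Rightarrow> 'a \<Rightarrow> 'a \<Rightarrow> 'a \<Rightarrow> 'a \<Rightarrow> real" and q :: "'a \<Rightarrow> 'a \<Rightarrow> 'a \<Rightarrow> 'a \<Rightarrow> real" and c :: "'a \<Rightarrow> 'a \<Rightarrow> 'a \<Rightarrow> real"
    where p': "\<forall>i\<in>Basis. \<forall>j\<in>Basis. \<forall>k\<in>Basis. \<forall>l\<in>Basis. p i j k l \<in> borel_measurable borel \<and> bounded (p i j k l ` \<Omega>)"
    and q': "\<forall>i\<in>Basis. \<forall>k\<in>Basis. \<forall>l\<in>Basis. q i k l \<in> borel_measurable borel \<and> bounded (q i k l ` \<Omega>)"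
    and c': "\<forall>i\<in>Basis. \<forall>k\<in>Basis. c i k \<in> borel_measurable borel \<and> bounded (c i k ` \<Omega>)"
    and weak_form: "\<forall>v \<in> D. \<forall>\<phi> :: 'a \<Rightarrow> 'a. test_function \<Omega> \<phi> \<longrightarrow>
        A v \<bullet> abs_L2 \<phi> = (LINT x:\<Omega>|lborel.
          (\<Sum>i\<in>Basis. \<Sum>j\<in>Basis. \<Sum>k\<in>Basis. \<Sum>l\<in>Basis.
            p i j k l x * (rep_L2 (wpartial \<Omega> l v) x \<bullet> k) * (partial_deriv j \<phi> x \<bullet> i)) +
          (\<Sum>i\<in>Basis. \<Sum>k\<in>Basis. \<Sum>l\<in>Basis.
            q i k l x * (rep_L2 (wpartial \<Omega> l v) x \<bullet> k) * (\<phi> x \<bullet> i)) +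
          (\<Sum>i\<in>Basis. \<Sum>k\<in>Basis. c i k x * (rep_L2 v x \<bullet> k) * (\<phi> x \<bullet> i)))"
    unfolding uniformly_elliptic_second_order_def by (elim exE conjE) (rule that, assumption+)
  have p: "bounded (p i j k l ` \<Omega>)" if "i \<in> Basis" "j \<in> Basis" "k \<in> Basis" "l \<in> Basis" for i j k l
    using p' that by blast
  have q: "bounded (q i k l ` \<Omega>)" if "i \<in> Basis" "k \<in> Basis" "l \<in> Basis" for i k l
    using q' that by blast
  have c: "bounded (c i k ` \<Omega>)" if "i \<in> Basis" "k \<in> Basis" for i k
    using c' that by blast
  define bd where "bd f = (SOME M. 0 \<le> M \<and> (\<forall>x\<in>\<Omega>. \<bar>f x\<bar> \<le> M))" for f :: "'a \<Rightarrow> real"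
  have bd: "0 \<le> bd f" "x \<in> \<Omega> \<Longrightarrow> \<bar>f x\<bar> \<le> bd f" if bf: "bounded (f ` \<Omega>)" for f x
  proof -
    obtain M where M: "\<And>x. x \<in> \<Omega> \<Longrightarrow> \<bar>f x\<bar> \<le> M" using bf by (auto simp: bounded_iff)
    have "\<exists>M. 0 \<le> M \<and> (\<forall>x\<in>\<Omega>. \<bar>f x\<bar> \<le> M)" by (rule exI[of _ "\<bar>M\<bar>"]) (use M in force)
    from someI_ex[OF this] show "0 \<le> bd f" "x \<in> \<Omega> \<Longrightarrow> \<bar>f x\<bar> \<le> bd f" by (auto simp: bd_def)
  qed
  define Mp where "Mp = (\<Sum>i\<in>Basis. \<Sum>j\<in>Basis. \<Sum>k\<in>Basis. \<Sum>l\<in>Basis. bd (p i j k l))"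
  define Mq where "Mq = (\<Sum>i\<in>Basis. \<Sum>k\<in>Basis. \<Sum>l\<in>Basis. bd (q i k l))"
  define Mc where "Mc = (\<Sum>i\<in>Basis. \<Sum>k\<in>Basis. bd (c i k))"
  have M0: "0 \<le> Mp" "0 \<le> Mq" "0 \<le> Mc"
    unfolding Mp_def Mq_def Mc_def using p q c by (auto intro!: sum_nonneg bd)
  have "\<bar>A v \<bullet> abs_L2 \<phi>\<bar> \<le> (Mp + Mq + Mc) * (h1_size \<Omega> v * h1_size \<Omega> (abs_L2 \<phi>))"
    if v: "v \<in> D" and \<phi>: "test_function \<Omega> \<phi>" for v and \<phi> :: "'a \<Rightarrow> 'a"
  proof -
    define w where "w = abs_L2 \<phi>"
    define F where "F x = (\<Sum>i\<in>Basis. \<Sum>j\<in>Basis. \<Sum>k\<in>Basis. \<Sum>l\<in>Basis.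
            p i j k l x * (rep_L2 (wpartial \<Omega> l v) x \<bullet> k) * (partial_deriv j \<phi> x \<bullet> i)) +
          (\<Sum>i\<in>Basis. \<Sum>k\<in>Basis. \<Sum>l\<in>Basis.
            q i k l x * (rep_L2 (wpartial \<Omega> l v) x \<bullet> k) * (\<phi> x \<bullet> i)) +
          (\<Sum>i\<in>Basis. \<Sum>k\<in>Basis. c i k x * (rep_L2 v x \<bullet> k) * (\<phi> x \<bullet> i))" for x
    let ?G = "\<lambda>x. (Mp + Mq + Mc) * (jet_norm \<Omega> v x * jet_norm \<Omega> w x)"
    have ae1: "AE x in lborel. rep_L2 w x = \<phi> x"
      unfolding w_def by (rule rep_abs_L2[OF test_function_sq_integrable[OF \<phi>]])
    have "AE x in lborel. \<forall>j\<in>Basis. rep_L2 (wpartial \<Omega> j w) x = partial_deriv j \<phi> x"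
      unfolding AE_ball_countable[OF countable_finite[OF finite_Basis]] w_def
      by (simp add: test_field_sobolev(2)[OF \<phi>] rep_abs_L2[OF test_function_sq_integrable[OF test_function_partial[OF \<phi>]]])
    with ae1 have "AE x in lborel. \<bar>indicator \<Omega> x *\<^sub>R F x\<bar> \<le> ?G x"
    proof eventually_elim
      case (elim x)
      let ?a = "jet_norm \<Omega> v x" and ?b = "jet_norm \<Omega> w x"
      have ab: "0 \<le> ?a" "0 \<le> ?b" unfolding jet_norm_def by (intro sum_nonneg norm_ge_zero)+
      have phi1: "norm (\<phi> x) \<le> ?b" using jet_norm_ge(1)[of w x \<Omega>] elim(1) by simp
      have phi2: "norm (partial_deriv j \<phi> x) \<le> ?b" if "j \<in> Basis" for j
        using jet_norm_ge(2)[OF that, of \<Omega> w x] elim(2) that by simp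
      have in_le: "\<bar>y \<bullet> k\<bar> \<le> t" if "norm y \<le> t" "k \<in> Basis" for y k :: 'a and t
        using Basis_le_norm[OF that(2), of y] that(1) by linarith
      have trm: "\<bar>f x * s * t\<bar> \<le> bd f * (?a * ?b)"
        if "bounded (f ` \<Omega>)" "x \<in> \<Omega>" "\<bar>s\<bar> \<le> ?a" "\<bar>t\<bar> \<le> ?b" for f s t
        unfolding abs_mult mult.assoc by (intro mult_mono bd that) (use that ab bd in auto)
      show ?case
      proof (cases "x \<in> \<Omega>")
        case True
        have "\<bar>\<Sum>i\<in>Basis. \<Sum>j\<in>Basis. \<Sum>k\<in>Basis. \<Sum>l\<in>Basis.
            p i j k l x * (rep_L2 (wpartial \<Omega> l v) x \<bullet> k) * (partial_deriv j \<phi> x \<bullet> i)\<bar> \<le>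
          (\<Sum>i\<in>Basis. \<Sum>j\<in>Basis. \<Sum>k\<in>Basis. \<Sum>l\<in>Basis. bd (p i j k l) * (?a * ?b))"
          by (intro order_trans[OF sum_abs] sum_mono trm True in_le jet_norm_ge p phi2)
        moreover have "\<bar>\<Sum>i\<in>Basis. \<Sum>k\<in>Basis. \<Sum>l\<in>Basis.
            q i k l x * (rep_L2 (wpartial \<Omega> l v) x \<bullet> k) * (\<phi> x \<bullet> i)\<bar> \<le>
          (\<Sum>i\<in>Basis. \<Sum>k\<in>Basis. \<Sum>l\<in>Basis. bd (q i k l) * (?a * ?b))"
          by (intro order_trans[OF sum_abs] sum_mono trm True in_le jet_norm_ge q phi1)
        moreover have "\<bar>\<Sum>i\<in>Basis. \<Sum>k\<in>Basis. c i k x * (rep_L2 v x \<bullet> k) * (\<phi> x \<bullet> i)\<bar> \<le>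
          (\<Sum>i\<in>Basis. \<Sum>k\<in>Basis. bd (c i k) * (?a * ?b))"
          by (intro order_trans[OF sum_abs] sum_mono trm True in_le jet_norm_ge c phi1)
        ultimately have "\<bar>F x\<bar> \<le> Mp * (?a * ?b) + Mq * (?a * ?b) + Mc * (?a * ?b)"
          unfolding F_def Mp_def Mq_def Mc_def sum_distrib_right by linarith
        then show ?thesis using True by (simp add: distrib_right)
      next
        case False
        then show ?thesis using M0 ab by simp
      qed
    qed
    then have "\<bar>LINT x|lborel. indicator \<Omega> x *\<^sub>R F x\<bar> \<le> (LINT x|lborel. ?G x)"
      by (rule abs_integral_le[rotated]) (intro integrable_mult_right jet_norm_product)
    also have "\<dots> \<le> (Mp + Mq + Mc) * (h1_size \<Omega> v * h1_size \<Omega> w)"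
      using jet_norm_product(2)[of \<Omega> v w] M0 by (simp add: mult_left_mono)
    finally show ?thesis
      using weak_form v \<phi> by (simp add: F_def w_def set_lebesgue_integral_def)
  qed
  then show ?thesis using M0 by (intro exI[of _ "Mp + Mq + Mc"]) auto
qed

lemma bounded_form: "\<exists>M\<ge>0. \<forall>v\<in>D. \<forall>w\<in>D. \<bar>A v \<bullet> w\<bar> \<le> M * (h1_size \<Omega> v * h1_size \<Omega> w)"
proof -
  obtain M where M: "M \<ge> 0" "\<And>v \<phi>. v \<in> D \<Longrightarrow> test_function \<Omega> (\<phi> :: 'a \<Rightarrow> 'a) \<Longrightarrow> \<bar>A v \<bullet> abs_L2 \<phi>\<bar> \<le> M * (h1_size \<Omega> v * h1_size \<Omega> (abs_L2 \<phi>))"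
    using bounded_form_test by blast
  have "\<bar>A v \<bullet> w\<bar> \<le> M * (h1_size \<Omega> v * h1_size \<Omega> w)" if v: "v \<in> D" and w: "w \<in> D" for v w
  proof -
    obtain \<phi> :: "nat \<Rightarrow> 'a \<Rightarrow> 'a" where \<phi>: "\<And>n. test_function \<Omega> (\<phi> n)" "(\<lambda>n. h1_size \<Omega> (w - abs_L2 (\<phi> n))) \<longlonglongrightarrow> 0"
      using sobolev0_approx[OF D_sobolev(2)[OF w]] by blast
    have "(\<lambda>n. w - abs_L2 (\<phi> n)) \<longlonglongrightarrow> 0"
      by (intro Lim_null_comparison[OF always_eventually \<phi>(2)] allI norm_le_h1_size)
    from tendsto_diff[OF tendsto_const[of w] this] have "(\<lambda>n. abs_L2 (\<phi> n)) \<longlonglongrightarrow> w" by simp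
    then have 1: "(\<lambda>n. \<bar>A v \<bullet> abs_L2 (\<phi> n)\<bar>) \<longlonglongrightarrow> \<bar>A v \<bullet> w\<bar>" by (intro tendsto_intros)
    have 2: "(\<lambda>n. M * (h1_size \<Omega> v * (h1_size \<Omega> w + h1_size \<Omega> (w - abs_L2 (\<phi> n))))) \<longlonglongrightarrow> M * (h1_size \<Omega> v * (h1_size \<Omega> w + 0))"
      by (intro tendsto_intros \<phi>(2))
    have "\<bar>A v \<bullet> abs_L2 (\<phi> n)\<bar> \<le> M * (h1_size \<Omega> v * (h1_size \<Omega> w + h1_size \<Omega> (w - abs_L2 (\<phi> n))))" for n
    proof -
      have "h1_size \<Omega> (abs_L2 (\<phi> n)) \<le> h1_size \<Omega> w + h1_size \<Omega> (w - abs_L2 (\<phi> n))"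
        using h1_size_reverse[OF test_field_sobolev(1)[OF \<phi>(1)] D_sobolev(1)[OF w], of n]
          h1_size_minus_commute[OF test_field_sobolev(1)[OF \<phi>(1)] D_sobolev(1)[OF w], of n] by simp
      then have "M * (h1_size \<Omega> v * h1_size \<Omega> (abs_L2 (\<phi> n))) \<le> M * (h1_size \<Omega> v * (h1_size \<Omega> w + h1_size \<Omega> (w - abs_L2 (\<phi> n))))"
        by (intro mult_left_mono M h1_size_nonneg)
      then show ?thesis using M(2)[OF v \<phi>(1), of n] by linarith
    qed
    then have "\<bar>A v \<bullet> w\<bar> \<le> M * (h1_size \<Omega> v * (h1_size \<Omega> w + 0))" using LIMSEQ_le[OF 1 2] by blast
    then show ?thesis by simp
  qed
  then show ?thesis using M(1) by blast
qed

text \<open>Links the abstract energy bounds with the norm of V. Coercivity makes the sequence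
  Cauchy in H^1, so the limit lies in V; boundedness of the form shows that all H^1-approximating
  sequences give one and the same limit, which resolves the definite description in
  \<open>energy_form\<close>.\<close>

lemma energy_norm_limit:
  assumes x: "\<And>n. x n \<in> D" "x \<longlonglongrightarrow> v" and bound: "\<And>n. A (x n) \<bullet> x n \<le> E\<^sup>2" and E: "0 \<le> E"
    and Cauchy: "\<And>r. r > 0 \<Longrightarrow> \<exists>N. \<forall>m\<ge>N. \<forall>n\<ge>N. A (x m - x n) \<bullet> (x m - x n) < r"
  shows "v \<in> sobolev0 \<Omega>" "energy_norm \<Omega> A v \<le> E"
proof -
  obtain C where C: "C > 0" "\<And>v. v \<in> D \<Longrightarrow> h1_size \<Omega> v \<le> C * sqrt (A v \<bullet> v)" using coercive by blast
  obtain M where M: "M \<ge> 0" "\<And>v w. v \<in> D \<Longrightarrow> w \<in> D \<Longrightarrow> \<bar>A v \<bullet> w\<bar> \<le> M * (h1_size \<Omega> v * h1_size \<Omega> w)"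
    using bounded_form by blast
  have xD: "x m - x n \<in> D" for m n by (rule subspace_diff[OF D_subspace x(1) x(1)])
  have hC: "\<exists>N. \<forall>m\<ge>N. \<forall>n\<ge>N. h1_size \<Omega> (x m - x n) < r" if r: "r > 0" for r
  proof -
    have "(r / C)\<^sup>2 > 0" using r C(1) by simp
    then obtain N where N: "\<And>m n. m \<ge> N \<Longrightarrow> n \<ge> N \<Longrightarrow> A (x m - x n) \<bullet> (x m - x n) < (r / C)\<^sup>2" using Cauchy by blast
    have "h1_size \<Omega> (x m - x n) < r" if "m \<ge> N" "n \<ge> N" for m n
    proof -
      have "sqrt (A (x m - x n) \<bullet> (x m - x n)) < sqrt ((r / C)\<^sup>2)" using N[OF that] by (rule real_sqrt_less_mono)
      also have "\<dots> = r / C" using r C(1) by simp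
      finally have "C * sqrt (A (x m - x n) \<bullet> (x m - x n)) < r" using C(1) by (simp add: pos_less_divide_eq mult.commute)
      then show ?thesis using C(2)[OF xD, of m n] by linarith
    qed
    then show ?thesis by blast
  qed
  show v0: "v \<in> sobolev0 \<Omega>" by (rule h1_Cauchy_limit(1)[OF D_sobolev(2)[OF x(1)] x(2) hC])
  have xv: "(\<lambda>n. h1_size \<Omega> (x n - v)) \<longlonglongrightarrow> 0"
    by (rule h1_Cauchy_limit(2)[OF D_sobolev(2)[OF x(1)] x(2) hC])
  note v1 = sobolev0_sobolev_1[OF v0]
  have diff0: "(\<lambda>n. A (X n) \<bullet> Y n - A (x n) \<bullet> x n) \<longlonglongrightarrow> 0"
    if X: "\<And>n. X n \<in> D" "(\<lambda>n. h1_size \<Omega> (X n - v)) \<longlonglongrightarrow> 0" and Y: "\<And>n. Y n \<in> D" "(\<lambda>n. h1_size \<Omega> (Y n - v)) \<longlonglongrightarrow> 0" for X Y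
  proof (rule Lim_null_comparison)
    define dx dX dY where "dx n = h1_size \<Omega> (x n - v)" and "dX n = h1_size \<Omega> (X n - v)" and "dY n = h1_size \<Omega> (Y n - v)" for n
    have "\<bar>A (X n) \<bullet> Y n - A (x n) \<bullet> x n\<bar> \<le> M * ((dX n + dx n) * (h1_size \<Omega> v + dY n)) + M * ((h1_size \<Omega> v + dx n) * (dY n + dx n))" for n
    proof -
      have "A (X n) \<bullet> Y n - A (x n) \<bullet> x n = A (X n - x n) \<bullet> Y n + A (x n) \<bullet> (Y n - x n)"
        by (simp add: A_diff[OF X(1) x(1)] inner_diff_left inner_diff_right)
      moreover have "\<bar>A (X n - x n) \<bullet> Y n\<bar> \<le> M * ((dX n + dx n) * (h1_size \<Omega> v + dY n))"
      proof -
        have "\<bar>A (X n - x n) \<bullet> Y n\<bar> \<le> M * (h1_size \<Omega> (X n - x n) * h1_size \<Omega> (Y n))"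
          by (intro M subspace_diff[OF D_subspace] X Y x)
        also have "\<dots> \<le> M * ((dX n + dx n) * (h1_size \<Omega> v + dY n))"
          unfolding dX_def dx_def dY_def
          by (intro mult_left_mono mult_mono M add_nonneg_nonneg h1_size_nonneg
              h1_size_triangle h1_size_reverse D_sobolev(1) X Y x v1)
        finally show ?thesis .
      qed
      moreover have "\<bar>A (x n) \<bullet> (Y n - x n)\<bar> \<le> M * ((h1_size \<Omega> v + dx n) * (dY n + dx n))"
      proof -
        have "\<bar>A (x n) \<bullet> (Y n - x n)\<bar> \<le> M * (h1_size \<Omega> (x n) * h1_size \<Omega> (Y n - x n))"
          by (intro M subspace_diff[OF D_subspace] X Y x)
        also have "\<dots> \<le> M * ((h1_size \<Omega> v + dx n) * (dY n + dx n))"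
          unfolding dX_def dx_def dY_def
          by (intro mult_left_mono mult_mono M add_nonneg_nonneg h1_size_nonneg
              h1_size_triangle h1_size_reverse D_sobolev(1) X Y x v1)
        finally show ?thesis .
      qed
      ultimately show ?thesis by linarith
    qed
    then show "\<forall>\<^sub>F n in sequentially. norm (A (X n) \<bullet> Y n - A (x n) \<bullet> x n)
        \<le> M * ((dX n + dx n) * (h1_size \<Omega> v + dY n)) + M * ((h1_size \<Omega> v + dx n) * (dY n + dx n))" by simp
    have "(\<lambda>n. M * ((dX n + dx n) * (h1_size \<Omega> v + dY n)) + M * ((h1_size \<Omega> v + dx n) * (dY n + dx n)))
        \<longlonglongrightarrow> M * ((0 + 0) * (h1_size \<Omega> v + 0)) + M * ((h1_size \<Omega> v + 0) * (0 + 0))"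
      unfolding dX_def dx_def dY_def by (intro tendsto_intros xv X Y)
    then show "(\<lambda>n. M * ((dX n + dx n) * (h1_size \<Omega> v + dY n)) + M * ((h1_size \<Omega> v + dx n) * (dY n + dx n))) \<longlonglongrightarrow> 0" by simp
  qed
  have hx: "h1_size \<Omega> (x n) \<le> C * E" for n
  proof -
    have "sqrt (A (x n) \<bullet> x n) \<le> E" using bound[of n] E by (simp add: real_sqrt_le_iff[symmetric, of _ "E\<^sup>2"] del: real_sqrt_le_iff)
    then have "C * sqrt (A (x n) \<bullet> x n) \<le> C * E" using C(1) by (intro mult_left_mono) auto
    then show ?thesis using C(2)[OF x(1), of n] by linarith
  qed
  have "Cauchy (\<lambda>n. A (x n) \<bullet> x n)"
  proof (rule CauchyI)
    fix r :: real assume r: "r > 0"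
    define B where "B = 2 * M * (C * E) + 1"
    have B: "B > 0" unfolding B_def using M(1) C(1) E by (intro add_nonneg_pos) auto
    obtain N where N: "\<And>m n. m \<ge> N \<Longrightarrow> n \<ge> N \<Longrightarrow> h1_size \<Omega> (x m - x n) < r / B" using hC[of "r / B"] r B by auto
    have "norm (A (x m) \<bullet> x m - A (x n) \<bullet> x n) < r" if "m \<ge> N" "n \<ge> N" for m n
    proof -
      let ?h = "h1_size \<Omega> (x m - x n)"
      have "A (x m) \<bullet> x m - A (x n) \<bullet> x n = A (x m - x n) \<bullet> x m + A (x n) \<bullet> (x m - x n)"
        by (simp add: A_diff[OF x(1) x(1)] inner_diff_left inner_diff_right)
      moreover have "\<bar>A (x m - x n) \<bullet> x m\<bar> \<le> M * (?h * (C * E))"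
        by (rule order_trans[OF M(2)[OF xD x(1)]]) (intro mult_left_mono hx M h1_size_nonneg)
      moreover have "\<bar>A (x n) \<bullet> (x m - x n)\<bar> \<le> M * ((C * E) * ?h)"
        by (rule order_trans[OF M(2)[OF x(1) xD]]) (intro mult_left_mono mult_right_mono hx M h1_size_nonneg)
      ultimately have "norm (A (x m) \<bullet> x m - A (x n) \<bullet> x n) \<le> 2 * M * (C * E) * ?h"
        by (simp add: mult_ac)
      also have "\<dots> \<le> B * ?h" unfolding B_def by (intro mult_right_mono h1_size_nonneg) simp
      also have "\<dots> < r" using N[OF that] B by (simp add: pos_less_divide_eq mult.commute)
      finally show ?thesis .
    qed
    then show "\<exists>N. \<forall>m\<ge>N. \<forall>n\<ge>N. norm (A (x m) \<bullet> x m - A (x n) \<bullet> x n) < r" by blast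
  qed
  then obtain l where l: "(\<lambda>n. A (x n) \<bullet> x n) \<longlonglongrightarrow> l" by (metis Cauchy_convergent_iff convergent_def)
  have lE: "l \<le> E\<^sup>2" by (rule LIMSEQ_le_const2[OF l]) (use bound in auto)
  have "energy_form \<Omega> A v v = l"
    unfolding energy_form_def h1_tendsto_iff
  proof (rule the_equality)
    show "\<forall>X Y. (\<forall>n. X n \<in> D) \<and> (\<lambda>n. h1_size \<Omega> (X n - v)) \<longlonglongrightarrow> 0 \<and> (\<forall>n. Y n \<in> D) \<and> (\<lambda>n. h1_size \<Omega> (Y n - v)) \<longlonglongrightarrow> 0
        \<longrightarrow> (\<lambda>n. A (X n) \<bullet> Y n) \<longlonglongrightarrow> l"
    proof (intro allI impI, elim conjE)
      fix X Y assume "\<forall>n. X n \<in> D" "(\<lambda>n. h1_size \<Omega> (X n - v)) \<longlonglongrightarrow> 0" "\<forall>n. Y n \<in> D" "(\<lambda>n. h1_size \<Omega> (Y n - v)) \<longlonglongrightarrow> 0"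
      then have "(\<lambda>n. A (X n) \<bullet> Y n - A (x n) \<bullet> x n) \<longlonglongrightarrow> 0" by (intro diff0) blast+
      from tendsto_add[OF this l] show "(\<lambda>n. A (X n) \<bullet> Y n) \<longlonglongrightarrow> l" by simp
    qed
    fix l' assume "\<forall>X Y. (\<forall>n. X n \<in> D) \<and> (\<lambda>n. h1_size \<Omega> (X n - v)) \<longlonglongrightarrow> 0 \<and> (\<forall>n. Y n \<in> D) \<and> (\<lambda>n. h1_size \<Omega> (Y n - v)) \<longlonglongrightarrow> 0
        \<longrightarrow> (\<lambda>n. A (X n) \<bullet> Y n) \<longlonglongrightarrow> l'"
    then have "(\<lambda>n. A (x n) \<bullet> x n) \<longlonglongrightarrow> l'" using x(1) xv by blast
    then show "l' = l" using l LIMSEQ_unique by blast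
  qed
  then show "energy_norm \<Omega> A v \<le> E"
    unfolding energy_norm_def using lE E real_le_lsqrt real_sqrt_le_mono[OF lE] by simp
qed

end

subsection \<open>The memory kernel\<close>

lemma set_integrable_bounded_mult:
  fixes f g :: "'a::euclidean_space \<Rightarrow> real"
  assumes g: "set_integrable lborel S g" and f: "continuous_on UNIV f" "\<And>x. \<bar>f x\<bar> \<le> B"
  shows "set_integrable lborel S (\<lambda>x. f x * g x)"
  unfolding set_integrable_def
proof (rule Bochner_Integration.integrable_bound)
  have m: "(\<lambda>x. indicator S x *\<^sub>R g x) \<in> borel_measurable lborel"
    using g by (auto simp: set_integrable_def)
  have B: "0 \<le> B" using f(2)[of 0] by linarith
  show "integrable lborel (\<lambda>x. B * (indicator S x *\<^sub>R g x))"
    using g unfolding set_integrable_def by (rule integrable_mult_right)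
  have "(\<lambda>x. f x * (indicator S x *\<^sub>R g x)) \<in> borel_measurable lborel"
    using borel_measurable_continuous_onI[OF f(1)] m by (intro borel_measurable_times) auto
  then show "(\<lambda>x. indicator S x *\<^sub>R (f x * g x)) \<in> borel_measurable lborel" by (simp add: mult_ac)
  have "norm (indicator S x *\<^sub>R (f x * g x)) \<le> norm (B * (indicator S x *\<^sub>R g x))" for x
    using f(2)[of x] B by (auto simp: indicator_def abs_mult intro!: mult_right_mono)
  then show "AE x in lborel. norm (indicator S x *\<^sub>R (f x * g x)) \<le> norm (B * (indicator S x *\<^sub>R g x))" by simp
qed

lemma test_function_bounded:
  fixes \<psi> :: "'a::euclidean_space \<Rightarrow> real"
  assumes "test_function \<Omega> \<psi>"
  shows "\<exists>B. \<forall>x. \<bar>\<psi> x\<bar> \<le> B"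
proof -
  obtain S where S: "compact S" "\<And>x. x \<notin> S \<Longrightarrow> \<psi> x = 0"
    using assms unfolding test_function_def by blast
  have c: "continuous_on UNIV \<psi>" using assms unfolding test_function_def smooth_on_def by (metis Ck_on.simps(1))
  have "bounded (\<psi> ` S)" by (intro compact_imp_bounded compact_continuous_image continuous_on_subset[OF c] S) simp
  then obtain B where B: "\<And>x. x \<in> S \<Longrightarrow> \<bar>\<psi> x\<bar> \<le> B" by (auto simp: bounded_iff)
  have "\<bar>\<psi> x\<bar> \<le> max B 0" for x using S(2)[of x] B[of x] by (cases "x \<in> S") auto
  then show ?thesis by blast
qed

text \<open>Its negative is the primitive of \<open>h\<close> that vanishes at infinity. The maximum
  with 0 continues it as a constant to negative arguments, which makes it continuous on the whole
  line.\<close>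

definition tail_integral :: "(real \<Rightarrow> real) \<Rightarrow> real \<Rightarrow> real" where
  "tail_integral h t = (LINT s:{max t 0<..}|lborel. h s)"

lemma tail_integrable:
  assumes "set_integrable lborel {0<..} (h :: real \<Rightarrow> real)"
  shows "set_integrable lborel {max t 0<..} h"
  by (rule set_integrable_subset[OF assms]) auto

lemma tail_integral_abs_le:
  assumes "set_integrable lborel {0<..} h" "s \<le> t"
  shows "\<bar>tail_integral h t\<bar> \<le> tail_integral (\<lambda>x. \<bar>h x\<bar>) s"
proof -
  have "\<bar>tail_integral h t\<bar> \<le> (LINT s|lborel. \<bar>indicator {max t 0<..} s *\<^sub>R h s\<bar>)"
    unfolding tail_integral_def set_lebesgue_integral_def by (rule integral_abs_bound)
  also have "\<dots> \<le> (LINT x|lborel. indicator {max s 0<..} x *\<^sub>R \<bar>h x\<bar>)"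
    using tail_integrable[OF assms(1), of t] tail_integrable[OF set_integrable_abs[OF assms(1)], of s] assms(2)
    unfolding set_integrable_def by (intro integral_mono) (auto simp: indicator_def)
  finally show ?thesis by (simp add: tail_integral_def set_lebesgue_integral_def)
qed

lemma tail_integral_le:
  assumes "set_integrable lborel {0<..} h"
  shows "\<bar>tail_integral h t\<bar> \<le> L1_norm_pos h"
proof -
  have "tail_integral (\<lambda>x. \<bar>h x\<bar>) (min t 0) = L1_norm_pos h"
    by (simp add: tail_integral_def L1_norm_pos_def max_def min_def)
  then show ?thesis using tail_integral_abs_le[OF assms, of "min t 0" t] by simp
qed

lemma tail_integral_continuous:
  assumes h: "set_integrable lborel {0<..} h"
  shows "continuous_on UNIV (tail_integral h)"
  unfolding continuous_on_sequentially
proof (intro allI ballI impI, elim conjE)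
  fix X :: "nat \<Rightarrow> real" and t assume X: "X \<longlonglongrightarrow> t"
  define h0 where "h0 s = indicator {0<..} s *\<^sub>R h s" for s
  have h0: "integrable lborel h0" using h by (simp add: set_integrable_def h0_def[abs_def])
  have eq: "indicator {max t 0<..} s *\<^sub>R h s = indicator {t<..} s *\<^sub>R h0 s" for s t
    by (auto simp: h0_def indicator_def)
  have Xeq: "(tail_integral h \<circ> X) = (\<lambda>n. LINT s|lborel. indicator {X n<..} s *\<^sub>R h0 s)"
    by (simp only: fun_eq_iff tail_integral_def set_lebesgue_integral_def eq comp_def) simp
  have teq: "tail_integral h t = (LINT s|lborel. indicator {t<..} s *\<^sub>R h0 s)"
    by (simp only: tail_integral_def set_lebesgue_integral_def eq)
  show "(tail_integral h \<circ> X) \<longlonglongrightarrow> tail_integral h t"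
    unfolding Xeq teq
  proof (rule integral_dominated_convergence)
    show "integrable lborel (\<lambda>s. \<bar>h0 s\<bar>)" using h0 by simp
    show "(\<lambda>s. indicator {t<..} s *\<^sub>R h0 s) \<in> borel_measurable lborel" for t
      using h0 by (intro borel_measurable_scaleR) auto
    then show "(\<lambda>s. indicator {X n<..} s *\<^sub>R h0 s) \<in> borel_measurable lborel" for n .
    show "AE s in lborel. norm (indicator {X n<..} s *\<^sub>R h0 s) \<le> \<bar>h0 s\<bar>" for n
      by (auto simp: indicator_def)
    have "AE s in lborel. s \<noteq> t" by (rule AE_lborel_singleton)
    then show "AE s in lborel. (\<lambda>n. indicator {X n<..} s *\<^sub>R h0 s) \<longlonglongrightarrow> indicator {t<..} s *\<^sub>R h0 s"
    proof eventually_elim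
      case (elim s)
      show ?case
      proof (rule tendsto_eventually, cases "t < s")
        case True
        then have "\<forall>\<^sub>F n in sequentially. X n < s" using order_tendstoD(2)[OF X] by blast
        then show "\<forall>\<^sub>F n in sequentially. indicator {X n<..} s *\<^sub>R h0 s = indicator {t<..} s *\<^sub>R h0 s"
          by (rule eventually_mono) (use True in auto)
      next
        case False
        then have "\<forall>\<^sub>F n in sequentially. X n > s" using order_tendstoD(1)[OF X, of s] elim by auto
        then show "\<forall>\<^sub>F n in sequentially. indicator {X n<..} s *\<^sub>R h0 s = indicator {t<..} s *\<^sub>R h0 s"
          by (rule eventually_mono) (use False in auto)
      qed
    qed
  qed
qed

lemma tail_integral_diff:
  assumes h: "set_integrable lborel {0<..} h" and st: "0 \<le> s" "s \<le> t"
  shows "tail_integral h s - tail_integral h t = (LINT u:{s<..t}|lborel. h u)"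
proof -
  have U: "{s<..} = {s<..t} \<union> {t<..}" using st by auto
  have i1: "set_integrable lborel {s<..t} h"
    by (rule set_integrable_subset[OF h]) (use st in auto)
  have i2: "set_integrable lborel {t<..} h"
    by (rule set_integrable_subset[OF h]) (use st in auto)
  have "(LINT u:{s<..}|lborel. h u) = (LINT u:{s<..t}|lborel. h u) + (LINT u:{t<..}|lborel. h u)"
    by (subst U, rule set_integral_Un[OF _ i1 i2]) auto
  moreover have "max s 0 = s" "max t 0 = t" using st by auto
  ultimately show ?thesis by (simp add: tail_integral_def)
qed

lemma tail_integral_tendsto_0:
  assumes h: "set_integrable lborel {0<..} h"
  shows "(\<lambda>n. tail_integral h (real n)) \<longlonglongrightarrow> 0"
proof -
  define h0 where "h0 s = indicator {0<..} s *\<^sub>R h s" for s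
  have h0: "integrable lborel h0" using h by (simp add: set_integrable_def h0_def[abs_def])
  have "(\<lambda>n. LINT s|lborel. indicator {real n<..} s *\<^sub>R h0 s) \<longlonglongrightarrow> (LINT s::real|lborel. (0 :: real))"
  proof (rule integral_dominated_convergence[where f = "\<lambda>_. 0"])
    show "integrable lborel (\<lambda>s. \<bar>h0 s\<bar>)" using h0 by simp
    show "(\<lambda>s. indicator {real n<..} s *\<^sub>R h0 s) \<in> borel_measurable lborel" for n
      using h0 by (intro borel_measurable_scaleR) auto
    show "AE s in lborel. norm (indicator {real n<..} s *\<^sub>R h0 s) \<le> \<bar>h0 s\<bar>" for n
      by (auto simp: indicator_def)
    have "(\<lambda>n. indicator {real n<..} s *\<^sub>R h0 s) \<longlonglongrightarrow> 0" for s
    proof (rule tendsto_eventually)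
      show "\<forall>\<^sub>F n in sequentially. indicator {real n<..} s *\<^sub>R h0 s = 0"
        using eventually_ge_at_top[of "nat \<lceil>s\<rceil>"] by eventually_elim (simp add: nat_le_iff ceiling_le_iff)
    qed
    then show "AE s in lborel. (\<lambda>n. indicator {real n<..} s *\<^sub>R h0 s) \<longlonglongrightarrow> 0" by simp
  qed simp
  moreover have "indicator {max (real n) 0<..} s *\<^sub>R h s = indicator {real n<..} s *\<^sub>R h0 s" for s n
    by (auto simp: h0_def indicator_def)
  ultimately show ?thesis by (simp only: tail_integral_def set_lebesgue_integral_def) simp
qed

lemma test_function_integrable:
  fixes \<psi> :: "real \<Rightarrow> real"
  assumes "test_function \<Omega> \<psi>"
  shows "integrable lborel \<psi>"
proof -
  obtain S where S: "compact S" "\<And>x. x \<notin> S \<Longrightarrow> \<psi> x = 0"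
    using assms unfolding test_function_def by blast
  have c: "continuous_on S \<psi>" using assms unfolding test_function_def smooth_on_def
    by (metis Ck_on.simps(1) continuous_on_subset subset_UNIV)
  have "indicator S s *\<^sub>R \<psi> s = \<psi> s" for s using S(2)[of s] by (cases "s \<in> S") auto
  then show ?thesis using borel_integrable_compact[OF S(1) c] by (simp only:)
qed

text \<open>Zero mean makes the primitive vanish to the right of the support as well, so that it is
  compactly supported.\<close>

lemma test_function_antiderivative:
  fixes \<eta> :: "real \<Rightarrow> real"
  assumes \<eta>: "test_function {0<..} \<eta>" and zero: "(LINT s|lborel. \<eta> s) = 0"
  defines "\<phi> \<equiv> \<lambda>t. LINT s|lborel. indicator {..t} s * \<eta> s"
  shows "test_function {0<..} \<phi>" "partial_deriv 1 \<phi> = \<eta>"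
proof -
  obtain S where S: "compact S" "S \<subseteq> {0<..}" "\<And>x. x \<notin> S \<Longrightarrow> \<eta> x = 0"
    using \<eta> unfolding test_function_def by blast
  have Ck: "Ck_on k UNIV \<eta>" for k using \<eta> unfolding test_function_def smooth_on_def by blast
  have c: "continuous_on UNIV \<eta>" using Ck[of 0] by simp
  \<comment> \<open>The support is enlarged to an interval, because the primitive need not vanish in
    the gaps of \<open>S\<close>.\<close>
  have "compact (convex hull S)" "connected (convex hull S)"
    using S(1) by (auto intro: compact_convex_hull convex_connected convex_convex_hull)
  then obtain a b where ab: "convex hull S = {a..b}" using connected_compact_interval_1 by blast
  have sub: "{a..b} \<subseteq> {0<..}" unfolding ab[symmetric] by (rule hull_minimal) (use S(2) in auto)
  have \<eta>0: "\<eta> x = 0" if "x \<notin> {a..b}" for x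
    using S(3)[of x] that hull_subset[of S convex] ab by blast
  have \<phi>_eq: "\<phi> t = integral {a - 1..t} \<eta>" for t
  proof -
    have "indicator {..t} s * \<eta> s = indicator {a - 1..t} s *\<^sub>R \<eta> s" for s
      using \<eta>0[of s] by (auto simp: indicator_def)
    then have "\<phi> t = (LINT s:{a - 1..t}|lborel. \<eta> s)"
      by (simp only: \<phi>_def set_lebesgue_integral_def)
    also have "\<dots> = integral {a - 1..t} \<eta>"
      using borel_integrable_compact[OF compact_Icc continuous_on_subset[OF c subset_UNIV], of "a - 1" t]
      by (intro set_borel_integral_eq_integral(2)) (simp only: set_integrable_def)
    finally show ?thesis .
  qed
  have deriv: "(\<phi> has_real_derivative \<eta> t) (at t)" for t
  proof (cases "t < a")
    case True
    have "\<phi> s = 0" if "s < a" for s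
    proof -
      have "indicator {..s} u * \<eta> u = 0" for u using \<eta>0[of u] that by (auto simp: indicator_def)
      then show ?thesis by (simp only: \<phi>_def) simp
    qed
    then have "((\<lambda>_. 0) has_real_derivative \<eta> t) (at t) \<Longrightarrow> ?thesis"
      by (rule_tac has_field_derivative_transform_within_open[where S = "{..<a}"]) (use True in auto)
    moreover have "\<eta> t = 0" using \<eta>0[of t] True by auto
    ultimately show ?thesis by simp
  next
    case False
    have "((\<lambda>t. integral {a - 1..t} \<eta>) has_vector_derivative \<eta> t) (at t within {a - 1..t + 1})"
      by (rule integral_has_vector_derivative) (use False in \<open>auto intro: continuous_on_subset[OF c]\<close>)
    then have "((\<lambda>t. integral {a - 1..t} \<eta>) has_vector_derivative \<eta> t) (at t)"
      by (subst (asm) at_within_interior) (use False in auto)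
    then show ?thesis by (simp add: \<phi>_eq[abs_def] has_real_derivative_iff_has_vector_derivative)
  qed
  have fd: "(\<phi> has_derivative (\<lambda>h. \<eta> t * h)) (at t)" for t using deriv[of t] by (simp add: has_field_derivative_def)
  show "partial_deriv 1 \<phi> = \<eta>" using frechet_derivative_eqI[OF fd] by auto
  have supp: "\<phi> t = 0" if "t \<notin> {a..b}" for t
  proof (cases "t < a")
    case True
    have "indicator {..t} s * \<eta> s = 0" for s using \<eta>0[of s] True by (auto simp: indicator_def)
    then show ?thesis by (simp only: \<phi>_def) simp
  next
    case False
    then have "b < t" using that by auto
    then have "indicator {..t} s * \<eta> s = \<eta> s" for s using \<eta>0[of s] by (auto simp: indicator_def)
    then show ?thesis using zero by (simp only: \<phi>_def)
  qed
  have "Ck_on k UNIV \<phi>" for k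
  proof (rule Ck_on_Suc_imp, rule Ck_on_SucI[OF fd])
    show "Ck_on k UNIV (\<lambda>x. \<eta> x * b)" for b by (intro Ck_on_mult Ck Ck_on_const)
  qed
  then show "test_function {0<..} \<phi>"
    unfolding test_function_def smooth_on_def using sub supp by (auto intro!: exI[of _ "{a..b}"])
qed

lemma bump_1_2: "test_function {0<..} (bump 1 2 1 :: real \<Rightarrow> real)" "(LINT s|lborel. bump 1 2 1 (s :: real)) > 0"
proof -
  show tf: "test_function {0<..} (bump 1 2 1 :: real \<Rightarrow> real)" by (rule test_function_bump) (auto simp: cbox_interval)
  have pos: "bump 1 2 1 s > 0" if "s \<in> {1<..<2}" for s :: real
    using that by (auto simp: bump_def flat_def)
  have int: "integrable lborel (bump 1 2 1 :: real \<Rightarrow> real)" by (rule test_function_integrable[OF tf])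
  have nn: "AE s in lborel. 0 \<le> bump 1 2 1 (s :: real)" by (simp add: bump_bounds)
  have "(LINT s|lborel. bump 1 2 1 (s :: real)) \<noteq> 0"
  proof
    assume "(LINT s|lborel. bump 1 2 1 (s :: real)) = 0"
    then have "AE s in lborel. bump 1 2 1 (s :: real) = 0"
      using integral_nonneg_eq_0_iff_AE[OF int nn] by simp
    then have "AE s in lborel. s \<notin> {1<..<2::real}" by eventually_elim (use pos in force)
    then have "{1<..<2::real} \<in> null_sets lborel" by (subst AE_iff_null_sets) auto
    then have "emeasure lborel {1<..<2::real} = 0" by (rule null_setsD1)
    moreover have "emeasure lborel {1<..<2::real} = 1" by (subst emeasure_lborel_Ioo) auto
    ultimately show False by (metis zero_neq_one)
  qed
  moreover have "(LINT s|lborel. bump 1 2 1 (s :: real)) \<ge> 0" by (rule integral_nonneg_AE) (simp add: bump_bounds)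
  ultimately show "(LINT s|lborel. bump 1 2 1 (s :: real)) > 0" by simp
qed

text \<open>Testing with the primitive of $\psi - c\zeta$, where \<open>\<zeta>\<close> is a fixed test function and \<open>c\<close> makes the mean zero,
  shows that a function differs by a constant from the primitive of its weak derivative.\<close>

lemma weak_deriv_half_line:
  fixes g h :: "real \<Rightarrow> real"
  assumes g: "set_integrable lborel {0<..} g" and h: "set_integrable lborel {0<..} h" and wd: "weak_deriv {0<..} 1 g h"
  shows "AE t in lborel. t > 0 \<longrightarrow> g t = - tail_integral h t"
proof -
  define h0 where "h0 s = indicator {0<..} s *\<^sub>R h s" for s
  have h0: "integrable lborel h0" using h by (simp add: set_integrable_def h0_def[abs_def])
  define H where "H = tail_integral h"
  have H_eq: "H s = (LINT t|lborel. indicator {..t} s * h0 t)" for s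
  proof -
    have "AE t in lborel. t \<noteq> s" by (rule AE_lborel_singleton)
    then have ae: "AE t in lborel. indicator {..t} s * h0 t = indicator {max s 0<..} t *\<^sub>R h t"
      by eventually_elim (auto simp: h0_def indicator_def)
    have "(\<lambda>t. indicator {..t} s * h0 t) = (\<lambda>t. indicator {s..} t * h0 t)" by (auto simp: indicator_def)
    then have "(\<lambda>t. indicator {..t} s * h0 t) \<in> borel_measurable lborel"
      using h0 by (auto intro!: borel_measurable_times)
    then have "(LINT t|lborel. indicator {..t} s * h0 t) = (LINT t|lborel. indicator {max s 0<..} t *\<^sub>R h t)"
      using tail_integrable[OF h, of s] ae unfolding set_integrable_def
      by (intro integral_cong_AE) auto
    then show ?thesis by (simp add: H_def tail_integral_def set_lebesgue_integral_def)
  qed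
  have H_cont: "continuous_on UNIV H" unfolding H_def by (rule tail_integral_continuous[OF h])
  have H_bound: "\<bar>H t\<bar> \<le> L1_norm_pos h" for t unfolding H_def by (rule tail_integral_le[OF h])
  \<comment> \<open>Fubini replaces the integral of \<open>\<phi> t * h t\<close> by that of
    \<open>\<eta> s * H s\<close>, where \<open>\<phi>\<close> is the primitive of
    \<open>\<eta>\<close>.\<close>
  have key: "(LINT s:{0<..}|lborel. \<eta> s * (g s + H s)) = 0"
    if \<eta>: "test_function {0<..} \<eta>" and zero: "(LINT s|lborel. \<eta> s) = 0" for \<eta>
  proof -
    define \<phi> where "\<phi> t = (LINT s|lborel. indicator {..t} s * \<eta> s)" for t
    note anti = test_function_antiderivative[OF \<eta> zero, folded \<phi>_def[abs_def]]
    have \<eta>int: "integrable lborel \<eta>" by (rule test_function_integrable[OF \<eta>])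
    obtain B where B: "\<And>x. \<bar>\<eta> x\<bar> \<le> B" using test_function_bounded[OF \<eta>] by blast
    have c: "continuous_on UNIV \<eta>" using \<eta> unfolding test_function_def smooth_on_def by (metis Ck_on.simps(1))
    have supp: "\<eta> s = 0" if "s \<le> 0" for s
    proof -
      obtain S where "S \<subseteq> {0<..}" "\<And>x. x \<notin> S \<Longrightarrow> \<eta> x = 0" using \<eta> unfolding test_function_def by blast
      then show ?thesis using that by force
    qed
    have "(LINT s:{0<..}|lborel. \<eta> s * g s) = - (LINT t:{0<..}|lborel. \<phi> t * h t)"
      using wd anti unfolding weak_deriv_def by fastforce
    also have "(LINT t:{0<..}|lborel. \<phi> t * h t) = (LINT t|lborel. (LINT s|lborel. indicator {..t} s * \<eta> s * h0 t))"
      unfolding set_lebesgue_integral_def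
      by (rule Bochner_Integration.integral_cong) (auto simp: \<phi>_def h0_def)
    also have "\<dots> = (LINT s|lborel. (LINT t|lborel. indicator {..t} s * \<eta> s * h0 t))"
    proof (rule lborel_pair.Fubini_integral[symmetric])
      have [measurable]: "h0 \<in> borel_measurable borel" "\<eta> \<in> borel_measurable borel"
        using h0 \<eta>int by auto
      have prod: "integrable (lborel \<Otimes>\<^sub>M lborel) (\<lambda>(t, s). h0 t * \<eta> s)"
        by (rule lborel_pair.Fubini_integrable) (use h0 \<eta>int in \<open>auto simp: abs_mult\<close>)
      have "(\<lambda>(t, s). indicator {..t} s * \<eta> s * h0 t) = (\<lambda>p. (if snd p \<le> fst p then 1 else 0) * \<eta> (snd p) * h0 (fst p))"
        by (auto simp: indicator_def)
      then have meas: "(\<lambda>(t, s). indicator {..t} s * \<eta> s * h0 t) \<in> borel_measurable (lborel \<Otimes>\<^sub>M lborel)"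
        by simp
      show "integrable (lborel \<Otimes>\<^sub>M lborel) (\<lambda>(t, s). indicator {..t} s * \<eta> s * h0 t)"
      proof (rule Bochner_Integration.integrable_bound[OF prod meas], rule AE_I2)
        fix p :: "real \<times> real"
        show "norm (case p of (t, s) \<Rightarrow> indicator {..t} s * \<eta> s * h0 t) \<le> norm (case p of (t, s) \<Rightarrow> h0 t * \<eta> s)"
          by (cases p) (simp add: indicator_def abs_mult)
      qed
    qed
    also have "\<dots> = (LINT s|lborel. \<eta> s * H s)"
      by (rule Bochner_Integration.integral_cong) (auto simp: H_eq mult_ac simp flip: integral_mult_right_zero)
    also have "\<dots> = (LINT s:{0<..}|lborel. \<eta> s * H s)"
      unfolding set_lebesgue_integral_def by (rule Bochner_Integration.integral_cong) (auto simp: indicator_def supp not_less)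
    finally have 1: "(LINT s:{0<..}|lborel. \<eta> s * g s) = - (LINT s:{0<..}|lborel. \<eta> s * H s)" .
    have i1: "set_integrable lborel {0<..} (\<lambda>s. \<eta> s * g s)" by (rule set_integrable_bounded_mult[OF g c B])
    have i2: "set_integrable lborel {0<..} (\<lambda>s. \<eta> s * H s)"
    proof -
      have "set_integrable lborel {0<..} (\<lambda>s. H s * \<eta> s)"
        by (rule set_integrable_bounded_mult[OF _ H_cont H_bound])
          (rule integrable_mult_indicator[OF _ \<eta>int, folded set_integrable_def], simp)
      then show ?thesis by (simp add: mult.commute)
    qed
    show ?thesis using set_integral_add(2)[OF i1 i2] 1 by (simp add: distrib_left)
  qed
  define \<zeta> :: "real \<Rightarrow> real" where "\<zeta> = bump 1 2 1"
  have \<zeta>: "test_function {0<..} \<zeta>" "(LINT s|lborel. \<zeta> s) > 0" using bump_1_2 by (auto simp: \<zeta>_def)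
  have int: "set_integrable lborel {0<..} (\<lambda>s. \<psi> s * (g s + H s))" "(LINT s:{0<..}|lborel. \<psi> s) = (LINT s|lborel. \<psi> s)"
    "set_integrable lborel {0<..} \<psi>" "integrable lborel \<psi>"
    if \<psi>: "test_function {0<..} \<psi>" for \<psi>
  proof -
    obtain B where B: "\<And>x. \<bar>\<psi> x\<bar> \<le> B" using test_function_bounded[OF \<psi>] by blast
    have c: "continuous_on UNIV \<psi>" using \<psi> unfolding test_function_def smooth_on_def by (metis Ck_on.simps(1))
    show i: "integrable lborel \<psi>" by (rule test_function_integrable[OF \<psi>])
    show si: "set_integrable lborel {0<..} \<psi>"
      by (rule integrable_mult_indicator[OF _ i, folded set_integrable_def]) simp
    have "set_integrable lborel {0<..} (\<lambda>s. H s * \<psi> s)" by (rule set_integrable_bounded_mult[OF si H_cont H_bound])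
    then have "set_integrable lborel {0<..} (\<lambda>s. \<psi> s * H s)" by (simp add: mult.commute)
    with set_integrable_bounded_mult[OF g c B]
    show "set_integrable lborel {0<..} (\<lambda>s. \<psi> s * (g s + H s))"
      using set_integral_add(1)[of lborel "{0<..}" "\<lambda>s. \<psi> s * g s" "\<lambda>s. \<psi> s * H s"] by (simp add: distrib_left)
    obtain S where S: "S \<subseteq> {0<..}" "\<And>x. x \<notin> S \<Longrightarrow> \<psi> x = 0" using \<psi> unfolding test_function_def by blast
    have "indicator {0<..} s *\<^sub>R \<psi> s = \<psi> s" for s using S(2)[of s] S(1) by (cases "s \<in> S") auto
    then show "(LINT s:{0<..}|lborel. \<psi> s) = (LINT s|lborel. \<psi> s)" by (simp only: set_lebesgue_integral_def)
  qed
  define m where "m = (LINT s:{0<..}|lborel. \<zeta> s * (g s + H s)) / (LINT s|lborel. \<zeta> s)"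
  have zero: "(LINT s:{0<..}|lborel. \<psi> s *\<^sub>R (g s + H s - m)) = 0" if \<psi>: "test_function {0<..} \<psi>" for \<psi> :: "real \<Rightarrow> real"
  proof -
    define c where "c = (LINT s|lborel. \<psi> s) / (LINT s|lborel. \<zeta> s)"
    define \<eta> where "\<eta> s = \<psi> s + (- c) * \<zeta> s" for s
    obtain S1 where S1: "compact S1" "S1 \<subseteq> {0<..}" "\<And>x. x \<notin> S1 \<Longrightarrow> \<psi> x = 0" using \<psi> unfolding test_function_def by blast
    obtain S2 where S2: "compact S2" "S2 \<subseteq> {0<..}" "\<And>x. x \<notin> S2 \<Longrightarrow> \<zeta> x = 0" using \<zeta>(1) unfolding test_function_def by blast
    have "Ck_on k UNIV \<eta>" for k
      using \<psi> \<zeta>(1) unfolding \<eta>_def[abs_def] test_function_def smooth_on_def by (intro Ck_on_add Ck_on_mult Ck_on_const) auto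
    moreover have "compact (S1 \<union> S2) \<and> S1 \<union> S2 \<subseteq> {0<..} \<and> (\<forall>x. x \<notin> S1 \<union> S2 \<longrightarrow> \<eta> x = 0)"
      using S1 S2 by (auto simp: \<eta>_def)
    ultimately have \<eta>: "test_function {0<..} \<eta>" unfolding test_function_def smooth_on_def by blast
    have "(LINT s|lborel. \<eta> s) = (LINT s|lborel. \<psi> s) + (- c) * (LINT s|lborel. \<zeta> s)"
      unfolding \<eta>_def using int(4)[OF \<psi>] int(4)[OF \<zeta>(1)] by simp
    then have "(LINT s|lborel. \<eta> s) = 0" using \<zeta>(2) by (simp add: c_def)
    then have "0 = (LINT s:{0<..}|lborel. \<eta> s * (g s + H s))" using key[OF \<eta>] by simp
    also have "\<dots> = (LINT s:{0<..}|lborel. \<psi> s * (g s + H s) - c * (\<zeta> s * (g s + H s)))"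
      by (simp add: \<eta>_def algebra_simps)
    also have "\<dots> = (LINT s:{0<..}|lborel. \<psi> s * (g s + H s)) - (LINT s:{0<..}|lborel. c * (\<zeta> s * (g s + H s)))"
      by (rule set_integral_diff(2)[OF int(1)[OF \<psi>]]) (use int(1)[OF \<zeta>(1)] in simp)
    also have "(LINT s:{0<..}|lborel. c * (\<zeta> s * (g s + H s))) = (LINT s|lborel. \<psi> s) * m"
      by (simp add: c_def m_def)
    finally have eq: "(LINT s:{0<..}|lborel. \<psi> s * (g s + H s)) = (LINT s|lborel. \<psi> s) * m" by simp
    have "(LINT s:{0<..}|lborel. \<psi> s *\<^sub>R (g s + H s - m)) = (LINT s:{0<..}|lborel. \<psi> s * (g s + H s) - \<psi> s * m)"
      by (simp add: right_diff_distrib)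
    also have "\<dots> = (LINT s:{0<..}|lborel. \<psi> s * (g s + H s)) - (LINT s:{0<..}|lborel. \<psi> s * m)"
      by (rule set_integral_diff(2)[OF int(1)[OF \<psi>]]) (use int(3)[OF \<psi>] in simp)
    finally show ?thesis using eq int(2)[OF \<psi>] by simp
  qed
  have "AE t in lborel. t \<in> {0<..} \<longrightarrow> g t + H t - m = 0"
  proof (rule fundamental_lemma[OF _ _ zero])
    fix a b :: real assume sub: "cbox a b \<subseteq> {0<..}"
    have "set_integrable lborel (cbox a b) g" by (rule set_integrable_subset[OF g _ sub]) simp
    moreover have "set_integrable lborel (cbox a b) (\<lambda>t. H t - m)"
      unfolding set_integrable_def
      by (rule borel_integrable_compact) (auto intro!: continuous_intros continuous_on_subset[OF H_cont])
    ultimately have "set_integrable lborel (cbox a b) (\<lambda>t. g t + (H t - m))" by (rule set_integral_add(1))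
    then show "set_integrable lborel (cbox a b) (\<lambda>t. g t + H t - m)" by (simp add: algebra_simps)
  qed auto
  then have ae: "AE t in lborel. t > 0 \<longrightarrow> g t = m - H t" by eventually_elim auto
  \<comment> \<open>Since \<open>H\<close> tends to 0 at infinity, a nonzero \<open>m\<close> would
    keep \<open>g\<close> away from 0 on a half line, contradicting its integrability.\<close>
  have "m = 0"
  proof (rule ccontr)
    assume m: "m \<noteq> 0"
    have "(\<lambda>n. tail_integral (\<lambda>x. \<bar>h x\<bar>) (real n)) \<longlonglongrightarrow> 0"
      by (rule tail_integral_tendsto_0[OF set_integrable_abs[OF h]])
    then have "\<forall>\<^sub>F n in sequentially. tail_integral (\<lambda>x. \<bar>h x\<bar>) (real n) < \<bar>m\<bar> / 2"
      by (rule order_tendstoD(2)) (use m in simp)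
    then obtain n where n: "tail_integral (\<lambda>x. \<bar>h x\<bar>) (real n) < \<bar>m\<bar> / 2" by (auto simp: eventually_sequentially)
    have "integrable lborel (\<lambda>t. indicator {real n<..} t * (\<bar>m\<bar> / 2))"
    proof (rule Bochner_Integration.integrable_bound)
      show "integrable lborel (\<lambda>s. indicator {0<..} s *\<^sub>R g s)" using g by (simp add: set_integrable_def)
      show "AE t in lborel. norm (indicator {real n<..} t * (\<bar>m\<bar> / 2)) \<le> norm (indicator {0<..} t *\<^sub>R g t)"
        using ae
      proof eventually_elim
        case (elim t)
        show ?case
        proof (cases "real n < t")
          case True
          then have "\<bar>H t\<bar> \<le> tail_integral (\<lambda>x. \<bar>h x\<bar>) (real n)" unfolding H_def by (intro tail_integral_abs_le[OF h]) simp
          moreover have "g t = m - H t" using elim True by auto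
          ultimately have "\<bar>m\<bar> / 2 \<le> \<bar>g t\<bar>" using n by linarith
          then show ?thesis using True by auto
        qed simp
      qed
    qed simp
    then have "integrable lborel (\<lambda>t. indicator {real n<..} t * (\<bar>m\<bar> / 2) * (2 / \<bar>m\<bar>))"
      by (rule integrable_mult_left)
    then have "integrable lborel (indicator {real n<..} :: real \<Rightarrow> real)" using m by simp
    then have "emeasure lborel {real n<..} < \<infinity>" using integrable_indicator_iff[of lborel "{real n<..}"] by simp
    then obtain c where c: "0 \<le> c" "emeasure lborel {real n<..} = ennreal c"
      by (cases "emeasure lborel {real n<..}") auto
    have "emeasure lborel {real n<..<real n + (c + 1)} \<le> emeasure lborel {real n<..}"
      by (rule emeasure_mono) auto
    then have "ennreal (c + 1) \<le> ennreal c" using c by (subst (asm) emeasure_lborel_Ioo) auto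
    then show False using c(1) by (simp add: ennreal_le_iff del: ennreal_plus)
  qed
  then show ?thesis using ae by (simp add: H_def)
qed

section \<open>Iterated weak derivatives and the continuous kernel\<close>

lemma weak_deriv_pos_works:
  assumes "set_integrable lborel {0<..} h" "weak_deriv {0<..} 1 g h"
  shows "set_integrable lborel {0<..} (weak_deriv_pos g)" "weak_deriv {0<..} 1 g (weak_deriv_pos g)"
  using someI[of "\<lambda>h. set_integrable lborel {0<..} h \<and> weak_deriv {0<..} 1 g h" h] assms
  unfolding weak_deriv_pos_def by blast+

lemma weak_deriv_half_line_unique:
  fixes g h h' :: "real \<Rightarrow> real"
  assumes h: "set_integrable lborel {0<..} h" "weak_deriv {0<..} 1 g h"
    and h': "set_integrable lborel {0<..} h'" "weak_deriv {0<..} 1 g h'"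
  shows "AE t in lborel. t > 0 \<longrightarrow> h t = h' t"
proof -
  have "AE t in lborel. t \<in> {0<..} \<longrightarrow> h t - h' t = 0"
  proof (rule fundamental_lemma)
    fix \<phi> :: "real \<Rightarrow> real" assume \<phi>: "test_function {0<..} \<phi>"
    obtain B where B: "\<And>x. \<bar>\<phi> x\<bar> \<le> B" using test_function_bounded[OF \<phi>] by blast
    have c: "continuous_on UNIV \<phi>" using \<phi> unfolding test_function_def smooth_on_def by (metis Ck_on.simps(1))
    have "(LINT x:{0<..}|lborel. \<phi> x * h x - \<phi> x * h' x) = (LINT x:{0<..}|lborel. \<phi> x * h x) - (LINT x:{0<..}|lborel. \<phi> x * h' x)"
      by (intro set_integral_diff set_integrable_bounded_mult[OF _ c B] h h')
    also have "\<dots> = 0" using h(2) h'(2) \<phi> unfolding weak_deriv_def by fastforce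
    finally show "(LINT x:{0<..}|lborel. \<phi> x *\<^sub>R (h x - h' x)) = 0" by (simp add: right_diff_distrib)
  next
    fix a b :: real assume sub: "cbox a b \<subseteq> {0<..}"
    show "set_integrable lborel (cbox a b) (\<lambda>t. h t - h' t)"
      by (intro set_integral_diff set_integrable_subset[OF h(1) _ sub] set_integrable_subset[OF h'(1) _ sub]) auto
  qed simp
  then show ?thesis by eventually_elim auto
qed

lemma W1_pos_integrable: "g \<in> W1_pos r \<Longrightarrow> set_integrable lborel {0<..} g"
  by (cases r) auto

text \<open>\<open>weak_deriv_pos\<close> picks an arbitrary representative, so membership has to be
  insensitive to null sets.\<close>

lemma W1_pos_cong:
  assumes g: "g \<in> W1_pos r" and g': "set_integrable lborel {0<..} g'"
    and ae: "AE t in lborel. t > 0 \<longrightarrow> g t = g' t"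
  shows "g' \<in> W1_pos r"
proof (cases r)
  case 0
  then show ?thesis using g' by simp
next
  case (Suc n)
  then obtain h where h: "h \<in> W1_pos n" "weak_deriv {0<..} 1 g h" using g by auto
  have "weak_deriv {0<..} 1 g' h"
    unfolding weak_deriv_def
  proof (intro allI impI)
    fix \<phi> :: "real \<Rightarrow> real" assume \<phi>: "test_function {0<..} \<phi>"
    have "Ck_on 0 UNIV (partial_deriv 1 \<phi>)" using \<phi> unfolding test_function_def smooth_on_def by (metis Ck_on.simps(2) Basis_real_def insertI1)
    then have m: "partial_deriv 1 \<phi> \<in> borel_measurable lborel" using borel_measurable_continuous_onI by auto
    have meas: "(\<lambda>x. indicator {0<..} x *\<^sub>R (partial_deriv 1 \<phi> x *\<^sub>R k x)) \<in> borel_measurable lborel"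
      if "set_integrable lborel {0<..} k" for k :: "real \<Rightarrow> real"
    proof -
      have "(\<lambda>x. indicator {0<..} x *\<^sub>R k x) \<in> borel_measurable lborel" using that unfolding set_integrable_def by auto
      then have "(\<lambda>x. partial_deriv 1 \<phi> x * (indicator {0<..} x *\<^sub>R k x)) \<in> borel_measurable lborel"
        using m by (rule borel_measurable_times[rotated])
      then show ?thesis by (simp add: mult_ac)
    qed
    have "(LINT x:{0<..}|lborel. partial_deriv 1 \<phi> x *\<^sub>R g' x) = (LINT x:{0<..}|lborel. partial_deriv 1 \<phi> x *\<^sub>R g x)"
      unfolding set_lebesgue_integral_def
    proof (rule integral_cong_AE)
      show "AE x in lborel. indicator {0<..} x *\<^sub>R partial_deriv 1 \<phi> x *\<^sub>R g' x = indicator {0<..} x *\<^sub>R partial_deriv 1 \<phi> x *\<^sub>R g x"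
        using ae by eventually_elim (auto simp: indicator_def)
    qed (rule meas[OF g'], rule meas[OF W1_pos_integrable[OF g]])
    then show "(LINT x:{0<..}|lborel. partial_deriv 1 \<phi> x *\<^sub>R g' x) = - (LINT x:{0<..}|lborel. \<phi> x *\<^sub>R h x)"
      using h(2) \<phi> unfolding weak_deriv_def by simp
  qed
  then show ?thesis using g' h(1) Suc by auto
qed

lemma W1_pos_Suc:
  assumes "g \<in> W1_pos (Suc r)"
  shows "weak_deriv_pos g \<in> W1_pos r" "weak_deriv {0<..} 1 g (weak_deriv_pos g)"
proof -
  obtain h where h: "h \<in> W1_pos r" "weak_deriv {0<..} 1 g h" using assms by auto
  note w = weak_deriv_pos_works[OF W1_pos_integrable[OF h(1)] h(2)]
  show "weak_deriv {0<..} 1 g (weak_deriv_pos g)" by (rule w(2))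
  show "weak_deriv_pos g \<in> W1_pos r"
    by (rule W1_pos_cong[OF h(1) w(1) weak_deriv_half_line_unique[OF W1_pos_integrable[OF h(1)] h(2) w]])
qed

lemma L1_norm_pos_nonneg: "0 \<le> L1_norm_pos g"
  unfolding L1_norm_pos_def set_lebesgue_integral_def by (intro integral_nonneg_AE) auto

lemma W1_norm_pos_nonneg: "0 \<le> W1_norm_pos r g"
  by (induction r arbitrary: g) (auto intro: add_nonneg_nonneg L1_norm_pos_nonneg)

lemma W1_pos_iterate:
  assumes "g \<in> W1_pos r" "i \<le> r"
  shows "(weak_deriv_pos ^^ i) g \<in> W1_pos (r - i)" "L1_norm_pos ((weak_deriv_pos ^^ i) g) \<le> W1_norm_pos r g"
proof -
  have "(weak_deriv_pos ^^ i) g \<in> W1_pos (r - i) \<and> L1_norm_pos ((weak_deriv_pos ^^ i) g) \<le> W1_norm_pos r g"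
    using assms
  proof (induction r arbitrary: g i)
    case (Suc r)
    show ?case
    proof (cases i)
      case 0
      then show ?thesis using Suc.prems(1) W1_norm_pos_nonneg[of r "weak_deriv_pos g"] by (simp del: W1_pos.simps)
    next
      case (Suc j)
      have "(weak_deriv_pos ^^ j) (weak_deriv_pos g) \<in> W1_pos (r - j) \<and>
          L1_norm_pos ((weak_deriv_pos ^^ j) (weak_deriv_pos g)) \<le> W1_norm_pos r (weak_deriv_pos g)"
        by (rule Suc.IH[OF W1_pos_Suc(1)[OF Suc.prems(1)]]) (use Suc Suc.prems(2) in simp)
      then show ?thesis using L1_norm_pos_nonneg[of g] Suc by (simp add: funpow_swap1)
    qed
  qed simp
  then show "(weak_deriv_pos ^^ i) g \<in> W1_pos (r - i)" "L1_norm_pos ((weak_deriv_pos ^^ i) g) \<le> W1_norm_pos r g" by auto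
qed

lemma AE_nonneg_continuous:
  fixes F :: "real \<Rightarrow> real"
  assumes c: "continuous_on UNIV F" and ae: "AE t in lborel. t > 0 \<longrightarrow> F t \<ge> 0" and t: "t \<ge> 0"
  shows "F t \<ge> 0"
proof (rule ccontr)
  assume "\<not> ?thesis"
  moreover have "(F \<longlongrightarrow> F t) (at t)" using c by (simp add: continuous_on_def)
  ultimately have "\<forall>\<^sub>F s in at t. F s < 0" by (intro order_tendstoD(2)[of F "F t"]) auto
  then obtain d where d: "d > 0" "\<And>s. s \<noteq> t \<Longrightarrow> dist s t < d \<Longrightarrow> F s < 0" unfolding eventually_at by blast
  have "AE s in lborel. s \<notin> {t<..<t + d}"
    using ae
  proof eventually_elim
    case (elim s)
    then show ?case using d(2)[of s] t by (auto simp: dist_real_def)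
  qed
  then have "{t<..<t + d} \<in> null_sets lborel" by (subst AE_iff_null_sets) auto
  then have "emeasure lborel {t<..<t + d} = 0" by (rule null_setsD1)
  moreover have "emeasure lborel {t<..<t + d} = ennreal d" using d(1) by (subst emeasure_lborel_Ioo) auto
  ultimately show False using d(1) by simp
qed

text \<open>\<open>k i\<close> is minus the tail integral of the derivative of order
  \<open>i + 1\<close>: it is continuous, agrees almost everywhere with the derivative of order
  \<open>i\<close>, and is bounded by the L1 norm of the next derivative. That norm is a summand of
  the W-norm, which is below 1, for all \<open>i < r\<close>.\<close>

lemma kernel_representation:
  assumes K: "admissible_kernel r K" and r: "r \<ge> 1"
  shows "\<exists>k. memory_kernel (k 0) (L1_norm_pos K) \<and>
    (\<forall>i<r. continuous_on UNIV (k i) \<and> (\<forall>t. \<bar>k i t\<bar> \<le> 1)) \<and>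
    (\<forall>i T. Suc i < r \<longrightarrow> (\<forall>t\<in>{0..T}. (k i has_real_derivative k (Suc i) t) (at t within {0..T}))) \<and>
    (AE t in lborel. t > 0 \<longrightarrow> K t = k 0 t)"
proof -
  define h where "h i = (weak_deriv_pos ^^ i) K" for i
  define k where "k i t = - tail_integral (h (Suc i)) t" for i t
  have W: "K \<in> W1_pos r" "W1_norm_pos r K < 1" "L1_norm_pos K < 1"
    "AE t in lborel. t > 0 \<longrightarrow> K t \<ge> 0" "AE t in lborel. t > 0 \<longrightarrow> weak_deriv_pos K t \<le> 0"
    using K by (auto simp: admissible_kernel_def)
  have int: "set_integrable lborel {0<..} (h i)" if "i \<le> r" for i
    using W1_pos_integrable W1_pos_iterate(1)[OF W(1) that] by (auto simp: h_def)
  have norm: "L1_norm_pos (h i) \<le> 1" if "i \<le> r" for i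
    using W1_pos_iterate(2)[OF W(1) that] W(2) by (simp add: h_def)
  have wd: "weak_deriv {0<..} 1 (h i) (h (Suc i))" if "i < r" for i
  proof -
    have "h i \<in> W1_pos (Suc (r - Suc i))" using W1_pos_iterate(1)[OF W(1), of i] that by (simp only: h_def Suc_diff_Suc less_imp_le)
    then show ?thesis using W1_pos_Suc(2)[of "h i"] by (simp only: h_def funpow.simps comp_def)
  qed
  have ae: "AE t in lborel. t > 0 \<longrightarrow> h i t = k i t" if "i < r" for i
    unfolding k_def using that by (intro weak_deriv_half_line int wd) auto
  have cont: "continuous_on UNIV (k i)" if "i < r" for i
    unfolding k_def[abs_def] using that by (intro continuous_on_minus tail_integral_continuous int) auto
  have bound: "\<bar>k i t\<bar> \<le> 1" if "i < r" for i t
    using tail_integral_le[OF int[of "Suc i"], of t] norm[of "Suc i"] that by (simp add: k_def)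
  have ki: "k i t = k i 0 + integral {0..t} (k (Suc i))" if i: "Suc i < r" and t: "0 \<le> t" for i t
  proof -
    have "k i t - k i 0 = (LINT u:{0<..t}|lborel. h (Suc i) u)"
      using tail_integral_diff[OF int[of "Suc i"] order_refl t] i by (simp add: k_def)
    also have "\<dots> = (LINT u:{0..t}|lborel. k (Suc i) u)"
      unfolding set_lebesgue_integral_def
    proof (rule integral_cong_AE)
      have "AE u in lborel. u \<noteq> (0::real)" by (rule AE_lborel_singleton)
      then show "AE u in lborel. indicator {0<..t} u *\<^sub>R h (Suc i) u = indicator {0..t} u *\<^sub>R k (Suc i) u"
        using ae[OF i] by eventually_elim (auto simp: indicator_def)
      have "set_integrable lborel {0<..t} (h (Suc i))" by (rule set_integrable_subset[OF int]) (use i in auto)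
      then show "(\<lambda>u. indicator {0<..t} u *\<^sub>R h (Suc i) u) \<in> borel_measurable lborel" by (auto simp: set_integrable_def)
      show "(\<lambda>u. indicator {0..t} u *\<^sub>R k (Suc i) u) \<in> borel_measurable lborel"
        using borel_measurable_continuous_onI[OF cont[OF i]] by (intro borel_measurable_scaleR) auto
    qed
    also have "\<dots> = integral {0..t} (k (Suc i))"
      using borel_integrable_compact[OF compact_Icc continuous_on_subset[OF cont[OF i] subset_UNIV], of 0 t]
      by (intro set_borel_integral_eq_integral(2)) (simp only: set_integrable_def)
    finally show ?thesis by simp
  qed
  have deriv: "(k i has_real_derivative k (Suc i) t) (at t within {0..T})" if i: "Suc i < r" and t: "t \<in> {0..T}" for i t T
  proof -
    have "((\<lambda>t. integral {0..t} (k (Suc i))) has_vector_derivative k (Suc i) t) (at t within {0..T})"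
      by (rule integral_has_vector_derivative[OF continuous_on_subset[OF cont[OF i] subset_UNIV] t])
    then have "((\<lambda>t. k i 0 + integral {0..t} (k (Suc i))) has_vector_derivative 0 + k (Suc i) t) (at t within {0..T})"
      by (intro has_vector_derivative_add has_vector_derivative_const)
    then have "((\<lambda>t. k i 0 + integral {0..t} (k (Suc i))) has_real_derivative k (Suc i) t) (at t within {0..T})"
      by (simp add: has_real_derivative_iff_has_vector_derivative)
    then show ?thesis
      by (rule has_field_derivative_transform_within[OF _ zero_less_one t]) (rule ki[OF i, symmetric], simp)
  qed
  have r0: "0 < r" using r by simp
  have ae0: "AE t in lborel. t > 0 \<longrightarrow> K t = k 0 t" using ae[OF r0] by (simp add: h_def)
  have "AE t in lborel. t > 0 \<longrightarrow> k 0 t \<ge> 0" using ae0 W(4) by eventually_elim auto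
  then have nonneg: "k 0 t \<ge> 0" if "t \<ge> 0" for t
    by (rule AE_nonneg_continuous[OF cont[OF r0] _ that])
  have anti: "k 0 t \<le> k 0 s" if st: "0 \<le> s" "s \<le> t" for s t
  proof -
    have "k 0 s - k 0 t = - (LINT u:{s<..t}|lborel. h 1 u)"
      using tail_integral_diff[OF int[of 1] st] r by (simp add: k_def)
    also have "\<dots> = (LINT u|lborel. - (indicator {s<..t} u *\<^sub>R h 1 u))" by (simp add: set_lebesgue_integral_def)
    also have "\<dots> \<ge> 0"
    proof (rule integral_nonneg_AE)
      have "AE u in lborel. u > 0 \<longrightarrow> h 1 u \<le> 0" using W(5) by (simp add: h_def)
      then show "AE u in lborel. 0 \<le> - (indicator {s<..t} u *\<^sub>R h 1 u)"
        by eventually_elim (use st in \<open>auto simp: indicator_def\<close>)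
    qed
    finally show ?thesis by simp
  qed
  have mass: "integral {0..t} (k 0) \<le> L1_norm_pos K" for t
  proof -
    have c: "integrable lborel (\<lambda>u. indicator {0..t} u *\<^sub>R k 0 u)"
      by (rule borel_integrable_compact[OF compact_Icc continuous_on_subset[OF cont[OF r0] subset_UNIV]])
    have "integral {0..t} (k 0) = (LINT u|lborel. indicator {0..t} u *\<^sub>R k 0 u)"
      using set_borel_integral_eq_integral(2)[of "{0..t}" "k 0"] c by (simp only: set_integrable_def set_lebesgue_integral_def)
    also have "\<dots> \<le> (LINT u|lborel. indicator {0<..} u *\<^sub>R \<bar>K u\<bar>)"
    proof (rule integral_mono_AE[OF c])
      show "integrable lborel (\<lambda>u. indicator {0<..} u *\<^sub>R \<bar>K u\<bar>)"
        using set_integrable_abs[OF W1_pos_integrable[OF W(1)]] by (simp only: set_integrable_def)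
      have "AE u in lborel. u \<noteq> (0::real)" by (rule AE_lborel_singleton)
      then show "AE u in lborel. indicator {0..t} u *\<^sub>R k 0 u \<le> indicator {0<..} u *\<^sub>R \<bar>K u\<bar>"
        using ae0 by eventually_elim (auto simp: indicator_def)
    qed
    finally show ?thesis by (simp add: L1_norm_pos_def set_lebesgue_integral_def)
  qed
  have "memory_kernel (k 0) (L1_norm_pos K)"
  proof
    show "k 0 0 \<le> 1" using bound[OF r0, of 0] by linarith
  qed (use cont[OF r0] nonneg anti mass W(3) in auto)
  then show ?thesis using cont bound deriv ae0 by (intro exI[of _ k]) blast
qed

text \<open>The exceptional set of the kernel enters reflected and translated, which preserves
  negligibility. The point \<open>s = t\<close> is added because the hypothesis is silent about the
  argument 0.\<close>

lemma conv_cong_AE: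
  assumes "AE t in lborel. t > 0 \<longrightarrow> K t = k t"
  shows "integral {0..t} (\<lambda>s. K (t - s) *\<^sub>R u s) = conv k u t"
proof -
  define N where "N = {x. \<not> (x > 0 \<longrightarrow> K x = k x)}"
  have "AE t in lebesgue. t > 0 \<longrightarrow> K t = k t" using assms by (rule AE_completion)
  then obtain M where M: "M \<in> null_sets lebesgue" "N \<subseteq> M"
    by (auto simp: eventually_ae_filter N_def)
  then have "negligible N" by (metis negligible_iff_null_sets negligible_subset)
  then have "negligible ((+) t ` (uminus ` N))"
    by (intro negligible_translation negligible_differentiable_image_negligible)
      (auto simp: differentiable_on_def intro!: bounded_linear_imp_differentiable bounded_linear_minus[OF bounded_linear_ident])
  then have neg: "negligible (insert t ((+) t ` (uminus ` N)))" by simp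
  show ?thesis unfolding conv_def
  proof (rule integral_spike[OF neg])
    fix s assume s: "s \<in> {0..t} - insert t ((+) t ` (uminus ` N))"
    have "t - s \<notin> N"
    proof
      assume "t - s \<in> N"
      then have "t + - (t - s) \<in> (+) t ` (uminus ` N)" by blast
      then show False using s by simp
    qed
    then show "k (t - s) *\<^sub>R u s = K (t - s) *\<^sub>R u s" using s by (auto simp: N_def)
  qed
qed

subsection \<open>Time derivatives and absolute continuity\<close>

text \<open>Testing with the orthogonal complement reduces membership of vector-valued derivatives
  and integrals to statements about scalar functions.\<close>

lemma mem_closed_subspaceI:
  fixes M :: "'h::{real_inner,banach} set"
  assumes M: "subspace M" "closed M" and x: "\<And>y. (\<And>m. m \<in> M \<Longrightarrow> y \<bullet> m = 0) \<Longrightarrow> y \<bullet> x = 0"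
  shows "x \<in> M"
proof -
  obtain m where m: "m \<in> M" "\<forall>z\<in>M. (x - m) \<bullet> z = 0" using orthogonal_projection[OF M, of x] by blast
  have "(x - m) \<bullet> x = 0" by (rule x) (use m(2) in blast)
  moreover have "(x - m) \<bullet> m = 0" using m by blast
  ultimately have "(x - m) \<bullet> (x - m) = 0" by (simp only: inner_diff_right)
  then show ?thesis using m(1) by simp
qed

lemma has_vector_derivative_zero_const:
  fixes f :: "real \<Rightarrow> 'h::real_normed_vector"
  assumes "\<And>t. t \<in> {0..T} \<Longrightarrow> (f has_vector_derivative 0) (at t within {0..T})" "t \<in> {0..T}"
  shows "f t = f 0"
  using has_vector_derivative_zero_constant[of "{0..T}" f] assms by fastforce

lemma vector_derivative_Icc:
  fixes f :: "real \<Rightarrow> 'h::real_normed_vector"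
  assumes "0 < T" "t \<in> {0..T}" "(f has_vector_derivative y) (at t within {0..T})"
  shows "vector_derivative f (at t within {0..T}) = y"
  using vector_derivative_within_cbox[of 0 T t f y] assms by (simp add: cbox_interval)

lemma derivative_mem_closed_subspace:
  fixes M :: "'h::{real_inner,banach} set"
  assumes M: "subspace M" "closed M" and T: "0 < T" and t: "t \<in> {0..T}"
    and f: "\<And>s. s \<in> {0..T} \<Longrightarrow> f s \<in> M" "(f has_vector_derivative f') (at t within {0..T})"
  shows "f' \<in> M"
proof (rule mem_closed_subspaceI[OF M])
  fix y assume y: "\<And>m. m \<in> M \<Longrightarrow> y \<bullet> m = 0"
  have "((\<lambda>s. y \<bullet> f s) has_vector_derivative y \<bullet> f') (at t within {0..T})"
    by (rule bounded_linear.has_vector_derivative[OF bounded_linear_inner_right f(2)])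
  then have "((\<lambda>s. 0) has_vector_derivative y \<bullet> f') (at t within {0..T})"
    by (rule has_vector_derivative_transform[OF t, rotated]) (use y f(1) in simp)
  then have "vector_derivative (\<lambda>s. 0) (at t within {0..T}) = y \<bullet> f'" by (rule vector_derivative_Icc[OF T t])
  moreover have "vector_derivative (\<lambda>s. 0 :: real) (at t within {0..T}) = 0"
    by (rule vector_derivative_Icc[OF T t has_vector_derivative_const])
  ultimately show "y \<bullet> f' = 0" by simp
qed

lemma integral_mem_closed_subspace:
  fixes M :: "'h::{real_inner,banach} set" and f :: "real \<Rightarrow> 'h"
  assumes M: "subspace M" "closed M" and f: "\<And>s. s \<in> {0..t} \<Longrightarrow> f s \<in> M"
  shows "integral {0..t} f \<in> M"
proof (cases "f integrable_on {0..t}")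
  case True
  show ?thesis
  proof (rule mem_closed_subspaceI[OF M])
    fix y assume y: "\<And>m. m \<in> M \<Longrightarrow> y \<bullet> m = 0"
    have "y \<bullet> integral {0..t} f = integral {0..t} (\<lambda>s. y \<bullet> f s)"
      using integral_linear[OF True bounded_linear_inner_right[of y]] by (simp add: o_def)
    also have "\<dots> = integral {0..t} (\<lambda>s. 0)" by (rule integral_cong) (use y f in simp)
    finally show "y \<bullet> integral {0..t} f = 0" by simp
  qed
next
  case False
  then show ?thesis using subspace_0[OF M(1)] by (simp add: not_integrable_integral)
qed

lemma times_differentiableD:
  assumes "times_differentiable T n g" "m < n" "t \<in> {0..T}"
  shows "(time_deriv T m g has_vector_derivative time_deriv T (Suc m) g t) (at t within {0..T})"
  using assms by (auto simp: times_differentiable_def vector_derivative_works)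

text \<open>Matches a chain of derivatives with the chosen \<open>time_deriv\<close>; derivatives
  are unique on an interval of positive length.\<close>

lemma time_deriv_eqI:
  assumes T: "0 < T" and w: "\<And>j t. j < n \<Longrightarrow> t \<in> {0..T} \<Longrightarrow> (w j has_vector_derivative w (Suc j) t) (at t within {0..T})"
  shows "times_differentiable T n (w 0)" "\<And>j t. j \<le> n \<Longrightarrow> t \<in> {0..T} \<Longrightarrow> time_deriv T j (w 0) t = w j t"
proof -
  show eq: "time_deriv T j (w 0) t = w j t" if "j \<le> n" "t \<in> {0..T}" for j t
    using that
  proof (induction j arbitrary: t)
    case (Suc j)
    have "(time_deriv T j (w 0) has_vector_derivative w (Suc j) t) (at t within {0..T})"
      by (rule has_vector_derivative_transform[OF Suc.prems(2) _ w[OF _ Suc.prems(2)]]) (use Suc in auto)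
    then show ?case using vector_derivative_Icc[OF T Suc.prems(2)] by simp
  qed simp
  show "times_differentiable T n (w 0)"
    unfolding times_differentiable_def
  proof (intro allI impI ballI)
    fix m t assume m: "m < n" and t: "t \<in> {0..T}"
    have "(time_deriv T m (w 0) has_vector_derivative w (Suc m) t) (at t within {0..T})"
      by (rule has_vector_derivative_transform[OF t _ w[OF m t]]) (use m in \<open>simp add: eq\<close>)
    then show "time_deriv T m (w 0) differentiable (at t within {0..T})" by (rule differentiableI_vector)
  qed
qed

section \<open>Absolutely continuous functions of time\<close>

lemma abs_contD:
  assumes "abs_cont T g" "\<epsilon> > 0"
  shows "\<exists>\<delta>>0. \<forall>P. finite P \<and> (\<forall>(a, b)\<in>P. 0 \<le> a \<and> a \<le> b \<and> b \<le> T) \<and>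
      disjoint_family_on (\<lambda>(a, b). {a<..<b}) P \<and> (\<Sum>(a, b)\<in>P. b - a) < \<delta> \<longrightarrow>
      (\<Sum>(a, b)\<in>P. norm (g b - g a)) < \<epsilon>"
  using assms unfolding abs_cont_def by blast

text \<open>Dominating the increments covers sums, bounded linear images and continuously differentiable functions alike.\<close>

lemma abs_cont_dominated:
  assumes g: "abs_cont T g" and h: "abs_cont T h" and c: "0 \<le> c"
    and le: "\<And>a b. 0 \<le> a \<Longrightarrow> a \<le> b \<Longrightarrow> b \<le> T \<Longrightarrow> norm (f b - f a) \<le> c * norm (g b - g a) + c * norm (h b - h a)"
  shows "abs_cont T f"
  unfolding abs_cont_def
proof (intro allI impI)
  fix \<epsilon> :: real assume \<epsilon>: "\<epsilon> > 0"
  define \<eta> where "\<eta> = \<epsilon> / 2 / (c + 1)"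
  have \<eta>: "\<eta> > 0" using \<epsilon> c by (simp add: \<eta>_def)
  obtain d1 where d1: "d1 > 0" "\<And>P. finite P \<Longrightarrow> (\<forall>(a, b)\<in>P. 0 \<le> a \<and> a \<le> b \<and> b \<le> T) \<Longrightarrow>
      disjoint_family_on (\<lambda>(a, b). {a<..<b}) P \<Longrightarrow> (\<Sum>(a, b)\<in>P. b - a) < d1 \<Longrightarrow>
      (\<Sum>(a, b)\<in>P. norm (g b - g a)) < \<eta>"
    using abs_contD[OF g \<eta>] by blast
  obtain d2 where d2: "d2 > 0" "\<And>P. finite P \<Longrightarrow> (\<forall>(a, b)\<in>P. 0 \<le> a \<and> a \<le> b \<and> b \<le> T) \<Longrightarrow>
      disjoint_family_on (\<lambda>(a, b). {a<..<b}) P \<Longrightarrow> (\<Sum>(a, b)\<in>P. b - a) < d2 \<Longrightarrow>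
      (\<Sum>(a, b)\<in>P. norm (h b - h a)) < \<eta>"
    using abs_contD[OF h \<eta>] by blast
  show "\<exists>\<delta>>0. \<forall>P. finite P \<and> (\<forall>(a, b)\<in>P. 0 \<le> a \<and> a \<le> b \<and> b \<le> T) \<and>
      disjoint_family_on (\<lambda>(a, b). {a<..<b}) P \<and> (\<Sum>(a, b)\<in>P. b - a) < \<delta> \<longrightarrow>
      (\<Sum>(a, b)\<in>P. norm (f b - f a)) < \<epsilon>"
  proof (rule exI[of _ "min d1 d2"], intro conjI allI impI)
    show "0 < min d1 d2" using d1 d2 by simp
    fix P :: "(real \<times> real) set"
    assume P: "finite P \<and> (\<forall>(a, b)\<in>P. 0 \<le> a \<and> a \<le> b \<and> b \<le> T) \<and>
      disjoint_family_on (\<lambda>(a, b). {a<..<b}) P \<and> (\<Sum>(a, b)\<in>P. b - a) < min d1 d2"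
    have G: "(\<Sum>(a, b)\<in>P. norm (g b - g a)) < \<eta>" by (rule d1(2)) (use P in auto)
    have H: "(\<Sum>(a, b)\<in>P. norm (h b - h a)) < \<eta>" by (rule d2(2)) (use P in auto)
    have "(\<Sum>(a, b)\<in>P. norm (f b - f a)) \<le> (\<Sum>(a, b)\<in>P. c * norm (g b - g a) + c * norm (h b - h a))"
      by (rule sum_mono) (use P le in fastforce)
    also have "\<dots> = c * (\<Sum>(a, b)\<in>P. norm (g b - g a)) + c * (\<Sum>(a, b)\<in>P. norm (h b - h a))"
      by (simp add: sum.distrib sum_distrib_left case_prod_unfold)
    also have "\<dots> \<le> c * \<eta> + c * \<eta>" using G H c by (intro add_mono mult_left_mono) auto
    also have "\<dots> < (c + 1) * \<eta> + (c + 1) * \<eta>" using \<eta> by (simp add: distrib_right)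
    also have "(c + 1) * \<eta> = \<epsilon> / 2"
    proof -
      have "c + 1 \<noteq> 0" using c by linarith
      then show ?thesis unfolding \<eta>_def by (metis nonzero_mult_div_cancel_left times_divide_eq_right)
    qed
    also have "\<epsilon> / 2 + \<epsilon> / 2 = \<epsilon>" by simp
    finally show "(\<Sum>(a, b)\<in>P. norm (f b - f a)) < \<epsilon>" .
  qed
qed

lemma abs_cont_id: "abs_cont T (\<lambda>t. t :: real)"
  unfolding abs_cont_def
proof (intro allI impI)
  fix \<epsilon> :: real assume \<epsilon>: "\<epsilon> > 0"
  have "(\<Sum>(a, b)\<in>P. norm (b - a)) = (\<Sum>(a, b)\<in>P. b - a)" if "\<forall>(a, b)\<in>P. 0 \<le> a \<and> a \<le> b \<and> b \<le> T"
    for P :: "(real \<times> real) set"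
    by (rule sum.cong) (use that in auto)
  then show "\<exists>\<delta>>0. \<forall>P. finite P \<and> (\<forall>(a, b)\<in>P. 0 \<le> a \<and> a \<le> b \<and> b \<le> T) \<and>
      disjoint_family_on (\<lambda>(a, b). {a<..<b}) P \<and> (\<Sum>(a, b)\<in>P. b - a) < \<delta> \<longrightarrow>
      (\<Sum>(a, b)\<in>P. norm (b - a)) < \<epsilon>"
    using \<epsilon> by (intro exI[of _ \<epsilon>]) simp
qed

lemma abs_cont_C1:
  fixes f :: "real \<Rightarrow> 'h::real_normed_vector"
  assumes f: "\<And>t. t \<in> {0..T} \<Longrightarrow> (f has_vector_derivative f' t) (at t within {0..T})" and c: "continuous_on {0..T} f'"
  shows "abs_cont T f"
proof -
  have "bounded (f' ` {0..T})" by (intro compact_imp_bounded compact_continuous_image c) simp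
  then obtain B where "\<forall>x\<in>f' ` {0..T}. norm x \<le> B" unfolding bounded_iff by blast
  then have B: "norm (f' t) \<le> B" if "t \<in> {0..T}" for t using that by blast
  show ?thesis
  proof (rule abs_cont_dominated[OF abs_cont_id abs_cont_id, of "\<bar>B\<bar>"])
    fix a b :: real assume ab: "0 \<le> a" "a \<le> b" "b \<le> T"
    have "norm (f b - f a) \<le> \<bar>B\<bar> * norm (b - a)"
    proof (rule differentiable_bound[of "{0..T}" f "\<lambda>t h. h *\<^sub>R f' t"])
      show "(f has_derivative (\<lambda>h. h *\<^sub>R f' t)) (at t within {0..T})" if "t \<in> {0..T}" for t
        using f[OF that] by (simp add: has_vector_derivative_def)
      show "onorm (\<lambda>h. h *\<^sub>R f' t) \<le> \<bar>B\<bar>" if "t \<in> {0..T}" for t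
        by (rule onorm_le) (use B[OF that] in \<open>auto simp: mult.commute intro!: mult_left_mono\<close>)
    qed (use ab in auto)
    then show "norm (f b - f a) \<le> \<bar>B\<bar> * norm (b - a) + \<bar>B\<bar> * norm (b - a)"
      using mult_nonneg_nonneg[OF abs_ge_zero norm_ge_zero, of B "b - a"] by linarith
  qed simp
qed

lemma abs_cont_cong:
  assumes "abs_cont T g" "\<And>t. t \<in> {0..T} \<Longrightarrow> f t = g t"
  shows "abs_cont T f"
  by (rule abs_cont_dominated[OF assms(1) assms(1), of 1]) (use assms(2) in auto)

lemma abs_cont_continuous:
  assumes "abs_cont T g"
  shows "continuous_on {0..T} g"
  unfolding continuous_on_iff
proof (intro ballI allI impI)
  fix x \<epsilon> :: real assume x: "x \<in> {0..T}" and \<epsilon>: "\<epsilon> > 0"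
  obtain d where d: "d > 0" "\<And>P. finite P \<Longrightarrow> (\<forall>(a, b)\<in>P. 0 \<le> a \<and> a \<le> b \<and> b \<le> T) \<Longrightarrow>
      disjoint_family_on (\<lambda>(a, b). {a<..<b}) P \<Longrightarrow> (\<Sum>(a, b)\<in>P. b - a) < d \<Longrightarrow>
      (\<Sum>(a, b)\<in>P. norm (g b - g a)) < \<epsilon>"
    using abs_contD[OF assms \<epsilon>] by blast
  have *: "norm (g b - g a) < \<epsilon>" if "0 \<le> a" "a \<le> b" "b \<le> T" "b - a < d" for a b
    using d(2)[of "{(a, b)}"] that by (simp add: disjoint_family_on_def)
  show "\<exists>d>0. \<forall>y\<in>{0..T}. dist y x < d \<longrightarrow> dist (g y) (g x) < \<epsilon>"
  proof (intro exI[of _ d] conjI ballI impI)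
    fix y assume y: "y \<in> {0..T}" "dist y x < d"
    show "dist (g y) (g x) < \<epsilon>"
    proof (cases "x \<le> y")
      case True
      then show ?thesis using *[of x y] x y by (auto simp: dist_norm)
    next
      case False
      then show ?thesis using *[of y x] x y by (auto simp: dist_norm norm_minus_commute)
    qed
  qed (use d in simp)
qed

primrec iterated_primitive :: "(nat \<Rightarrow> 'h::banach) \<Rightarrow> (real \<Rightarrow> 'h) \<Rightarrow> nat \<Rightarrow> real \<Rightarrow> 'h" where
  "iterated_primitive c v 0 = v"
| "iterated_primitive c v (Suc n) = (\<lambda>t. c n + integral {0..t} (iterated_primitive c v n))"

lemma iterated_primitive_derivative:
  assumes v: "continuous_on {0..T} v" and t: "t \<in> {0..T}"
  shows "(iterated_primitive c v (Suc n) has_vector_derivative iterated_primitive c v n t) (at t within {0..T})"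
proof -
  have d: "(iterated_primitive c v (Suc n) has_vector_derivative iterated_primitive c v n t) (at t within {0..T})"
    if "continuous_on {0..T} (iterated_primitive c v n)" "t \<in> {0..T}" for n t
  proof -
    have "((\<lambda>t. c n + integral {0..t} (iterated_primitive c v n)) has_vector_derivative 0 + iterated_primitive c v n t) (at t within {0..T})"
      by (intro has_vector_derivative_add has_vector_derivative_const integral_has_vector_derivative that)
    then show ?thesis by simp
  qed
  have "continuous_on {0..T} (iterated_primitive c v n)" for n
  proof (induction n)
    case (Suc n)
    show ?case unfolding continuous_on_eq_continuous_within
      by (intro ballI has_vector_derivative_continuous[OF d[OF Suc]])
  qed (simp add: v)
  then show ?thesis using d t by blast
qed

section \<open>Domains and norms of the powers of A\<close>

context elliptic_inverse
begin

abbreviation P where "P \<equiv> op_power_dom (L2_on \<Omega>) D A"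

lemma subspace_P: "subspace (P n)"
proof (induction n)
  case (Suc n)
  have "A 0 = 0" using A_scaleR[of 0 0] subspace_0[OF D_subspace] by simp
  then show ?case using D_subspace Suc A_add A_scaleR by (auto simp: subspace_def)
qed (simp add: subspace_L2_on)

lemma P_Suc_subset: "P (Suc n) \<subseteq> P n"
proof (induction n)
  case 0
  then show ?case using D_L2_on by auto
qed auto

lemma P_mono: "m \<le> n \<Longrightarrow> P n \<subseteq> P m"
  by (rule lift_Suc_antimono_le[of P]) (rule P_Suc_subset)

lemma P_power: "v \<in> P (m + n) \<Longrightarrow> (A ^^ m) v \<in> P n"
  by (induction m arbitrary: v) (auto simp: funpow_swap1)

text \<open>\<open>op_power_dom\<close> peels off the first application of \<open>A\<close>, whereas
  the compatibility conditions speak about the last one.\<close>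

lemma P_SucI: "v \<in> P n \<Longrightarrow> (A ^^ n) v \<in> D \<Longrightarrow> v \<in> P (Suc n)"
  by (induction n arbitrary: v) (use A_L2_on in \<open>auto simp: funpow_swap1\<close>)

lemma power_add: "v \<in> P n \<Longrightarrow> w \<in> P n \<Longrightarrow> (A ^^ n) (v + w) = (A ^^ n) v + (A ^^ n) w"
  by (induction n arbitrary: v w) (auto simp: A_add funpow_swap1)

lemma power_scaleR: "v \<in> P n \<Longrightarrow> (A ^^ n) (c *\<^sub>R v) = c *\<^sub>R (A ^^ n) v"
  by (induction n arbitrary: v) (auto simp: A_scaleR funpow_swap1)

lemma power_sum:
  assumes "finite I" "\<And>i. i \<in> I \<Longrightarrow> v i \<in> P n"
  shows "(A ^^ n) (\<Sum>i\<in>I. v i) = (\<Sum>i\<in>I. (A ^^ n) (v i))"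
  using assms
proof (induction rule: finite_induct)
  case empty
  then show ?case using power_scaleR[of 0 n 0] subspace_0[OF subspace_P] by simp
next
  case (insert i I)
  then show ?case using power_add[of "v i" n "sum v I"] subspace_sum[OF subspace_P, of I v] by simp
qed

text \<open>The lower power is recovered from the higher one by \<open>n\<close> applications of
  \<open>S\<close>, each costing a factor \<open>b\<close>.\<close>

lemma power_norm_le:
  assumes b: "b \<ge> 1" "\<And>x. norm (S x) \<le> b * norm x" and v: "v \<in> P (m + n)"
  shows "norm ((A ^^ m) v) \<le> b ^ n * norm ((A ^^ (m + n)) v)"
  using v
proof (induction n)
  case (Suc n)
  have "v \<in> P (m + n)" using Suc.prems P_Suc_subset[of "m + n"] by auto
  then have "norm ((A ^^ m) v) \<le> b ^ n * norm ((A ^^ (m + n)) v)" by (rule Suc.IH)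
  also have "(A ^^ (m + n)) v \<in> D" using P_power[of v "m + n" 1] Suc.prems by simp
  then have "norm ((A ^^ (m + n)) v) \<le> b * norm (A ((A ^^ (m + n)) v))" using b(2)[of "A ((A ^^ (m + n)) v)"] SA by simp
  finally show ?case using b(1) by (simp add: mult_left_mono mult.assoc mult.left_commute)
qed simp

end

subsection \<open>Regularity in time\<close>

text \<open>\<open>U j\<close> is the prescribed value of the j-th time derivative at 0. The
  recursion \<open>U_rec\<close> is the equation differentiated \<open>j\<close> times at
  \<open>t = 0\<close>, where the convolution integral vanishes and only its boundary terms
  remain.\<close>

locale evolution_data = elliptic_inverse \<Omega> S A
  for \<Omega> :: "'a::euclidean_space set" and S A :: "'a L2 \<Rightarrow> 'a L2" +
  fixes k :: "nat \<Rightarrow> real \<Rightarrow> real" and \<kappa> T :: real and r :: nat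
    and f :: "nat \<Rightarrow> real \<Rightarrow> 'a L2" and U :: "nat \<Rightarrow> 'a L2"
  assumes mk: "memory_kernel (k 0) \<kappa>" and T_pos: "0 < T" and r: "1 \<le> r"
    and k_cont: "\<And>i. i < r \<Longrightarrow> continuous_on UNIV (k i)"
    and k_deriv: "\<And>i t. Suc i < r \<Longrightarrow> t \<in> {0..T} \<Longrightarrow> (k i has_real_derivative k (Suc i) t) (at t within {0..T})"
    and f_deriv: "\<And>i t. i < r \<Longrightarrow> t \<in> {0..T} \<Longrightarrow> (f i has_vector_derivative f (Suc i) t) (at t within {0..T})"
    and f_cont: "continuous_on {0..T} (f r)"
    and f_L2: "\<And>i t. i \<le> r \<Longrightarrow> t \<in> {0..T} \<Longrightarrow> f i t \<in> L2_on \<Omega>"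
    and U_D: "\<And>i. i \<le> r \<Longrightarrow> U i \<in> D" and U_L2: "U (Suc r) \<in> L2_on \<Omega>"
    and U_rec: "\<And>j. j < r \<Longrightarrow> U (Suc (Suc j)) = f j 0 - A (U j) + (\<Sum>i<j. k i 0 *\<^sub>R A (U (j - 1 - i)))"
begin

sublocale memory_kernel "k 0" \<kappa> by (rule mk)

definition source :: "real \<Rightarrow> 'a L2" where
  "source t = f r t + (\<Sum>i<r. k i t *\<^sub>R A (U (r - 1 - i)))"

lemma source_cont: "continuous_on {0..T} source"
  unfolding source_def[abs_def]
  by (intro continuous_intros f_cont continuous_on_subset[OF k_cont]) auto

lemma source_L2: "t \<in> {0..T} \<Longrightarrow> source t \<in> L2_on \<Omega>"
  unfolding source_def
  by (intro subspace_add[OF subspace_L2_on] subspace_sum[OF subspace_L2_on] subspace_scale[OF subspace_L2_on]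
      f_L2 A_L2_on U_D) auto

lemma S_source:
  "S (source t) = S (f r t) + (\<Sum>i<r. k i t *\<^sub>R U (r - 1 - i))"
proof -
  have "(\<Sum>i<r. k i t *\<^sub>R S (A (U (r - 1 - i)))) = (\<Sum>i<r. k i t *\<^sub>R U (r - 1 - i))"
    by (rule sum.cong) (use SA[OF U_D] in auto)
  then show ?thesis by (simp add: source_def S.add S.sum S.scaleR)
qed

sublocale wave: wave_problem "k 0" \<kappa> S T "A (U r)" "U (Suc r)" source
proof
  show "0 < T" by (rule T_pos)
  show "continuous_on {0..T} source" by (rule source_cont)
  show "U (Suc r) \<in> closure (range S)" using U_L2 L2_on_closure by simp
  show "source s \<in> closure (range S)" if "s \<in> {0..T}" for s using source_L2[OF that] L2_on_closure by simp
qed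

text \<open>The time derivatives $u, \dots, u^{(r+1)}$ are obtained from the weak solution
  $v = u^{(r)}$ of the differentiated problem by integrating with the initial values
  $u^{(j)}(0) = U_j$; the differentiated equation of order \<open>j\<close> follows downwards from the one
  of order $j + 1$, since it holds at $t = 0$.\<close>

theorem regular_solution:
  "\<exists>w. (\<forall>j\<le>r. \<forall>t\<in>{0..T}. (w j has_vector_derivative w (Suc j) t) (at t within {0..T})) \<and>
    (\<forall>j\<le>Suc r. w j 0 = U j) \<and> continuous_on {0..T} (w (Suc r)) \<and>
    (\<forall>t\<in>{0..T}. w 0 t - conv (k 0) (w 0) t = S (f 0 t - w 2 t)) \<and>
    (\<forall>j\<le>Suc r. \<forall>t\<in>{0..T}. w j t \<in> L2_on \<Omega>) \<and>
    (\<forall>t\<in>{0..T}. w r t \<in> sobolev0 \<Omega> \<and> energy_norm \<Omega> A (w r t) \<le> wave.energy_size t / (1 - \<kappa>) \<and>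
      norm (w (Suc r) t) \<le> wave.energy_size t)"
proof -
  obtain v x where vx: "continuous_on {0..T} x \<and> v 0 = S (A (U r)) \<and> x 0 = U (Suc r) \<and>
    (\<forall>t\<in>{0..T}. (v has_vector_derivative x t) (at t within {0..T})) \<and>
    (\<forall>t\<in>{0..T}. S (x t) = S (U (Suc r)) + integral {0..t} (\<lambda>s. S (source s) - (v s - conv (k 0) v s))) \<and>
    (\<forall>t\<in>{0..T}. norm (x t) \<le> wave.energy_size t \<and>
      (\<exists>y. (\<lambda>m. S (y m)) \<longlonglongrightarrow> v t \<and>
        (\<forall>m. y m \<bullet> S (y m) \<le> (wave.energy_size t / (1 - \<kappa>))\<^sup>2) \<and>
        (\<forall>r>0. \<exists>N. \<forall>m\<ge>N. \<forall>k\<ge>N. (y m - y k) \<bullet> S (y m - y k) < r)))"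
    using wave.weak_solution by (elim exE)
  note x_cont = vx[THEN conjunct1] and v0 = vx[THEN conjunct2, THEN conjunct1]
    and x0 = vx[THEN conjunct2, THEN conjunct2, THEN conjunct1]
  note vx' = vx[THEN conjunct2, THEN conjunct2, THEN conjunct2]
  note v_deriv = vx'[THEN conjunct1, THEN bspec] and eq = vx'[THEN conjunct2, THEN conjunct1, THEN bspec]
  note x_le = vx'[THEN conjunct2, THEN conjunct2, THEN bspec, THEN conjunct1]
    and approx = vx'[THEN conjunct2, THEN conjunct2, THEN bspec, THEN conjunct2]
  have v_cont: "continuous_on {0..T} v"
    using v_deriv by (meson continuous_on_eq_continuous_within has_vector_derivative_continuous)
  have v_V: "v t \<in> sobolev0 \<Omega>" "energy_norm \<Omega> A (v t) \<le> wave.energy_size t / (1 - \<kappa>)" "v t \<in> L2_on \<Omega>"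
    if t: "t \<in> {0..T}" for t
  proof -
    obtain y where y: "(\<lambda>m. S (y m)) \<longlonglongrightarrow> v t" "\<And>m. y m \<bullet> S (y m) \<le> (wave.energy_size t / (1 - \<kappa>))\<^sup>2"
      "\<And>r. r > 0 \<Longrightarrow> \<exists>N. \<forall>m\<ge>N. \<forall>k\<ge>N. (y m - y k) \<bullet> S (y m - y k) < r"
      using approx[OF t] by blast
    have SD: "S z \<in> D" for z using ran by blast
    have form: "A (S z) \<bullet> S z = z \<bullet> S z" for z
    proof -
      have "A (S z) \<bullet> S z = S (A (S z)) \<bullet> z" by (rule S_sym[symmetric])
      also have "\<dots> = z \<bullet> S z" using SA[OF SD, of z] by (simp add: inner_commute)
      finally show ?thesis .
    qed
    have E: "0 \<le> wave.energy_size t / (1 - \<kappa>)" using wave.energy_bound_le_size(2)[OF t] \<kappa>_less_1 by simp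
    have b: "A (S (y m)) \<bullet> S (y m) \<le> (wave.energy_size t / (1 - \<kappa>))\<^sup>2" for m unfolding form by (rule y(2))
    have C: "\<exists>N. \<forall>m\<ge>N. \<forall>n\<ge>N. A (S (y m) - S (y n)) \<bullet> (S (y m) - S (y n)) < r" if "r > 0" for r
      unfolding S.diff[symmetric] form by (rule y(3)[OF that])
    show "v t \<in> sobolev0 \<Omega>" "energy_norm \<Omega> A (v t) \<le> wave.energy_size t / (1 - \<kappa>)"
      by (rule energy_norm_limit[OF SD y(1) b E C]; assumption)+
    show "v t \<in> L2_on \<Omega>"
      by (rule closed_sequentially[OF closed_L2_on[OF \<Omega>] _ y(1)]) (rule D_L2_on[OF SD])
  qed
  have x_L2: "x t \<in> L2_on \<Omega>" if "t \<in> {0..T}" for t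
    by (rule derivative_mem_closed_subspace[OF subspace_L2_on closed_L2_on[OF \<Omega>] T_pos that v_V(3) v_deriv[OF that]])
  \<comment> \<open>\<open>X n\<close> is the derivative of order \<open>r - n\<close>; accordingly
    the constant of the step from \<open>n\<close> to \<open>Suc n\<close> is the initial value of
    order \<open>r - Suc n\<close>.\<close>
  define X where "X = iterated_primitive (\<lambda>n. U (r - Suc n)) v"
  define w where "w j = (if j = Suc r then x else X (r - j))" for j
  have wr: "w r = v" "w (Suc r) = x" by (auto simp: w_def X_def)
  have w_deriv: "(w j has_vector_derivative w (Suc j) t) (at t within {0..T})" if "j \<le> r" "t \<in> {0..T}" for j t
  proof (cases "j = r")
    case True
    then show ?thesis using v_deriv[OF that(2)] wr by simp
  next
    case False
    then have "w (Suc j) = X (r - Suc j)" "w j = X (Suc (r - Suc j))" using that(1) by (auto simp: w_def Suc_diff_Suc)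
    then show ?thesis unfolding X_def by (simp only: iterated_primitive_derivative[OF v_cont that(2)])
  qed
  have w_cont: "continuous_on {0..T} (w j)" if "j \<le> r" for j
    using w_deriv[OF that] by (meson continuous_on_eq_continuous_within has_vector_derivative_continuous)
  have w0: "w j 0 = U j" if "j \<le> Suc r" for j
  proof (cases "j \<ge> r")
    case True
    then have "j = r \<or> j = Suc r" using that by auto
    then show ?thesis using v0 x0 wr SA[OF U_D[of r]] by auto
  next
    case False
    then have "r - j = Suc (r - Suc j)" by simp
    moreover have "r - Suc (r - Suc j) = j" using False by simp
    ultimately show ?thesis using False by (simp add: w_def X_def)
  qed
  have X_L2: "X n t \<in> L2_on \<Omega>" if "t \<in> {0..T}" for n t
    using that
  proof (induction n arbitrary: t)
    case 0
    then show ?case using v_V(3) by (simp add: X_def)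
  next
    case (Suc n)
    have "integral {0..t} (X n) \<in> L2_on \<Omega>"
      by (rule integral_mem_closed_subspace[OF subspace_L2_on closed_L2_on[OF \<Omega>]], rule Suc.IH) (use Suc.prems in auto)
    then show ?case using subspace_add[OF subspace_L2_on D_L2_on[OF U_D[of "r - Suc n"]]] by (simp add: X_def)
  qed
  \<comment> \<open>The j-th time derivative of the convolution of \<open>k 0\<close> with
    \<open>w 0\<close>, including the boundary terms from time 0.\<close>
  define E where "E j t = conv (k 0) (w j) t + (\<Sum>i<j. k i t *\<^sub>R U (j - 1 - i))" for j t
  have E_deriv: "(E j has_vector_derivative E (Suc j) t) (at t within {0..T})" if j: "j < r" and t: "t \<in> {0..T}" for j t
  proof -
    have "(conv (k 0) (w j) has_vector_derivative k 0 t *\<^sub>R U j + conv (k 0) (w (Suc j)) t) (at t within {0..T})"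
      using conv_has_vector_derivative[OF K_cont w_cont[of "Suc j"] w_deriv[of j] t] w0[of j] j by simp
    moreover have "((\<lambda>t. \<Sum>i<j. k i t *\<^sub>R U (j - 1 - i)) has_vector_derivative (\<Sum>i<j. k (Suc i) t *\<^sub>R U (j - 1 - i))) (at t within {0..T})"
    proof (rule has_vector_derivative_sum)
      fix i assume "i \<in> {..<j}"
      then have "(k i has_real_derivative k (Suc i) t) (at t within {0..T})" using j t by (intro k_deriv) auto
      then show "((\<lambda>t. k i t *\<^sub>R U (j - 1 - i)) has_vector_derivative k (Suc i) t *\<^sub>R U (j - 1 - i)) (at t within {0..T})"
        using has_vector_derivative_scaleR[OF _ has_vector_derivative_const] by fastforce
    qed
    ultimately have "((\<lambda>t. conv (k 0) (w j) t + (\<Sum>i<j. k i t *\<^sub>R U (j - 1 - i))) has_vector_derivative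
        k 0 t *\<^sub>R U j + conv (k 0) (w (Suc j)) t + (\<Sum>i<j. k (Suc i) t *\<^sub>R U (j - 1 - i))) (at t within {0..T})"
      by (rule has_vector_derivative_add)
    moreover have "E (Suc j) t = k 0 t *\<^sub>R U j + conv (k 0) (w (Suc j)) t + (\<Sum>i<j. k (Suc i) t *\<^sub>R U (j - 1 - i))"
      unfolding E_def sum.lessThan_Suc_shift by (simp add: add.left_commute add.assoc)
    ultimately have "((\<lambda>t. conv (k 0) (w j) t + (\<Sum>i<j. k i t *\<^sub>R U (j - 1 - i))) has_vector_derivative E (Suc j) t)
        (at t within {0..T})" by (simp only:)
    then show ?thesis by (simp only: E_def[of j, abs_def])
  qed
  \<comment> \<open>The residual, after applying \<open>S\<close>, of the equation differentiated
    \<open>j\<close> times; its derivative is the residual of order \<open>j + 1\<close>.\<close>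
  define Phi where "Phi j t = S (w (Suc (Suc j)) t) + w j t - E j t - S (f j t)" for j t
  have Phi0: "Phi j 0 = 0" if j: "j < r" for j
  proof -
    have "S (U (Suc (Suc j))) = S (f j 0) - S (A (U j)) + (\<Sum>i<j. k i 0 *\<^sub>R S (A (U (j - 1 - i))))"
      unfolding U_rec[OF j] by (simp add: S.add S.diff S.sum S.scaleR)
    also have "S (A (U j)) = U j" using j by (intro SA U_D) simp
    also have "(\<Sum>i<j. k i 0 *\<^sub>R S (A (U (j - 1 - i)))) = (\<Sum>i<j. k i 0 *\<^sub>R U (j - 1 - i))"
      by (rule sum.cong) (use SA[OF U_D] j in auto)
    finally show ?thesis using w0[of "Suc (Suc j)"] w0[of j] j by (simp add: Phi_def E_def)
  qed
  \<comment> \<open>At the highest order a derivative is available for \<open>S (x t)\<close> rather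
    than for \<open>x t\<close>; it comes from the integrated equation.\<close>
  have top: "((\<lambda>t. S (x t)) has_vector_derivative S (source t) - (v t - conv (k 0) v t)) (at t within {0..T})"
    if t: "t \<in> {0..T}" for t
  proof -
    have c: "continuous_on {0..T} (\<lambda>s. S (source s) - (v s - conv (k 0) v s))"
      using T_pos by (intro continuous_intros S.continuous_on source_cont v_cont conv_continuous[OF K_cont v_cont]) auto
    have "((\<lambda>t. S (U (Suc r)) + integral {0..t} (\<lambda>s. S (source s) - (v s - conv (k 0) v s))) has_vector_derivative
      0 + (S (source t) - (v t - conv (k 0) v t))) (at t within {0..T})"
      by (intro has_vector_derivative_add has_vector_derivative_const integral_has_vector_derivative[OF c t])
    then have d: "((\<lambda>t. S (U (Suc r)) + integral {0..t} (\<lambda>s. S (source s) - (v s - conv (k 0) v s))) has_vector_derivative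
      S (source t) - (v t - conv (k 0) v t)) (at t within {0..T})" by (simp only: add_0_left)
    show ?thesis by (rule has_vector_derivative_transform[OF t eq d])
  qed
  have Phi: "Phi j t = 0" if "j < r" "t \<in> {0..T}" for j t
    using that
  proof (induction "r - Suc j" arbitrary: j t)
    case 0
    then have j: "Suc j = r" by simp
    have jr: "j < r" using j by simp
    have "(Phi j has_vector_derivative S (source s) - (v s - conv (k 0) v s) + w r s - E r s - S (f r s)) (at s within {0..T})"
      if s: "s \<in> {0..T}" for s
    proof -
      note d = w_deriv[of j s, unfolded j] E_deriv[of j s, unfolded j] f_deriv[of j s, unfolded j]
      show ?thesis
        unfolding Phi_def[abs_def] j wr(2)
        by (intro has_vector_derivative_diff has_vector_derivative_add top[OF s] S.has_vector_derivative d s jr)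
          (use jr in simp)
    qed
    moreover have "S (source s) - (v s - conv (k 0) v s) + w r s - E r s - S (f r s) = 0" for s
      unfolding wr(1) S_source E_def by (simp add: wr(1))
    ultimately show ?case using has_vector_derivative_zero_const[of T "Phi j" t] Phi0[of j] 0 by simp
  next
    case (Suc n)
    then have j: "Suc j < r" "n = r - Suc (Suc j)" by auto
    have "(Phi j has_vector_derivative Phi (Suc j) s) (at s within {0..T})" if s: "s \<in> {0..T}" for s
      unfolding Phi_def[abs_def]
      by (intro has_vector_derivative_diff has_vector_derivative_add S.has_vector_derivative w_deriv E_deriv f_deriv s) (use j in auto)
    moreover have "Phi (Suc j) s = 0" if "s \<in> {0..T}" for s using Suc.hyps(1)[OF j(2) j(1) that] .
    ultimately show ?case using has_vector_derivative_zero_const[of T "Phi j" t] Phi0[of j] Suc.prems by simp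
  qed
  have "w 0 t - conv (k 0) (w 0) t = S (f 0 t - w 2 t)" if "t \<in> {0..T}" for t
    using Phi[of 0 t] r that by (simp add: Phi_def E_def S.diff numeral_2_eq_2 algebra_simps)
  moreover have "w j t \<in> L2_on \<Omega>" if "t \<in> {0..T}" for j t
    using X_L2 x_L2 that by (simp add: w_def)
  ultimately show ?thesis
    using w_deriv w0 x_cont v_V x_le by (intro exI[of _ w]) (simp add: wr)
qed

end

text \<open>The values $u^{(j)}(0)$ determined by differentiating the equation at $t = 0$, where $\kappa_i = K^{(i)}(0)$.\<close>

fun initial_derivs ::
    "('h::real_vector \<Rightarrow> 'h) \<Rightarrow> (nat \<Rightarrow> real) \<Rightarrow> (nat \<Rightarrow> 'h) \<Rightarrow> 'h \<Rightarrow> 'h \<Rightarrow> nat \<Rightarrow> 'h" where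
  "initial_derivs A \<kappa> F u0 u1 0 = u0"
| "initial_derivs A \<kappa> F u0 u1 (Suc 0) = u1"
| "initial_derivs A \<kappa> F u0 u1 (Suc (Suc j)) = F j - A (initial_derivs A \<kappa> F u0 u1 j) +
    (\<Sum>i<j. \<kappa> i *\<^sub>R A (initial_derivs A \<kappa> F u0 u1 (j - 1 - i)))"

text \<open>Origin of the constant: 2 for \<open>U (Suc r)\<close>, \<open>2 * b\<close> for the
  root of the form at \<open>A (U r)\<close>, and \<open>4 * T * real r\<close> for the
  \<open>r\<close> memory terms in \<open>source\<close>, each of norm at most \<open>M\<close>,
  integrated over a time of at most \<open>T\<close>.\<close>

lemma (in evolution_data) energy_size_le:
  assumes b: "b \<ge> 1" "\<And>x. norm (S x) \<le> b * norm x" and M: "norm (U (Suc r)) \<le> M" "\<And>i. i \<le> r \<Longrightarrow> norm (A (U i)) \<le> M"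
    and k1: "\<And>i t. i < r \<Longrightarrow> \<bar>k i t\<bar> \<le> 1" and t: "t \<in> {0..T}"
  shows "wave.energy_size t \<le> exp (4 / (1 - \<kappa>) * T) *
    ((2 + 2 * b + 4 * T * real r) * M + 4 * integral {0..t} (\<lambda>s. norm (f r s)))"
proof -
  have M0: "0 \<le> M" using M(1) norm_ge_zero by (rule order_trans[rotated])
  have sub: "{0..t} \<subseteq> {0..T}" using t by auto
  have int: "(\<lambda>s. norm (f r s)) integrable_on {0..t}" "(\<lambda>s. norm (source s)) integrable_on {0..t}"
    by (intro integrable_continuous_interval continuous_on_norm continuous_on_subset[OF f_cont sub]
        continuous_on_subset[OF source_cont sub])+
  have src: "norm (source s) \<le> norm (f r s) + real r * M" for s
  proof -
    have "norm (\<Sum>i<r. k i s *\<^sub>R A (U (r - 1 - i))) \<le> (\<Sum>i<r. M)"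
    proof (rule sum_norm_le)
      fix i assume "i \<in> {..<r}"
      then have "\<bar>k i s\<bar> * norm (A (U (r - 1 - i))) \<le> 1 * M" by (intro mult_mono k1 M(2)) auto
      then show "norm (k i s *\<^sub>R A (U (r - 1 - i))) \<le> M" by simp
    qed
    then show ?thesis unfolding source_def by (intro norm_triangle_le) simp
  qed
  have "integral {0..t} (\<lambda>s. norm (source s)) \<le> integral {0..t} (\<lambda>s. norm (f r s) + real r * M)"
    by (intro integral_le int(2) integrable_add int(1) integrable_const_ivl src)
  also have "\<dots> = integral {0..t} (\<lambda>s. norm (f r s)) + t * (real r * M)"
    using t by (subst integral_add[OF int(1) integrable_const_ivl]) simp
  also have "t * (real r * M) \<le> T * (real r * M)" using t M0 by (intro mult_right_mono) auto
  finally have I: "integral {0..t} (\<lambda>s. norm (source s)) \<le> integral {0..t} (\<lambda>s. norm (f r s)) + T * (real r * M)" by simp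
  have "A (U r) \<bullet> S (A (U r)) \<le> norm (A (U r)) * (b * norm (A (U r)))"
    using norm_cauchy_schwarz[of "A (U r)" "S (A (U r))"] mult_left_mono[OF b(2), of "norm (A (U r))" "A (U r)"] by simp
  also have "\<dots> \<le> M * (b * M)" using M(2)[of r] b(1) M0 by (intro mult_mono mult_left_mono) auto
  also have "\<dots> \<le> (b * M)\<^sup>2"
  proof -
    have "1 * (b * (M * M)) \<le> b * (b * (M * M))" using b(1) M0 by (intro mult_right_mono) auto
    then show ?thesis by (simp add: power2_eq_square mult_ac)
  qed
  finally have "sqrt (A (U r) \<bullet> S (A (U r))) \<le> b * M"
    using b(1) M0 by (intro real_le_lsqrt) auto
  then have "2 * norm (U (Suc r)) + 2 * sqrt (A (U r) \<bullet> S (A (U r))) + 4 * integral {0..t} (\<lambda>s. norm (source s))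
      \<le> (2 + 2 * b + 4 * T * real r) * M + 4 * integral {0..t} (\<lambda>s. norm (f r s))"
    using I M(1) by (simp add: algebra_simps)
  moreover have "exp (4 / (1 - \<kappa>) * t) \<le> exp (4 / (1 - \<kappa>) * T)"
    unfolding exp_le_cancel_iff using t \<kappa>_less_1 by (intro mult_left_mono) auto
  moreover have "0 \<le> integral {0..t} (\<lambda>s. norm (source s))" "0 \<le> sqrt (A (U r) \<bullet> S (A (U r)))"
    using S_pos[of "A (U r)"] int(2) by (auto intro: integral_nonneg simp: inner_commute)
  ultimately show ?thesis unfolding wave.energy_size_def by (intro mult_mono) auto
qed

lemma (in evolution_data) solution_exists:
  assumes K: "AE t in lborel. t > 0 \<longrightarrow> K t = k 0 t"
  shows "\<exists>u. solution \<Omega> A K T (f 0) (U 0) (U 1) u \<and> times_differentiable T (r + 1) u \<and>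
    (\<forall>t\<in>{0..T}. time_deriv T r u t \<in> sobolev0 \<Omega> \<and>
      energy_norm \<Omega> A (time_deriv T r u t) + norm (time_deriv T (r + 1) u t) \<le> (1 / (1 - \<kappa>) + 1) * wave.energy_size t)"
proof -
  obtain w where w: "(\<forall>j\<le>r. \<forall>t\<in>{0..T}. (w j has_vector_derivative w (Suc j) t) (at t within {0..T})) \<and>
    (\<forall>j\<le>Suc r. w j 0 = U j) \<and> continuous_on {0..T} (w (Suc r)) \<and>
    (\<forall>t\<in>{0..T}. w 0 t - conv (k 0) (w 0) t = S (f 0 t - w 2 t)) \<and>
    (\<forall>j\<le>Suc r. \<forall>t\<in>{0..T}. w j t \<in> L2_on \<Omega>) \<and>
    (\<forall>t\<in>{0..T}. w r t \<in> sobolev0 \<Omega> \<and> energy_norm \<Omega> A (w r t) \<le> wave.energy_size t / (1 - \<kappa>) \<and>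
      norm (w (Suc r) t) \<le> wave.energy_size t)"
    using regular_solution by (elim exE)
  note w' = w[THEN conjunct2] note w'' = w'[THEN conjunct2, THEN conjunct2]
  have wd: "(w j has_vector_derivative w (Suc j) t) (at t within {0..T})" if "j < Suc r" "t \<in> {0..T}" for j t
    using w[THEN conjunct1] that by simp
  note w0 = w'[THEN conjunct1, rule_format]
  note weq = w''[THEN conjunct1, THEN bspec]
  note wL2 = w''[THEN conjunct2, THEN conjunct1, rule_format]
  note wE = w''[THEN conjunct2, THEN conjunct2, THEN bspec]
  \<comment> \<open>Absolute continuity of the velocity will follow from a continuous second
    derivative. For \<open>r = 1\<close> this is the top function of the chain, otherwise a
    differentiable one.\<close>
  have "continuous_on {0..T} (w 2)"
  proof (cases "r = 1")
    case True
    then show ?thesis using w'[THEN conjunct2, THEN conjunct1] by (simp add: numeral_2_eq_2)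
  next
    case False
    then have "2 < Suc r" using r by simp
    then show ?thesis using wd[of 2] by (meson continuous_on_eq_continuous_within has_vector_derivative_continuous)
  qed
  then have c2: "continuous_on {0..T} (w (Suc 1))" by (simp add: numeral_2_eq_2)
  note td = time_deriv_eqI(2)[of T "Suc r" w, OF T_pos wd]
  have td1: "times_differentiable T 1 (w 0)" by (rule time_deriv_eqI(1)[of T _ w, OF T_pos wd]) (use r in auto)
  have e1: "time_deriv T 1 (w 0) t = w 1 t" if "t \<in> {0..T}" for t by (rule td[OF _ _ _ that]) (use r in auto)
  have e2: "time_deriv T 2 (w 0) t = w 2 t" if "t \<in> {0..T}" for t by (rule td[OF _ _ _ that]) (use r in auto)
  have ac: "abs_cont T (time_deriv T 1 (w 0))"
    by (rule abs_cont_cong[OF abs_cont_C1[OF wd c2] e1]) (use r in auto)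
  have eq: "time_deriv T 1 (w 0) differentiable (at t) \<and>
      w 0 t - integral {0..t} (\<lambda>s. K (t - s) *\<^sub>R w 0 s) \<in> D \<and>
      time_deriv T 2 (w 0) t + A (w 0 t - integral {0..t} (\<lambda>s. K (t - s) *\<^sub>R w 0 s)) = f 0 t" if t: "t \<in> {0<..<T}" for t
  proof -
    have t': "t \<in> {0..T}" using t by auto
    have "(w 1 has_vector_derivative w (Suc 1) t) (at t within {0..T})" by (rule wd[OF _ t']) (use r in simp)
    from has_vector_derivative_transform[OF t' e1 this]
    have "(time_deriv T 1 (w 0) has_vector_derivative w (Suc 1) t) (at t within {0..T})" .
    then have "(time_deriv T 1 (w 0) has_vector_derivative w (Suc 1) t) (at t)"
      by (subst (asm) at_within_interior) (use t in auto)
    then have 1: "time_deriv T 1 (w 0) differentiable (at t)" by (rule differentiableI_vector)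
    have 2: "w 0 t - integral {0..t} (\<lambda>s. K (t - s) *\<^sub>R w 0 s) = S (f 0 t - w 2 t)"
      using weq[OF t'] unfolding conv_cong_AE[OF K] .
    have 3: "f 0 t - w 2 t \<in> L2_on \<Omega>"
      by (rule subspace_diff[OF subspace_L2_on f_L2[OF _ t'] wL2[OF _ t']]) (use r in auto)
    have 4: "S (f 0 t - w 2 t) \<in> D" using ran by blast
    show ?thesis unfolding 2 AS[OF 3] e2[OF t'] using 1 4 by simp
  qed
  have "solution \<Omega> A K T (f 0) (U 0) (U 1) (w 0)"
    unfolding solution_def
  proof (intro conjI ballI)
    show "w 0 t \<in> L2_on \<Omega>" if "t \<in> {0..T}" for t by (rule wL2[OF _ that]) simp
    show "AE t in lborel. t \<in> {0<..<T} \<longrightarrow> time_deriv T 1 (w 0) differentiable (at t) \<and>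
      w 0 t - integral {0..t} (\<lambda>s. K (t - s) *\<^sub>R w 0 s) \<in> D \<and>
      time_deriv T 2 (w 0) t + A (w 0 t - integral {0..t} (\<lambda>s. K (t - s) *\<^sub>R w 0 s)) = f 0 t"
      by (rule AE_I2, rule impI, rule eq)
    show "w 0 0 = U 0" by (rule w0) simp
    have "(0 :: real) \<in> {0..T}" using T_pos by simp
    then show "time_deriv T 1 (w 0) 0 = U 1" using e1[of 0] w0[of 1] by simp
  qed (rule td1 ac)+
  moreover have "times_differentiable T (r + 1) (w 0)" by (rule time_deriv_eqI(1)[of T _ w, OF T_pos wd]) auto
  moreover have "time_deriv T r (w 0) t \<in> sobolev0 \<Omega> \<and>
      energy_norm \<Omega> A (time_deriv T r (w 0) t) + norm (time_deriv T (r + 1) (w 0) t) \<le> (1 / (1 - \<kappa>) + 1) * wave.energy_size t"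
    if t: "t \<in> {0..T}" for t
  proof -
    have e: "time_deriv T r (w 0) t = w r t" "time_deriv T (r + 1) (w 0) t = w (Suc r) t"
      by (rule td[OF _ _ _ t]; simp)+ (simp only: Suc_eq_plus1[symmetric], rule td[OF _ _ _ t]; simp)
    show ?thesis unfolding e using wE[OF t] by (simp add: distrib_right)
  qed
  ultimately show ?thesis by (intro exI[of _ "w 0"]) blast
qed

section \<open>Initial values, uniqueness and well-posedness\<close>

context elliptic_inverse
begin

lemma power_diff: "v \<in> P n \<Longrightarrow> w \<in> P n \<Longrightarrow> (A ^^ n) (v - w) = (A ^^ n) v - (A ^^ n) w"
  using power_add[of v n "(-1) *\<^sub>R w"] power_scaleR[of w n "-1"] subspace_scale[OF subspace_P, of w n "-1"] by simp

text \<open>Two time derivatives cost one power of \<open>A\<close>, so \<open>U j\<close> keeps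
  \<open>(r + 2 - j) div 2\<close> of them. In the growth factor the 2 counts \<open>F i\<close> and
  \<open>A (U i)\<close>; the other summand counts at most \<open>r\<close> memory terms, whose
  spare powers of \<open>A\<close> are given up at the price \<open>b ^ (r + 2)\<close>.\<close>

lemma initial_derivs_bound:
  fixes \<kappa> F u0 u1 r
  defines "U \<equiv> initial_derivs A \<kappa> F u0 u1"
  assumes b: "b \<ge> 1" "\<And>x. norm (S x) \<le> b * norm x" and \<kappa>: "\<And>i. i < r \<Longrightarrow> \<bar>\<kappa> i\<bar> \<le> 1"
    and u0: "u0 \<in> P ((r + 2) div 2)" "norm ((A ^^ ((r + 2) div 2)) u0) \<le> R"
    and u1: "u1 \<in> P ((r + 1) div 2)" "norm ((A ^^ ((r + 1) div 2)) u1) \<le> R"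
    and F: "\<And>i. i < r \<Longrightarrow> F i \<in> P ((r - i) div 2)" "\<And>i. i < r \<Longrightarrow> norm ((A ^^ ((r - i) div 2)) (F i)) \<le> R"
    and j: "j \<le> Suc r"
  shows "U j \<in> P ((r + 2 - j) div 2) \<and>
    norm ((A ^^ ((r + 2 - j) div 2)) (U j)) \<le> (2 + real r * b ^ (r + 2)) ^ j * R"
  using j
proof (induction j rule: less_induct)
  case (less j)
  define x where "x = 2 + real r * b ^ (r + 2)"
  have x: "1 \<le> x" using b(1) by (simp add: x_def)
  have R: "0 \<le> R" using u0(2) norm_ge_zero by (rule order_trans[rotated])
  consider "j = 0" | "j = Suc 0" | i where "j = Suc (Suc i)" by (cases j rule: nat.exhaust; metis nat.exhaust)
  then show ?case
  proof cases
    case 1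
    then show ?thesis using u0 by (simp add: U_def)
  next
    case 2
    have "1 * R \<le> x * R" by (rule mult_right_mono[OF x R])
    then show ?thesis using u1 2 by (simp add: U_def x_def)
  next
    case (3 i)
    define p where "p = (r - i) div 2"
    have i: "i < r" using 3 less.prems by simp
    have pj: "(r + 2 - j) div 2 = p" using 3 by (simp add: p_def)
    have U: "U j = F i - A (U i) + (\<Sum>l<i. \<kappa> l *\<^sub>R A (U (i - 1 - l)))" by (simp add: U_def 3)
    have AU: "A (U l) \<in> P p \<and> norm ((A ^^ p) (A (U l))) \<le> b ^ (r + 2) * (x ^ i * R)" if "l \<le> i" for l
    proof -
      \<comment> \<open>The spare powers: an earlier derivative has more powers of \<open>A\<close>
        available than the new one requires.\<close>
      define n where "n = (r + 2 - l) div 2 - Suc p"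
      have n: "(r + 2 - l) div 2 = Suc p + n" "n \<le> r + 2" using that i by (auto simp: n_def p_def)
      have ih: "U l \<in> P (Suc p + n)" "norm ((A ^^ (Suc p + n)) (U l)) \<le> x ^ l * R"
        using less.IH[of l] that 3 less.prems n(1) by (auto simp: x_def)
      have mem: "A (U l) \<in> P p" using P_mono[of "Suc p" "Suc p + n"] ih(1) by auto
      have "norm ((A ^^ Suc p) (U l)) \<le> b ^ n * norm ((A ^^ (Suc p + n)) (U l))" by (rule power_norm_le[OF b ih(1)])
      also have "\<dots> \<le> b ^ (r + 2) * (x ^ i * R)"
        using ih(2) n(2) b(1) x R that
        by (intro mult_mono power_increasing order_trans[OF ih(2)] mult_right_mono) auto
      finally show ?thesis using mem by (simp only: funpow_Suc_right comp_def)
    qed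
    have AUi: "norm ((A ^^ p) (A (U i))) \<le> x ^ i * R"
    proof -
      have "(r + 2 - i) div 2 = Suc p" using i by (simp add: p_def Suc_diff_le)
      then show ?thesis using less.IH[of i] 3 less.prems by (simp add: x_def funpow_swap1)
    qed
    have mem: "(\<Sum>l<i. \<kappa> l *\<^sub>R A (U (i - 1 - l))) \<in> P p" "F i - A (U i) \<in> P p"
      using AU F(1)[OF i] by (auto intro!: subspace_sum[OF subspace_P] subspace_scale[OF subspace_P] subspace_diff[OF subspace_P] simp: p_def)
    have "(A ^^ p) (\<Sum>l<i. \<kappa> l *\<^sub>R A (U (i - 1 - l))) = (\<Sum>l<i. (A ^^ p) (\<kappa> l *\<^sub>R A (U (i - 1 - l))))"
      by (rule power_sum) (use AU in \<open>auto intro!: subspace_scale[OF subspace_P]\<close>)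
    also have "\<dots> = (\<Sum>l<i. \<kappa> l *\<^sub>R (A ^^ p) (A (U (i - 1 - l))))"
      by (rule sum.cong) (use AU power_scaleR in auto)
    finally have s: "(A ^^ p) (\<Sum>l<i. \<kappa> l *\<^sub>R A (U (i - 1 - l))) = (\<Sum>l<i. \<kappa> l *\<^sub>R (A ^^ p) (A (U (i - 1 - l))))" .
    have "norm (\<Sum>l<i. \<kappa> l *\<^sub>R (A ^^ p) (A (U (i - 1 - l)))) \<le> (\<Sum>l<i. b ^ (r + 2) * (x ^ i * R))"
    proof (rule sum_norm_le)
      fix l assume l: "l \<in> {..<i}"
      then have "\<bar>\<kappa> l\<bar> * norm ((A ^^ p) (A (U (i - 1 - l)))) \<le> 1 * (b ^ (r + 2) * (x ^ i * R))"
        using AU[of "i - 1 - l"] \<kappa>[of l] i by (intro mult_mono) auto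
      then show "norm (\<kappa> l *\<^sub>R (A ^^ p) (A (U (i - 1 - l)))) \<le> b ^ (r + 2) * (x ^ i * R)" by simp
    qed
    also have "\<dots> = real i * (b ^ (r + 2) * (x ^ i * R))" by simp
    also have "\<dots> \<le> real r * (b ^ (r + 2) * (x ^ i * R))"
      using i b(1) x R by (intro mult_right_mono mult_nonneg_nonneg) auto
    finally have S3: "norm (\<Sum>l<i. \<kappa> l *\<^sub>R (A ^^ p) (A (U (i - 1 - l)))) \<le> real r * (b ^ (r + 2) * (x ^ i * R))" .
    have "(A ^^ p) (U j) = (A ^^ p) (F i) - (A ^^ p) (A (U i)) + (\<Sum>l<i. \<kappa> l *\<^sub>R (A ^^ p) (A (U (i - 1 - l))))"
      unfolding U power_add[OF mem(2,1)] s using power_diff[of "F i" p "A (U i)"] F(1)[OF i] AU[of i] by (simp add: p_def)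
    also have "norm \<dots> \<le> (norm ((A ^^ p) (F i)) + norm ((A ^^ p) (A (U i)))) + norm (\<Sum>l<i. \<kappa> l *\<^sub>R (A ^^ p) (A (U (i - 1 - l))))"
      by (intro norm_triangle_mono norm_triangle_ineq4 order_refl)
    also have "\<dots> \<le> (R + x ^ i * R) + real r * (b ^ (r + 2) * (x ^ i * R))"
      using F(2)[OF i] AUi S3 by (intro add_mono) (auto simp: p_def)
    also have "\<dots> \<le> (x ^ i * R + x ^ i * R) + real r * (b ^ (r + 2) * (x ^ i * R))"
      using mult_right_mono[OF one_le_power[OF x, of i] R] by (simp add: mult.commute)
    also have "\<dots> = x ^ Suc i * R" by (simp add: x_def algebra_simps)
    also have "\<dots> \<le> x ^ j * R" using x R 3 by (intro mult_right_mono power_increasing) auto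
    finally have "norm ((A ^^ p) (U j)) \<le> x ^ j * R" .
    moreover have "U j \<in> P p" unfolding U by (rule subspace_add[OF subspace_P mem(2,1)])
    ultimately show ?thesis unfolding pj x_def by simp
  qed
qed

text \<open>The equation holds only almost everywhere. Applying \<open>S\<close> to
  \<open>z'\<close> and adding the primitive of \<open>z - conv k z\<close> gives an absolutely
  continuous function with derivative 0 almost everywhere, hence a constant. This is the integrated
  equation at every time, as \<open>weak_uniqueness\<close> requires it.\<close>

lemma solution_unique:
  assumes mk: "memory_kernel k \<kappa>" and K: "AE t in lborel. t > 0 \<longrightarrow> K t = k t" and T: "0 < T"
    and w: "solution \<Omega> A K T f u0 u1 w" and u: "solution \<Omega> A K T f u0 u1 u" and t: "t \<in> {0..T}"
  shows "w t = u t"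
proof -
  interpret memory_kernel k \<kappa> by (rule mk)
  have d: "(g has_vector_derivative time_deriv T 1 g t) (at t within {0..T})"
    if "solution \<Omega> A K T f u0 u1 g" "t \<in> {0..T}" for g t
    using times_differentiableD[of T 1 g 0 t] that unfolding solution_def time_deriv.simps(1) by (simp only: One_nat_def)
  have ac: "abs_cont T (time_deriv T 1 g)" and init: "g 0 = u0" "time_deriv T 1 g 0 = u1"
    and eq: "AE t in lborel. t \<in> {0<..<T} \<longrightarrow> time_deriv T 1 g differentiable (at t) \<and>
      g t - integral {0..t} (\<lambda>s. K (t - s) *\<^sub>R g s) \<in> D \<and>
      time_deriv T 2 g t + A (g t - integral {0..t} (\<lambda>s. K (t - s) *\<^sub>R g s)) = f t"
    if "solution \<Omega> A K T f u0 u1 g" for g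
    using that unfolding solution_def by blast+
  define z where "z t = w t - u t" for t
  define z' where "z' t = time_deriv T 1 w t - time_deriv T 1 u t" for t
  have zd: "(z has_vector_derivative z' t) (at t within {0..T})" if "t \<in> {0..T}" for t
    unfolding z_def[abs_def] z'_def by (intro has_vector_derivative_diff d w u that)
  have cont: "continuous_on {0..T} g" if "solution \<Omega> A K T f u0 u1 g" for g
    using d[OF that] by (meson continuous_on_eq_continuous_within has_vector_derivative_continuous)
  have z_cont: "continuous_on {0..T} z" unfolding z_def[abs_def] by (intro continuous_on_diff cont w u)
  have z'_cont: "continuous_on {0..T} z'"
    unfolding z'_def[abs_def] by (intro continuous_on_diff abs_cont_continuous ac w u)
  define p where "p t = z t - conv k z t" for t
  have p_cont: "continuous_on {0..T} p"
    unfolding p_def[abs_def] using T by (intro continuous_on_diff z_cont conv_continuous[OF K_cont z_cont]) simp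
  define G where "G t = S (z' t) + integral {0..t} p" for t
  have pd: "((\<lambda>t. integral {0..t} p) has_vector_derivative p t) (at t within {0..T})" if "t \<in> {0..T}" for t
    by (rule integral_has_vector_derivative[OF p_cont that])
  obtain B where B: "0 < B" "\<And>x. norm (S x) \<le> norm x * B" using S.pos_bounded by blast
  have S_ac: "abs_cont T (\<lambda>t. S (z' t))"
  proof (rule abs_cont_dominated[OF ac[OF w] ac[OF u]])
    show "0 \<le> B" using B(1) by simp
    fix a b :: real
    define X where "X = time_deriv T 1 w b - time_deriv T 1 w a"
    define Y where "Y = time_deriv T 1 u b - time_deriv T 1 u a"
    have "S (z' b) - S (z' a) = S X - S Y" by (simp add: z'_def X_def Y_def S.diff)
    also have "norm \<dots> \<le> norm (S X) + norm (S Y)" by (rule norm_triangle_ineq4)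
    also have "\<dots> \<le> B * norm X + B * norm Y" using B(2)[of X] B(2)[of Y] by (simp add: mult.commute add_mono)
    finally show "norm (S (z' b) - S (z' a)) \<le> B * norm X + B * norm Y" .
  qed
  have G_ac: "abs_cont T G"
  proof (rule abs_cont_dominated[OF S_ac abs_cont_C1[OF pd p_cont]])
    fix a b :: real
    have "G b - G a = (S (z' b) - S (z' a)) + (integral {0..b} p - integral {0..a} p)" by (simp add: G_def)
    then show "norm (G b - G a) \<le> 1 * norm (S (z' b) - S (z' a)) + 1 * norm (integral {0..b} p - integral {0..a} p)"
      by (simp add: norm_triangle_ineq)
    show "0 \<le> (1 :: real)" by simp
  qed
  have "AE t in lborel. t \<in> {0<..<T} \<longrightarrow> (G has_vector_derivative 0) (at t)"
    using eq[OF w] eq[OF u]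
  proof eventually_elim
    case (elim t)
    show ?case
    proof
      assume t: "t \<in> {0<..<T}"
      then have t': "t \<in> {0..T}" by auto
      have int: "at t within {0..T} = at t" by (rule at_within_interior) (use t in auto)
      have d2: "(time_deriv T 1 g has_vector_derivative time_deriv T 2 g t) (at t)"
        if "time_deriv T 1 g differentiable (at t)" for g :: "real \<Rightarrow> 'a L2"
        using that unfolding vector_derivative_works numeral_2_eq_2 One_nat_def by (simp add: int)
      have "((\<lambda>t. S (z' t) + integral {0..t} p) has_vector_derivative
          S (time_deriv T 2 w t - time_deriv T 2 u t) + p t) (at t)"
        unfolding z'_def[abs_def]
        by (intro has_vector_derivative_add S.has_vector_derivative has_vector_derivative_diff d2 pd[OF t', unfolded int])
          (use elim t in blast)+
      moreover have "S (time_deriv T 2 w t - time_deriv T 2 u t) + p t = 0"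
      proof -
        have e: "w t - conv k w t = S (f t - time_deriv T 2 w t)" "u t - conv k u t = S (f t - time_deriv T 2 u t)"
        proof -
          have "w t - conv k w t \<in> D" "A (w t - conv k w t) = f t - time_deriv T 2 w t"
            using elim(1) t unfolding conv_cong_AE[OF K] by (auto simp: algebra_simps)
          then show "w t - conv k w t = S (f t - time_deriv T 2 w t)" using SA by metis
          have "u t - conv k u t \<in> D" "A (u t - conv k u t) = f t - time_deriv T 2 u t"
            using elim(2) t unfolding conv_cong_AE[OF K] by (auto simp: algebra_simps)
          then show "u t - conv k u t = S (f t - time_deriv T 2 u t)" using SA by metis
        qed
        have "p t = (w t - conv k w t) - (u t - conv k u t)"
          unfolding p_def z_def[abs_def] conv_diff[OF K_cont cont[OF w] cont[OF u] t'] by simp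
        then show ?thesis unfolding e by (simp add: S.diff)
      qed
      ultimately show "(G has_vector_derivative 0) (at t)" unfolding G_def[abs_def] by simp
    qed
  qed
  then have "G s = G 0" if "s \<in> {0..T}" for s by (rule abs_cont_imp_constant[OF G_ac _ that])
  moreover have "G 0 = 0" by (simp add: G_def z'_def init[OF w] init[OF u] del: One_nat_def)
  ultimately have "S (z' s) = - integral {0..s} (\<lambda>s. z s - conv k z s)" if "s \<in> {0..T}" for s
    using that unfolding G_def p_def[abs_def] by (simp add: eq_neg_iff_add_eq_0)
  then have "z t = 0"
    by (intro weak_uniqueness[OF mk pos_operator_axioms T zd z'_cont _ _ t]) (simp_all add: z_def init[OF w] init[OF u])
  then show ?thesis by (simp add: z_def)
qed

text \<open>\<open>R\<close> collects the initial data. In \<open>X\<close>, the power of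
  \<open>2 + real r * b ^ (r + 2)\<close> bounds every \<open>U j\<close> together with all its
  powers of \<open>A\<close>, and the factor \<open>b ^ (r + 2)\<close> descends to the single power
  that enters \<open>source\<close>.\<close>

lemma well_posed:
  fixes b :: real
  assumes r: "1 \<le> r" and b: "b \<ge> 1" "\<And>x. norm (S x) \<le> b * norm x"
    and T: "0 < T" and K: "admissible_kernel r K" and fL2: "\<And>t. t \<in> {0..T} \<Longrightarrow> f t \<in> L2_on \<Omega>"
    and ft: "times_differentiable T r f" and fc: "continuous_on {0..T} (time_deriv T r f)"
    and u0: "u0 \<in> P ((r + 2) div 2)" and u1: "u1 \<in> P ((r + 1) div 2)"
    and F: "\<And>i. i < r \<Longrightarrow> time_deriv T i f 0 \<in> P ((r - i) div 2)"
  defines "R \<equiv> norm ((A ^^ ((r + 2) div 2)) u0) + norm ((A ^^ ((r + 1) div 2)) u1) +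
    (\<Sum>i<r. norm ((A ^^ ((r - i) div 2)) (time_deriv T i f 0)))"
    and "X \<equiv> b ^ (r + 2) * (2 + real r * b ^ (r + 2)) ^ (r + 1)"
  shows "\<exists>u. solution \<Omega> A K T f u0 u1 u \<and>
    (\<forall>w. solution \<Omega> A K T f u0 u1 w \<longrightarrow> (\<forall>t\<in>{0..T}. w t = u t)) \<and>
    times_differentiable T (r + 1) u \<and> (\<forall>t\<in>{0..T}. time_deriv T r u t \<in> sobolev0 \<Omega> \<and>
      energy_norm \<Omega> A (time_deriv T r u t) + norm (time_deriv T (r + 1) u t) \<le>
      (1 / (1 - L1_norm_pos K) + 1) * (exp (4 / (1 - L1_norm_pos K) * T) * ((2 + 2 * b + 4 * T * real r) * X + 4)) *
        (R + integral {0..t} (\<lambda>s. norm (time_deriv T r f s))))"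
proof -
  define \<kappa> where "\<kappa> = L1_norm_pos K"
  obtain k where mk: "memory_kernel (k 0) \<kappa>"
    and k: "\<And>i. i < r \<Longrightarrow> continuous_on UNIV (k i)" "\<And>i t. i < r \<Longrightarrow> \<bar>k i t\<bar> \<le> 1"
    and kd: "\<And>i T t. Suc i < r \<Longrightarrow> t \<in> {0..T} \<Longrightarrow> (k i has_real_derivative k (Suc i) t) (at t within {0..T})"
    and Kk: "AE t in lborel. t > 0 \<longrightarrow> K t = k 0 t"
    using kernel_representation[OF K r] unfolding \<kappa>_def by blast
  define F where "F i = time_deriv T i f" for i
  define U where "U = initial_derivs A (\<lambda>i. k i 0) (\<lambda>i. F i 0) u0 u1"
  have R_le: "norm ((A ^^ ((r + 2) div 2)) u0) \<le> R" "norm ((A ^^ ((r + 1) div 2)) u1) \<le> R"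
    "\<And>i. i < r \<Longrightarrow> norm ((A ^^ ((r - i) div 2)) (F i 0)) \<le> R"
  proof -
    have s: "0 \<le> (\<Sum>i<r. norm ((A ^^ ((r - i) div 2)) (time_deriv T i f 0)))" by (rule sum_nonneg) simp
    show "norm ((A ^^ ((r + 2) div 2)) u0) \<le> R" unfolding R_def
      using s norm_ge_zero[of "(A ^^ ((r + 1) div 2)) u1"] by linarith
    show "norm ((A ^^ ((r + 1) div 2)) u1) \<le> R" unfolding R_def
      using s norm_ge_zero[of "(A ^^ ((r + 2) div 2)) u0"] by linarith
    fix i assume "i < r"
    then have "norm ((A ^^ ((r - i) div 2)) (F i 0)) \<le> (\<Sum>i<r. norm ((A ^^ ((r - i) div 2)) (time_deriv T i f 0)))"
      unfolding F_def by (intro member_le_sum) auto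
    then show "norm ((A ^^ ((r - i) div 2)) (F i 0)) \<le> R" unfolding R_def
      using norm_ge_zero[of "(A ^^ ((r + 1) div 2)) u1"] norm_ge_zero[of "(A ^^ ((r + 2) div 2)) u0"] by linarith
  qed
  have R: "0 \<le> R" using R_le(1) norm_ge_zero by (rule order_trans[rotated])
  define x where "x = 2 + real r * b ^ (r + 2)"
  have x: "1 \<le> x" using b(1) by (simp add: x_def)
  have X: "X = b ^ (r + 2) * x ^ (r + 1)" by (simp add: X_def x_def)
  have Ub: "U j \<in> P ((r + 2 - j) div 2)" "norm ((A ^^ ((r + 2 - j) div 2)) (U j)) \<le> x ^ (r + 1) * R" if j: "j \<le> Suc r" for j
  proof -
    have *: "U j \<in> P ((r + 2 - j) div 2) \<and> norm ((A ^^ ((r + 2 - j) div 2)) (U j)) \<le> x ^ j * R"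
      unfolding U_def x_def by (rule initial_derivs_bound[OF b k(2) u0 R_le(1) u1 R_le(2) _ R_le(3) j]) (auto simp: F_def F)
    then show "U j \<in> P ((r + 2 - j) div 2)" by blast
    have "x ^ j * R \<le> x ^ (r + 1) * R" using x R j by (intro mult_right_mono power_increasing) auto
    with * show "norm ((A ^^ ((r + 2 - j) div 2)) (U j)) \<le> x ^ (r + 1) * R" by linarith
  qed
  have AU: "U i \<in> D" "norm (A (U i)) \<le> X * R" if i: "i \<le> r" for i
  proof -
    define n where "n = (r + 2 - i) div 2 - 1"
    have n: "(r + 2 - i) div 2 = 1 + n" "n \<le> r + 2" using i by (auto simp: n_def)
    have mem: "U i \<in> P (1 + n)" and le: "norm ((A ^^ (1 + n)) (U i)) \<le> x ^ (r + 1) * R"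
      using Ub[of i] i unfolding n(1) by auto
    show "U i \<in> D" using mem by simp
    have "norm ((A ^^ 1) (U i)) \<le> b ^ n * norm ((A ^^ (1 + n)) (U i))" by (rule power_norm_le[OF b mem])
    also have "\<dots> \<le> b ^ (r + 2) * (x ^ (r + 1) * R)" using b(1) x R n(2) le by (intro mult_mono power_increasing) auto
    finally show "norm (A (U i)) \<le> X * R" by (simp add: X mult.assoc)
  qed
  have Ur: "U (Suc r) \<in> L2_on \<Omega>" "norm (U (Suc r)) \<le> X * R"
  proof -
    have e: "(r + 2 - Suc r) div 2 = 0" by simp
    show "U (Suc r) \<in> L2_on \<Omega>" using Ub(1)[of "Suc r"] unfolding e by simp
    have "norm (U (Suc r)) \<le> 1 * (x ^ (r + 1) * R)" using Ub(2)[of "Suc r"] unfolding e by simp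
    also have "\<dots> \<le> b ^ (r + 2) * (x ^ (r + 1) * R)" using b(1) x R by (intro mult_right_mono one_le_power) auto
    finally show "norm (U (Suc r)) \<le> X * R" by (simp add: X mult.assoc)
  qed
  have Fd: "(F i has_vector_derivative F (Suc i) t) (at t within {0..T})" if "i < r" "t \<in> {0..T}" for i t
    unfolding F_def by (rule times_differentiableD[OF ft that])
  have FL2: "F i t \<in> L2_on \<Omega>" if "i \<le> r" "t \<in> {0..T}" for i t
    using that
  proof (induction i arbitrary: t)
    case 0
    then show ?case using fL2 by (simp add: F_def)
  next
    case (Suc i)
    show ?case
      by (rule derivative_mem_closed_subspace[OF subspace_L2_on closed_L2_on[OF \<Omega>] T Suc.prems(2) Suc.IH Fd]) (use Suc.prems in auto)
  qed
  interpret evolution_data \<Omega> S A k \<kappa> T r F U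
  proof (rule evolution_data.intro[OF elliptic_inverse_axioms], rule evolution_data_axioms.intro)
    show "U (Suc (Suc j)) = F j 0 - A (U j) + (\<Sum>i<j. k i 0 *\<^sub>R A (U (j - 1 - i)))" for j by (simp add: U_def)
    show "continuous_on {0..T} (F r)" unfolding F_def by (rule fc)
  qed (fact mk T r k(1) kd Fd FL2 AU(1) Ur(1))+
  have U01: "F 0 = f" "U 0 = u0" "U 1 = u1" by (auto simp: F_def U_def)
  obtain u where u: "solution \<Omega> A K T f u0 u1 u" "times_differentiable T (r + 1) u"
    "\<And>t. t \<in> {0..T} \<Longrightarrow> time_deriv T r u t \<in> sobolev0 \<Omega> \<and>
      energy_norm \<Omega> A (time_deriv T r u t) + norm (time_deriv T (r + 1) u t) \<le> (1 / (1 - \<kappa>) + 1) * wave.energy_size t"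
    using solution_exists[OF Kk] unfolding U01 by blast
  have "energy_norm \<Omega> A (time_deriv T r u t) + norm (time_deriv T (r + 1) u t) \<le>
      (1 / (1 - \<kappa>) + 1) * (exp (4 / (1 - \<kappa>) * T) * ((2 + 2 * b + 4 * T * real r) * X + 4)) *
        (R + integral {0..t} (\<lambda>s. norm (time_deriv T r f s)))" if t: "t \<in> {0..T}" for t
  proof -
    define I where "I = integral {0..t} (\<lambda>s. norm (F r s))"
    have I: "0 \<le> I" unfolding I_def using t
      by (intro integral_nonneg integrable_continuous_interval continuous_on_norm continuous_on_subset[OF f_cont]) auto
    have X0: "0 \<le> X" using b(1) x by (simp add: X)
    define Y where "Y = (2 + 2 * b + 4 * T * real r) * X"
    have Y0: "0 \<le> Y" unfolding Y_def using b(1) T X0 by (intro mult_nonneg_nonneg add_nonneg_nonneg) auto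
    have "wave.energy_size t \<le> exp (4 / (1 - \<kappa>) * T) * ((2 + 2 * b + 4 * T * real r) * (X * R) + 4 * I)"
      unfolding I_def by (rule energy_size_le[OF b Ur(2) AU(2) k(2) t])
    also have "\<dots> \<le> exp (4 / (1 - \<kappa>) * T) * ((Y + 4) * (R + I))"
    proof (rule mult_left_mono)
      have "0 \<le> Y * I" "0 \<le> 4 * R" using Y0 I R by auto
      then show "(2 + 2 * b + 4 * T * real r) * (X * R) + 4 * I \<le> (Y + 4) * (R + I)"
        unfolding mult.assoc[symmetric] Y_def[symmetric] by (simp add: algebra_simps)
    qed simp
    finally have "(1 / (1 - \<kappa>) + 1) * wave.energy_size t \<le> (1 / (1 - \<kappa>) + 1) * (exp (4 / (1 - \<kappa>) * T) * ((Y + 4) * (R + I)))"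
      using \<kappa>_less_1 by (intro mult_left_mono) auto
    then show ?thesis using u(3)[OF t] unfolding Y_def I_def F_def by (simp add: mult.assoc)
  qed
  then show ?thesis
    using u solution_unique[OF mk Kk T _ u(1)] unfolding \<kappa>_def by (intro exI[of _ u]) blast
qed

end

text \<open>For \<open>r = 2 * k\<close> the orders \<open>2 * k - 2 * j\<close> and
  \<open>2 * k - 2 * j + 1\<close> leave \<open>j\<close> and \<open>j - 1\<close> powers of
  \<open>A\<close> in \<open>(r - i) div 2\<close>; so one sum over \<open>i < r\<close> becomes the
  two sums of the estimate.\<close>

lemma sum_pairs_down:
  fixes G :: "nat \<Rightarrow> real"
  shows "(\<Sum>i<2 * k. G i) = (\<Sum>j=1..k. G (2 * k - 2 * j)) + (\<Sum>j=1..k. G (2 * k - 2 * j + 1))"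
proof (induction k arbitrary: G)
  case (Suc k)
  have "(\<Sum>i<2 * Suc k. G i) = G 0 + G 1 + (\<Sum>i<2 * k. G (i + 2))"
    by (simp add: sum.lessThan_Suc_shift del: sum.lessThan_Suc)
  also have "(\<Sum>i<2 * k. G (i + 2)) = (\<Sum>j=1..k. G (2 * Suc k - 2 * j)) + (\<Sum>j=1..k. G (2 * Suc k - 2 * j + 1))"
  proof -
    have e: "2 * k - 2 * j + 2 = 2 * Suc k - 2 * j" "2 * k - 2 * j + 1 + 2 = 2 * Suc k - 2 * j + 1" if "j \<in> {1..k}" for j
      using that by auto
    show ?thesis unfolding Suc.IH[of "\<lambda>i. G (i + 2)"]
      by (intro arg_cong2[where f = "(+)"] sum.cong refl) (simp_all only: e)
  qed
  finally show ?case by simp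
qed simp

lemma sum_pairs_down_odd:
  fixes G :: "nat \<Rightarrow> real"
  shows "(\<Sum>i<2 * k + 1. G i) = (\<Sum>j=1..k. G (2 * k + 1 - 2 * j)) + (\<Sum>j=1..k + 1. G (2 * k + 1 + 1 - 2 * j))"
proof -
  have e: "2 * k - 2 * j + 1 = 2 * k + 1 - 2 * j" "2 * k + 1 - 2 * j + 1 = 2 * k + 1 + 1 - 2 * j" if "j \<in> {1..k}" for j
    using that by auto
  have "(\<Sum>i<2 * k + 1. G i) = G 0 + (\<Sum>i<2 * k. G (i + 1))"
    by (simp add: sum.lessThan_Suc_shift del: sum.lessThan_Suc)
  also have "(\<Sum>i<2 * k. G (i + 1)) = (\<Sum>j=1..k. G (2 * k + 1 - 2 * j)) + (\<Sum>j=1..k. G (2 * k + 1 + 1 - 2 * j))"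
    unfolding sum_pairs_down[of "\<lambda>i. G (i + 1)"]
    by (intro arg_cong2[where f = "(+)"] sum.cong refl) (simp_all only: e)
  finally show ?thesis by simp
qed

text \<open>Counting powers by \<open>div 2\<close> treats both parities of \<open>r\<close> at
  once. The last power for \<open>u0\<close> (even case) or \<open>u1\<close> (odd case) comes from
  its iterate lying in the domain of \<open>A\<close>.\<close>

lemma (in elliptic_inverse) compatible_data:
  assumes "data_compatible \<Omega> A r T f u0 u1" and r: "1 \<le> r"
  shows "u0 \<in> P ((r + 2) div 2)" "u1 \<in> P ((r + 1) div 2)"
    "\<And>i. i < r \<Longrightarrow> time_deriv T i f 0 \<in> P ((r - i) div 2)"
proof -
  have "u0 \<in> P ((r + 2) div 2) \<and> u1 \<in> P ((r + 1) div 2) \<and> (\<forall>i<r. time_deriv T i f 0 \<in> P ((r - i) div 2))"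
  proof (cases "even r")
    case True
    then obtain k where k: "r = 2 * k" by blast
    have c: "u0 \<in> P k" "(A ^^ k) u0 \<in> D" "u1 \<in> P k"
      "\<And>j. j \<in> {1..k} \<Longrightarrow> time_deriv T (r - 2 * j) f 0 \<in> P j \<and> time_deriv T (r - 2 * j + 1) f 0 \<in> P (j - 1)"
      using assms(1) k r unfolding data_compatible_def Let_def by auto
    have "time_deriv T i f 0 \<in> P ((r - i) div 2)" if i: "i < r" for i
    proof (cases "even i")
      case True
      then have "(r - i) div 2 \<in> {1..k}" "r - 2 * ((r - i) div 2) = i" using i k by (auto elim!: evenE)
      then show ?thesis using c(4)[of "(r - i) div 2"] by simp
    next
      case False
      then obtain m where m: "i = 2 * m + 1" by (auto elim: oddE)
      then have "k - m \<in> {1..k}" "r - 2 * (k - m) + 1 = i" "k - m - 1 = (r - i) div 2" using i k by auto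
      then show ?thesis using c(4)[of "k - m"] by simp
    qed
    moreover have "u0 \<in> P (Suc k)" by (rule P_SucI[OF c(1,2)])
    ultimately show ?thesis using c(3) k by simp
  next
    case False
    then obtain k where k: "r = 2 * k + 1" by (auto elim: oddE)
    have c: "u1 \<in> P k" "(A ^^ k) u1 \<in> D" "u0 \<in> P (k + 1)"
      "\<And>j. j \<in> {1..k} \<Longrightarrow> time_deriv T (r - 2 * j) f 0 \<in> P j"
      "\<And>j. j \<in> {1..k + 1} \<Longrightarrow> time_deriv T (r + 1 - 2 * j) f 0 \<in> P (j - 1)"
      using assms(1) k unfolding data_compatible_def Let_def by blast+
    have "time_deriv T i f 0 \<in> P ((r - i) div 2)" if i: "i < r" for i
    proof (cases "even i")
      case True
      then obtain m where m: "i = 2 * m" by (auto elim: evenE)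
      then have "k + 1 - m \<in> {1..k + 1}" "r + 1 - 2 * (k + 1 - m) = i" "k + 1 - m - 1 = (r - i) div 2" using i k by auto
      then show ?thesis using c(5)[of "k + 1 - m"] by simp
    next
      case False
      then obtain m where m: "i = 2 * m + 1" by (auto elim: oddE)
      then have "k - m \<in> {1..k}" "r - 2 * (k - m) = i" "k - m = (r - i) div 2" using i k by auto
      then show ?thesis using c(4)[of "k - m"] by simp
    qed
    moreover have "u1 \<in> P (Suc k)" by (rule P_SucI[OF c(1,2)])
    ultimately show ?thesis using c(3) k by simp
  qed
  then show "u0 \<in> P ((r + 2) div 2)" "u1 \<in> P ((r + 1) div 2)"
    "\<And>i. i < r \<Longrightarrow> time_deriv T i f 0 \<in> P ((r - i) div 2)" by auto
qed

theorem theorem2: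
  fixes \<Omega> :: "'a::euclidean_space set" and A :: "'a L2 \<Rightarrow> 'a L2" and r :: nat
  assumes domain: "smooth_convex_domain \<Omega>"
    and operator: "elliptic_operator \<Omega> A"
    and r: "r \<ge> 1"
  shows "\<exists>C :: real \<Rightarrow> real \<Rightarrow> real \<Rightarrow> real.
    \<forall>(T :: real) (K :: real \<Rightarrow> real) (f :: real \<Rightarrow> 'a L2) (u0 :: 'a L2) (u1 :: 'a L2).
      T > 0 \<and> admissible_kernel r K \<and>
      (\<forall>t\<in>{0..T}. f t \<in> L2_on \<Omega>) \<and> times_differentiable T r f \<and>
      (\<exists>L. L-lipschitz_on {0..T} (time_deriv T r f)) \<and>
      data_compatible \<Omega> A r T f u0 u1 \<longrightarrow>
      (\<exists>u. solution \<Omega> A K T f u0 u1 u \<and>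
        (\<forall>w. solution \<Omega> A K T f u0 u1 w \<longrightarrow> (\<forall>t\<in>{0..T}. w t = u t)) \<and>
        times_differentiable T (r + 1) u \<and>
        (\<forall>t\<in>{0..T}. time_deriv T r u t \<in> sobolev0 \<Omega>) \<and>
        (\<forall>k\<ge>1. r = 2 * k \<longrightarrow> (\<forall>t\<in>{0..T}.
          energy_norm \<Omega> A (time_deriv T r u t) + norm (time_deriv T (r + 1) u t) \<le>
          C (L1_norm_pos K) (W1_norm_pos r K) T *
            (norm ((A ^^ (k + 1)) u0) + norm ((A ^^ k) u1)
             + (\<Sum>j=1..k. norm ((A ^^ j) (time_deriv T (r - 2 * j) f 0)))
             + (\<Sum>j=1..k. norm ((A ^^ (j - 1)) (time_deriv T (r - 2 * j + 1) f 0)))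
             + integral {0..t} (\<lambda>s. norm (time_deriv T r f s))))) \<and>
        (\<forall>k. r = 2 * k + 1 \<longrightarrow> (\<forall>t\<in>{0..T}.
          energy_norm \<Omega> A (time_deriv T r u t) + norm (time_deriv T (r + 1) u t) \<le>
          C (L1_norm_pos K) (W1_norm_pos r K) T *
            (norm ((A ^^ (k + 1)) u0) + norm ((A ^^ (k + 1)) u1)
             + (\<Sum>j=1..k. norm ((A ^^ j) (time_deriv T (r - 2 * j) f 0)))
             + (\<Sum>j=1..k + 1. norm ((A ^^ (j - 1)) (time_deriv T (r + 1 - 2 * j) f 0)))
             + integral {0..t} (\<lambda>s. norm (time_deriv T r f s))))))"
proof -
  have \<Omega>: "open \<Omega>" using domain by (simp add: smooth_convex_domain_def)
  have sp: "self_adjoint_on (L2_on \<Omega>) (elliptic_dom \<Omega>) A" "positive_definite_on (elliptic_dom \<Omega>) A"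
    using operator by (auto simp: elliptic_operator_def)
  obtain S where S: "pos_operator S" "range S = elliptic_dom \<Omega>" "\<forall>v\<in>elliptic_dom \<Omega>. S (A v) = v" "\<forall>x\<in>L2_on \<Omega>. A (S x) = x"
    using inverse_operator[OF subspace_L2_on closed_L2_on[OF \<Omega>] sp] by blast
  interpret elliptic_inverse \<Omega> S A
  proof (rule elliptic_inverse.intro[OF open_domain.intro[OF \<Omega>] S(1)], rule elliptic_inverse_axioms.intro)
  qed (use operator S in auto)
  obtain B where B: "\<And>x. norm (S x) \<le> norm x * B" using S.bounded by blast
  \<comment> \<open>At least 1, so that powers of \<open>b\<close> increase with the
    exponent.\<close>
  define b where "b = max 1 B"
  have b: "b \<ge> 1" "norm (S x) \<le> b * norm x" for x
  proof -
    have "norm x * B \<le> norm x * b" unfolding b_def by (intro mult_left_mono) auto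
    then show "norm (S x) \<le> b * norm x" using B[of x] by (simp add: mult.commute)
  qed (simp add: b_def)
  define X where "X = b ^ (r + 2) * (2 + real r * b ^ (r + 2)) ^ (r + 1)"
  \<comment> \<open>The domain and \<open>A\<close> enter through \<open>b\<close> alone, and the
    function is fixed before the time, the kernel and the data are chosen.\<close>
  define C :: "real \<Rightarrow> real \<Rightarrow> real \<Rightarrow> real" where
    "C \<kappa> W T = (1 / (1 - \<kappa>) + 1) * (exp (4 / (1 - \<kappa>) * T) * ((2 + 2 * b + 4 * T * real r) * X + 4))" for \<kappa> W T
  show ?thesis
  proof (rule exI[of _ C], intro allI impI)
    fix T :: real and K :: "real \<Rightarrow> real" and f :: "real \<Rightarrow> 'a L2" and u0 u1 :: "'a L2"
    assume h: "T > 0 \<and> admissible_kernel r K \<and> (\<forall>t\<in>{0..T}. f t \<in> L2_on \<Omega>) \<and> times_differentiable T r f \<and>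
      (\<exists>L. L-lipschitz_on {0..T} (time_deriv T r f)) \<and> data_compatible \<Omega> A r T f u0 u1"
    then have fc: "continuous_on {0..T} (time_deriv T r f)" using lipschitz_on_continuous_on by blast
    note data = compatible_data[of r T f u0 u1, OF _ r]
    define R where "R = norm ((A ^^ ((r + 2) div 2)) u0) + norm ((A ^^ ((r + 1) div 2)) u1) +
      (\<Sum>i<r. norm ((A ^^ ((r - i) div 2)) (time_deriv T i f 0)))"
    obtain u where u: "solution \<Omega> A K T f u0 u1 u"
      "\<forall>w. solution \<Omega> A K T f u0 u1 w \<longrightarrow> (\<forall>t\<in>{0..T}. w t = u t)" "times_differentiable T (r + 1) u"
      "\<forall>t\<in>{0..T}. time_deriv T r u t \<in> sobolev0 \<Omega> \<and>
        energy_norm \<Omega> A (time_deriv T r u t) + norm (time_deriv T (r + 1) u t) \<le>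
        C (L1_norm_pos K) (W1_norm_pos r K) T * (R + integral {0..t} (\<lambda>s. norm (time_deriv T r f s)))"
      using well_posed[of r b T K f u0 u1, OF r b _ _ _ _ fc data] h unfolding C_def X_def R_def by blast
    have even: "R = norm ((A ^^ (k + 1)) u0) + norm ((A ^^ k) u1)
        + (\<Sum>j=1..k. norm ((A ^^ j) (time_deriv T (r - 2 * j) f 0)))
        + (\<Sum>j=1..k. norm ((A ^^ (j - 1)) (time_deriv T (r - 2 * j + 1) f 0)))" if k: "r = 2 * k" for k
    proof -
      have e: "(2 * k - (2 * k - 2 * j)) div 2 = j" "(2 * k - (2 * k - 2 * j + 1)) div 2 = j - 1" if "j \<in> {1..k}" for j
        using that by auto
      have "(\<Sum>i<r. norm ((A ^^ ((r - i) div 2)) (time_deriv T i f 0)))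
          = (\<Sum>j=1..k. norm ((A ^^ j) (time_deriv T (r - 2 * j) f 0)))
          + (\<Sum>j=1..k. norm ((A ^^ (j - 1)) (time_deriv T (r - 2 * j + 1) f 0)))"
        unfolding k sum_pairs_down by (intro arg_cong2[where f = "(+)"] sum.cong refl) (simp_all only: e)
      moreover have "(r + 2) div 2 = k + 1" "(r + 1) div 2 = k" using k by auto
      ultimately show ?thesis unfolding R_def by simp
    qed
    have odd: "R = norm ((A ^^ (k + 1)) u0) + norm ((A ^^ (k + 1)) u1)
        + (\<Sum>j=1..k. norm ((A ^^ j) (time_deriv T (r - 2 * j) f 0)))
        + (\<Sum>j=1..k + 1. norm ((A ^^ (j - 1)) (time_deriv T (r + 1 - 2 * j) f 0)))" if k: "r = 2 * k + 1" for k
    proof -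
      have e: "(2 * k + 1 - (2 * k + 1 - 2 * j)) div 2 = j" if "j \<in> {1..k}" for j
        using that by auto
      have e': "(2 * k + 1 - (2 * k + 1 + 1 - 2 * j)) div 2 = j - 1" if "j \<in> {1..k + 1}" for j
        using that by auto
      have "(\<Sum>i<r. norm ((A ^^ ((r - i) div 2)) (time_deriv T i f 0)))
          = (\<Sum>j=1..k. norm ((A ^^ j) (time_deriv T (r - 2 * j) f 0)))
          + (\<Sum>j=1..k + 1. norm ((A ^^ (j - 1)) (time_deriv T (r + 1 - 2 * j) f 0)))"
        unfolding k sum_pairs_down_odd by (intro arg_cong2[where f = "(+)"] sum.cong refl) (simp_all only: e e')
      moreover have "(r + 2) div 2 = k + 1" "(r + 1) div 2 = k + 1" using k by auto
      ultimately show ?thesis unfolding R_def by simp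
    qed
    show "(\<exists>u. solution \<Omega> A K T f u0 u1 u \<and>
        (\<forall>w. solution \<Omega> A K T f u0 u1 w \<longrightarrow> (\<forall>t\<in>{0..T}. w t = u t)) \<and>
        times_differentiable T (r + 1) u \<and>
        (\<forall>t\<in>{0..T}. time_deriv T r u t \<in> sobolev0 \<Omega>) \<and>
        (\<forall>k\<ge>1. r = 2 * k \<longrightarrow> (\<forall>t\<in>{0..T}.
          energy_norm \<Omega> A (time_deriv T r u t) + norm (time_deriv T (r + 1) u t) \<le>
          C (L1_norm_pos K) (W1_norm_pos r K) T *
            (norm ((A ^^ (k + 1)) u0) + norm ((A ^^ k) u1)
             + (\<Sum>j=1..k. norm ((A ^^ j) (time_deriv T (r - 2 * j) f 0)))
             + (\<Sum>j=1..k. norm ((A ^^ (j - 1)) (time_deriv T (r - 2 * j + 1) f 0)))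
             + integral {0..t} (\<lambda>s. norm (time_deriv T r f s))))) \<and>
        (\<forall>k. r = 2 * k + 1 \<longrightarrow> (\<forall>t\<in>{0..T}.
          energy_norm \<Omega> A (time_deriv T r u t) + norm (time_deriv T (r + 1) u t) \<le>
          C (L1_norm_pos K) (W1_norm_pos r K) T *
            (norm ((A ^^ (k + 1)) u0) + norm ((A ^^ (k + 1)) u1)
             + (\<Sum>j=1..k. norm ((A ^^ j) (time_deriv T (r - 2 * j) f 0)))
             + (\<Sum>j=1..k + 1. norm ((A ^^ (j - 1)) (time_deriv T (r + 1 - 2 * j) f 0)))
             + integral {0..t} (\<lambda>s. norm (time_deriv T r f s))))))"
    proof (rule exI[of _ u], intro conjI allI impI ballI)
      fix k t assume kt: "1 \<le> k" "r = 2 * k" "t \<in> {0..T}"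
      note le = u(4)[rule_format, OF kt(3), THEN conjunct2, unfolded even[OF kt(2)]]
      then show "energy_norm \<Omega> A (time_deriv T r u t) + norm (time_deriv T (r + 1) u t) \<le>
          C (L1_norm_pos K) (W1_norm_pos r K) T *
            (norm ((A ^^ (k + 1)) u0) + norm ((A ^^ k) u1)
             + (\<Sum>j=1..k. norm ((A ^^ j) (time_deriv T (r - 2 * j) f 0)))
             + (\<Sum>j=1..k. norm ((A ^^ (j - 1)) (time_deriv T (r - 2 * j + 1) f 0)))
             + integral {0..t} (\<lambda>s. norm (time_deriv T r f s)))" .
    next
      fix k t assume kt: "r = 2 * k + 1" "t \<in> {0..T}"
      note le = u(4)[rule_format, OF kt(2), THEN conjunct2, unfolded odd[OF kt(1)]]
      then show "energy_norm \<Omega> A (time_deriv T r u t) + norm (time_deriv T (r + 1) u t) \<le>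
          C (L1_norm_pos K) (W1_norm_pos r K) T *
            (norm ((A ^^ (k + 1)) u0) + norm ((A ^^ (k + 1)) u1)
             + (\<Sum>j=1..k. norm ((A ^^ j) (time_deriv T (r - 2 * j) f 0)))
             + (\<Sum>j=1..k + 1. norm ((A ^^ (j - 1)) (time_deriv T (r + 1 - 2 * j) f 0)))
             + integral {0..t} (\<lambda>s. norm (time_deriv T r f s)))" .
    qed (use u in blast)+
  qed
qed

end
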